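(* Let $0<p<\infty$, $k\ge1$, $0<s/2<k-1+1/p$, and $1/\tau=s/2+1/p$. Then there is a constant $c>0$, depending only on $s,p,k$ and $N_0,c_0,\beta$, such that for every $n\ge n_0$ and all $S_1,S_2\in\mathcal{S}(n,k)$: $$|S_1|_{B^{s,k}_\tau}\le|S_2|_{B^{s,k}_\tau}+c\,n^{s/2}\|S_1-S_2\|_{L^p(\Omega)}\quad\text{if }\tau\ge1,$$ and $$|S_1|_{B^{s,k}_\tau}^\tau\le|S_2|_{B^{s,k}_\tau}^\tau+c\,n^{\tau s/2}\|S_1-S_2\|_{L^p(\Omega)}^\tau\quad\text{if }\tau<1.$$
   Context: Fix constants $N_0\in\mathbb{N}$, $c_0\ge 1$ and $0<\beta\le\pi/3$. A compact convex set $Q\subset\mathbb{R}^2$ is regular if there are balls $B(x_2,r_2)\subset Q\subset B(x_1,r_1)$ with $r_1\le c_0r_2$. A set $R\subset\mathbb{R}^2$ is a ring if $R=Q_1\setminus Q_2$ where: (a) $Q_2\subset Q_1$ or $Q_2=\emptyset$; (b) each of $Q_1,Q_2$ (when nonempty) is a compact regular convex set whose boundary is a polygon consisting of at most $N_0$ line segments; (c) each edge $E$ of $\partial R$ can be written as $E=E_1\cup E_2$, a union of at most two segments with disjoint one-dimensional interiors, such that for each $i$ there is a triangle $\triangle_i\subset R$ having $E_i$ as a side with both angles adjacent to $E_i$ equal to $\beta$. The domain $\Omega$ is either $\mathbb{R}^2$ or a compact polygonal domain, i.e. a union of finitely many triangles with disjoint interiors obeying the minimum angle condition; in the compact case it is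 assumed that $\Omega$ is the union of $n_0$ rings with disjoint interiors for some fixed $n_0\ge1$, and if $\Omega=\mathbb{R}^2$ then $n_0:=1$. $\Pi_k$ is the space of algebraic polynomials in two variables of total degree $\le k-1$. $\mathcal{S}(n,k)$ (splines of maximal smoothness): if $\Omega$ is compact, the set of all $S=\sum_{j=1}^nP_j\mathbb{1}_{R_j}$ with $P_j\in\Pi_k$, where $R_1,\dots,R_n$ are rings with disjoint interiors and $\Omega=\bigcup_jR_j$, and $S\in W^{k-2}(\Omega)$, meaning all partial derivatives $\partial^\alpha S$ with $|\alpha|\le k-2$ are continuous on $\Omega$; if $\Omega=\mathbb{R}^2$, the same except that $\bigcup_jR_j$ is required to be a ring. For $k=1$ no smoothness is imposed (piecewise constants). Besov spaces: for $h\in\mathbb{R}^2$, $\Delta_h^kf(x)=\sum_{\nu=0}^k(-1)^{k+\nu}\binom{k}{\nu}f(x+\nu h)$ if the segment $[x,x+kh]\subset\Omega$ and $\Delta_h^kf(x)=0$ otherwise; $\omega_k(f,t)_\tau=\sup_{|h|\le t}\|\Delta_h^kf\|_{L^\tau(\Omega)}$; $|f|_{B^{s,k}_\tau}=\big(\int_0^\infty[t^{-s}\omega_k(f,t)_\tau]^\tau\,dt/t\big)^{1/\tau}$. *)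

theory Defs
  imports "HOL-Analysis.Analysis"
begin

type_synonym pt = "real^2"

definition regular_set :: "real \<Rightarrow> pt set \<Rightarrow> bool" where
  "regular_set c0 Q \<longleftrightarrow> compact Q \<and> convex Q \<and>
     (\<exists>x1 x2 r1 r2. r2 > 0 \<and> cball x2 r2 \<subseteq> Q \<and> Q \<subseteq> cball x1 r1 \<and> r1 \<le> c0 * r2)"

definition polygon_boundary :: "nat \<Rightarrow> pt set \<Rightarrow> bool" where
  "polygon_boundary N0 Q \<longleftrightarrow>
     (\<exists>L :: (pt \<times> pt) list. length L \<le> N0 \<and>
        frontier Q = (\<Union>(a,b)\<in>set L. closed_segment a b))"

definition reg_polygon :: "nat \<Rightarrow> real \<Rightarrow> pt set \<Rightarrow> bool" where
  "reg_polygon N0 c0 Q \<longleftrightarrow> regular_set c0 Q \<and> polygon_boundary N0 Q"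

definition edges :: "pt set \<Rightarrow> pt set set" where
  "edges A = {closed_segment a b | a b. a \<noteq> b \<and> closed_segment a b \<subseteq> A \<and>
      (\<forall>c d. closed_segment a b \<subseteq> closed_segment c d \<and> closed_segment c d \<subseteq> A
              \<longrightarrow> closed_segment c d = closed_segment a b)}"

definition vec_angle :: "pt \<Rightarrow> pt \<Rightarrow> real" where
  "vec_angle u v = arccos ((u \<bullet> v) / (norm u * norm v))"

definition has_beta_triangle :: "real \<Rightarrow> pt set \<Rightarrow> pt \<Rightarrow> pt \<Rightarrow> bool" where
  "has_beta_triangle \<beta> T a b \<longleftrightarrow>
     (\<exists>c. convex hull {a, b, c} \<subseteq> T \<and>
          vec_angle (b - a) (c - a) = \<beta> \<and> vec_angle (a - b) (c - b) = \<beta>)"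

definition is_ring :: "nat \<Rightarrow> real \<Rightarrow> real \<Rightarrow> pt set \<Rightarrow> bool" where
  "is_ring N0 c0 \<beta> R \<longleftrightarrow>
     (\<exists>Q1 Q2. R = Q1 - Q2 \<and>
        (Q2 \<subseteq> Q1 \<or> Q2 = {}) \<and>
        reg_polygon N0 c0 Q1 \<and> (Q2 = {} \<or> reg_polygon N0 c0 Q2) \<and>
        (\<forall>E\<in>edges (frontier R). \<exists>a b m. E = closed_segment a b \<and>
            (has_beta_triangle \<beta> (closure R) a b \<or>
             (m \<in> open_segment a b \<and> has_beta_triangle \<beta> (closure R) a m
                \<and> has_beta_triangle \<beta> (closure R) m b))))"

definition nondeg_triangle :: "pt set \<Rightarrow> bool" where
  "nondeg_triangle T \<longleftrightarrow> (\<exists>a b c. \<not> collinear {a, b, c} \<and> T = convex hull {a, b, c})"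

definition polygonal_domain :: "pt set \<Rightarrow> bool" where
  "polygonal_domain \<Omega> \<longleftrightarrow>
     (\<exists>\<T>. finite \<T> \<and> \<T> \<noteq> {} \<and> (\<forall>T\<in>\<T>. nondeg_triangle T) \<and>
          (\<forall>T\<in>\<T>. \<forall>T'\<in>\<T>. T \<noteq> T' \<longrightarrow> interior T \<inter> interior T' = {}) \<and>
          \<Omega> = \<Union>\<T>)"

definition admissible_domain :: "nat \<Rightarrow> real \<Rightarrow> real \<Rightarrow> pt set \<Rightarrow> nat \<Rightarrow> bool" where
  "admissible_domain N0 c0 \<beta> \<Omega> n0 \<longleftrightarrow>
     (\<Omega> = UNIV \<and> n0 = 1) \<or>
     (polygonal_domain \<Omega> \<and> n0 \<ge> 1 \<and>
      (\<exists>R :: nat \<Rightarrow> pt set. (\<forall>j<n0. is_ring N0 c0 \<beta> (R j)) \<and>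
          (\<forall>i<n0. \<forall>j<n0. i \<noteq> j \<longrightarrow> interior (R i) \<inter> interior (R j) = {}) \<and>
          (\<Union>j<n0. R j) = \<Omega>))"

definition poly2 :: "nat \<Rightarrow> (nat \<Rightarrow> nat \<Rightarrow> real) \<Rightarrow> pt \<Rightarrow> real" where
  "poly2 k a x = (\<Sum>i<k. \<Sum>j<k - i. a i j * (x$1)^i * (x$2)^j)"

fun C_on :: "nat \<Rightarrow> pt set \<Rightarrow> (pt \<Rightarrow> real) \<Rightarrow> bool" where
  "C_on 0 \<Omega> f = continuous_on \<Omega> f"
| "C_on (Suc m) \<Omega> f = (continuous_on \<Omega> f \<and>
     (\<exists>g1 g2. (\<forall>x\<in>\<Omega>. (f has_derivative (\<lambda>h. h$1 * g1 x + h$2 * g2 x)) (at x within \<Omega>)) \<and>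
              C_on m \<Omega> g1 \<and> C_on m \<Omega> g2))"

definition splines :: "nat \<Rightarrow> real \<Rightarrow> real \<Rightarrow> pt set \<Rightarrow> nat \<Rightarrow> nat \<Rightarrow> (pt \<Rightarrow> real) set" where
  "splines N0 c0 \<beta> \<Omega> n k = {S. \<exists>(R :: nat \<Rightarrow> pt set) (P :: nat \<Rightarrow> nat \<Rightarrow> nat \<Rightarrow> real).
      (\<forall>j<n. is_ring N0 c0 \<beta> (R j)) \<and>
      (\<forall>i<n. \<forall>j<n. i \<noteq> j \<longrightarrow> interior (R i) \<inter> interior (R j) = {}) \<and>
      (if \<Omega> = UNIV then is_ring N0 c0 \<beta> (\<Union>j<n. R j) else (\<Union>j<n. R j) = \<Omega>) \<and>
      (AE x in lborel. S x = (\<Sum>j<n. poly2 k (P j) x * indicator (R j) x)) \<and>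
      (k \<ge> 2 \<longrightarrow> C_on (k - 2) \<Omega> S)}"

definition enn_powr :: "ennreal \<Rightarrow> real \<Rightarrow> ennreal" where
  "enn_powr x a = (if x = \<infinity> then \<infinity> else ennreal (enn2real x powr a))"

definition Lnorm :: "real \<Rightarrow> pt set \<Rightarrow> (pt \<Rightarrow> real) \<Rightarrow> ennreal" where
  "Lnorm q \<Omega> g = enn_powr (\<integral>\<^sup>+ x\<in>\<Omega>. ennreal (\<bar>g x\<bar> powr q) \<partial>lborel) (1 / q)"

definition fdiff :: "pt set \<Rightarrow> nat \<Rightarrow> pt \<Rightarrow> (pt \<Rightarrow> real) \<Rightarrow> pt \<Rightarrow> real" where
  "fdiff \<Omega> k h f x = (if closed_segment x (x + real k *\<^sub>R h) \<subseteq> \<Omega>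
      then (\<Sum>\<nu>\<le>k. (-1) ^ (k + \<nu>) * real (k choose \<nu>) * f (x + real \<nu> *\<^sub>R h)) else 0)"

definition modulus :: "pt set \<Rightarrow> nat \<Rightarrow> real \<Rightarrow> (pt \<Rightarrow> real) \<Rightarrow> real \<Rightarrow> ennreal" where
  "modulus \<Omega> k \<tau> f t = (SUP h\<in>{h. norm h \<le> t}. Lnorm \<tau> \<Omega> (fdiff \<Omega> k h f))"

definition besov_semi :: "pt set \<Rightarrow> real \<Rightarrow> nat \<Rightarrow> real \<Rightarrow> (pt \<Rightarrow> real) \<Rightarrow> ennreal" where
  "besov_semi \<Omega> s k \<tau> f = enn_powr
     (\<integral>\<^sup>+ t\<in>{0<..}. enn_powr (ennreal (t powr (- s)) * modulus \<Omega> k \<tau> f t) \<tau> / ennreal t \<partial>lborel)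
     (1 / \<tau>)"

end

(* Away from the set V of vertices, at distance r from V, both splines are on a ball of radius
comparable to r polynomials plus one jump c (u . x - b)_+^(k-1); their k-th differences of step h
differ there in L^tau by at most the integral of |S1 - S2|^tau min(1, |h|/r)^(tau(k-1)+1).
Averaging the centre of the ball with a kernel of constant mass, and then Minkowski over t, reduce
the claim to bounding the integral of |f|^tau r^(-s tau) for f = S1 - S2 by C n^(s tau/2) |f|_p^tau.
By Hoelder this needs only that r^(-2) has integral O(#V) on the relevant set. That fails on annuli
around clusters of V that are large and meet V nowhere; but there f is polynomial along long rays
leaving the cluster, so its values near the cluster are controlled by those far away, and the
excess is absorbed because s tau < 2. *)

theory Submission
 imports Defs "HOL-Analysis.Analysis"
begin

text \<open>The seminorm of \<open>S2\<close> enters with factor one, so no estimate may lose a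
  constant there. This rules out covering the plane by balls of bounded overlap and explains the
  average over centres, whose kernel has the same mass at every point. It also rules out passing to
  \<open>S1 - S2\<close>: where two edges nearly coincide, that function lives on a thin sliver and
  has larger differences than its norm allows. Hence the two jumps themselves are compared; if they
  differ in height, direction or position, the integral of |S1 - S2|^tau pays for it. Both
  assertions are one inequality for integrals raised to \<open>1 / max 1 tau\<close>. The hypotheses
  on s enter as \<open>s * tau < 2\<close>, as \<open>tau / p + s * tau / 2 = 1\<close> for Hoelder,
  and as \<open>s * tau < tau * (k - 1) + 1\<close>, which makes the integral over t converge at
  zero. The angle condition enters only through half-discs: a point of an edge at distance r from
  the vertices has a half-disc of radius comparable to r in its ring, so two rings meeting there
  fill a ball and produce a single jump.\<close>

abbreviation (input) "cseg == closed_segment"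


abbreviation LI :: "('a::euclidean_space => ennreal) => ennreal" (binder "LI " 10)
 where "LI x. f x == nn_integral lborel f"

abbreviation pw :: "real => real => ennreal"
 where "pw a y == ennreal (\<bar>y\<bar> powr a)"

abbreviation (input) bm where "bm == borel_measurable borel"

lemma pos_exE: "\<exists>C>0. P C ==> (!!C::real. C > 0 ==> P C ==> thesis) ==> thesis"
 by blast

section \<open>Scaling of planar measure and powers of extended reals\<close>

lemma nn_integral_scale_pt:
 fixes g :: "pt => ennreal"
 assumes [measurable]: "g \<in> bm" and c: "c ~= 0"
 shows "(LI x. g (t + c *\<^sub>R x)) = ennreal (1 / c\<^sup>2) * (LI x. g x)"
proof -
 have "(LI x. g x) = (\<integral>\<^sup>+ x. g x \<partial>density (distr lborel borel (%x. t + c *\<^sub>R x)) (%_. abs(c)^DIM(pt)))"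
  using lborel_affine[OF c, of t] by simp
 also have "... = ennreal (c\<^sup>2) * (LI x. g (t + c *\<^sub>R x))"
  by (subst nn_integral_density) (auto simp: nn_integral_distr nn_integral_cmult)
 finally have "ennreal (1 / c\<^sup>2) * (LI x. g x)
   = (ennreal (1 / c\<^sup>2) * ennreal (c\<^sup>2)) * (LI x. g (t + c *\<^sub>R x))"
  by (simp add: mult.assoc)
 also have "ennreal (1 / c\<^sup>2) * ennreal (c\<^sup>2) = 1"
  using c by (simp add: ennreal_mult[symmetric])
 finally show ?thesis by simp
qed

lemma emeasure_ball_scale_pt:
 fixes z :: pt
 assumes "r > 0"
 shows "emeasure lborel (ball z r) = ennreal (r\<^sup>2) * emeasure lborel (ball (0::pt) 1)"
proof -
 have "(LI x. indicator (ball z r) (z + r *\<^sub>R x)) = ennreal (1/r\<^sup>2) * (LI x. indicator (ball z r) (x::pt))"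
  using assms by (intro nn_integral_scale_pt borel_measurable_indicator) auto
 moreover have "indicator (ball z r) (z + r *\<^sub>R x) = (indicator (ball (0::pt) 1) x :: ennreal)" for x
  using assms by (auto simp: indicator_def dist_norm)
 ultimately have "emeasure lborel (ball (0::pt) 1) = ennreal (1/r\<^sup>2) * emeasure lborel (ball z r)"
  by simp
 hence "ennreal (r\<^sup>2) * emeasure lborel (ball (0::pt) 1) = (ennreal (r\<^sup>2) * ennreal (1/r\<^sup>2)) * emeasure lborel (ball z r)"
  by (simp add: mult.assoc)
 also have "ennreal (r\<^sup>2) * ennreal (1/r\<^sup>2) = 1"
  using assms by (simp add: ennreal_mult[symmetric])
 finally show ?thesis by simp
qed

definition unit_area :: real where "unit_area = measure lborel (ball (0::pt) 1)"

lemma unit_area_pos: "unit_area > 0"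
 unfolding unit_area_def by (simp add: content_ball_pos)

lemma emeasure_ball_pt:
 fixes z :: pt
 assumes "r > 0"
 shows "emeasure lborel (ball z r) = ennreal (r\<^sup>2 * unit_area)"
proof -
 have "emeasure lborel (ball (0::pt) 1) = ennreal unit_area"
  unfolding unit_area_def using emeasure_lborel_ball_finite[of "0::pt" 1] by (intro emeasure_eq_ennreal_measure) (auto simp: less_top)
 thus ?thesis using emeasure_ball_scale_pt[OF assms, of z] unit_area_pos
  by (simp add: ennreal_mult)
qed

lemma enn_powr_ennreal [simp]: "x >= 0 ==> enn_powr (ennreal x) a = ennreal (x powr a)"
 by (simp add: enn_powr_def)

lemma enn_powr_top [simp]: "enn_powr \<infinity> a = \<infinity>" "enn_powr top a = \<infinity>"
 by (simp_all add: enn_powr_def)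

lemma enn_powr_0 [simp]: "enn_powr 0 a = 0"
 by (simp add: enn_powr_def)

lemma enn_powr_mono: "0 <= a ==> x <= y ==> enn_powr x a <= enn_powr y a"
 by (cases x; cases y) (auto simp: powr_mono2 top_unique ennreal_leI)

lemma enn_powr_one [simp]: "enn_powr x 1 = x"
 by (cases x) auto

lemma enn_powr_powr: "enn_powr (enn_powr x a) b = enn_powr x (a * b)"
 by (cases x) (auto simp: powr_powr)

lemma enn_powr_mult:
 assumes "a > 0" shows "enn_powr (x * y) a = enn_powr x a * enn_powr y a"
proof (cases x; cases y)
 fix r s :: real assume "0 <= r" "x = ennreal r" "0 <= s" "y = ennreal s"
 thus ?thesis by (simp add: ennreal_mult[symmetric] powr_mult)
next
 fix r assume "0 <= r" "x = ennreal r" "y = top"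
 thus ?thesis using assms by (cases "r = 0") (auto simp: ennreal_mult_top ennreal_top_mult)
next
 fix r assume "0 <= r" "y = ennreal r" "x = top"
 thus ?thesis using assms by (cases "r = 0") (auto simp: ennreal_mult_top ennreal_top_mult)
qed (use assms in \<open>simp add: ennreal_mult_top\<close>)

lemma measurable_enn_powr [measurable]:
 assumes [measurable]: "f \<in> borel_measurable M"
 shows "(%x. enn_powr (f x) a) \<in> borel_measurable M"
 unfolding enn_powr_def by measurable

lemma enn_powr_eq_top_iff [simp]: "enn_powr x a = top \<longleftrightarrow> x = top"
 by (auto simp: enn_powr_def)

section \<open>Inequalities for real powers; Minkowski and Hoelder\<close>

lemma powr_sum_le:
 fixes a b t :: real
 assumes "0 <= a" "0 <= b" "0 < t" "t <= 1"
 shows "(a + b) powr t <= a powr t + b powr t"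
proof (cases "a + b = 0")
 case True thus ?thesis using assms by simp
next
 case False
 hence p: "a + b > 0" using assms by simp
 have l: "x / (a+b) <= (x / (a+b)) powr t" if "0 <= x" "x <= a + b" for x
 proof (cases "x = 0")
  case False
  hence "(x/(a+b)) powr 1 <= (x/(a+b)) powr t"
   using that p assms by (intro powr_mono') auto
  thus ?thesis using that p by simp
 qed simp
 have "1 = a/(a+b) + b/(a+b)" using p by (simp add: add_divide_distrib[symmetric])
 also have "... <= (a/(a+b)) powr t + (b/(a+b)) powr t" using l[of a] l[of b] assms by simp
 also have "... = (a powr t + b powr t) / (a+b) powr t"
  using assms p by (simp add: powr_divide add_divide_distrib)
 finally show ?thesis using p by (simp add: field_simps)
qed

text \<open>Comparing with the largest summand works for exponents below and above one alike, so the
  crude estimates need no case distinction on \<open>tau\<close>.\<close>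

lemma sum_powr_le:
 fixes x :: "'i => real"
 assumes "finite I" "!!i. i \<in> I ==> 0 <= x i" "0 < t"
 shows "(\<Sum>i\<in>I. x i) powr t <= real (card I) powr t * (\<Sum>i\<in>I. x i powr t)"
proof (cases "I = {}")
 case False
 define m where "m = Max (x ` I)"
 have mI: "m \<in> x ` I" and mm: "!!i. i \<in> I ==> x i <= m"
  unfolding m_def using False assms by auto
 obtain j where j: "j \<in> I" "x j = m" using mI by auto
 have "(\<Sum>i\<in>I. x i) <= real (card I) * m"
  using sum_bounded_above[of I x m] mm by simp
 hence "(\<Sum>i\<in>I. x i) powr t <= (real (card I) * m) powr t"
  using assms by (intro powr_mono2 sum_nonneg) auto
 also have "... = real (card I) powr t * m powr t"
  using assms j by (simp add: powr_mult)
 also have "m powr t <= (\<Sum>i\<in>I. x i powr t)"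
  using j assms by (metis (no_types, lifting) member_le_sum powr_ge_zero)
 finally show ?thesis by (simp add: mult_left_mono)
qed simp

lemma powr_lipschitz_pos:
 fixes a b p :: real
 assumes "0 < a" "a < b"
 shows "\<exists>A\<ge>0. \<forall>x\<in>{a..b}. \<forall>y\<in>{a..b}. abs(x powr p - y powr p) <= A * abs(x - y)"
proof -
 define A where "A = abs(p) * (a powr (p-1) + b powr (p-1))"
 have *: "abs(x powr p - y powr p) <= A * abs(x - y)" if "a <= x" "x < y" "y <= b" for x y
 proof -
  have "\<exists>z. x < z & z < y & y powr p - x powr p = (y - x) * (p * z powr (p - 1))"
   using that assms by (intro MVT2) (auto intro!: derivative_eq_intros DERIV_powr simp: )
  then obtain z where z: "x < z" "z < y" "y powr p - x powr p = (y - x) * (p * z powr (p - 1))" by auto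
  have "z powr (p-1) <= a powr (p-1) + b powr (p-1)"
  proof (cases "p >= 1")
   case True
   hence "z powr (p-1) <= b powr (p-1)" using z that assms by (intro powr_mono2) auto
   thus ?thesis by (simp add: add_increasing)
  next
   case False
   hence "z powr (p-1) <= a powr (p-1)" using z that assms by (intro powr_mono2') auto
   thus ?thesis by (simp add: add_increasing2)
  qed
  hence "abs(p * z powr (p-1)) <= A" unfolding A_def by (simp add: abs_mult mult_left_mono)
  hence "(y-x) * abs(p * z powr (p-1)) <= (y-x) * A"
   using that by (intro mult_left_mono) auto
  moreover have "abs(x powr p - y powr p) = (y-x) * abs(p * z powr (p-1))"
   using z that by (subst abs_minus_commute, subst z(3)) (simp add: abs_mult)
  ultimately show ?thesis using that by (simp add: mult.commute)
 qed
 have A0: "A >= 0" unfolding A_def by simp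
 have "abs(x powr p - y powr p) <= A * abs(x - y)" if "x\<in>{a..b}" "y\<in>{a..b}" for x y
  using *[of x y] *[of y x] that A0
  by (cases "x = y"; cases "x < y") (auto simp: abs_minus_commute)
 with A0 show ?thesis by blast
qed

text \<open>Exponents from one on allow the base to reach zero. This version serves the vanishing
  factor of the averaging kernel, the previous one the factor whose base stays away from
  zero.\<close>

lemma powr_lipschitz_ge1:
 fixes b p :: real
 assumes "1 <= p" "0 < b"
 shows "\<exists>A\<ge>0. \<forall>x\<in>{0..b}. \<forall>y\<in>{0..b}. abs(x powr p - y powr p) <= A * abs(x - y)"
proof -
 define A where "A = p * b powr (p-1)"
 have *: "abs(x powr p - y powr p) <= A * abs(x - y)" if "0 <= x" "x < y" "y <= b" for x y
 proof -
  have "continuous_on {x..y} (%x. x powr p)"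
   using that assms by (intro continuous_on_powr') (auto intro!: continuous_intros)
  moreover have "(%x. x powr p) differentiable (at w)" if "x < w" "w < y" for w
   using has_real_derivative_powr[of w p] that \<open>0 <= x\<close> unfolding real_differentiable_def by fastforce
  ultimately have "\<exists>l z. x < z & z < y & ((%x. x powr p) has_real_derivative l) (at z) & y powr p - x powr p = (y - x) * l"
   using that by (intro MVT) auto
  then obtain l z where z: "x < z" "z < y" and d: "((%x. x powr p) has_real_derivative l) (at z)"
   and e: "y powr p - x powr p = (y - x) * l" by auto
  have l: "l = p * z powr (p - 1)"
   using d has_real_derivative_powr[of z p] DERIV_unique z that by fastforce
  have "z powr (p-1) <= b powr (p-1)" using z that assms by (intro powr_mono2) auto
  hence "abs(l) <= A" unfolding A_def l using assms by (simp add: abs_mult mult_left_mono)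
  hence "(y-x) * abs(l) <= (y-x) * A"
   using that by (intro mult_left_mono) auto
  moreover have "abs(x powr p - y powr p) = (y-x) * abs(l)"
   using e that by (subst abs_minus_commute, subst e) (simp add: abs_mult)
  ultimately show ?thesis using that by (simp add: mult.commute)
 qed
 have A0: "A >= 0" unfolding A_def using assms by simp
 have "abs(x powr p - y powr p) <= A * abs(x - y)" if "x\<in>{0..b}" "y\<in>{0..b}" for x y
  using *[of x y] *[of y x] that A0
  by (cases "x = y"; cases "x < y") (auto simp: abs_minus_commute)
 with A0 show ?thesis by blast
qed

text \<open>Convexity at the weights \<open>l\<close> and \<open>1 - l\<close>. The weight stays
  free so that it can be chosen after integration, which turns this pointwise bound into Minkowski's
  inequality.\<close>

lemma add_powr_convex:
 fixes a b q l :: real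
 assumes "0 <= a" "0 <= b" "1 <= q" "0 < l" "l < 1"
 shows "(a + b) powr q <= l powr (1 - q) * a powr q + (1 - l) powr (1 - q) * b powr q"
proof -
 have pos: "(a + b) powr q <= l powr (1 - q) * a powr q + (1 - l) powr (1 - q) * b powr q"
  if "0 < a" "0 < b" for a b
 proof -
  have "(%x. x powr q) ((1 - l) *\<^sub>R (b/(1-l)) + l *\<^sub>R (a/l)) <= (1 - l) * (b/(1-l)) powr q + l * (a/l) powr q"
   using powr_convex[OF assms(3)] that assms
   by (intro convex_onD) auto
  moreover have "(1 - l) *\<^sub>R (b/(1-l)) + l *\<^sub>R (a/l) = a + b" using assms by simp
  ultimately have "(a + b) powr q <= (1-l) * (b/(1-l)) powr q + l * (a/l) powr q"
   by simp
  also have "l * (a/l) powr q = l powr (1-q) * a powr q"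
   using assms that by (simp add: powr_divide powr_diff field_simps)
  also have "(1-l) * (b/(1-l)) powr q = (1-l) powr (1-q) * b powr q"
   using assms that by (simp add: powr_divide powr_diff field_simps)
  finally show ?thesis by simp
 qed
 have l1: "1 <= l powr (1-q)" "1 <= (1-l) powr (1-q)"
  using powr_mono'[of "1-q" 0 l] powr_mono'[of "1-q" 0 "1-l"] assms by auto
 show ?thesis
  using pos[of a b] assms l1 by (cases "a = 0"; cases "b = 0") (auto simp: mult_le_cancel_right1)
qed

text \<open>The integrands themselves play the role of q-th powers; only their roots have to satisfy
  the triangle inequality. In this form it serves over points, over the centres of balls and over
  the time t.\<close>

lemma minkowski_nn:
 assumes [measurable]: "F \<in> borel_measurable M" "G \<in> borel_measurable M" "H \<in> borel_measurable M"
  and q: "1 <= q"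
  and le: "AE x in M. enn_powr (F x) (1/q) <= enn_powr (G x) (1/q) + enn_powr (H x) (1/q)"
 shows "enn_powr (\<integral>\<^sup>+ x. F x \<partial>M) (1/q) <= enn_powr (\<integral>\<^sup>+ x. G x \<partial>M) (1/q) + enn_powr (\<integral>\<^sup>+ x. H x \<partial>M) (1/q)"
proof -
 let ?A = "\<integral>\<^sup>+ x. G x \<partial>M" and ?B = "\<integral>\<^sup>+ x. H x \<partial>M"
 have pw: "F x <= ennreal (l powr (1-q)) * G x + ennreal ((1-l) powr (1-q)) * H x"
  if "enn_powr (F x) (1/q) <= enn_powr (G x) (1/q) + enn_powr (H x) (1/q)" "0 < l" "l < 1" for x l
 proof -
  have "enn_powr (enn_powr (F x) (1/q)) q <= enn_powr (enn_powr (G x) (1/q) + enn_powr (H x) (1/q)) q"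
   using that q by (intro enn_powr_mono) auto
  hence 1: "F x <= enn_powr (enn_powr (G x) (1/q) + enn_powr (H x) (1/q)) q"
   using q by (simp add: enn_powr_powr)
  show ?thesis
  proof (cases "G x = top | H x = top")
   case True thus ?thesis using that by (auto simp: ennreal_mult_top)
  next
   case False
   then obtain g h where gh: "G x = ennreal g" "H x = ennreal h" "g >= 0" "h >= 0"
    by (metis ennreal_cases)
   have "(g powr (1/q) + h powr (1/q)) powr q <= l powr (1-q) * g + (1-l) powr (1-q) * h"
    using add_powr_convex[of "g powr (1/q)" "h powr (1/q)" q l] that q gh by (simp add: powr_powr)
   with 1 gh q show ?thesis
    by (simp add: ennreal_plus[symmetric] ennreal_mult[symmetric] del: ennreal_plus) (meson ennreal_leI order_trans)
  qed
 qed
 have I: "(\<integral>\<^sup>+ x. F x \<partial>M) <= ennreal (l powr (1-q)) * ?A + ennreal ((1-l) powr (1-q)) * ?B" if "0 < l" "l < 1" for l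
 proof -
  have "(\<integral>\<^sup>+ x. F x \<partial>M) <= (\<integral>\<^sup>+ x. ennreal (l powr (1-q)) * G x + ennreal ((1-l) powr (1-q)) * H x \<partial>M)"
   using le pw that by (intro nn_integral_mono_AE) auto
  also have "... = ennreal (l powr (1-q)) * ?A + ennreal ((1-l) powr (1-q)) * ?B"
   by (subst nn_integral_add) (auto simp: nn_integral_cmult)
  finally show ?thesis .
 qed
 consider "?A = top | ?B = top" | "?A = 0" | "?B = 0" | a b where "?A = ennreal a" "?B = ennreal b" "a > 0" "b > 0"
  by (metis ennreal_cases ennreal_0 less_eq_real_def)
 thus ?thesis
 proof cases
  case 1 thus ?thesis by auto
 next
  case 2
  hence "AE x in M. G x = 0" by (simp add: nn_integral_0_iff_AE)
  with le have "AE x in M. F x <= H x"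
  proof eventually_elim
   case (elim x)
   hence "enn_powr (F x) (1/q) <= enn_powr (H x) (1/q)" by simp
   hence "enn_powr (enn_powr (F x) (1/q)) q <= enn_powr (enn_powr (H x) (1/q)) q"
    using q by (auto intro: enn_powr_mono[of q])
   thus ?case using q by (simp add: enn_powr_powr)
  qed
  hence "(\<integral>\<^sup>+ x. F x \<partial>M) <= ?B" by (rule nn_integral_mono_AE)
  thus ?thesis using q enn_powr_mono[of "1/q"] by (simp add: add_increasing)
 next
  case 3
  hence "AE x in M. H x = 0" by (simp add: nn_integral_0_iff_AE)
  with le have "AE x in M. F x <= G x"
  proof eventually_elim
   case (elim x)
   hence "enn_powr (F x) (1/q) <= enn_powr (G x) (1/q)" by simp
   hence "enn_powr (enn_powr (F x) (1/q)) q <= enn_powr (enn_powr (G x) (1/q)) q"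
    using q by (auto intro: enn_powr_mono[of q])
   thus ?case using q by (simp add: enn_powr_powr)
  qed
  hence "(\<integral>\<^sup>+ x. F x \<partial>M) <= ?A" by (rule nn_integral_mono_AE)
  thus ?thesis using q enn_powr_mono[of "1/q"] by (simp add: add_increasing2)
 next
  case 4
  \<comment> \<open>This weight minimises the right hand side of \<open>I\<close>, where the two
    summands combine to \<open>(u+v) powr q\<close>.\<close>
  define u v l where "u = a powr (1/q)" and "v = b powr (1/q)" and "l = u / (u + v)"
  have uv: "u > 0" "v > 0" using 4 by (auto simp: u_def v_def)
  have l: "0 < l" "l < 1" "1 - l = v / (u+v)" using uv by (auto simp: l_def field_simps)
  have a: "a = u powr q" "b = v powr q" using 4 q by (auto simp: u_def v_def powr_powr)
  have d: "(w / (u+v)) powr (1-q) = w powr (1-q) * (u+v) powr (q-1)" if "w > 0" for w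
   using uv that powr_minus_divide[of "u+v" "q-1"] by (simp add: powr_divide)
  have m: "w powr (1-q) * w powr q = w" if "w > 0" for w :: real
   using that by (simp flip: powr_add)
  have "l powr (1-q) * a + (1-l) powr (1-q) * b
    = (u+v) powr (q - 1) * (u powr (1-q) * u powr q + v powr (1-q) * v powr q)"
   unfolding l(3) unfolding l_def a d[OF uv(1)] d[OF uv(2)] by (simp add: algebra_simps)
  also have "... = (u+v) powr (q-1) * (u+v) powr 1"
   using uv by (simp add: m)
  also have "... = (u+v) powr q" unfolding powr_add[symmetric] by simp
  finally have e: "l powr (1-q) * a + (1-l) powr (1-q) * b = (u+v) powr q" .
  have "(\<integral>\<^sup>+ x. F x \<partial>M) <= ennreal ((u+v) powr q)"
   using I[OF l(1,2)] 4 unfolding e[symmetric] by (simp add: ennreal_plus ennreal_mult)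
  hence "enn_powr (\<integral>\<^sup>+ x. F x \<partial>M) (1/q) <= enn_powr (ennreal ((u+v) powr q)) (1/q)"
   using q by (intro enn_powr_mono) auto
  also have "... = ennreal (u + v)" using uv q by (simp add: powr_powr)
  also have "... = enn_powr ?A (1/q) + enn_powr ?B (1/q)"
   using 4 uv by (simp add: u_def v_def)
  finally show ?thesis .
 qed
qed

lemma weighted_am_gm:
 fixes x y l :: real
 assumes "0 <= x" "0 <= y" "0 < l" "l < 1"
 shows "x powr l * y powr (1-l) <= l * x + (1-l) * y"
proof (cases "x = 0 | y = 0")
 case True thus ?thesis using assms by auto
next
 case False
 hence p: "x > 0" "y > 0" using assms by auto
 have "exp (l * ln x + (1-l) * ln y) <= l * exp (ln x) + (1-l) * exp (ln y)"
  using convex_onD[OF exp_convex, of l "ln y" "ln x"] assms by (simp add: algebra_simps)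
 thus ?thesis using p by (simp add: powr_def exp_add)
qed

lemma holder_nn:
 fixes f g :: "'a => real"
 assumes [measurable]: "f \<in> borel_measurable M" "g \<in> borel_measurable M"
  and nn: "!!x. 0 <= f x" "!!x. 0 <= g x" and l: "0 < l" "l < 1"
 shows "(\<integral>\<^sup>+ x. ennreal (f x powr l * g x powr (1-l)) \<partial>M)
   <= enn_powr (\<integral>\<^sup>+ x. ennreal (f x) \<partial>M) l * enn_powr (\<integral>\<^sup>+ x. ennreal (g x) \<partial>M) (1-l)"
proof -
 let ?A = "\<integral>\<^sup>+ x. ennreal (f x) \<partial>M" and ?B = "\<integral>\<^sup>+ x. ennreal (g x) \<partial>M"
 consider "?A = 0 | ?B = 0" | "?A ~= 0" "?B ~= 0" "?A = top | ?B = top"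
  | a b where "?A = ennreal a" "?B = ennreal b" "a > 0" "b > 0"
  by (metis ennreal_cases ennreal_0 less_eq_real_def)
 thus ?thesis
 proof cases
  case 1
  hence "(AE x in M. ennreal (f x) = 0) | (AE x in M. ennreal (g x) = 0)"
   by (simp add: nn_integral_0_iff_AE)
  hence "AE x in M. ennreal (f x powr l * g x powr (1-l)) = 0"
  proof
   assume "AE x in M. ennreal (f x) = 0" thus ?thesis
   proof eventually_elim
    case (elim x)
    hence "f x = 0" using nn(1)[of x] by (simp add: ennreal_eq_0_iff)
    thus ?case by simp
   qed
  next
   assume "AE x in M. ennreal (g x) = 0" thus ?thesis
   proof eventually_elim
    case (elim x)
    hence "g x = 0" using nn(2)[of x] by (simp add: ennreal_eq_0_iff)
    thus ?case by simp
   qed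
  qed
  hence "(\<integral>\<^sup>+ x. ennreal (f x powr l * g x powr (1-l)) \<partial>M) = 0"
   by (subst nn_integral_0_iff_AE) auto
  thus ?thesis by simp
 next
  case 2
  have "enn_powr x c ~= 0" if "x ~= 0" for x c
   using that by (cases x) (auto simp: enn_powr_def ennreal_eq_0_iff)
  hence "enn_powr ?A l * enn_powr ?B (1-l) = top"
   using 2 by (auto simp: ennreal_mult_eq_top_iff)
  thus ?thesis by simp
 next
  case 3
  have pw: "f x powr l * g x powr (1-l) <= (a powr l * b powr (1-l)) * (l / a * f x + (1-l) / b * g x)" for x
  proof -
   have "(f x / a) powr l * (g x / b) powr (1-l) <= l * (f x / a) + (1-l) * (g x / b)"
    using nn 3 l by (intro weighted_am_gm) auto
   hence "f x powr l * g x powr (1-l) / (a powr l * b powr (1-l)) <= l / a * f x + (1-l) / b * g x"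
    using nn 3 l by (simp add: powr_divide)
   thus ?thesis using 3 by (simp add: divide_le_eq mult.commute)
  qed
  have "(\<integral>\<^sup>+ x. ennreal (f x powr l * g x powr (1-l)) \<partial>M) <=
    (\<integral>\<^sup>+ x. ennreal (a powr l * b powr (1-l)) * (ennreal (l/a) * ennreal (f x) + ennreal ((1-l)/b) * ennreal (g x)) \<partial>M)"
   using pw nn 3 l
   by (intro nn_integral_mono) (auto simp: ennreal_mult[symmetric] ennreal_plus[symmetric] simp del: ennreal_plus intro!: ennreal_leI)
  also have "... = ennreal (a powr l * b powr (1-l)) * (ennreal (l/a) * ?A + ennreal ((1-l)/b) * ?B)"
   by (simp add: nn_integral_cmult nn_integral_add)
  also have "... = ennreal (a powr l * b powr (1-l))"
   using 3 l by (simp add: ennreal_mult[symmetric] ennreal_plus[symmetric] del: ennreal_plus)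
  also have "... = enn_powr ?A l * enn_powr ?B (1-l)"
   using 3 by (simp add: ennreal_mult)
  finally show ?thesis .
 qed
qed

text \<open>The linear part is the identity plus a rank one map, with determinant one plus
  \<open>w \<bullet> m\<close>. Such maps will carry one jump line onto another without a
  Jacobian.\<close>

lemma nn_integral_shear:
 fixes m w :: pt and g :: "pt => ennreal"
 assumes wm: "w \<bullet> m = 0" and [measurable]: "g \<in> bm"
 shows "(LI u. g (u + (w \<bullet> u + b) *\<^sub>R m)) = (LI u. g u)"
proof -
 define F where "F u = u + (w \<bullet> u) *\<^sub>R m" for u :: pt
 \<comment> \<open>Inverse of \<open>F\<close>, because \<open>w\<close> is orthogonal to
   \<open>m\<close>. Preimages of boxes under \<open>F\<close> are images under \<open>G\<close>, so
   it is the determinant of \<open>G\<close> that is computed.\<close>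
 define G where "G u = u - (w \<bullet> u) *\<^sub>R m" for u :: pt
 have FG: "F (G u) = u" "G (F u) = u" for u
 proof -
  have "w \<bullet> G u = w \<bullet> u" "w \<bullet> F u = w \<bullet> u"
   unfolding F_def G_def inner_diff_right inner_add_right inner_scaleR_right wm by simp_all
  thus "F (G u) = u" "G (F u) = u"
   unfolding F_def[of "G u"] G_def[of "F u"] by (simp_all add: F_def G_def)
 qed
 have linG: "linear G" unfolding G_def
  by (intro linearI) (simp_all add: inner_add_right scaleR_add_left scaleR_diff_right)
 have [measurable]: "F \<in> bm"
  unfolding F_def by measurable
 have wm2: "w$1 * m$1 + w$2 * m$2 = 0" using wm by (simp add: inner_vec_def sum_2)
 have e: "matrix G $ i $ j = (if i = j then 1 else 0) - w$j * m$i" for i j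
  unfolding matrix_def G_def by (auto simp: inner_axis) (auto simp: axis_def)
 have "det (matrix G) = 1 - (w$1 * m$1 + w$2 * m$2)"
  unfolding det_2 e by (simp add: algebra_simps)
 hence det: "det (matrix G) = 1" using wm2 by simp
 have "lborel = distr lborel borel F"
 proof (rule lborel_eqI)
  fix l u :: pt
  assume lu: "!!b. b \<in> Basis ==> l \<bullet> b <= u \<bullet> b"
  have eq: "F -` box l u = G ` box l u"
  proof (intro set_eqI iffI)
   fix x assume "x \<in> F -` box l u"
   hence "G (F x) \<in> G ` box l u" by blast
   thus "x \<in> G ` box l u" by (simp add: FG)
  qed (auto simp: FG)
  have bx: "box l u \<in> lmeasurable" by simp
  have "emeasure (distr lborel borel F) (box l u) = emeasure lborel (F -` box l u)"
   by (subst emeasure_distr) auto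
  also have "... = emeasure lebesgue (G ` box l u)"
  proof -
   have "F -` box l u \<in> sets borel"
    using measurable_sets_borel[OF \<open>F \<in> bm\<close>, of "box l u"] by simp
   thus ?thesis unfolding eq[symmetric] by simp
  qed
  also have "... = ennreal (measure lebesgue (G ` box l u))"
   using measurable_linear_image[OF linG bx] by (simp add: emeasure_eq_measure2)
  also have "... = ennreal (measure lebesgue (box l u))"
   using measure_linear_image[OF linG bx] det by simp
  also have "... = emeasure lborel (box l u)"
   using bx by (simp add: emeasure_eq_measure2)
  also have "... = ennreal (\<Prod>b\<in>Basis. (u - l) \<bullet> b)"
   using lu by (simp add: emeasure_lborel_box)
  finally show "emeasure (distr lborel borel F) (box l u) = ennreal (\<Prod>b\<in>Basis. (u - l) \<bullet> b)" .
 qed simp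
 hence "integral\<^sup>N lborel k = integral\<^sup>N (distr lborel borel F) k" for k :: "pt => ennreal"
  by (rule arg_cong)
 hence F: "(LI u. k (F u)) = (LI u. k u)" if "k \<in> bm" for k :: "pt => ennreal"
  using nn_integral_distr[of F lborel borel k] that by simp
 have "(LI u. g (u + (w \<bullet> u + b) *\<^sub>R m)) = (LI u. g (b *\<^sub>R m + 1 *\<^sub>R F u))"
  by (simp add: F_def algebra_simps)
 also have "... = (LI u. g (b *\<^sub>R m + 1 *\<^sub>R u))"
  by (rule F) measurable
 also have "... = (LI u. g u)"
  by (subst nn_integral_scale_pt) auto
 finally show ?thesis .
qed

section \<open>Finite differences and polynomials\<close>

text \<open>The k-th difference without the domain condition of \<open>fdiff\<close>. The type is
  general because the difference of a function of \<open>n \<bullet> x\<close> is one on the real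
  line, with step \<open>n \<bullet> h\<close>.\<close>

definition dsum :: "nat => 'a::real_vector => ('a => real) => 'a => real" where
 "dsum k h f x = (\<Sum>nv\<le>k. (-1) ^ (k + nv) * real (k choose nv) * f (x + real nv *\<^sub>R h))"

text \<open>Frechet's functional equation for polynomials of degree below k. In this form the
  property passes to affine substitutions and gives extrapolation along arithmetic progressions
  directly.\<close>

definition polyfun :: "nat => ('a::real_vector => real) => bool" where
 "polyfun k f \<longleftrightarrow> (\<forall>x h. dsum k h f x = 0)"

lemma dsum_0 [simp]: "dsum 0 h f x = f x"
 by (simp add: dsum_def)

lemma dsum_Suc: "dsum (Suc k) h f x = dsum k h f (x + h) - dsum k h f x"
proof -
 let ?g = "%nv. f (x + real nv *\<^sub>R h)"
 have 1: "dsum k h f (x + h) = (\<Sum>nv\<le>k. (-1) ^ (k + nv) * real (k choose nv) * ?g (Suc nv))"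
  by (simp add: dsum_def algebra_simps)
 have "dsum k h f x = (\<Sum>nv\<le>Suc k. (-1) ^ (k + nv) * real (k choose nv) * ?g nv)"
  by (simp add: dsum_def)
 also have "... = (-1)^k * ?g 0 + (\<Sum>nv\<le>k. (-1) ^ (k + Suc nv) * real (k choose Suc nv) * ?g (Suc nv))"
  by (subst sum.atMost_Suc_shift) simp
 finally have 2: "dsum k h f x = (-1)^k * ?g 0 + (\<Sum>nv\<le>k. (-1) ^ (k + Suc nv) * real (k choose Suc nv) * ?g (Suc nv))" .
 have "dsum (Suc k) h f x = (-1)^(Suc k) * ?g 0 + (\<Sum>nv\<le>k. (-1) ^ (Suc k + Suc nv) * real (Suc k choose Suc nv) * ?g (Suc nv))"
  unfolding dsum_def by (subst sum.atMost_Suc_shift) simp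
 also have "... = dsum k h f (x + h) - dsum k h f x"
  unfolding 1 2 by (simp add: algebra_simps sum.distrib sum_subtractf sum_negf)
 finally show ?thesis .
qed

lemma dsum_add: "dsum k h (%x. f x + g x) x = dsum k h f x + dsum k h g x"
 by (simp add: dsum_def algebra_simps sum.distrib)
lemma dsum_diff: "dsum k h (%x. f x - g x) x = dsum k h f x - dsum k h g x"
 by (simp add: dsum_def algebra_simps sum_subtractf)
lemma dsum_cmult: "dsum k h (%x. c * f x) x = c * dsum k h f x"
 by (simp add: dsum_def algebra_simps sum_distrib_left)
lemma dsum_sum: "dsum k h (%x. \<Sum>i\<in>I. f i x) x = (\<Sum>i\<in>I. dsum k h (f i) x)"
 unfolding dsum_def by (subst sum.swap) (simp add: sum_distrib_left)
lemma dsum_affine: "dsum k h (%x. f (z + c *\<^sub>R x)) x = dsum k (c *\<^sub>R h) f (z + c *\<^sub>R x)"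
 by (simp add: dsum_def algebra_simps)
lemma dsum_shift: "dsum k h (%x. f (x + w)) x = dsum k h f (x + w)"
 by (simp add: dsum_def algebra_simps)
lemma dsum_inner: "dsum k h (%x. g (n \<bullet> x - a)) x = dsum k (n \<bullet> h) g (n \<bullet> x - a)"
 by (simp add: dsum_def inner_add_right algebra_simps)

lemma polyfun_add: "polyfun k f ==> polyfun k g ==> polyfun k (%x. f x + g x)"
 by (simp add: polyfun_def dsum_add)
lemma polyfun_diff: "polyfun k f ==> polyfun k g ==> polyfun k (%x. f x - g x)"
 by (simp add: polyfun_def dsum_diff)
lemma polyfun_cmult: "polyfun k f ==> polyfun k (%x. c * f x)"
 by (simp add: polyfun_def dsum_cmult)
lemma polyfun_affine: "polyfun k f ==> polyfun k (%x. f (z + c *\<^sub>R x))"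
 by (simp add: polyfun_def dsum_affine)

lemma polyfun_SucI:
 assumes "!!h. polyfun k (%x. f (x + h) - f x)"
 shows "polyfun (Suc k) f"
 using assms by (simp add: polyfun_def dsum_Suc dsum_diff dsum_shift)

text \<open>All powers up to k are treated together: the first difference of \<open>y ^ j\<close> is
  a combination of lower powers, and the remaining difference of order k - 1 sees only the one of
  exponent k - 1.\<close>

lemma dsum_power:
 fixes u y :: real
 assumes "j <= k"
 shows "dsum k u (%y. y ^ j) y = (if j = k then fact k * u ^ k else 0)"
 using assms
proof (induction k arbitrary: j y)
 case (Suc k)
 have "dsum (Suc k) u (%y. y^j) y = dsum k u (%y. (y + u)^j - y^j) y"
  using dsum_shift[of k u "%y. y^j" u y] by (simp add: dsum_Suc dsum_diff)
 also have "(%y::real. (y + u)^j - y^j) = (%y. \<Sum>i<j. (real (j choose i) * u ^ (j - i)) * y ^ i)"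
 proof
  fix y :: real
  have "(y + u)^j = (\<Sum>i<Suc j. real (j choose i) * y ^ i * u ^ (j - i))"
   by (simp only: binomial_ring lessThan_Suc_atMost)
  also have "... = (\<Sum>i<j. real (j choose i) * y ^ i * u ^ (j - i)) + y^j" by simp
  finally show "(y + u)^j - y^j = (\<Sum>i<j. (real (j choose i) * u ^ (j - i)) * y ^ i)"
   by (simp add: mult_ac)
 qed
 also have "dsum k u ... y = (\<Sum>i<j. (real (j choose i) * u ^ (j - i)) * dsum k u (%y. y^i) y)"
  by (simp add: dsum_sum dsum_cmult)
 also have "... = (\<Sum>i<j. (real (j choose i) * u ^ (j - i)) * (if i = k then fact k * u ^ k else 0))"
  using Suc.prems by (intro sum.cong refl) (subst Suc.IH, auto)
 also have "... = (if j = Suc k then real (j choose k) * u ^ (j - k) * (fact k * u ^ k) else 0)"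
 proof (cases "j = Suc k")
  case False
  hence "i ~= k" if "i < j" for i using that Suc.prems by auto
  thus ?thesis using False by simp
 qed simp
 finally show ?case by simp
qed simp

lemma dsum_linear_power:
 fixes n :: pt
 shows "dsum k h (%x. (n \<bullet> x - a) ^ k) x = fact k * (n \<bullet> h) ^ k"
 using dsum_power[of k k "n \<bullet> h" "n \<bullet> x - a"] dsum_inner[of k h "%y. y^k" n a x] by simp

lemma polyfun_linear_power:
 fixes n :: pt
 assumes "j < k" shows "polyfun k (%x. (n \<bullet> x - a) ^ j)"
 using assms by (simp add: polyfun_def dsum_inner[of k _ "%y. y^j"] dsum_power)

text \<open>A vanishing k-th difference expresses each value by the k values before it. The constant
  depends on k and M only, whatever the function, base point and step.\<close>

lemma polyfun_extrapolate:
 "\<exists>C\<ge>0. \<forall>(f::'a::real_vector => real) x h. polyfun k f -->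
   abs(f (x + real M *\<^sub>R h)) <= C * (\<Sum>nv<k. abs(f (x + real nv *\<^sub>R h)))"
proof (induction M rule: less_induct)
 case (less M)
 show ?case
 proof (cases "M < k")
  case True
  hence "abs(f (x + real M *\<^sub>R h)) <= 1 * (\<Sum>nv<k. abs(f (x + real nv *\<^sub>R h)))" for f :: "'a => real" and x h
   by (simp add: member_le_sum[of M "{..<k}" "%nv. abs(f (x + real nv *\<^sub>R h))"])
  thus ?thesis by (intro exI[of _ 1]) auto
 next
  case False
  define m where "m = M - k"
  have M: "M = m + k" using False by (simp add: m_def)
  have "\<forall>nv. \<exists>C. nv < k --> (C >= 0 & (\<forall>(f::'a => real) x h. polyfun k f -->
    abs(f (x + real (m + nv) *\<^sub>R h)) <= C * (\<Sum>nv<k. abs(f (x + real nv *\<^sub>R h)))))"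
   using less.IH M by (metis add_less_cancel_left)
  then obtain C where C: "!!nv. nv < k ==> C nv >= 0"
   "!!nv (f::'a => real) x h. nv < k ==> polyfun k f ==>
    abs(f (x + real (m + nv) *\<^sub>R h)) <= C nv * (\<Sum>nv<k. abs(f (x + real nv *\<^sub>R h)))"
   by metis
  have "abs(f (x + real M *\<^sub>R h)) <= (\<Sum>nv<k. real (k choose nv) * C nv) * (\<Sum>nv<k. abs(f (x + real nv *\<^sub>R h)))"
   if p: "polyfun k f" for f :: "'a => real" and x h
  proof -
   have "dsum k h f (x + real m *\<^sub>R h) = 0" using p by (simp add: polyfun_def)
   hence "f (x + real M *\<^sub>R h) = - (\<Sum>nv<k. (-1) ^ (k + nv) * real (k choose nv) * f (x + real (m + nv) *\<^sub>R h))"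
    unfolding dsum_def lessThan_Suc_atMost[symmetric] M by (simp add: algebra_simps)
   also have "\<bar>...\<bar> <= (\<Sum>nv<k. real (k choose nv) * \<bar>f (x + real (m + nv) *\<^sub>R h)\<bar>)"
    unfolding abs_minus_cancel by (rule order_trans[OF sum_abs]) (simp add: abs_mult power_abs)
   also have "... <= (\<Sum>nv<k. real (k choose nv) * (C nv * (\<Sum>nv<k. abs(f (x + real nv *\<^sub>R h)))))"
    using C p by (intro sum_mono mult_left_mono) auto
   finally show ?thesis by (simp add: sum_distrib_right algebra_simps)
  qed
  moreover have "(\<Sum>nv<k. real (k choose nv) * C nv) >= 0" using C by (intro sum_nonneg) auto
  ultimately show ?thesis by blast
 qed
qed

text \<open>Averaging the extrapolation formula along the segments from y into the ball replaces
 the equivalence of norms on a finite-dimensional space and makes the bound scale invariant.\<close>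

lemma ball_measurable [measurable]: "ball (z::pt) r \<in> sets borel"
 by simp

lemma polyfun_remez:
 fixes tau A :: real
 assumes "tau > 0" "A >= 0"
 shows "\<exists>C>0. \<forall>(f :: pt => real) z rho y. polyfun k f --> f \<in> bm --> rho > 0 -->
   dist y z <= A * rho -->
   ennreal (abs(f y) powr tau * rho\<^sup>2) <= ennreal C * (\<integral>\<^sup>+ x\<in>ball z rho. pw tau (f x) \<partial>lborel)"
proof -
 \<comment> \<open>With this many subdivisions of the segment from x to y, its first k nodes lie
   within \<open>rho / 2\<close> of x, and each map from x to such a node has ratio at least one
   half.\<close>
 obtain M :: nat where "2 * real k * (A + 1) + 2 < real M" using reals_Archimedean2 by blast
 moreover have "2 * real k * (A + 1) >= 2 * real k" using assms by (simp add: mult_le_cancel_left1)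
 ultimately have M: "2 * real k * (A + 1) < real M" "real M > 0" "2 * real k < real M" using assms by auto
 obtain C0 where C0: "C0 >= 0" "!!(f::pt => real) x h. polyfun k f ==>
   abs(f (x + real M *\<^sub>R h)) <= C0 * (\<Sum>nv<k. abs(f (x + real nv *\<^sub>R h)))"
  using polyfun_extrapolate[where 'a=pt, of k M] by blast
 define K where "K = C0 powr tau * real k powr tau"
 have K: "K >= 0" by (simp add: K_def)
 define C where "C = 16 * K * real k / unit_area + 1"
 have main: "ennreal (abs(f y) powr tau * rho\<^sup>2) <= ennreal C * (\<integral>\<^sup>+ x\<in>ball z rho. pw tau (f x) \<partial>lborel)"
  if pf: "polyfun k f" and [measurable]: "f \<in> bm" and r: "rho > 0" and d: "dist y z <= A * rho"
  for f :: "pt => real" and z rho y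
 proof -
  define g where "g x = pw tau (f x) * indicator (ball z rho) x" for x
  have [measurable]: "g \<in> bm" unfolding g_def by measurable
  let ?c = "%nv. real nv / real M"
  have pw: "pw tau (f y) * indicator (ball z (rho/2)) x <= ennreal K * (\<Sum>nv<k. g (?c nv *\<^sub>R y + (1 - ?c nv) *\<^sub>R x))" for x
  proof (cases "x \<in> ball z (rho/2)")
   case True
   define h where "h = (1 / real M) *\<^sub>R (y - x)"
   have e: "x + real nv *\<^sub>R h = ?c nv *\<^sub>R y + (1 - ?c nv) *\<^sub>R x" for nv
    by (simp add: h_def algebra_simps)
   have eM: "x + real M *\<^sub>R h = y" using M by (simp add: h_def)
   have in_ball: "x + real nv *\<^sub>R h \<in> ball z rho" if "nv < k" for nv
   proof -
    have "norm (y - x) <= (A + 1) * rho"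
     using d True r norm_triangle_ineq[of "y - z" "z - x"] by (simp add: dist_norm algebra_simps)
    hence "norm (real nv *\<^sub>R h) <= real k / real M * ((A + 1) * rho)"
     unfolding h_def using that M
     by (simp add: frac_le mult_mono divide_right_mono)
    also have "... <= rho / 2"
     using mult_right_mono[OF less_imp_le[OF M(1)], of rho] M r by (simp add: field_simps)
    finally show ?thesis using True norm_triangle_ineq[of "x - z" "real nv *\<^sub>R h"]
     by (simp add: dist_norm norm_minus_commute algebra_simps)
   qed
   have "abs(f y) <= C0 * (\<Sum>nv<k. abs(f (x + real nv *\<^sub>R h)))"
    using C0(2)[OF pf, of x h] eM by simp
   hence "abs(f y) powr tau <= (C0 * (\<Sum>nv<k. abs(f (x + real nv *\<^sub>R h)))) powr tau"
    using assms by (intro powr_mono2) auto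
   also have "... = C0 powr tau * (\<Sum>nv<k. abs(f (x + real nv *\<^sub>R h))) powr tau"
    using C0 by (simp add: powr_mult sum_nonneg)
   also have "... <= C0 powr tau * (real k powr tau * (\<Sum>nv<k. abs(f (x + real nv *\<^sub>R h)) powr tau))"
    using sum_powr_le[of "{..<k}" "%nv. abs(f (x + real nv *\<^sub>R h))" tau] assms by (intro mult_left_mono) auto
   finally have "pw tau (f y) <= ennreal (K * (\<Sum>nv<k. abs(f (x + real nv *\<^sub>R h)) powr tau))"
    by (intro ennreal_leI) (simp add: K_def mult.assoc)
   also have "... = ennreal K * (\<Sum>nv<k. pw tau (f (x + real nv *\<^sub>R h)))"
    using K by (simp add: ennreal_mult sum_nonneg)
   also have "... = ennreal K * (\<Sum>nv<k. g (?c nv *\<^sub>R y + (1 - ?c nv) *\<^sub>R x))"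
    using in_ball by (auto simp: g_def e[symmetric] indicator_def intro!: arg_cong2[of _ _ _ _ "(*)"] sum.cong)
   finally show ?thesis using True by simp
  qed simp
  have quarter: "1 / c\<^sup>2 <= 4" if "c >= 1/2" for c :: real
  proof -
   have "(1/2)\<^sup>2 <= c\<^sup>2" using that by (intro power_mono) auto
   thus ?thesis using that by (simp add: field_simps power2_eq_square)
  qed
  have "pw tau (f y) * ennreal ((rho/2)\<^sup>2 * unit_area) = (LI x. pw tau (f y) * indicator (ball z (rho/2)) x)"
   using r by (subst nn_integral_cmult_indicator) (auto simp: emeasure_ball_pt)
  also have "... <= (LI x. ennreal K * (\<Sum>nv<k. g (?c nv *\<^sub>R y + (1 - ?c nv) *\<^sub>R x)))"
   by (intro nn_integral_mono pw)
  also have "... = ennreal K * (\<Sum>nv<k. (LI x. g (?c nv *\<^sub>R y + (1 - ?c nv) *\<^sub>R x)))"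
   by (subst nn_integral_cmult) (auto simp: nn_integral_sum)
  also have "... = ennreal K * (\<Sum>nv<k. ennreal (1 / (1 - ?c nv)\<^sup>2) * (LI x. g x))"
  proof -
   have "1 - ?c nv ~= 0" if "nv < k" for nv using that M by (auto simp: field_simps)
   thus ?thesis by (intro arg_cong2[of _ _ _ _ "(*)"] sum.cong refl nn_integral_scale_pt) auto
  qed
  also have "... <= ennreal K * (\<Sum>nv<k. ennreal 4 * (LI x. g x))"
  proof -
   have "1 / (1 - ?c nv)\<^sup>2 <= 4" if "nv < k" for nv
   proof -
    have "1 - ?c nv >= 1/2" using that M by (auto simp: field_simps)
    thus ?thesis by (rule quarter)
   qed
   thus ?thesis by (intro mult_left_mono sum_mono mult_right_mono ennreal_leI) auto
  qed
  also have "... = ennreal (4 * K * real k) * (LI x. g x)"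
   using K by (simp add: ennreal_mult ennreal_of_nat_eq_real_of_nat mult_ac)
  finally have e1: "ennreal (4 / unit_area) * (pw tau (f y) * ennreal ((rho/2)\<^sup>2 * unit_area))
    <= ennreal (4 / unit_area) * (ennreal (4 * K * real k) * (LI x. g x))"
   by (rule mult_left_mono) simp
  have e2: "ennreal (4 / unit_area) * (pw tau (f y) * ennreal ((rho/2)\<^sup>2 * unit_area)) = ennreal (abs(f y) powr tau * rho\<^sup>2)"
   using unit_area_pos by (simp add: ennreal_mult[symmetric] mult.assoc[symmetric]) (simp add: field_simps power2_eq_square)
  have e3: "ennreal (4 / unit_area) * (ennreal (4 * K * real k) * I) <= ennreal C * I" for I
  proof -
   have "ennreal (4 / unit_area) * ennreal (4 * K * real k) <= ennreal C"
    using unit_area_pos K by (auto simp: ennreal_mult[symmetric] C_def simp del: ennreal_plus intro!: ennreal_leI)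
   thus ?thesis by (simp add: mult.assoc[symmetric] mult_right_mono)
  qed
  show ?thesis using order_trans[OF e1 e3] unfolding e2 unfolding g_def .
 qed
 moreover have "C > 0" using K unit_area_pos by (simp add: C_def add_nonneg_pos)
 ultimately show ?thesis by (intro exI[of _ C] conjI allI impI main)
qed

text \<open>Polynomials of degree below d through their gradients. The recursion copies that of
  \<open>C_on\<close>, so that smoothness and degree can be lowered together in
  \<open>C_on_jump\<close>.\<close>

fun pol :: "nat => (pt => real) => bool" where
 "pol 0 f = (\<forall>x. f x = 0)"
| "pol (Suc d) f = (\<exists>g1 g2. (\<forall>x. (f has_derivative (%h. h$1 * g1 x + h$2 * g2 x)) (at x)) & pol d g1 & pol d g2)"

lemma pol_SucI:
 "(!!x. (f has_derivative (%h. h$1 * g1 x + h$2 * g2 x)) (at x)) ==> pol d g1 ==> pol d g2 ==> pol (Suc d) f"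
 by auto

lemma pol_continuous: "pol d f ==> continuous_on UNIV f"
proof (cases d)
 case (Suc e)
 assume "pol d f"
 with Suc obtain g1 g2 where d: "!!x. (f has_derivative (%h. h$1 * g1 x + h$2 * g2 x)) (at x)" by auto
 show ?thesis
  using has_derivative_continuous[OF d] by (simp add: continuous_on_eq_continuous_at)
next
 case 0
 assume "pol d f"
 with 0 have "f = (%x. 0)" by auto
 thus ?thesis by simp
qed

lemma zero_derivative_const:
 fixes f :: "pt => real"
 assumes "!!x. (f has_derivative (%h. 0)) (at x)"
 shows "f x = f y"
 using has_derivative_zero_unique[of UNIV f y x] assms by auto

text \<open>Translation differences commute with gradients and so lower the degree; at the bottom a
  function with zero gradient is constant.\<close>

lemma pol_diff_shift: "pol (Suc d) f ==> pol d (%x. f (x + w) - f x)"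
proof (induction d arbitrary: f)
 case 0
 hence "(f has_derivative (%h. 0)) (at x)" for x by auto
 from zero_derivative_const[OF this] show ?case by simp
next
 case (Suc d)
 then obtain f1 f2 where
  d: "!!x. (f has_derivative (%h. h$1 * f1 x + h$2 * f2 x)) (at x)"
  and p: "pol (Suc d) f1" "pol (Suc d) f2" by auto
 have s: "((%x. f (x + w)) has_derivative (%h. h$1 * (f1 (x + w)) + h$2 * (f2 (x + w)))) (at x)" for x
  by (rule has_derivative_compose[of "%x. x + w" "%h. h" x UNIV f, OF _ d[of "x + w"]])
   (auto intro!: derivative_eq_intros)
 have D: "((%x. f (x + w) - f x) has_derivative (%h. h$1 * (f1 (x + w) - f1 x) + h$2 * (f2 (x + w) - f2 x))) (at x)" for x
  using has_derivative_diff[OF s[of x] d[of x]] by (simp add: algebra_simps)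
 show ?case by (rule pol_SucI[OF D Suc.IH[OF p(1)] Suc.IH[OF p(2)]])
qed

lemma pol_polyfun: "pol d f ==> polyfun d f"
proof (induction d arbitrary: f)
 case (Suc d)
 thus ?case by (intro polyfun_SucI Suc.IH pol_diff_shift)
qed (simp add: polyfun_def)

lemma has_derivative_monomial:
 fixes x :: pt
 shows "((%x::pt. c * (x$1)^i * (x$2)^j) has_derivative
   (%h. c * (real i * h$1 * (x$1)^(i-1)) * (x$2)^j + c * (x$1)^i * (real j * h$2 * (x$2)^(j-1)))) (at x)"
proof -
 have p: "((%x::pt. (x$l)^i) has_derivative (%h. real i * h$l * (x$l)^(i-1))) (at x)" for l :: 2 and i
  using has_derivative_power[OF bounded_linear.has_derivative[OF bounded_linear_vec_nth has_derivative_ident], of l i x UNIV]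
  by (simp add: mult_ac)
 have "((%x::pt. (x$1)^i * (x$2)^j) has_derivative
   (%h. (x$1)^i * (real j * h$2 * (x$2)^(j-1)) + (real i * h$1 * (x$1)^(i-1)) * (x$2)^j)) (at x)"
  by (rule has_derivative_mult[OF p[of 1 i] p[of 2 j]])
 from has_derivative_mult_right[OF this, of c] show ?thesis
  by (simp add: algebra_simps)
qed

lemma pol_poly2: "pol k (poly2 k a)"
proof (induction k arbitrary: a)
 case (Suc k)
 define a1 where "a1 i j = real (Suc i) * a (Suc i) j" for i j
 define a2 where "a2 i j = real (Suc j) * a i (Suc j)" for i j
 have D: "(poly2 (Suc k) a has_derivative (%h. h$1 * poly2 k a1 x + h$2 * poly2 k a2 x)) (at x)" for x
 proof -
  have "(poly2 (Suc k) a has_derivative (%h. \<Sum>i<Suc k. \<Sum>j<Suc k - i. a i j * (real i * h$1 * (x$1)^(i-1)) * (x$2)^j + a i j * (x$1)^i * (real j * h$2 * (x$2)^(j-1)))) (at x)"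
   unfolding poly2_def by (intro has_derivative_sum has_derivative_monomial)
  moreover have "(\<Sum>i<Suc k. \<Sum>j<Suc k - i. a i j * (real i * h$1 * (x$1)^(i-1)) * (x$2)^j + a i j * (x$1)^i * (real j * h$2 * (x$2)^(j-1))) = h$1 * poly2 k a1 x + h$2 * poly2 k a2 x" for h :: pt
  proof -
   have s1: "(\<Sum>i<Suc k. \<Sum>j<Suc k - i. a i j * (real i * h$1 * (x$1)^(i-1)) * (x$2)^j)
     = (\<Sum>i<k. \<Sum>j<k - i. a (Suc i) j * (real (Suc i) * h$1 * (x$1)^i) * (x$2)^j)"
    by (subst sum.lessThan_Suc_shift) simp
   have s2: "... = h$1 * poly2 k a1 x"
    by (simp add: poly2_def a1_def sum_distrib_left mult_ac del: of_nat_Suc)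
   have s3: "(\<Sum>j<Suc k - i. a i j * (x$1)^i * (real j * h$2 * (x$2)^(j-1))) = h$2 * (\<Sum>j<k - i. a2 i j * (x$1)^i * (x$2)^j)" if "i < Suc k" for i
   proof -
    have e: "Suc k - i = Suc (k - i)" using that by simp
    have "(\<Sum>j<Suc k - i. a i j * (x$1)^i * (real j * h$2 * (x$2)^(j-1)))
      = (\<Sum>j<k - i. a i (Suc j) * (x$1)^i * (real (Suc j) * h$2 * (x$2)^j))"
     unfolding e by (subst sum.lessThan_Suc_shift) simp
    also have "... = h$2 * (\<Sum>j<k - i. a2 i j * (x$1)^i * (x$2)^j)"
     by (simp add: a2_def sum_distrib_left mult_ac del: of_nat_Suc)
    finally show ?thesis .
   qed
   have s4: "(\<Sum>i<Suc k. \<Sum>j<Suc k - i. a i j * (x$1)^i * (real j * h$2 * (x$2)^(j-1)))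
     = (\<Sum>i<Suc k. h$2 * (\<Sum>j<k - i. a2 i j * (x$1)^i * (x$2)^j))"
    by (rule sum.cong[OF refl]) (rule s3, simp)
   have s5: "... = h$2 * poly2 k a2 x" by (simp add: poly2_def sum_distrib_left)
   show ?thesis by (simp only: sum.distrib s1[unfolded s2] s4[unfolded s5])
  qed
  ultimately show ?thesis by simp
 qed
 show ?case by (rule pol_SucI[OF D Suc.IH Suc.IH])
qed (simp add: poly2_def)

lemma polyfun_poly2: "polyfun k (poly2 k a)"
 by (rule pol_polyfun[OF pol_poly2])

lemma continuous_poly2: "continuous_on S (poly2 k a)"
 by (rule continuous_on_subset[OF pol_continuous[OF pol_poly2]]) simp

section \<open>Truncated powers and their differences\<close>

definition tp :: "nat => real => real" where
 "tp k y = (if y > 0 then y ^ (k - 1) else 0)"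

lemma tp_measurable [measurable]: "tp k \<in> bm"
 unfolding tp_def by measurable

lemma dsum_measurable [measurable]:
 fixes f :: "'a::euclidean_space => real"
 assumes [measurable]: "f \<in> bm"
 shows "dsum k h f \<in> bm"
 unfolding dsum_def by measurable

lemma dsum_bound:
 assumes "!!nv. nv <= k ==> abs(f (x + real nv *\<^sub>R h)) <= E"
 shows "abs(dsum k h f x) <= 2 ^ k * E"
proof -
 have "abs(dsum k h f x) <= (\<Sum>nv\<le>k. real (k choose nv) * E)"
  unfolding dsum_def using assms
  by (intro order_trans[OF sum_abs] sum_mono) (auto simp: abs_mult power_abs intro!: mult_left_mono)
 also have "... = real (\<Sum>nv\<le>k. k choose nv) * E" by (simp add: sum_distrib_right)
 also have "... = 2 ^ k * E" by (simp add: choose_row_sum)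
 finally show ?thesis .
qed

text \<open>No sample point changes side, and on either side the truncated power is a polynomial of
  degree below k. Differences of a jump are thus confined to a strip about its line.\<close>

lemma dsum_tp_eq_0:
 assumes k: "k >= 1" and y: "abs(y) > real k * abs(v)"
 shows "dsum k v (tp k) y = 0"
proof -
 have s: "abs(real nv * v) <= real k * abs(v)" if "nv <= k" for nv
  using that by (simp add: abs_mult mult_right_mono)
 show ?thesis
 proof (cases "y > 0")
  case True
  have "tp k (y + real nv *\<^sub>R v) = (y + real nv *\<^sub>R v) ^ (k - 1)" if "nv <= k" for nv
   using s[OF that] True y by (auto simp: tp_def)
  hence "dsum k v (tp k) y = dsum k v (%y. y ^ (k - 1)) y"
   unfolding dsum_def by (intro sum.cong) auto
  thus ?thesis using dsum_power[of "k-1" k v y] k by auto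
 next
  case False
  have "tp k (y + real nv *\<^sub>R v) = 0" if "nv <= k" for nv
   using s[OF that] False y by (auto simp: tp_def)
  thus ?thesis unfolding dsum_def by (intro sum.neutral) auto
 qed
qed

lemma dsum_tp_bound:
 assumes k: "k >= 1"
 shows "abs(dsum k v (tp k) y) <= 2 ^ k * (2 * real k * abs(v)) ^ (k - 1)"
proof (cases "abs(y) > real k * abs(v)")
 case True thus ?thesis using dsum_tp_eq_0[OF k True] by simp
next
 case False
 have "abs(tp k (y + real nv *\<^sub>R v)) <= (2 * real k * abs(v)) ^ (k - 1)" if "nv <= k" for nv
 proof -
  have s: "abs(real nv * v) <= real k * abs(v)"
   using that by (simp add: abs_mult mult_right_mono)
  thus ?thesis using False by (auto simp: tp_def power_abs[symmetric] intro!: power_mono)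
 qed
 thus ?thesis by (rule dsum_bound)
qed

lemma power_diff_le:
 fixes x y B :: real
 assumes "0 <= x" "x <= B" "0 <= y" "y <= B"
 shows "abs(x ^ Suc m - y ^ Suc m) <= real (Suc m) * B ^ m * abs(x - y)"
proof (induction m)
 case (Suc m)
 have "x ^ Suc (Suc m) - y ^ Suc (Suc m) = x * (x ^ Suc m - y ^ Suc m) + (x - y) * y ^ Suc m"
  by (simp add: algebra_simps)
 also have "\<bar>...\<bar> <= x * \<bar>x ^ Suc m - y ^ Suc m\<bar> + \<bar>x - y\<bar> * y ^ Suc m"
  using assms by (intro order_trans[OF abs_triangle_ineq]) (simp add: abs_mult)
 also have "... <= B * (real (Suc m) * B ^ m * abs(x - y)) + abs(x - y) * B ^ Suc m"
  using assms Suc by (intro add_mono mult_mono power_mono) auto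
 also have "... = real (Suc (Suc m)) * B ^ Suc m * abs(x - y)"
  by (simp add: algebra_simps)
 finally show ?case .
qed simp

text \<open>Converts a bound on the difference of two powers back into one on their bases, which is
  possible once the bases stay away from zero.\<close>

lemma power_diff_ge:
 fixes x y e :: real
 assumes "0 <= e" "e <= x" "e <= y"
 shows "e ^ m * abs(x - y) <= abs(x ^ Suc m - y ^ Suc m)"
proof -
 have *: "e ^ m * (x - y) <= x ^ Suc m - y ^ Suc m" if "e <= y" "y <= x" for x y
 proof -
  have "e ^ m * (x - y) <= y ^ m * (x - y)" using that assms by (intro mult_right_mono power_mono) auto
  also have "... <= x * x ^ m - y * y ^ m"
   using that assms power_mono[of y x m] mult_left_mono[of "y^m" "x^m" x] by (simp add: algebra_simps)
  finally show ?thesis by simp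
 qed
 show ?thesis
 proof (cases "y <= x")
  case True
  thus ?thesis using *[of y x] assms power_mono[of y x "Suc m"] by simp
 next
  case False
  thus ?thesis using *[of x y] assms power_mono[of x y "Suc m"] by (simp add: abs_minus_commute)
 qed
qed

lemma tp_lipschitz:
 assumes k: "k >= 2" and "abs(y) <= B" "abs(z) <= B"
 shows "abs(tp k y - tp k z) <= real k * B ^ (k - 2) * abs(y - z)"
proof -
 define m where "m = k - 2"
 have m: "k = Suc (Suc m)" using k by (simp add: m_def)
 have e: "tp k x = (max 0 x) ^ Suc m" for x unfolding tp_def m by (auto simp: max_def)
 have B: "B >= 0" using assms by simp
 have "abs(tp k y - tp k z) <= real (Suc m) * B ^ m * abs(max 0 y - max 0 z)"
  unfolding e using assms B by (intro power_diff_le) auto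
 also have "... <= real k * B ^ m * abs(y - z)"
  using B unfolding m by (intro mult_mono) auto
 finally show ?thesis unfolding m by simp
qed

text \<open>Changing the step trades one power of t for \<open>abs(v - v')\<close>, because the
  truncated power is Lipschitz when k is at least two. The step function, k = 1, gets its own
  argument below.\<close>

lemma dsum_tp_lipschitz:
 assumes k: "k >= 2" and "abs(v) <= t" "abs(v') <= t" "abs(y) <= real k * t"
 shows "abs(dsum k v (tp k) y - dsum k v' (tp k) y) <= 2 ^ k * (real k * (2 * real k * t) ^ (k - 2) * (real k * abs(v - v')))"
proof -
 have t: "t >= 0" using assms(2) abs_ge_zero[of v] by linarith
 have "dsum k v (tp k) y - dsum k v' (tp k) y = (\<Sum>nv\<le>k. (-1) ^ (k + nv) * real (k choose nv) * (tp k (y + real nv * v) - tp k (y + real nv * v')))"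
  unfolding dsum_def sum_subtractf[symmetric] real_scaleR_def by (intro sum.cong refl) (simp only: right_diff_distrib)
 also have "\<bar>...\<bar> <= (\<Sum>nv\<le>k. real (k choose nv) * (real k * (2 * real k * t) ^ (k - 2) * (real k * \<bar>v - v'\<bar>)))"
 proof (intro order_trans[OF sum_abs] sum_mono)
  fix nv assume "nv \<in> {..k}"
  hence nu: "nv <= k" by simp
  have b: "abs(y + real nv * w) <= 2 * real k * t" if "abs(w) <= t" for w
  proof -
   have "abs(real nv * w) <= real k * t" unfolding abs_mult using nu that t by (intro mult_mono) auto
   thus ?thesis using assms(4) abs_triangle_ineq[of y "real nv * w"] by linarith
  qed
  have "abs(tp k (y + real nv * v) - tp k (y + real nv * v')) <= real k * (2 * real k * t) ^ (k - 2) * abs((y + real nv * v) - (y + real nv * v'))"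
   using assms b by (intro tp_lipschitz) auto
  also have "abs((y + real nv * v) - (y + real nv * v')) = real nv * abs(v - v')"
   by (simp add: abs_mult flip: right_diff_distrib)
  also have "real k * (2 * real k * t) ^ (k - 2) * (real nv * abs(v - v')) <= real k * (2 * real k * t) ^ (k - 2) * (real k * abs(v - v'))"
   using nu t by (intro mult_left_mono mult_right_mono) auto
  finally show "abs((-1) ^ (k + nv) * real (k choose nv) * (tp k (y + real nv * v) - tp k (y + real nv * v')))
    <= real (k choose nv) * (real k * (2 * real k * t) ^ (k - 2) * (real k * abs(v - v')))"
   by (auto simp: abs_mult power_abs intro!: mult_left_mono)
 qed
 also have "... = real (\<Sum>nv\<le>k. k choose nv) * (real k * (2 * real k * t) ^ (k - 2) * (real k * abs(v - v')))"
  by (simp add: sum_distrib_right)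
 also have "... = 2 ^ k * (real k * (2 * real k * t) ^ (k - 2) * (real k * abs(v - v')))" by (simp add: choose_row_sum)
 finally show ?thesis .
qed

section \<open>Lipschitz cutoffs and the area of strips\<close>

lemma integrable_cutoff:
 fixes w \<phi> :: "pt => real"
 assumes [measurable]: "w \<in> bm" "\<phi> \<in> bm"
  and b: "!!u. abs(w u) <= A" "!!u. abs(\<phi> u) <= B" and z: "!!u. norm u >= R ==> w u = 0"
 shows "integrable lborel (%u. w u * \<phi> u)"
proof (rule Bochner_Integration.integrable_bound)
 show "integrable lborel (%u. (A * B) * indicator (ball (0::pt) R) u)"
  using emeasure_lborel_ball_finite[of "0::pt" R] by (intro integrable_mult_right integrable_real_indicator) auto
 have A: "A >= 0" "B >= 0" using b[of 0] abs_ge_zero[of "w 0"] abs_ge_zero[of "\<phi> 0"] by linarith+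
 have "abs(w u * \<phi> u) <= A * B" for u unfolding abs_mult using b A by (intro mult_mono) auto
 thus "AE u in lborel. norm (w u * \<phi> u) <= norm ((A * B) * indicator (ball (0::pt) R) u)"
  using A z by (auto simp: indicator_def abs_mult)
qed measurable

lemma integral_translation:
 fixes f :: "pt => real"
 assumes [measurable]: "f \<in> bm"
 shows "(\<integral>u. f (u + h) \<partial>lborel) = (\<integral>u. f u \<partial>lborel)"
proof -
 have "(\<integral>u. f u \<partial>lborel) = (\<integral>u. f u \<partial>distr lborel borel ((+) h))"
  by (simp only: lborel_distr_plus)
 also have "... = (\<integral>u. f (h + u) \<partial>lborel)" by (subst integral_distr) auto
 finally show ?thesis by (simp add: add.commute)
qed

text \<open>Translating the variable moves the difference from the possibly discontinuous
  \<open>\<phi>\<close> to the Lipschitz weight \<open>w\<close>. Only the integral of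
  \<open>abs(\<phi> u)\<close> over a ball remains, which makes step functions tractable.\<close>

lemma cutoff_summation_by_parts:
 fixes w \<phi> :: "pt => real"
 assumes [measurable]: "w \<in> bm" "\<phi> \<in> bm"
  and b: "!!u. abs(w u) <= A" "!!u. abs(\<phi> u) <= 1" and z: "!!u. norm u >= R ==> w u = 0"
  and lip: "!!u u'. abs(w u - w u') <= A * norm (u - u')" and h: "R + norm h <= R'"
 shows "abs(\<integral>u. w u * (\<phi> (u + h) - \<phi> u) \<partial>lborel) <= A * norm h * (\<integral>u. indicator (ball 0 R') u * abs(\<phi> u) \<partial>lborel)"
proof -
 have i1: "integrable lborel (%u. w u * \<phi> (u + h))"
  using b z by (intro integrable_cutoff[where A=A and B=1 and R=R]) auto
 have i2: "integrable lborel (%u. w u * \<phi> u)"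
  using b z by (intro integrable_cutoff[where A=A and B=1 and R=R]) auto
 have i3: "integrable lborel (%u. w (u - h) * \<phi> u)"
 proof (rule integrable_cutoff[where A=A and B=1 and R=R'])
  fix u :: pt assume "R' <= norm u"
  hence "norm (u - h) >= R" using h norm_triangle_ineq2[of u h] by simp
  thus "w (u - h) = 0" by (rule z)
 qed (use b in auto)
 have i4: "integrable lborel (%u. indicator (ball 0 R') u * abs(\<phi> u))"
  by (rule integrable_cutoff[where A=1 and B=1 and R=R']) (use b in \<open>auto simp: indicator_def\<close>)
 have "(\<integral>u. w u * (\<phi> (u + h) - \<phi> u) \<partial>lborel) = (\<integral>u. w u * \<phi> (u + h) \<partial>lborel) - (\<integral>u. w u * \<phi> u \<partial>lborel)"
  using i1 i2 by (simp add: right_diff_distrib)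
 also have "(\<integral>u. w u * \<phi> (u + h) \<partial>lborel) = (\<integral>u. w (u - h) * \<phi> u \<partial>lborel)"
  using integral_translation[of "%u. w (u - h) * \<phi> u" h] by simp
 also have "(\<integral>u. w (u - h) * \<phi> u \<partial>lborel) - (\<integral>u. w u * \<phi> u \<partial>lborel) = (\<integral>u. (w (u - h) - w u) * \<phi> u \<partial>lborel)"
  using i2 i3 by (simp add: left_diff_distrib)
 finally have e: "(\<integral>u. w u * (\<phi> (u + h) - \<phi> u) \<partial>lborel) = (\<integral>u. (w (u - h) - w u) * \<phi> u \<partial>lborel)" .
 have "norm (\<integral>u. (w (u - h) - w u) * \<phi> u \<partial>lborel) <= (\<integral>u. A * norm h * (indicator (ball 0 R') u * abs(\<phi> u)) \<partial>lborel)"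
 proof (rule Bochner_Integration.integral_norm_bound_integral)
  show "integrable lborel (%u. (w (u - h) - w u) * \<phi> u)" using i2 i3 by (simp add: left_diff_distrib)
  show "integrable lborel (%u. A * norm h * (indicator (ball 0 R') u * abs(\<phi> u)))" using i4 by simp
  fix u :: pt
  show "norm ((w (u - h) - w u) * \<phi> u) <= A * norm h * (indicator (ball 0 R') u * abs(\<phi> u))"
  proof (cases "u \<in> ball 0 R'")
   case True
   thus ?thesis using mult_right_mono[OF lip[of "u - h" u], of "abs(\<phi> u)"] by (simp add: abs_mult)
  next
   case False
   hence "norm u >= R'" by simp
   hence "norm (u - h) >= R" "norm u >= R" using h norm_triangle_ineq2[of u h] norm_ge_zero[of h] by linarith+
   thus ?thesis using z False by simp
  qed
 qed
 also have "... = A * norm h * (\<integral>u. indicator (ball 0 R') u * abs(\<phi> u) \<partial>lborel)" by simp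
 finally show ?thesis unfolding e by simp
qed

text \<open>A strip is a difference of two half-planes, so summation by parts against a Lipschitz
  cutoff bounds its area without rotating coordinates. For s above one the area of the whole ball
  suffices.\<close>

lemma strip_area:
 "\<exists>C>0. \<forall>(n::pt) a s. norm n = 1 --> s > 0 --> emeasure lborel {u \<in> ball 0 5. abs(n \<bullet> u - a) <= s} <= ennreal (C * s)"
proof -
 define C where "C = 2000 * unit_area"
 have main: "emeasure lborel {u \<in> ball 0 5. abs(n \<bullet> u - a) <= s} <= ennreal (C * s)"
  if n: "norm n = 1" and s: "s > 0" for n :: pt and a s
 proof (cases "s <= 1")
  case False
  have "emeasure lborel {u \<in> ball 0 5. abs(n \<bullet> u - a) <= s} <= emeasure lborel (ball (0::pt) 5)"
   by (intro emeasure_mono) auto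
  also have "... = ennreal (25 * unit_area)" by (simp add: emeasure_ball_pt)
  also have "... <= ennreal (C * s)"
   using False unit_area_pos by (intro ennreal_leI) (simp add: C_def mult_mono)
  finally show ?thesis .
 next
  case True
  \<comment> \<open>At least one on the ball of radius 5.\<close>
  define w where "w u = max 0 (6 - norm u)" for u :: pt
  define \<phi> where "\<phi> u = (if n \<bullet> u >= a - s then 1 else 0 :: real)" for u :: pt
  \<comment> \<open>The shift exceeds the width \<open>2 * s\<close> of the strip, so
    \<open>\<phi> u - \<phi> (u + h)\<close> is one on all of it.\<close>
  define h where "h = - (3 * s) *\<^sub>R n"
  have [measurable]: "w \<in> bm" "\<phi> \<in> bm"
   unfolding w_def \<phi>_def by measurable
  have nn: "n \<bullet> n = 1" using n by (simp add: norm_eq_1)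
  have nh: "norm h = 3 * s" using n s by (simp add: h_def)
  have lip: "abs(w u - w u') <= norm (u - u')" for u u'
   unfolding w_def using norm_triangle_ineq3[of u u'] by (auto simp: max_def abs_if split: if_splits)
  have lip6: "abs(w u - w u') <= 6 * norm (u - u')" for u u'
   using lip[of u u'] norm_ge_zero[of "u-u'"] by linarith
  let ?S = "{u \<in> ball 0 5. abs(n \<bullet> u - a) <= s}"
  have Sm [measurable]: "?S \<in> sets borel" by measurable
  have pw: "indicator ?S u <= w u * (\<phi> u - \<phi> (u + h))" for u
  proof (cases "u \<in> ?S")
   case True
   hence "n \<bullet> u >= a - s" "n \<bullet> u <= a + s" "norm u < 5" by auto
   moreover have "n \<bullet> (u + h) = n \<bullet> u - 3 * s" using nn by (simp add: h_def inner_add_right inner_diff_right)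
   ultimately show ?thesis using s True by (simp add: w_def \<phi>_def)
  next
   case False
   have "n \<bullet> (u + h) = n \<bullet> u - 3 * s" using nn by (simp add: h_def inner_add_right inner_diff_right)
   hence "\<phi> u >= \<phi> (u + h)" using s by (auto simp: \<phi>_def)
   thus ?thesis using False by (simp add: w_def)
  qed
  have i1: "integrable lborel (%u. w u * (\<phi> u - \<phi> (u + h)))"
   by (rule integrable_cutoff[where A=6 and B=1 and R=6]) (auto simp: w_def \<phi>_def)
  have fin: "emeasure lborel ?S < \<infinity>"
   by (rule le_less_trans[OF emeasure_mono emeasure_lborel_ball_finite[of "0::pt" 5]]) auto
  have "measure lborel ?S = (\<integral>u. indicator ?S u \<partial>lborel)" by simp
  also have "... <= (\<integral>u. w u * (\<phi> u - \<phi> (u + h)) \<partial>lborel)"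
   using fin i1 pw by (intro Bochner_Integration.integral_mono integrable_real_indicator) auto
  also have "... = - (\<integral>u. w u * (\<phi> (u + h) - \<phi> u) \<partial>lborel)"
   by (subst Bochner_Integration.integral_minus[symmetric]) (simp add: algebra_simps)
  also have "... <= abs(\<integral>u. w u * (\<phi> (u + h) - \<phi> u) \<partial>lborel)" by simp
  also have "... <= 6 * norm h * (\<integral>u. indicator (ball 0 9) u * abs(\<phi> u) \<partial>lborel)"
   by (rule cutoff_summation_by_parts[where R=6])
    (use lip6 nh True in \<open>auto simp: w_def \<phi>_def\<close>)
  also have "(\<integral>u. indicator (ball 0 9) u * abs(\<phi> u) \<partial>lborel) <= (\<integral>u. indicator (ball (0::pt) 9) u \<partial>lborel)"
  proof (rule Bochner_Integration.integral_mono)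
   show "integrable lborel (%u. indicator (ball (0::pt) 9) u * abs(\<phi> u))"
    by (rule integrable_cutoff[where A=1 and B=1 and R=9]) (auto simp: \<phi>_def indicator_def)
   show "integrable lborel (indicator (ball (0::pt) 9) :: pt => real)"
    using emeasure_lborel_ball_finite[of "0::pt" 9] by (intro integrable_real_indicator) auto
  qed (auto simp: \<phi>_def indicator_def)
  also have "(\<integral>u. indicator (ball (0::pt) 9) u \<partial>lborel) = 81 * unit_area"
   using emeasure_ball_pt[of 9 0] unit_area_pos by (simp add: measure_def)
  finally have "measure lborel ?S <= 6 * (3 * s) * (81 * unit_area)" using nh s by (simp add: mult_left_mono)
  also have "... <= 2000 * unit_area * s" using s unit_area_pos by simp
  finally have m: "measure lborel ?S <= 2000 * unit_area * s" .
  have "emeasure lborel ?S = ennreal (measure lborel ?S)"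
   using fin by (intro emeasure_eq_ennreal_measure) (simp add: less_top)
  thus ?thesis using m by (simp add: C_def ennreal_leI)
 qed
 show ?thesis using main unit_area_pos by (intro exI[of _ C]) (auto simp: C_def)
qed

section \<open>Comparison of single jumps\<close>

text \<open>Both the weight and its tau-th power are Lipschitz: the first is used for k at least
  two, where the weight stays under the power, the second for k = 1, where the integral is linear in
  the tau-th power.\<close>

definition cutoff :: "real => real => (pt => real) => bool" where
 "cutoff A tau w \<longleftrightarrow> w \<in> bm & (\<forall>u. 0 <= w u & w u <= A & w u powr tau <= A) &
   (\<forall>u. norm u >= 1/2 --> w u = 0) & (\<forall>u u'. \<bar>w u - w u'\<bar> <= A * norm (u - u')) &
   (\<forall>u u'. \<bar>w u powr tau - w u' powr tau\<bar> <= A * norm (u - u'))"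

lemma cutoffD:
 assumes "cutoff A tau w"
 shows "w \<in> bm" "0 <= w u" "w u <= A" "w u powr tau <= A" "norm u >= 1/2 ==> w u = 0"
  "abs(w u - w u') <= A * norm (u - u')" "\<bar>w u powr tau - w u' powr tau\<bar> <= A * norm (u - u')"
 using assms unfolding cutoff_def by auto

definition jumpint :: "nat => real => (pt => real) => pt => real => pt => ennreal" where
 "jumpint k tau w n b h = (LI u. pw tau (w u * dsum k (n \<bullet> h) (tp k) (n \<bullet> u - b)))"

text \<open>The differences are of size \<open>norm h\<close> to the power k - 1 and live on a strip
  of width comparable to \<open>norm h\<close>. This is the origin of the exponent
  \<open>tau * (real k - 1) + 1\<close>, the rate of all later error terms.\<close>

lemma jumpint_bound:
 assumes k: "k >= 1" and tau: "tau > 0" and A: "A >= 0"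
 shows "\<exists>C>0. \<forall>w n b h. cutoff A tau w --> norm n = 1 --> h ~= 0 -->
   jumpint k tau w n b h <= ennreal (C * norm h powr (tau * (real k - 1) + 1))"
proof -
 obtain Cs where Cs: "Cs > 0" "!!(n::pt) a s. norm n = 1 ==> s > 0 ==> emeasure lborel {u \<in> ball 0 5. abs(n \<bullet> u - a) <= s} <= ennreal (Cs * s)"
  using strip_area by blast
 define D where "D = 2 ^ k * (2 * real k) ^ (k - 1)"
 have D: "D > 0" using k by (simp add: D_def)
 define C where "C = (A + 1) * D powr tau * (Cs * real k)"
 have main: "jumpint k tau w n b h <= ennreal (C * norm h powr (tau * (real k - 1) + 1))"
  if w: "cutoff A tau w" and n: "norm n = 1" and h: "h ~= 0" for w n b h
 proof -
  let ?t = "norm h"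
  have t: "?t > 0" using h by simp
  let ?S = "{u \<in> ball 0 5. abs(n \<bullet> u - b) <= real k * ?t}"
  have [measurable]: "?S \<in> sets borel" by measurable
  have v: "abs(n \<bullet> h) <= ?t" using Cauchy_Schwarz_ineq2[of n h] n by simp
  let ?M = "(A + 1) * (D powr tau * ?t powr (tau * (real k - 1)))"
  have pw: "abs(w u * dsum k (n \<bullet> h) (tp k) (n \<bullet> u - b)) powr tau <= ?M * indicator ?S u" for u
  proof (cases "w u = 0 | abs(n \<bullet> u - b) > real k * abs(n \<bullet> h)")
   case True
   hence e: "w u * dsum k (n \<bullet> h) (tp k) (n \<bullet> u - b) = 0"
    using dsum_tp_eq_0[OF k, of "n \<bullet> h" "n \<bullet> u - b"] by auto
   show ?thesis unfolding e using A by (simp add: indicator_def)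
  next
   case False
   hence u5: "norm u < 1/2" using cutoffD(5)[OF w, of u] by force
   have "real k * abs(n \<bullet> h) <= real k * ?t" using v by (intro mult_left_mono) auto
   hence uS: "u \<in> ?S" using False u5 by auto
   have "abs(dsum k (n \<bullet> h) (tp k) (n \<bullet> u - b)) <= 2 ^ k * (2 * real k * abs(n \<bullet> h)) ^ (k - 1)"
    by (rule dsum_tp_bound[OF k])
   also have "... <= 2 ^ k * (2 * real k * ?t) ^ (k - 1)"
    using v by (intro mult_left_mono power_mono) auto
   also have "... = D * ?t ^ (k - 1)" unfolding D_def by (simp add: power_mult_distrib)
   finally have "abs(dsum k (n \<bullet> h) (tp k) (n \<bullet> u - b)) powr tau <= (D * ?t ^ (k - 1)) powr tau"
    using tau by (intro powr_mono2) auto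
   also have "... = D powr tau * ?t powr (tau * (real k - 1))"
    using t D k by (simp add: powr_mult powr_powr powr_realpow[symmetric] of_nat_diff mult.commute)
   finally have 1: "abs(dsum k (n \<bullet> h) (tp k) (n \<bullet> u - b)) powr tau <= D powr tau * ?t powr (tau * (real k - 1))" .
   have "abs(w u * dsum k (n \<bullet> h) (tp k) (n \<bullet> u - b)) powr tau = w u powr tau * abs(dsum k (n \<bullet> h) (tp k) (n \<bullet> u - b)) powr tau"
    using cutoffD(2)[OF w, of u] by (simp add: abs_mult powr_mult)
   also have "... <= ?M"
    using 1 cutoffD(4)[OF w, of u] A by (intro mult_mono) auto
   finally show ?thesis using uS by simp
  qed
  have "jumpint k tau w n b h <= (LI u. ennreal ?M * indicator ?S u)"
   unfolding jumpint_def
  proof (rule nn_integral_mono)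
   fix u show "pw tau (w u * dsum k (n \<bullet> h) (tp k) (n \<bullet> u - b)) <= ennreal ?M * indicator ?S u"
    using ennreal_leI[OF pw[of u]] by (cases "u \<in> ?S") auto
  qed
  also have "... = ennreal ?M * emeasure lborel ?S" by (subst nn_integral_cmult_indicator) auto
  also have "... <= ennreal ?M * ennreal (Cs * (real k * ?t))"
   using k t by (intro mult_left_mono Cs n) auto
  also have "... = ennreal (?M * (Cs * (real k * ?t)))"
   using A D Cs by (simp add: ennreal_mult)
  also have "?M * (Cs * (real k * ?t)) = C * norm h powr (tau * (real k - 1) + 1)"
   unfolding C_def using t by (simp add: powr_add)
  finally show ?thesis .
 qed
 have "C > 0" unfolding C_def using A D Cs k by (intro mult_pos_pos) auto
 thus ?thesis using main by blast
qed

text \<open>The exponent \<open>1 / max 1 tau\<close> turns the integral into the norm when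
  \<open>tau\<close> is at least one and leaves its tau-th power when \<open>tau\<close> is smaller;
  in both readings the triangle inequality holds with factor one.\<close>

lemma minkowski_powr:
 fixes F G H :: "'a => real"
 assumes tau: "tau > 0" and [measurable]: "F \<in> borel_measurable M" "G \<in> borel_measurable M" "H \<in> borel_measurable M"
  and le: "AE x in M. abs(F x) <= abs(G x) + abs(H x)"
 shows "enn_powr (\<integral>\<^sup>+ x. pw tau (F x) \<partial>M) (1 / max 1 tau) <=
   enn_powr (\<integral>\<^sup>+ x. pw tau (G x) \<partial>M) (1 / max 1 tau) + enn_powr (\<integral>\<^sup>+ x. pw tau (H x) \<partial>M) (1 / max 1 tau)"
proof (rule minkowski_nn)
 let ?q = "max 1 tau"
 show "AE x in M. enn_powr (pw tau (F x)) (1/?q) <= enn_powr (pw tau (G x)) (1/?q) + enn_powr (pw tau (H x)) (1/?q)"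
  using le
 proof eventually_elim
  case (elim x)
  have "abs(F x) powr (tau/?q) <= (abs(G x) + abs(H x)) powr (tau/?q)" using elim tau by (intro powr_mono2) auto
  also have "... <= abs(G x) powr (tau/?q) + abs(H x) powr (tau/?q)" using tau by (intro powr_sum_le) auto
  finally have "abs(F x) powr (tau/?q) <= abs(G x) powr (tau/?q) + abs(H x) powr (tau/?q)" .
  thus ?case by (simp add: powr_powr ennreal_plus[symmetric] ennreal_leI del: ennreal_plus)
 qed
qed auto

text \<open>A shear carries the first jump line onto the second. After this substitution both
  integrands have the argument \<open>n1 \<bullet> u - b1\<close> and differ only through step and
  weight, each by a multiple of \<open>norm (n1 - n2) + abs(b1 - b2)\<close>. The condition
  \<open>n1 \<bullet> n2 >= 0\<close> keeps the shear bounded.\<close>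

lemma jumpint_shear:
 assumes k: "k >= 2" and tau: "tau > 0" and A: "A >= 0"
 shows "\<exists>C>0. \<forall>w n1 n2 b1 b2 h. cutoff A tau w --> norm n1 = 1 --> norm n2 = 1 --> n1 \<bullet> n2 >= 0 -->
   abs(b1) <= 1/4 --> abs(b2) <= 1/4 --> h ~= 0 -->
   enn_powr (jumpint k tau w n1 b1 h) (1 / max 1 tau) <= enn_powr (jumpint k tau w n2 b2 h) (1 / max 1 tau)
    + enn_powr (ennreal (C * (norm (n1 - n2) + abs(b1 - b2)) powr tau * norm h powr (tau * (real k - 1) + 1))) (1 / max 1 tau)"
proof -
 obtain Cs where Cs: "Cs > 0" "!!(n::pt) a s. norm n = 1 ==> s > 0 ==> emeasure lborel {u \<in> ball 0 5. abs(n \<bullet> u - a) <= s} <= ennreal (Cs * s)"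
  using strip_area by blast
 define m where "m = k - 2"
 have km: "k = Suc (Suc m)" using k by (simp add: m_def)
 define D1 where "D1 = 2 ^ k * (2 * real k) ^ (k - 1)"
 define D2 where "D2 = 2 ^ k * (real k * (2 * real k) ^ (k - 2) * real k)"
 define D where "D = 8 * A * D1 + A * D2 + 1"
 have D12: "D1 > 0" "D2 > 0" using k by (auto simp: D1_def D2_def)
 have D: "D > 0" unfolding D_def using A D12 by (intro add_nonneg_pos) auto
 define C where "C = D powr tau * (Cs * real k)"
 have main: "enn_powr (jumpint k tau w n1 b1 h) (1 / max 1 tau) <= enn_powr (jumpint k tau w n2 b2 h) (1 / max 1 tau)
    + enn_powr (ennreal (C * (norm (n1 - n2) + abs(b1 - b2)) powr tau * norm h powr (tau * (real k - 1) + 1))) (1 / max 1 tau)"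
  if w: "cutoff A tau w" and n: "norm n1 = 1" "norm n2 = 1" "n1 \<bullet> n2 >= 0" and b: "abs(b1) <= 1/4" "abs(b2) <= 1/4" and h: "h ~= 0"
  for w n1 n2 b1 b2 h
 proof -
  note [measurable] = cutoffD(1)[OF w]
  let ?t = "norm h"
  have t: "?t > 0" using h by simp
  define e where "e = n1 - n2"
  define d where "d = norm e + abs(b1 - b2)"
  have d0: "d >= 0" by (simp add: d_def)
  have nn: "n1 \<bullet> n1 = 1" "n2 \<bullet> n2 = 1" using n by (auto simp: norm_eq_1)
  define g where "g = 1 + n1 \<bullet> n2"
  have g: "g >= 1" using n by (simp add: g_def)
  text \<open>The shear below has determinant one, moves points by O(d) and carries one line onto the other.\<close>
  define m' where "m' = (1 / g) *\<^sub>R (n1 + n2)"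
  have em: "e \<bullet> m' = 0" using nn by (simp add: e_def m'_def inner_diff_left inner_add_right inner_diff_right inner_commute[of n2 n1])
  have n2m: "n2 \<bullet> m' = 1" using nn g by (simp add: m'_def g_def inner_add_right inner_commute)
  have nm': "norm m' <= 2"
  proof -
   have "norm (n1 + n2) <= 2" using norm_triangle_ineq[of n1 n2] n by simp
   hence "norm (n1 + n2) / g <= 2 / 1" using g by (intro frac_le) auto
   thus ?thesis using g by (simp add: m'_def)
  qed
  have ne: "norm e <= 3/2"
  proof -
   have "(norm e)\<^sup>2 = 2 - 2 * (n1 \<bullet> n2)" using nn by (simp add: e_def power2_norm_eq_inner inner_diff_left inner_diff_right inner_commute)
   hence "(norm e)\<^sup>2 <= (3/2)\<^sup>2" using n by (simp add: power2_eq_square)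
   thus ?thesis by (rule power2_le_imp_le) simp
  qed
  define T where "T u = u + (e \<bullet> u + - (b1 - b2)) *\<^sub>R m'" for u
  have [measurable]: "T \<in> bm" unfolding T_def by measurable
  have eT: "e \<bullet> T u = e \<bullet> u" for u unfolding T_def using em by (simp add: inner_add_right)
  have L2T: "n2 \<bullet> T u - b2 = n1 \<bullet> u - b1" for u
   unfolding T_def using n2m by (simp add: inner_add_right e_def inner_diff_left)
  \<comment> \<open>Either end of the move may serve in the bound, because \<open>T\<close>
    preserves \<open>e \<bullet> u\<close>. This matters where only one of \<open>w u\<close> and
    \<open>w (T u)\<close> is known to be nonzero, so that only that point is known to be near the
    origin.\<close>
  have Tu: "norm (T u - u) <= 2 * (norm e * norm v + abs(b1 - b2))" if "v = u | v = T u" for u v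
  proof -
   have "e \<bullet> v = e \<bullet> u" using that eT by auto
   hence "abs(e \<bullet> u) <= norm e * norm v" using Cauchy_Schwarz_ineq2[of e v] by simp
   hence "abs(e \<bullet> u + - (b1 - b2)) <= norm e * norm v + abs(b1 - b2)" by linarith
   hence "abs(e \<bullet> u + - (b1 - b2)) * norm m' <= (norm e * norm v + abs(b1 - b2)) * 2"
    using nm' by (intro mult_mono) auto
   thus ?thesis unfolding T_def by simp
  qed
  let ?v1 = "n1 \<bullet> h" and ?v2 = "n2 \<bullet> h"
  have v: "abs(?v1) <= ?t" "abs(?v2) <= ?t" using Cauchy_Schwarz_ineq2[of n1 h] Cauchy_Schwarz_ineq2[of n2 h] n by auto
  have v12: "abs(?v1 - ?v2) <= d * ?t"
  proof -
   have "abs(?v1 - ?v2) = abs(e \<bullet> h)" by (simp add: e_def inner_diff_left)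
   also have "... <= norm e * ?t" by (rule Cauchy_Schwarz_ineq2)
   also have "... <= d * ?t" unfolding d_def by (intro mult_right_mono) auto
   finally show ?thesis .
  qed
  let ?F = "%u. w u * dsum k ?v1 (tp k) (n1 \<bullet> u - b1)"
  let ?G = "%u. w (T u) * dsum k ?v2 (tp k) (n1 \<bullet> u - b1)"
  have [measurable]: "?F \<in> borel_measurable lborel" "?G \<in> borel_measurable lborel" by measurable
  have "jumpint k tau w n2 b2 h = (LI u. pw tau (w (T u) * dsum k ?v2 (tp k) (n2 \<bullet> T u - b2)))"
   unfolding jumpint_def T_def by (rule nn_integral_shear[OF em, symmetric]) measurable
  hence G2: "jumpint k tau w n2 b2 h = (LI u. pw tau (?G u))" unfolding L2T .
  let ?S = "{u \<in> ball 0 5. abs(n1 \<bullet> u - b1) <= real k * ?t}"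
  have [measurable]: "?S \<in> sets borel" by measurable
  have pw: "abs(?F u - ?G u) <= D * d * ?t ^ (k - 1) * indicator ?S u" for u
  proof (cases "abs(n1 \<bullet> u - b1) > real k * ?t | (w u = 0 & w (T u) = 0)")
   case True
   thus ?thesis
   proof
    assume L: "abs(n1 \<bullet> u - b1) > real k * ?t"
    have "real k * abs(?v1) <= real k * ?t" "real k * abs(?v2) <= real k * ?t" using v by (auto intro!: mult_left_mono)
    hence "dsum k ?v1 (tp k) (n1 \<bullet> u - b1) = 0" "dsum k ?v2 (tp k) (n1 \<bullet> u - b1) = 0"
     using L k by (intro dsum_tp_eq_0; linarith)+
    thus ?thesis using D d0 by (simp add: indicator_def)
   next
    assume "w u = 0 & w (T u) = 0"
    thus ?thesis using D d0 by (simp add: indicator_def)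
   qed
  next
   case False
   obtain z where z: "z = u | z = T u" "w z ~= 0" using False by auto
   have nz: "norm z < 1/2" using cutoffD(5)[OF w, of z] z by force
   have ez: "norm e * norm z <= norm e * (1/2)" using nz by (intro mult_left_mono) auto
   have mv: "norm (T u - u) <= 2 * d"
   proof -
    have "2 * (norm e * norm z + abs(b1 - b2)) <= 2 * d"
    proof -
     have "norm e * norm z <= norm e" using ez norm_ge_zero[of e] by linarith
     thus ?thesis unfolding d_def by simp
    qed
    thus ?thesis using Tu[OF z(1)] by linarith
   qed
   have d2: "d <= 2" unfolding d_def using ne b by linarith
   have nu: "norm u < 5"
   proof -
    have "norm u <= norm z + norm (T u - u)" using z(1) norm_triangle_ineq2[of u "T u"] by (auto simp: norm_minus_commute)
    thus ?thesis using nz mv d2 by linarith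
   qed
   have uS: "u \<in> ?S" using False nu by auto
   have "abs(?F u - ?G u) <= abs(w u - w (T u)) * abs(dsum k ?v1 (tp k) (n1 \<bullet> u - b1)) + w (T u) * abs(dsum k ?v1 (tp k) (n1 \<bullet> u - b1) - dsum k ?v2 (tp k) (n1 \<bullet> u - b1))"
   proof -
    have "?F u - ?G u = (w u - w (T u)) * dsum k ?v1 (tp k) (n1 \<bullet> u - b1) + w (T u) * (dsum k ?v1 (tp k) (n1 \<bullet> u - b1) - dsum k ?v2 (tp k) (n1 \<bullet> u - b1))"
     by (simp add: algebra_simps)
    thus ?thesis using cutoffD(2)[OF w, of "T u"]
     by (metis (no_types, lifting) abs_mult abs_of_nonneg abs_triangle_ineq)
   qed
   also have "... <= (A * (2 * d)) * (D1 * ?t ^ (k - 1)) + A * (D2 * d * ?t ^ (k - 1))"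
   proof (intro add_mono mult_mono)
    show "abs(w u - w (T u)) <= A * (2 * d)"
     using cutoffD(6)[OF w, of u "T u"] mult_left_mono[OF mv A] by (simp add: norm_minus_commute)
    have "abs(dsum k ?v1 (tp k) (n1 \<bullet> u - b1)) <= 2 ^ k * (2 * real k * abs(?v1)) ^ (k - 1)"
     using k by (intro dsum_tp_bound) auto
    also have "... <= 2 ^ k * (2 * real k * ?t) ^ (k - 1)"
     using v by (intro mult_left_mono power_mono) auto
    finally show "abs(dsum k ?v1 (tp k) (n1 \<bullet> u - b1)) <= D1 * ?t ^ (k - 1)"
     unfolding D1_def by (simp add: power_mult_distrib)
    have "abs(dsum k ?v1 (tp k) (n1 \<bullet> u - b1) - dsum k ?v2 (tp k) (n1 \<bullet> u - b1)) <= 2 ^ k * (real k * (2 * real k * ?t) ^ (k - 2) * (real k * abs(?v1 - ?v2)))"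
     using False k v by (intro dsum_tp_lipschitz) auto
    also have "... <= 2 ^ k * (real k * (2 * real k * ?t) ^ (k - 2) * (real k * (d * ?t)))"
     using v12 by (intro mult_left_mono) auto
    also have "... = D2 * d * ?t ^ (k - 1)" unfolding D2_def km by (simp add: power_mult_distrib)
    finally show "abs(dsum k ?v1 (tp k) (n1 \<bullet> u - b1) - dsum k ?v2 (tp k) (n1 \<bullet> u - b1)) <= D2 * d * ?t ^ (k - 1)" .
   qed (use cutoffD[OF w] d0 D12 A in auto)
   also have "... = (2 * A * D1 + A * D2) * (d * ?t ^ (k - 1))" by (simp add: algebra_simps)
   also have "... <= D * (d * ?t ^ (k - 1))"
    unfolding D_def using A D12 d0 by (intro mult_right_mono) auto
   finally show ?thesis using uS by (simp add: mult.assoc)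
  qed
  have "(LI u. pw tau (?F u - ?G u)) <= (LI u. ennreal ((D * d * ?t ^ (k - 1)) powr tau) * indicator ?S u)"
  proof (rule nn_integral_mono)
   fix u
   have "abs(?F u - ?G u) powr tau <= (D * d * ?t ^ (k - 1) * indicator ?S u) powr tau" using pw[of u] tau by (intro powr_mono2) auto
   thus "pw tau (?F u - ?G u) <= ennreal ((D * d * ?t ^ (k - 1)) powr tau) * indicator ?S u"
    using tau by (cases "u \<in> ?S") (auto intro!: ennreal_leI)
  qed
  also have "... = ennreal ((D * d * ?t ^ (k - 1)) powr tau) * emeasure lborel ?S" by (subst nn_integral_cmult_indicator) auto
  also have "... <= ennreal ((D * d * ?t ^ (k - 1)) powr tau) * ennreal (Cs * (real k * ?t))"
   using k t by (intro mult_left_mono Cs n) auto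
  also have "... = ennreal ((D * d * ?t ^ (k - 1)) powr tau * (Cs * (real k * ?t)))"
   using Cs by (simp add: ennreal_mult)
  also have "(D * d * ?t ^ (k - 1)) powr tau * (Cs * (real k * ?t)) = C * d powr tau * ?t powr (tau * (real k - 1) + 1)"
   using t D d0 k by (simp add: C_def powr_mult powr_powr powr_realpow[symmetric] of_nat_diff powr_add mult_ac)
  finally have I: "(LI u. pw tau (?F u - ?G u)) <= ennreal (C * d powr tau * ?t powr (tau * (real k - 1) + 1))" .
  have "enn_powr (jumpint k tau w n1 b1 h) (1 / max 1 tau) <= enn_powr (jumpint k tau w n2 b2 h) (1 / max 1 tau)
    + enn_powr (LI u. pw tau (?F u - ?G u)) (1 / max 1 tau)"
   unfolding G2 unfolding jumpint_def by (intro minkowski_powr[OF tau]) auto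
  also have "... <= enn_powr (jumpint k tau w n2 b2 h) (1 / max 1 tau)
    + enn_powr (ennreal (C * d powr tau * ?t powr (tau * (real k - 1) + 1))) (1 / max 1 tau)"
   by (intro add_left_mono enn_powr_mono I) auto
  finally show ?thesis by (simp only: d_def e_def)
 qed
 have "C > 0" unfolding C_def using D Cs k by (intro mult_pos_pos) auto
 thus ?thesis using main by blast
qed

text \<open>The situation after rescaling a ball to the unit ball: \<open>f\<close> is the
  difference of the two splines, \<open>a\<close> its polynomial part, and \<open>F\<close> what is
  available to pay for errors. Exchanging the two sides of a line reverses its normal, so
  \<open>n1 \<bullet> n2 >= 0\<close> is a normalisation.\<close>

definition localpair :: "nat => real => (pt => real) => (pt => real) => real => real => pt => pt => real => real => real => bool" where
 "localpair k tau f a c1 c2 n1 n2 b1 b2 F \<longleftrightarrow> polyfun k a & a \<in> bm & f \<in> bm &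
   norm n1 = 1 & norm n2 = 1 & n1 \<bullet> n2 >= 0 & abs(b1) <= 1/4 & abs(b2) <= 1/4 & F >= 0 &
   (AE u in lborel. u \<in> ball 0 1 --> f u = a u + c1 * tp k (n1 \<bullet> u - b1) - c2 * tp k (n2 \<bullet> u - b2)) &
   (\<integral>\<^sup>+ u\<in>ball 0 1. pw tau (f u) \<partial>lborel) = ennreal F"

text \<open>The vector n1 + n2 has norm at least the square root of 2, of which 7/5 is a rational
  lower bound.\<close>

lemma unit_bisector:
 fixes n1 n2 :: pt
 assumes "norm n1 = 1" "norm n2 = 1" "n1 \<bullet> n2 >= 0"
 shows "\<exists>s m. s >= 7/5 & norm m = 1 & n1 \<bullet> m = s/2 & n2 \<bullet> m = s/2"
proof -
 have nn: "n1 \<bullet> n1 = 1" "n2 \<bullet> n2 = 1" using assms by (auto simp: norm_eq_1)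
 define s where "s = norm (n1 + n2)"
 have s2: "s\<^sup>2 = 2 * (1 + n1 \<bullet> n2)"
  unfolding s_def power2_norm_eq_inner using nn by (simp add: inner_add_left inner_add_right inner_commute)
 have s: "s >= 7/5"
 proof (rule power2_le_imp_le)
  show "(7/5)\<^sup>2 <= s\<^sup>2" unfolding s2 using assms by (simp add: power2_eq_square)
 qed (simp add: s_def)
 define m where "m = (1/s) *\<^sub>R (n1 + n2)"
 have "norm m = 1" using s by (simp add: m_def s_def[symmetric])
 moreover have "n1 \<bullet> m = (1 + n1 \<bullet> n2) / s" "n2 \<bullet> m = (1 + n1 \<bullet> n2) / s"
  unfolding m_def using nn by (simp_all add: inner_add_right inner_commute)
 moreover have "(1 + n1 \<bullet> n2) / s = s / 2" using s s2 by (simp add: field_simps power2_eq_square)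
 ultimately show ?thesis using s by auto
qed

text \<open>Far out along the bisector, at \<open>7/10\<close> and \<open>-7/10\<close>, both jumps
  are switched on or both off on a ball of radius 1/5, since 7/10 times half of 7/5 exceeds 1/4 +
  1/5. There \<open>f\<close> is a polynomial, and \<open>polyfun_remez\<close> spreads the bound
  over the unit ball.\<close>

lemma localpair_poly_bounds:
 assumes k: "k >= 1" and tau: "tau > 0"
 shows "\<exists>K>0. \<forall>f a c1 c2 n1 n2 b1 b2 F. localpair k tau f a c1 c2 n1 n2 b1 b2 F -->
   (\<forall>u\<in>ball 0 1. abs(a u) powr tau <= K * F) &
   (\<forall>u\<in>ball 0 1. abs(a u + c1 * (n1 \<bullet> u - b1) ^ (k - 1) - c2 * (n2 \<bullet> u - b2) ^ (k - 1)) powr tau <= K * F)"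
proof -
 obtain C where C: "C > 0" "!!(f :: pt => real) z rho y. polyfun k f ==> f \<in> bm ==> rho > 0 ==>
   dist y z <= 10 * rho ==>
   ennreal (abs(f y) powr tau * rho\<^sup>2) <= ennreal C * (\<integral>\<^sup>+ x\<in>ball z rho. pw tau (f x) \<partial>lborel)"
  using polyfun_remez[OF tau, of 10 k] by auto
 have main: "(\<forall>u\<in>ball 0 1. abs(a u) powr tau <= 25 * C * F) &
   (\<forall>u\<in>ball 0 1. abs(a u + c1 * (n1 \<bullet> u - b1) ^ (k - 1) - c2 * (n2 \<bullet> u - b2) ^ (k - 1)) powr tau <= 25 * C * F)"
  if lp: "localpair k tau f a c1 c2 n1 n2 b1 b2 F" for f a c1 c2 n1 n2 b1 b2 F
 proof -
  note L = lp[unfolded localpair_def]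
  have [measurable]: "a \<in> bm" "f \<in> bm" using L by auto
  have nn: "n1 \<bullet> n1 = 1" "n2 \<bullet> n2 = 1" and n12: "n1 \<bullet> n2 >= 0" using L by (auto simp: norm_eq_1)
  have F: "F >= 0" and bb: "abs(b1) <= 1/4" "abs(b2) <= 1/4" and n1: "norm n1 = 1" "norm n2 = 1" using L by auto
  obtain s m where s: "s >= 7/5" and nm: "norm m = 1" and nim: "n1 \<bullet> m = s/2" "n2 \<bullet> m = s/2"
   using unit_bisector[OF n1 n12] by blast
  have dev: "abs(ni \<bullet> u - ni \<bullet> z) < 1/5" if "u \<in> ball z (1/5)" "norm ni = 1" for u z ni :: pt
  proof -
   have "abs(ni \<bullet> (u - z)) <= norm (u - z)" using Cauchy_Schwarz_ineq2[of ni "u - z"] that by simp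
   thus ?thesis using that by (simp add: inner_diff_right dist_norm norm_minus_commute)
  qed
  have sub: "ball (c *\<^sub>R m) (1/5) <= ball 0 1" if "abs(c) = 7/10" for c
  proof
   fix u assume "u \<in> ball (c *\<^sub>R m) (1/5)"
   hence "norm (u - c *\<^sub>R m) < 1/5" by (simp add: dist_norm norm_minus_commute)
   moreover have "norm (c *\<^sub>R m) = 7/10" using nm that by simp
   ultimately have "norm u < 1" using norm_triangle_ineq2[of u "c *\<^sub>R m"] by linarith
   thus "u \<in> ball 0 1" by simp
  qed
  have fin: "abs(p y) powr tau <= 25 * C * F"
   if p: "polyfun k p" "p \<in> bm" and c: "abs(c) = 7/10" and y: "y \<in> ball 0 1"
    and eq: "!!u. u \<in> ball (c *\<^sub>R m) (1/5) ==> f u = a u + c1 * tp k (n1 \<bullet> u - b1) - c2 * tp k (n2 \<bullet> u - b2) ==> p u = f u"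
   for p c y
  proof -
   have "dist y (c *\<^sub>R m) <= norm y + norm (c *\<^sub>R m)" by (metis dist_norm norm_triangle_ineq4)
   hence "dist y (c *\<^sub>R m) <= 10 * (1/5)" using y c nm by simp
   hence "ennreal (abs(p y) powr tau * (1/5)\<^sup>2) <= ennreal C * (\<integral>\<^sup>+ x\<in>ball (c *\<^sub>R m) (1/5). pw tau (p x) \<partial>lborel)"
    using p by (intro C) auto
   also have "(\<integral>\<^sup>+ x\<in>ball (c *\<^sub>R m) (1/5). pw tau (p x) \<partial>lborel) <= (\<integral>\<^sup>+ x\<in>ball 0 1. pw tau (f x) \<partial>lborel)"
   proof (rule nn_integral_mono_AE)
    have "AE u in lborel. u \<in> ball 0 1 --> f u = a u + c1 * tp k (n1 \<bullet> u - b1) - c2 * tp k (n2 \<bullet> u - b2)" using L by auto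
    thus "AE x in lborel. pw tau (p x) * indicator (ball (c *\<^sub>R m) (1/5)) x <= pw tau (f x) * indicator (ball 0 1) x"
    proof eventually_elim
     case (elim x)
     thus ?case using eq[of x] sub[OF c] by (cases "x \<in> ball (c *\<^sub>R m) (1/5)") auto
    qed
   qed
   also have "... = ennreal F" using L by auto
   finally have "ennreal (abs(p y) powr tau * (1/5)\<^sup>2) <= ennreal (C * F)" using C F by (simp add: ennreal_mult mult_left_mono)
   hence "abs(p y) powr tau * (1/5)\<^sup>2 <= C * F" using C F by (subst (asm) ennreal_le_iff) auto
   thus ?thesis by (simp add: power2_eq_square)
  qed
  have 1: "abs(a u) powr tau <= 25 * C * F" if "u \<in> ball 0 1" for u
  proof (rule fin[where c="-7/10"])
   fix v assume v: "v \<in> ball ((-7/10) *\<^sub>R m) (1/5)" and e: "f v = a v + c1 * tp k (n1 \<bullet> v - b1) - c2 * tp k (n2 \<bullet> v - b2)"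
   have "n1 \<bullet> v - b1 <= 0" "n2 \<bullet> v - b2 <= 0"
   proof -
    have "n1 \<bullet> ((-7/10) *\<^sub>R m) = - (7/10) * (s/2)" "n2 \<bullet> ((-7/10) *\<^sub>R m) = - (7/10) * (s/2)" using nim by simp_all
    thus "n1 \<bullet> v - b1 <= 0" "n2 \<bullet> v - b2 <= 0"
     using dev[OF v n1(1)] dev[OF v n1(2)] bb s by linarith+
   qed
   thus "a v = f v" using e by (simp add: tp_def)
  qed (use L that in auto)
  let ?p = "%u. a u + c1 * (n1 \<bullet> u - b1) ^ (k - 1) - c2 * (n2 \<bullet> u - b2) ^ (k - 1)"
  have 2: "abs(?p u) powr tau <= 25 * C * F" if "u \<in> ball 0 1" for u
  proof (rule fin[where c="7/10" and p="?p"])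
   show "polyfun k ?p"
    using L k by (intro polyfun_diff polyfun_add polyfun_cmult polyfun_linear_power) auto
   fix v assume v: "v \<in> ball ((7/10) *\<^sub>R m) (1/5)" and e: "f v = a v + c1 * tp k (n1 \<bullet> v - b1) - c2 * tp k (n2 \<bullet> v - b2)"
   have "n1 \<bullet> v - b1 > 0" "n2 \<bullet> v - b2 > 0"
   proof -
    have "n1 \<bullet> ((7/10) *\<^sub>R m) = (7/10) * (s/2)" "n2 \<bullet> ((7/10) *\<^sub>R m) = (7/10) * (s/2)" using nim by simp_all
    thus "n1 \<bullet> v - b1 > 0" "n2 \<bullet> v - b2 > 0"
     using dev[OF v n1(1)] dev[OF v n1(2)] bb s by linarith+
   qed
   thus "?p v = f v" using e by (simp add: tp_def)
  qed (use that in auto)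
  show ?thesis using 1 2 by blast
 qed
 have "25 * C > 0" using C(1) by simp
 thus ?thesis by (intro exI[of _ "25 * C"] conjI[of "_ < _"] allI impI main)
qed

text \<open>The difference \<open>D\<close> of the two polynomials found above is controlled by
  \<open>F\<close>. Its difference of order k - 1 along the bisector, on which both normals agree,
  isolates \<open>c1 - c2\<close>. What is left of \<open>D\<close> is \<open>c1\<close> times a
  difference of two powers, and this controls the displacement of the lines because both bases stay
  positive on a small ball.\<close>

lemma localpair_jump_bounds:
 assumes k: "k >= 1" and tau: "tau > 0"
 shows "\<exists>K>0. \<forall>f a c1 c2 n1 n2 b1 b2 F. localpair k tau f a c1 c2 n1 n2 b1 b2 F -->
   abs(c1 - c2) powr tau <= K * F & (k >= 2 --> (abs(c1) * (norm (n1 - n2) + abs(b1 - b2))) powr tau <= K * F)"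
proof -
 obtain K0 where K0: "K0 > 0" "!!f a c1 c2 n1 n2 b1 b2 F u. localpair k tau f a c1 c2 n1 n2 b1 b2 F ==> u \<in> ball 0 1 ==>
   abs(a u) powr tau <= K0 * F"
   "!!f a c1 c2 n1 n2 b1 b2 F u. localpair k tau f a c1 c2 n1 n2 b1 b2 F ==> u \<in> ball 0 1 ==>
   abs(a u + c1 * (n1 \<bullet> u - b1) ^ (k - 1) - c2 * (n2 \<bullet> u - b2) ^ (k - 1)) powr tau <= K0 * F"
  using localpair_poly_bounds[OF assms] by meson
 define B1 where "B1 = 2 * (4 * real k) ^ (k - 1)"
 define B2 where "B2 = 25 ^ (k - 2) * (2 + B1 * 2 ^ (k - 1))"
 define B where "B = max B1 (50 * B2)"
 have B1: "B1 >= 1"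
 proof -
  have "(4 * real k) ^ (k - 1) >= 1" using k by (intro one_le_power) auto
  thus ?thesis unfolding B1_def by linarith
 qed
 have B2: "B2 >= 0" unfolding B2_def using B1 by auto
 have main: "abs(c1 - c2) powr tau <= B powr tau * K0 * F & (k >= 2 --> (abs(c1) * (norm (n1 - n2) + abs(b1 - b2))) powr tau <= B powr tau * K0 * F)"
  if lp: "localpair k tau f a c1 c2 n1 n2 b1 b2 F" for f a c1 c2 n1 n2 b1 b2 F
 proof -
  note L = lp[unfolded localpair_def]
  have nn: "n1 \<bullet> n1 = 1" "n2 \<bullet> n2 = 1" and n12: "n1 \<bullet> n2 >= 0" and n1: "norm n1 = 1" "norm n2 = 1" using L by (auto simp: norm_eq_1)
  have bb: "abs(b1) <= 1/4" "abs(b2) <= 1/4" using L by auto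
  have F: "F >= 0" using L by auto
  define E where "E = (K0 * F) powr (1/tau)"
  have E: "E >= 0" "E powr tau = K0 * F" unfolding E_def using K0 F tau by (auto simp: powr_powr)
  have toE: "abs(x) <= E" if "abs(x) powr tau <= K0 * F" for x
  proof -
   have "(abs(x) powr tau) powr (1/tau) <= (K0 * F) powr (1/tau)" using that tau by (intro powr_mono2) auto
   thus ?thesis using tau by (simp add: powr_powr E_def)
  qed
  have fromE: "x powr tau <= B powr tau * K0 * F" if "0 <= x" "x <= B * E" for x
  proof -
   have "x powr tau <= (B * E) powr tau" using that tau by (intro powr_mono2) auto
   also have "... = B powr tau * K0 * F" using E B1 unfolding B_def by (simp add: powr_mult)
   finally show ?thesis .
  qed
  define D where "D u = c1 * (n1 \<bullet> u - b1) ^ (k - 1) - c2 * (n2 \<bullet> u - b2) ^ (k - 1)" for u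
  have D: "abs(D u) <= 2 * E" if "u \<in> ball 0 1" for u
   using toE[OF K0(2)[OF lp that]] toE[OF K0(3)[OF lp that]] unfolding D_def by linarith
  obtain s m where s: "s >= 7/5" and nm: "norm m = 1" and nim: "n1 \<bullet> m = s/2" "n2 \<bullet> m = s/2"
   using unit_bisector[OF n1 n12] by blast
  have c12: "abs(c1 - c2) <= B1 * E"
  proof -
   \<comment> \<open>Both linear forms have the same slope along \<open>m\<close>, so the leading
     terms combine to the factor \<open>c1 - c2\<close>. The step keeps all nodes inside the unit
     ball.\<close>
   define h where "h = (1 / real k) *\<^sub>R m"
   have hb: "0 + real nv *\<^sub>R h \<in> ball 0 1" if "nv <= k - 1" for nv
    using that k nm by (simp add: h_def)
   have "abs(dsum (k - 1) h D 0) <= 2 ^ (k - 1) * (2 * E)"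
    by (rule dsum_bound) (rule D[OF hb])
   moreover have "dsum (k - 1) h D 0 = c1 * (fact (k - 1) * (n1 \<bullet> h) ^ (k - 1)) - c2 * (fact (k - 1) * (n2 \<bullet> h) ^ (k - 1))"
    unfolding D_def dsum_diff dsum_cmult dsum_linear_power ..
   moreover have "... = (c1 - c2) * (fact (k - 1) * (s / (2 * real k)) ^ (k - 1))"
    unfolding h_def inner_scaleR_right nim by (simp add: algebra_simps)
   ultimately have 1: "abs(c1 - c2) * abs(fact (k - 1) * (s / (2 * real k)) ^ (k - 1)) <= 2 ^ (k - 1) * (2 * E)"
    by (simp add: abs_mult)
   have "(1 / (2 * real k)) ^ (k - 1) <= (s / (2 * real k)) ^ (k - 1)"
    using s k by (intro power_mono divide_right_mono) auto
   moreover have "1 <= (fact (k - 1) :: real)" by (rule fact_ge_1)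
   ultimately have "1 * (1 / (2 * real k)) ^ (k - 1) <= fact (k - 1) * (s / (2 * real k)) ^ (k - 1)"
    by (intro mult_mono) auto
   hence "(1 / (2 * real k)) ^ (k - 1) <= abs(fact (k - 1) * (s / (2 * real k)) ^ (k - 1))" by linarith
   hence "abs(c1 - c2) * (1 / (2 * real k)) ^ (k - 1) <= abs(c1 - c2) * abs(fact (k - 1) * (s / (2 * real k)) ^ (k - 1))"
    by (intro mult_left_mono) auto
   with 1 have "abs(c1 - c2) * (1 / (2 * real k)) ^ (k - 1) <= 2 ^ (k - 1) * (2 * E)" by linarith
   hence "abs(c1 - c2) * (1 / (2 * real k)) ^ (k - 1) * (2 * real k) ^ (k - 1) <= 2 ^ (k - 1) * (2 * E) * (2 * real k) ^ (k - 1)"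
    by (intro mult_right_mono) auto
   moreover have "(1 / (2 * real k)) ^ (k - 1) * (2 * real k) ^ (k - 1) = 1"
    unfolding power_mult_distrib[symmetric] using k by simp
   moreover have "2 ^ (k - 1) * (2 * E) * (2 * real k) ^ (k - 1) = B1 * E"
   proof -
    have "(4 * real k) ^ (k - 1) = (2 * (2 * real k)) ^ (k - 1)" by simp
    also have "... = 2 ^ (k - 1) * (2 * real k) ^ (k - 1)" by (rule power_mult_distrib)
    finally have e: "(4 * real k) ^ (k - 1) = 2 ^ (k - 1) * (2 * real k) ^ (k - 1)" .
    show ?thesis unfolding B1_def e by (simp only: mult_ac)
   qed
   ultimately show ?thesis by (simp only: mult.assoc mult_1_right)
  qed
  have part1: "abs(c1 - c2) powr tau <= B powr tau * K0 * F"
  proof (rule fromE)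
   have "B1 * E <= B * E" unfolding B_def using E by (intro mult_right_mono) auto
   thus "abs(c1 - c2) <= B * E" using c12 by linarith
  qed simp
  have part2: "(abs(c1) * (norm (n1 - n2) + abs(b1 - b2))) powr tau <= B powr tau * K0 * F" if k2: "k >= 2"
  proof (rule fromE)
   define j where "j = k - 2"
   have kj: "k - 1 = Suc j" "k - 2 = j" using k2 by (auto simp: j_def)
   define e where "e = n1 - n2"
   have em: "e \<bullet> m = 0" by (simp add: e_def inner_diff_left nim)
   \<comment> \<open>Near \<open>(7/10) *\<^sub>R m\<close> both linear forms are at least 1/25, so
     \<open>power_diff_ge\<close> recovers their difference from that of their powers.\<close>
   have diff: "abs(c1) * abs(e \<bullet> u - (b1 - b2)) <= B2 * E" if u: "norm (u - (7/10) *\<^sub>R m) <= 1/10" for u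
   proof -
    have "norm u <= norm (u - (7/10) *\<^sub>R m) + norm ((7/10) *\<^sub>R m)" using norm_triangle_ineq[of "u - (7/10) *\<^sub>R m" "(7/10) *\<^sub>R m"] by simp
    hence nu: "norm u < 1" using u nm by simp
    have ge: "ni \<bullet> u - b >= 1/25" if "norm ni = 1" "ni \<bullet> m = s/2" "abs(b) <= 1/4" for ni b
    proof -
     have "abs(ni \<bullet> (u - (7/10) *\<^sub>R m)) <= norm (u - (7/10) *\<^sub>R m)" using Cauchy_Schwarz_ineq2[of ni "u - (7/10) *\<^sub>R m"] that by simp
     hence "abs(ni \<bullet> u - (7/10) * (s/2)) <= 1/10" using u that by (simp add: inner_diff_right)
     thus ?thesis using s that by linarith
    qed
    have l1: "n1 \<bullet> u - b1 >= 1/25" and l2: "n2 \<bullet> u - b2 >= 1/25" using ge n1 nim bb by auto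
    have l22: "abs(n2 \<bullet> u - b2) <= 2"
     using Cauchy_Schwarz_ineq2[of n2 u] n1 nu bb by simp
    have "(1/25) ^ j * abs((n1 \<bullet> u - b1) - (n2 \<bullet> u - b2)) <= abs((n1 \<bullet> u - b1) ^ Suc j - (n2 \<bullet> u - b2) ^ Suc j)"
     using l1 l2 by (intro power_diff_ge) auto
    hence "abs(c1) * ((1/25) ^ j * abs((n1 \<bullet> u - b1) - (n2 \<bullet> u - b2))) <= abs(c1) * abs((n1 \<bullet> u - b1) ^ Suc j - (n2 \<bullet> u - b2) ^ Suc j)"
     by (intro mult_left_mono) auto
    also have "... = abs(D u - (c1 - c2) * (n2 \<bullet> u - b2) ^ Suc j)"
     unfolding D_def kj abs_mult[symmetric] by (simp only: algebra_simps)
    also have "... <= abs(D u) + abs(c1 - c2) * abs(n2 \<bullet> u - b2) ^ Suc j"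
     by (rule order_trans[OF abs_triangle_ineq4]) (simp add: abs_mult power_abs)
    also have "... <= 2 * E + (B1 * E) * 2 ^ Suc j"
     using D[of u] nu c12 l22 E B1 by (intro add_mono mult_mono power_mono) auto
    finally have "25 ^ j * (abs(c1) * ((1/25) ^ j * abs((n1 \<bullet> u - b1) - (n2 \<bullet> u - b2)))) <= 25 ^ j * (2 * E + (B1 * E) * 2 ^ Suc j)"
     by (intro mult_left_mono) auto
    moreover have "25 ^ j * (abs(c1) * ((1/25) ^ j * abs((n1 \<bullet> u - b1) - (n2 \<bullet> u - b2)))) = abs(c1) * abs(e \<bullet> u - (b1 - b2))"
     by (simp add: e_def inner_diff_left power_one_over algebra_simps)
    moreover have "25 ^ j * (2 * E + (B1 * E) * 2 ^ Suc j) = B2 * E" unfolding B2_def kj by (simp add: algebra_simps)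
    ultimately show ?thesis by simp
   qed
   have b: "abs(c1) * abs(b1 - b2) <= B2 * E" using diff[of "(7/10) *\<^sub>R m"] em by (simp add: abs_minus_commute)
   have ne: "abs(c1) * norm e <= 20 * (B2 * E)"
   proof (cases "e = 0")
    case True thus ?thesis using B2 E by simp
   next
    case False
    \<comment> \<open>Moving by 1/10 in the direction of \<open>e\<close> turns the bound on values
      of the linear form into one on its slope \<open>norm e\<close>.\<close>
    define u where "u = (7/10) *\<^sub>R m + (1 / (10 * norm e)) *\<^sub>R e"
    have eu: "e \<bullet> u = norm e / 10" unfolding u_def using em False
     by (simp add: inner_add_right power2_norm_eq_inner[symmetric] power2_eq_square)
    have "norm (u - (7/10) *\<^sub>R m) <= 1/10" using False by (simp add: u_def)
    from diff[OF this] have "abs(c1) * abs(norm e / 10 - (b1 - b2)) <= B2 * E" unfolding eu .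
    moreover have "abs(c1) * (norm e / 10) <= abs(c1) * abs(norm e / 10 - (b1 - b2)) + abs(c1) * abs(b1 - b2)"
     unfolding distrib_left[symmetric] by (intro mult_left_mono; linarith)
    ultimately show ?thesis using b by simp
   qed
   have "abs(c1) * (norm (n1 - n2) + abs(b1 - b2)) <= (50 * B2) * E"
   proof -
    have "abs(c1) * (norm (n1 - n2) + abs(b1 - b2)) = abs(c1) * norm e + abs(c1) * abs(b1 - b2)"
     unfolding e_def by (rule distrib_left)
    also have "... <= 20 * (B2 * E) + B2 * E" using b ne by (rule add_mono[rotated])
    also have "... <= 50 * (B2 * E)" using mult_nonneg_nonneg[OF B2 E(1)] by simp
    finally show ?thesis by simp
   qed
   also have "... <= B * E" unfolding B_def using E by (intro mult_right_mono) auto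
   finally show "abs(c1) * (norm (n1 - n2) + abs(b1 - b2)) <= B * E" .
  qed simp
  show ?thesis using part1 part2 by blast
 qed
 have "B > 0" unfolding B_def using B1 by auto
 hence "B powr tau * K0 > 0" using K0(1) by simp
 thus ?thesis by (intro exI[of _ "B powr tau * K0"] conjI[of "_ < _"] allI impI main)
qed

text \<open>For k = 1 the difference of a half-plane indicator has constant sign and absolute value
  0 or 1. Hence \<open>tau\<close> disappears from it, absolute values can be taken outside the
  integral, and comparing the jumps becomes summation by parts for \<open>\<phi>\<close>, the
  difference of the two indicators.\<close>

lemma local_comparison_one:
 assumes tau: "tau > 0" and A: "A >= 0"
 shows "\<exists>C>0. \<forall>w f a c1 c2 n1 n2 b1 b2 F h. cutoff A tau w --> localpair 1 tau f a c1 c2 n1 n2 b1 b2 F --> norm h <= 1/4 -->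
   pw tau c1 * jumpint 1 tau w n1 b1 h <= pw tau c1 * jumpint 1 tau w n2 b2 h + ennreal (C * F * norm h)"
proof -
 obtain K1 where K1: "K1 > 0" "!!f a c1 c2 n1 n2 b1 b2 F u. localpair 1 tau f a c1 c2 n1 n2 b1 b2 F ==> u \<in> ball 0 1 ==> abs(a u) powr tau <= K1 * F"
  using localpair_poly_bounds[of 1 tau] tau by auto
 obtain K2 where K2: "K2 > 0" "!!f a c1 c2 n1 n2 b1 b2 F. localpair 1 tau f a c1 c2 n1 n2 b1 b2 F ==> abs(c1 - c2) powr tau <= K2 * F"
  using localpair_jump_bounds[of 1 tau] tau by auto
 define K where "K = 3 powr tau * (1 + (K1 + K2) * unit_area)"
 have K: "K > 0" unfolding K_def using K1(1) K2(1) unit_area_pos by (intro mult_pos_pos add_pos_pos) auto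
 have main: "pw tau c1 * jumpint 1 tau w n1 b1 h <= pw tau c1 * jumpint 1 tau w n2 b2 h + ennreal ((A + 1) * K * F * norm h)"
  if w: "cutoff A tau w" and lp: "localpair 1 tau f a c1 c2 n1 n2 b1 b2 F" and h: "norm h <= 1/4"
  for w f a c1 c2 n1 n2 b1 b2 F h
 proof -
  note L = lp[unfolded localpair_def]
  have [measurable]: "a \<in> bm" "f \<in> bm" "w \<in> bm" using L cutoffD(1)[OF w] by auto
  have F: "F >= 0" using L by auto
  define W where "W u = w u powr tau" for u
  have [measurable]: "W \<in> bm" unfolding W_def by measurable
  have W: "0 <= W u" "abs(W u) <= A" "norm u >= 1/2 ==> W u = 0" "abs(W u - W u') <= A * norm (u - u')" for u u'
   using cutoffD[OF w] tau by (auto simp: W_def)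
  define X where "X n b u = tp 1 (n \<bullet> u - b)" for n b and u :: pt
  have [measurable]: "X n b \<in> bm" for n b unfolding X_def by measurable
  have X01: "X n b u = 0 | X n b u = 1" for n b u by (simp add: X_def tp_def)
  have X1: "abs(X n b u) <= 1" for n b u using X01[of n b u] by auto
  \<comment> \<open>The sign of the difference of the indicator, the same at all points.\<close>
  define s where "s n = (if n \<bullet> h >= 0 then 1 else -1 :: real)" for n
  have ss: "s n * s n = 1" "s n = 1 | s n = -1" for n by (auto simp: s_def)
  define \<Delta> where "\<Delta> n b u = s n * (X n b (u + h) - X n b u)" for n b u
  have \<Delta>0: "\<Delta> n b u = 0 | \<Delta> n b u = 1" and \<Delta>abs: "abs(X n b (u + h) - X n b u) = \<Delta> n b u" for n b u
   by (auto simp: \<Delta>_def X_def s_def tp_def inner_add_right)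
  have [measurable]: "\<Delta> n b \<in> bm" for n b unfolding \<Delta>_def by measurable
  have d1: "abs(\<Delta> n b u) <= 1" for n b u using \<Delta>0[of n b u] by auto
  have int: "integrable lborel (%u. W u * \<Delta> n b u)" for n b
   by (rule integrable_cutoff[where A=A and B=1 and R="1/2"]) (use W d1 in auto)
  define G where "G n b = (\<integral>u. W u * \<Delta> n b u \<partial>lborel)" for n b
  have G0: "G n b >= 0" for n b
  proof -
   have "0 <= W u * \<Delta> n b u" for u using W(1)[of u] \<Delta>0[of n b u] by auto
   thus ?thesis unfolding G_def by (intro Bochner_Integration.integral_nonneg) auto
  qed
  have J: "jumpint 1 tau w n b h = ennreal (G n b)" for n b
  proof -
   have "abs(w u * dsum 1 (n \<bullet> h) (tp 1) (n \<bullet> u - b)) powr tau = W u * \<Delta> n b u" for u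
   proof -
    have "dsum 1 (n \<bullet> h) (tp 1) (n \<bullet> u - b) = X n b (u + h) - X n b u"
     unfolding One_nat_def dsum_Suc by (simp add: X_def inner_add_right algebra_simps)
    hence "abs(w u * dsum 1 (n \<bullet> h) (tp 1) (n \<bullet> u - b)) = w u * \<Delta> n b u"
     using \<Delta>abs[of n b u] cutoffD(2)[OF w, of u] by (simp add: abs_mult)
    thus ?thesis using \<Delta>0[of n b u] cutoffD(2)[OF w, of u] by (auto simp: W_def)
   qed
   hence "jumpint 1 tau w n b h = (LI u. ennreal (W u * \<Delta> n b u))" unfolding jumpint_def by simp
   also have "... = ennreal (G n b)" unfolding G_def
    using W(1) \<Delta>0 by (intro nn_integral_eq_integral int AE_I2) (metis mult_nonneg_nonneg zero_le_one order_refl)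
   finally show ?thesis .
  qed
  define \<phi> where "\<phi> u = X n1 b1 u - X n2 b2 u" for u
  have [measurable]: "\<phi> \<in> bm" unfolding \<phi>_def by measurable
  have \<phi>1: "abs(\<phi> u) <= 1" for u using X01[of n1 b1 u] X01[of n2 b2 u] by (auto simp: \<phi>_def)
  define I where "I = (\<integral>u. W u * (\<phi> (u + h) - \<phi> u) \<partial>lborel)"
  have wD: "W u * (X n b (u + h) - X n b u) = s n * (W u * \<Delta> n b u)" for n b u
   unfolding \<Delta>_def using ss(1)[of n] by (simp add: mult.left_commute mult.assoc[symmetric])
  have I: "I = s n1 * G n1 b1 - s n2 * G n2 b2"
  proof -
   have "I = (\<integral>u. s n1 * (W u * \<Delta> n1 b1 u) - s n2 * (W u * \<Delta> n2 b2 u) \<partial>lborel)"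
    unfolding I_def wD[symmetric] \<phi>_def by (simp add: algebra_simps)
   also have "... = s n1 * G n1 b1 - s n2 * G n2 b2"
    unfolding G_def using int by (subst Bochner_Integration.integral_diff) auto
   finally show ?thesis .
  qed
  define \<Phi> where "\<Phi> = (\<integral>u. indicator (ball 0 1) u * abs(\<phi> u) \<partial>lborel)"
  have Ib: "abs(I) <= A * norm h * \<Phi>"
   unfolding I_def \<Phi>_def by (rule cutoff_summation_by_parts[where R="1/2"]) (use W \<phi>1 h in auto)
  \<comment> \<open>With equal signs \<open>I\<close> is, up to sign, the difference of the two
    terms; with opposite signs it is their sum, which is even better.\<close>
  have G12: "G n1 b1 <= G n2 b2 + A * norm h * \<Phi>"
   using Ib I G0[of n1 b1] G0[of n2 b2] ss(2)[of n1] ss(2)[of n2] by (auto simp: abs_if split: if_splits)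
  have i\<Phi>: "integrable lborel (%u. indicator (ball 0 1) u * abs(\<phi> u))"
   by (rule integrable_cutoff[where A=1 and B=1 and R=1]) (use \<phi>1 in \<open>auto simp: indicator_def\<close>)
  have \<Phi>0: "\<Phi> >= 0" unfolding \<Phi>_def by (intro Bochner_Integration.integral_nonneg) auto
  have "ennreal (abs(c1) powr tau * \<Phi>) = pw tau c1 * (LI u. ennreal (indicator (ball 0 1) u * abs(\<phi> u)))"
   using nn_integral_eq_integral[OF i\<Phi>] \<Phi>0 by (simp add: \<Phi>_def ennreal_mult)
  also have "... = (LI u. pw tau c1 * ennreal (indicator (ball 0 1) u * abs(\<phi> u)))"
   by (rule nn_integral_cmult[symmetric]) measurable
  also have "... <= (LI u. ennreal (3 powr tau) * (pw tau (f u) * indicator (ball 0 1) u + ennreal ((K1 + K2) * F) * indicator (ball 0 1) u))"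
  proof (rule nn_integral_mono_AE)
   have "AE u in lborel. u \<in> ball 0 1 --> f u = a u + c1 * tp 1 (n1 \<bullet> u - b1) - c2 * tp 1 (n2 \<bullet> u - b2)" using L by auto
   thus "AE u in lborel. pw tau c1 * ennreal (indicator (ball 0 1) u * abs(\<phi> u))
    <= ennreal (3 powr tau) * (pw tau (f u) * indicator (ball 0 1) u + ennreal ((K1 + K2) * F) * indicator (ball 0 1) u)"
   proof eventually_elim
    case (elim u)
    show ?case
    proof (cases "u \<in> ball 0 1 & \<phi> u ~= 0")
     case True
     have eq: "f u = a u + c1 * X n1 b1 u - c2 * X n2 b2 u" using elim True by (simp add: X_def)
     \<comment> \<open>On the sliver between the lines exactly one jump is active, so
       \<open>f\<close> equals \<open>a + c1\<close> or \<open>a - c2\<close> there.\<close>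
     have "abs(c1) <= abs(f u) + abs(a u) + abs(c1 - c2)"
      using X01[of n1 b1 u] X01[of n2 b2 u] True eq by (auto simp: \<phi>_def)
     hence "abs(c1) powr tau <= (\<Sum>i<3. (if i = 0 then abs(f u) else if i = Suc 0 then abs(a u) else abs(c1 - c2))) powr tau"
      using tau by (intro powr_mono2) (auto simp: numeral_3_eq_3)
     also have "... <= 3 powr tau * (\<Sum>i<3. (if i = 0 then abs(f u) else if i = Suc 0 then abs(a u) else abs(c1 - c2)) powr tau)"
      using sum_powr_le[of "{..<3::nat}" "%i. if i = 0 then abs(f u) else if i = Suc 0 then abs(a u) else abs(c1 - c2)" tau] tau by simp
     also have "... = 3 powr tau * (abs(f u) powr tau + abs(a u) powr tau + abs(c1 - c2) powr tau)"
      by (simp add: numeral_3_eq_3)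
     also have "... <= 3 powr tau * (abs(f u) powr tau + (K1 + K2) * F)"
      using K1(2)[OF lp, of u] K2(2)[OF lp] True by (intro mult_left_mono) (auto simp: distrib_right)
     finally have "abs(c1) powr tau <= 3 powr tau * (abs(f u) powr tau + (K1 + K2) * F)" .
     moreover have "abs(c1) powr tau * abs(\<phi> u) <= abs(c1) powr tau * 1" using \<phi>1 by (intro mult_left_mono) auto
     ultimately have "abs(c1) powr tau * abs(\<phi> u) <= 3 powr tau * (abs(f u) powr tau + (K1 + K2) * F)" by linarith
     thus ?thesis using True K1(1) K2(1) F
      by (simp add: ennreal_mult[symmetric] ennreal_plus[symmetric] ennreal_leI del: ennreal_plus)
    qed auto
   qed
  qed
  also have "... = ennreal (3 powr tau) * (ennreal F + ennreal ((K1 + K2) * F) * emeasure lborel (ball (0::pt) 1))"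
   using L by (simp add: nn_integral_cmult nn_integral_add)
  also have "... = ennreal (K * F)"
   using K1(1) K2(1) F unit_area_pos unfolding K_def
   by (simp add: emeasure_ball_pt ennreal_mult[symmetric] ennreal_plus[symmetric] del: ennreal_plus) (simp add: algebra_simps)
  finally have KF: "abs(c1) powr tau * \<Phi> <= K * F" using K F by simp
  have "abs(c1) powr tau * G n1 b1 <= abs(c1) powr tau * (G n2 b2 + A * norm h * \<Phi>)" using G12 by (intro mult_left_mono) auto
  also have "... = abs(c1) powr tau * G n2 b2 + A * norm h * (abs(c1) powr tau * \<Phi>)" by (simp add: algebra_simps)
  also have "A * norm h * (abs(c1) powr tau * \<Phi>) <= (A + 1) * norm h * (K * F)"
   by (rule mult_mono[OF _ KF]) (use A \<Phi>0 in \<open>auto intro!: mult_right_mono\<close>)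
  finally have "abs(c1) powr tau * G n1 b1 <= abs(c1) powr tau * G n2 b2 + (A + 1) * K * F * norm h" by (simp add: mult_ac)
  thus ?thesis unfolding J using G0 A K F
   by (simp add: ennreal_mult[symmetric] ennreal_plus[symmetric] ennreal_leI del: ennreal_plus)
 qed
 have "(A + 1) * K > 0" using A K by simp
 thus ?thesis by (intro exI[of _ "(A + 1) * K"] conjI[of "_ < _"] allI impI main)
qed

lemma enn_powr_add_le:
 assumes "q >= 1" "0 <= x" "0 <= y"
 shows "enn_powr (ennreal x) (1/q) + enn_powr (ennreal y) (1/q) <= enn_powr (ennreal (2 powr q * (x + y))) (1/q)"
proof -
 have "x powr (1/q) <= (x + y) powr (1/q)" "y powr (1/q) <= (x + y) powr (1/q)"
  using assms by (auto intro!: powr_mono2)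
 hence "x powr (1/q) + y powr (1/q) <= 2 * (x + y) powr (1/q)" by linarith
 also have "... = (2 powr q * (x + y)) powr (1/q)"
  using assms by (simp add: powr_mult powr_powr)
 finally show ?thesis using assms by (simp add: ennreal_plus[symmetric] ennreal_leI del: ennreal_plus)
qed

text \<open>Exchanges the height \<open>c1\<close> for \<open>c2\<close> once the lines have been
  matched. The error is the change of height times the full integral \<open>G2\<close> of one
  jump.\<close>

lemma jump_combine:
 fixes c1 c2 :: real
 assumes tau: "tau > 0" and g: "G2 <= ennreal g" "g >= 0" and x: "x >= 0" and y: "abs(c1 - c2) powr tau <= y"
  and le: "enn_powr (pw tau c1 * G1) (1 / max 1 tau) <= enn_powr (pw tau c1 * G2) (1 / max 1 tau) + enn_powr (ennreal x) (1 / max 1 tau)"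
 shows "enn_powr (pw tau c1 * G1) (1 / max 1 tau) <=
   enn_powr (pw tau c2 * G2) (1 / max 1 tau) + enn_powr (ennreal (2 powr (max 1 tau) * (x + y * g))) (1 / max 1 tau)"
proof -
 let ?q = "max 1 tau"
 have q: "?q >= 1" by simp
 have y0: "y >= 0" using y by (meson order_trans powr_ge_zero)
 have M: "enn_powr (pw tau c * G2) (1/?q) = ennreal (abs(c) powr (tau/?q)) * enn_powr G2 (1/?q)" for c :: real
  using q by (subst enn_powr_mult) (auto simp: powr_powr)
 have "abs(c1) powr (tau/?q) <= (abs(c2) + abs(c1 - c2)) powr (tau/?q)" using tau by (intro powr_mono2) auto
 also have "... <= abs(c2) powr (tau/?q) + abs(c1 - c2) powr (tau/?q)" using tau by (intro powr_sum_le) auto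
 finally have "ennreal (abs(c1) powr (tau/?q)) <= ennreal (abs(c2) powr (tau/?q)) + ennreal (abs(c1 - c2) powr (tau/?q))"
  by (simp add: ennreal_plus[symmetric] ennreal_leI del: ennreal_plus)
 hence 1: "enn_powr (pw tau c1 * G2) (1/?q) <= enn_powr (pw tau c2 * G2) (1/?q) + enn_powr (pw tau (c1 - c2) * G2) (1/?q)"
  unfolding M distrib_right[symmetric] by (intro mult_right_mono) auto
 have 2: "enn_powr (pw tau (c1 - c2) * G2) (1/?q) <= enn_powr (ennreal (y * g)) (1/?q)"
 proof (rule enn_powr_mono)
  have "pw tau (c1 - c2) * G2 <= ennreal y * ennreal g" using y g by (intro mult_mono ennreal_leI) auto
  thus "pw tau (c1 - c2) * G2 <= ennreal (y * g)" using y0 g by (simp add: ennreal_mult)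
 qed simp
 have 3: "enn_powr (ennreal x) (1/?q) + enn_powr (ennreal (y * g)) (1/?q) <= enn_powr (ennreal (2 powr ?q * (x + y * g))) (1/?q)"
  using x y0 g by (intro enn_powr_add_le) auto
 note le
 also have "enn_powr (pw tau c1 * G2) (1/?q) + enn_powr (ennreal x) (1/?q)
   <= (enn_powr (pw tau c2 * G2) (1/?q) + enn_powr (ennreal (y * g)) (1/?q)) + enn_powr (ennreal x) (1/?q)"
  by (intro add_right_mono order_trans[OF 1] add_left_mono 2)
 also have "... = enn_powr (pw tau c2 * G2) (1/?q) + (enn_powr (ennreal x) (1/?q) + enn_powr (ennreal (y * g)) (1/?q))"
  by (simp only: ac_simps)
 also have "... <= enn_powr (pw tau c2 * G2) (1/?q) + enn_powr (ennreal (2 powr ?q * (x + y * g))) (1/?q)"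
  by (intro add_left_mono 3)
 finally show ?thesis .
qed

text \<open>The second term keeps the factor one. The error has the same rate in
  \<open>norm h\<close> as the integral of a single jump, but carries \<open>F\<close> in place of
  the height of the jump.\<close>

lemma local_comparison:
 assumes k: "k >= 1" and tau: "tau > 0" and A: "A >= 0"
 shows "\<exists>C>0. \<forall>w f a c1 c2 n1 n2 b1 b2 F h. cutoff A tau w --> localpair k tau f a c1 c2 n1 n2 b1 b2 F --> h ~= 0 --> norm h <= 1/4 -->
   enn_powr (pw tau c1 * jumpint k tau w n1 b1 h) (1 / max 1 tau) <=
   enn_powr (pw tau c2 * jumpint k tau w n2 b2 h) (1 / max 1 tau)
    + enn_powr (ennreal (C * F * norm h powr (tau * (real k - 1) + 1))) (1 / max 1 tau)"
proof -
 obtain K where K: "K > 0" "!!f a c1 c2 n1 n2 b1 b2 F. localpair k tau f a c1 c2 n1 n2 b1 b2 F ==> abs(c1 - c2) powr tau <= K * F"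
  "!!f a c1 c2 n1 n2 b1 b2 F. localpair k tau f a c1 c2 n1 n2 b1 b2 F ==> k >= 2 ==> (abs(c1) * (norm (n1 - n2) + abs(b1 - b2))) powr tau <= K * F"
  using localpair_jump_bounds[OF k tau] by auto
 obtain G where G: "G > 0" "!!w n b h. cutoff A tau w ==> norm n = 1 ==> h ~= 0 ==>
   jumpint k tau w n b h <= ennreal (G * norm h powr (tau * (real k - 1) + 1))"
  using jumpint_bound[OF k tau A] by auto
 have "\<exists>H>0. \<forall>w f a c1 c2 n1 n2 b1 b2 F h. cutoff A tau w --> localpair k tau f a c1 c2 n1 n2 b1 b2 F --> h ~= 0 --> norm h <= 1/4 -->
   enn_powr (pw tau c1 * jumpint k tau w n1 b1 h) (1 / max 1 tau) <=
   enn_powr (pw tau c1 * jumpint k tau w n2 b2 h) (1 / max 1 tau)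
    + enn_powr (ennreal (H * F * norm h powr (tau * (real k - 1) + 1))) (1 / max 1 tau)"
 proof (cases "k = 1")
  case True
  obtain H where H: "H > 0" "!!w f a c1 c2 n1 n2 b1 b2 F h. cutoff A tau w ==> localpair 1 tau f a c1 c2 n1 n2 b1 b2 F ==> norm h <= 1/4 ==>
   pw tau c1 * jumpint 1 tau w n1 b1 h <= pw tau c1 * jumpint 1 tau w n2 b2 h + ennreal (H * F * norm h)"
   using local_comparison_one[OF tau A] by auto
  have sub: "enn_powr (x + y) (1 / max 1 tau) <= enn_powr x (1 / max 1 tau) + enn_powr y (1 / max 1 tau)" for x y
  proof (cases "x = top | y = top")
   case False
   then obtain a b where ab: "x = ennreal a" "y = ennreal b" "a >= 0" "b >= 0" by (metis ennreal_cases)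
   show ?thesis unfolding ab using ab powr_sum_le[of a b "1 / max 1 tau"]
    by (simp add: ennreal_plus[symmetric] ennreal_leI del: ennreal_plus)
  qed auto
  show ?thesis
  proof (intro exI[of _ H] conjI allI impI)
   fix w f a c1 c2 n1 n2 b1 b2 F and h :: pt
   assume w: "cutoff A tau w" and lp: "localpair k tau f a c1 c2 n1 n2 b1 b2 F" and h: "norm h <= 1/4" "h ~= 0"
   have "pw tau c1 * jumpint k tau w n1 b1 h <= pw tau c1 * jumpint k tau w n2 b2 h + ennreal (H * F * norm h powr (tau * (real k - 1) + 1))"
    using H(2)[OF w lp[unfolded True] h(1)] unfolding True by simp
   thus "enn_powr (pw tau c1 * jumpint k tau w n1 b1 h) (1 / max 1 tau) <=
     enn_powr (pw tau c1 * jumpint k tau w n2 b2 h) (1 / max 1 tau)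
     + enn_powr (ennreal (H * F * norm h powr (tau * (real k - 1) + 1))) (1 / max 1 tau)"
    by (intro order_trans[OF enn_powr_mono sub]) auto
  qed (rule H(1))
 next
  case False
  hence k2: "k >= 2" using k by simp
  obtain H where H: "H > 0" "!!w n1 n2 b1 b2 h. cutoff A tau w ==> norm n1 = 1 ==> norm n2 = 1 ==> n1 \<bullet> n2 >= 0 ==>
   abs(b1) <= 1/4 ==> abs(b2) <= 1/4 ==> h ~= 0 ==>
   enn_powr (jumpint k tau w n1 b1 h) (1 / max 1 tau) <= enn_powr (jumpint k tau w n2 b2 h) (1 / max 1 tau)
    + enn_powr (ennreal (H * (norm (n1 - n2) + abs(b1 - b2)) powr tau * norm h powr (tau * (real k - 1) + 1))) (1 / max 1 tau)"
   using jumpint_shear[OF k2 tau A] by auto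
  show ?thesis
  proof (intro exI[of _ "H * K"] conjI allI impI)
   fix w f a c1 c2 n1 n2 b1 b2 F and h :: pt
   assume w: "cutoff A tau w" and lp: "localpair k tau f a c1 c2 n1 n2 b1 b2 F" and h: "norm h <= 1/4" "h ~= 0"
   note L = lp[unfolded localpair_def]
   let ?q = "max 1 tau" and ?d = "norm (n1 - n2) + abs(b1 - b2)" and ?t = "norm h powr (tau * (real k - 1) + 1)"
   have le: "enn_powr (jumpint k tau w n1 b1 h) (1 / ?q) <= enn_powr (jumpint k tau w n2 b2 h) (1 / ?q)
     + enn_powr (ennreal (H * ?d powr tau * ?t)) (1 / ?q)" using L by (intro H w h) auto
   have m: "enn_powr (pw tau c1 * x) (1/?q) = enn_powr (pw tau c1) (1/?q) * enn_powr x (1/?q)" for x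
    by (rule enn_powr_mult) simp
   have "enn_powr (pw tau c1 * jumpint k tau w n1 b1 h) (1 / ?q) <= enn_powr (pw tau c1 * jumpint k tau w n2 b2 h) (1 / ?q)
     + enn_powr (pw tau c1 * ennreal (H * ?d powr tau * ?t)) (1 / ?q)"
    unfolding m distrib_left[symmetric] by (intro mult_left_mono le) auto
   also have "pw tau c1 * ennreal (H * ?d powr tau * ?t) = ennreal (H * (abs(c1) * ?d) powr tau * ?t)"
    using H(1) by (subst ennreal_mult[symmetric]) (auto simp: powr_mult mult_ac)
   also have "enn_powr (ennreal (H * (abs(c1) * ?d) powr tau * ?t)) (1/?q) <= enn_powr (ennreal (H * K * F * ?t)) (1/?q)"
   proof (intro enn_powr_mono ennreal_leI)
    have "H * (abs(c1) * ?d) powr tau * ?t <= H * (K * F) * ?t"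
     using K(3)[OF lp k2] H(1) by (intro mult_right_mono mult_left_mono) auto
    thus "H * (abs(c1) * ?d) powr tau * ?t <= H * K * F * ?t" by (simp only: mult.assoc)
   qed simp
   finally show "enn_powr (pw tau c1 * jumpint k tau w n1 b1 h) (1 / ?q) <=
     enn_powr (pw tau c1 * jumpint k tau w n2 b2 h) (1 / ?q) + enn_powr (ennreal (H * K * F * ?t)) (1 / ?q)"
    by (simp add: add_left_mono)
  qed (use H(1) K(1) in simp)
 qed
 then obtain H where H: "H > 0" "!!w f a c1 c2 n1 n2 b1 b2 F h. cutoff A tau w ==> localpair k tau f a c1 c2 n1 n2 b1 b2 F ==> h ~= 0 ==> norm h <= 1/4 ==>
   enn_powr (pw tau c1 * jumpint k tau w n1 b1 h) (1 / max 1 tau) <=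
   enn_powr (pw tau c1 * jumpint k tau w n2 b2 h) (1 / max 1 tau)
    + enn_powr (ennreal (H * F * norm h powr (tau * (real k - 1) + 1))) (1 / max 1 tau)"
  by auto
 show ?thesis
 proof (intro exI[of _ "2 powr (max 1 tau) * (H + K * G)"] conjI allI impI)
  fix w f a c1 c2 n1 n2 b1 b2 F and h :: pt
  assume w: "cutoff A tau w" and lp: "localpair k tau f a c1 c2 n1 n2 b1 b2 F" and h: "norm h <= 1/4" "h ~= 0"
  note L = lp[unfolded localpair_def]
  let ?q = "max 1 tau" and ?t = "norm h powr (tau * (real k - 1) + 1)"
  have "enn_powr (pw tau c1 * jumpint k tau w n1 b1 h) (1 / ?q) <=
    enn_powr (pw tau c2 * jumpint k tau w n2 b2 h) (1 / ?q) + enn_powr (ennreal (2 powr ?q * (H * F * ?t + K * F * (G * ?t)))) (1 / ?q)"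
   using L H(1) G(1) by (intro jump_combine[OF tau] G(2)[OF w] H(2)[OF w lp] K(2)[OF lp] h) auto
  also have "2 powr ?q * (H * F * ?t + K * F * (G * ?t)) = 2 powr ?q * (H + K * G) * F * ?t" by (simp add: algebra_simps)
  finally show "enn_powr (pw tau c1 * jumpint k tau w n1 b1 h) (1 / ?q) <=
    enn_powr (pw tau c2 * jumpint k tau w n2 b2 h) (1 / ?q) + enn_powr (ennreal (2 powr ?q * (H + K * G) * F * ?t)) (1 / ?q)" .
 qed (use H(1) K(1) G(1) in \<open>auto intro!: mult_pos_pos add_pos_pos\<close>)
qed

section \<open>Geometry of rings and cells\<close>

definition halfdisc :: "pt => pt => real => pt set" where
 "halfdisc y nv rho = {z. dist z y <= rho & nv \<bullet> (z - y) >= 0}"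

text \<open>All that is kept of the beta-triangles: every point of an edge sees, on one side, a
  half-disc whose radius is proportional to the distance from the nearer endpoint. Degenerate pairs
  with equal endpoints are allowed and carry radius zero.\<close>

definition skel :: "real => (pt \<times> pt) set => pt set => bool" where
 "skel kp E R \<longleftrightarrow> finite E & R <= closure (interior R) & frontier R <= (\<Union>(a,b)\<in>E. cseg a b) &
   (\<forall>(a,b)\<in>E. \<exists>nv. norm nv = 1 & nv \<bullet> (b - a) = 0 &
    (\<forall>y\<in>cseg a b. halfdisc y nv (kp * min (dist y a) (dist y b)) <= closure R))"

lemma orthonormal_expand:
 fixes e nv x :: pt
 assumes "norm e = 1" "norm nv = 1" "e \<bullet> nv = 0"
 shows "x = (e \<bullet> x) *\<^sub>R e + (nv \<bullet> x) *\<^sub>R nv"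
proof (rule ccontr)
 have ee: "e \<bullet> e = 1" "nv \<bullet> nv = 1" "nv \<bullet> e = 0" using assms by (auto simp: norm_eq_1 inner_commute)
 define z where "z = x - (e \<bullet> x) *\<^sub>R e - (nv \<bullet> x) *\<^sub>R nv"
 assume "x ~= (e \<bullet> x) *\<^sub>R e + (nv \<bullet> x) *\<^sub>R nv"
 hence z0: "z ~= 0" unfolding z_def by (metis diff_diff_eq eq_iff_diff_eq_0)
 have ze: "e \<bullet> z = 0" "nv \<bullet> z = 0" using ee assms by (auto simp: z_def inner_diff_right)
 have ne: "e ~= 0" "nv ~= 0" "e ~= nv" "z ~= e" "z ~= nv" using ee ze assms by auto
 have "pairwise orthogonal {e, nv, z}"
  unfolding pairwise_insert orthogonal_def using ze ee assms by (auto simp: inner_commute)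
 hence "independent {e, nv, z}" using ne z0 by (intro pairwise_orthogonal_independent) auto
 hence "card {e, nv, z} <= DIM(pt)" using independent_bound by blast
 moreover have "card {e, nv, z} = 3" using ne by auto
 ultimately show False by simp
qed

lemma exists_perp:
 fixes w :: pt
 shows "\<exists>nv. norm nv = 1 & nv \<bullet> w = 0"
proof (cases "w = 0")
 case True
 thus ?thesis by (metis inner_zero_right vector_choose_size zero_le_one)
next
 case False
 define v :: pt where "v = vector [- (w$2), w$1]"
 have v: "v$1 = - (w$2)" "v$2 = w$1" by (auto simp: v_def)
 have "v \<bullet> w = 0" by (simp add: inner_vec_def sum_2 v)
 moreover have "v ~= 0" using False v by (auto simp: vec_eq_iff forall_2)
 ultimately show ?thesis by (intro exI[of _ "(1 / norm v) *\<^sub>R v"]) auto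
qed

lemma norm_orthonormal:
 fixes e nv :: pt
 assumes "norm e = 1" "norm nv = 1" "e \<bullet> nv = 0"
 shows "(norm (x *\<^sub>R e + y *\<^sub>R nv))\<^sup>2 = x\<^sup>2 + y\<^sup>2"
 unfolding power2_norm_eq_inner
 using assms by (simp add: inner_add_left inner_add_right norm_eq_1 inner_commute power2_eq_square)

text \<open>The bounds \<open>ka\<close> and \<open>kb\<close> say that \<open>kp\<close> is at most
  the sine of either base angle. Cauchy-Schwarz then keeps the half-disc on the inner side of the
  two lines through c, which is positivity of the barycentric coordinates.\<close>

lemma triangle_halfdisc:
 fixes a b c nv :: pt
 assumes nv: "norm nv = 1" "nv \<bullet> (b - a) = 0" and H: "nv \<bullet> (c - a) > 0" and k: "kp >= 0"
  and ka: "kp * dist c a <= nv \<bullet> (c - a)" and kb: "kp * dist c b <= nv \<bullet> (c - a)" and y: "y \<in> cseg a b"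
 shows "halfdisc y nv (kp * min (dist y a) (dist y b)) <= convex hull {a, b, c}"
proof
 fix z assume z: "z \<in> halfdisc y nv (kp * min (dist y a) (dist y b))"
 show "z \<in> convex hull {a, b, c}"
 proof (cases "a = b")
  case True
  hence "y = a" using y by simp
  hence "z = a" using z True by (auto simp: halfdisc_def)
  thus ?thesis by (auto intro: hull_inc)
 next
  case False
  define L where "L = norm (b - a)"
  have L: "L > 0" using False by (simp add: L_def)
  define e where "e = (1 / L) *\<^sub>R (b - a)"
  have e: "norm e = 1" "e \<bullet> nv = 0" using L nv by (auto simp: e_def L_def inner_commute)
  have ee: "e \<bullet> e = 1" "nv \<bullet> nv = 1" "nv \<bullet> e = 0" using e nv by (auto simp: norm_eq_1 inner_commute)
  have ba: "b - a = L *\<^sub>R e" using L by (simp add: e_def)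
  define H' where "H' = nv \<bullet> (c - a)"
  have H': "H' > 0" using H by (simp add: H'_def)
  define p where "p = e \<bullet> (c - a)"
  obtain u where u: "0 <= u" "u <= 1" "y = (1 - u) *\<^sub>R a + u *\<^sub>R b" using y by (auto simp: in_segment)
  define \<eta> where "\<eta> = u * L"
  have eta: "0 <= \<eta>" "\<eta> <= L" using u L mult_right_mono[OF u(2), of L] by (auto simp: \<eta>_def)
  have ya: "y - a = \<eta> *\<^sub>R e"
  proof -
   have "y - a = u *\<^sub>R (b - a)" unfolding u(3) by (simp add: algebra_simps)
   thus ?thesis unfolding ba \<eta>_def by simp
  qed
  have yb: "y - b = (\<eta> - L) *\<^sub>R e"
  proof -
   have "y - b = (y - a) - (b - a)" by simp
   thus ?thesis unfolding ya ba by (simp add: algebra_simps)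
  qed
  have d: "dist y a = \<eta>" "dist y b = L - \<eta>" unfolding dist_norm ya yb using e eta by auto
  define w where "w = z - y"
  have w: "norm w <= kp * \<eta>" "norm w <= kp * (L - \<eta>)" "nv \<bullet> w >= 0"
  proof -
   have "norm w <= kp * min \<eta> (L - \<eta>)" using z unfolding halfdisc_def d w_def by (simp add: dist_norm)
   moreover have "kp * min \<eta> (L - \<eta>) <= kp * \<eta>" "kp * min \<eta> (L - \<eta>) <= kp * (L - \<eta>)" using k by (auto intro!: mult_left_mono)
   ultimately show "norm w <= kp * \<eta>" "norm w <= kp * (L - \<eta>)" by linarith+
   show "nv \<bullet> w >= 0" using z by (simp add: halfdisc_def w_def)
  qed
  define alp where "alp = e \<bullet> (z - a)"
  define gam where "gam = nv \<bullet> (z - a)"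
  have za: "z - a = w + \<eta> *\<^sub>R e" using ya by (simp add: w_def algebra_simps)
  have al: "alp = e \<bullet> w + \<eta>" "gam = nv \<bullet> w" unfolding alp_def gam_def za using ee by (auto simp: inner_add_right)
  have ca: "c - a = p *\<^sub>R e + H' *\<^sub>R nv" unfolding p_def H'_def by (rule orthonormal_expand) (use e nv in auto)
  have cb: "c - b = (p - L) *\<^sub>R e + H' *\<^sub>R nv"
  proof -
   have "c - b = (c - a) - (b - a)" by simp
   thus ?thesis unfolding ca ba by (simp add: algebra_simps)
  qed
  \<comment> \<open>Up to sign the area form of \<open>w\<close> and
    \<open>t *\<^sub>R e + H' *\<^sub>R nv\<close>, written as an inner product with the latter
    turned by a right angle.\<close>
  have nH: "abs(H' * (e \<bullet> w) - t * (nv \<bullet> w)) <= norm (t *\<^sub>R e + H' *\<^sub>R nv) * norm w" for t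
  proof -
   have "norm (H' *\<^sub>R e + (- t) *\<^sub>R nv) = norm (t *\<^sub>R e + H' *\<^sub>R nv)"
   proof (rule power2_eq_imp_eq)
    show "(norm (H' *\<^sub>R e + (- t) *\<^sub>R nv))\<^sup>2 = (norm (t *\<^sub>R e + H' *\<^sub>R nv))\<^sup>2"
     unfolding norm_orthonormal[OF e(1) nv(1) e(2)] by (simp only: power2_minus add.commute)
   qed (rule norm_ge_zero)+
   moreover have "H' * (e \<bullet> w) - t * (nv \<bullet> w) = (H' *\<^sub>R e + (- t) *\<^sub>R nv) \<bullet> w" by (simp add: inner_add_left inner_diff_left)
   ultimately show ?thesis using Cauchy_Schwarz_ineq2[of "H' *\<^sub>R e + (- t) *\<^sub>R nv" w] by simp
  qed
  have b1: "norm (c - a) * norm w <= \<eta> * H'"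
  proof -
   have "norm (c - a) * norm w <= norm (c - a) * (kp * \<eta>)" using w by (intro mult_left_mono) auto
   also have "... = \<eta> * (kp * dist c a)" by (simp add: dist_norm)
   also have "... <= \<eta> * H'" using ka eta unfolding H'_def by (intro mult_left_mono) auto
   finally show ?thesis .
  qed
  have b2: "norm (c - b) * norm w <= (L - \<eta>) * H'"
  proof -
   have "norm (c - b) * norm w <= norm (c - b) * (kp * (L - \<eta>))" using w by (intro mult_left_mono) auto
   also have "... = (L - \<eta>) * (kp * dist c b)" by (simp add: dist_norm)
   also have "... <= (L - \<eta>) * H'" using kb eta unfolding H'_def by (intro mult_left_mono) auto
   finally show ?thesis .
  qed
  have v0: "alp * H' - gam * p >= 0"
   using nH[of p] b1 unfolding ca[symmetric] al by (auto simp: algebra_simps abs_le_iff)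
  have u0: "(L - alp) * H' + gam * (p - L) >= 0"
   using nH[of "p - L"] b2 unfolding cb[symmetric] al by (auto simp: algebra_simps abs_le_iff)
  \<comment> \<open>\<open>W\<close>, \<open>V\<close> and \<open>U\<close> are the barycentric
    coordinates of z for c, b and a.\<close>
  define W where "W = gam / H'"
  define V where "V = (alp - W * p) / L"
  define U where "U = 1 - V - W"
  have W0: "W >= 0" using w H' al by (simp add: W_def)
  have V0: "V >= 0" using v0 H' L by (simp add: V_def W_def field_simps)
  have U0: "U >= 0"
  proof -
   have "U * (L * H') = (L - alp) * H' + gam * (p - L)" unfolding U_def V_def W_def using L H' by (simp add: field_simps)
   hence "U * (L * H') >= 0" using u0 by simp
   thus ?thesis using mult_pos_pos[OF L H'] by (auto simp: zero_le_mult_iff)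
  qed
  have "z - a = alp *\<^sub>R e + gam *\<^sub>R nv" unfolding alp_def gam_def by (rule orthonormal_expand) (use e nv in auto)
  also have "... = (V * L + W * p) *\<^sub>R e + (W * H') *\<^sub>R nv" using L H' by (simp add: V_def W_def)
  also have "... = V *\<^sub>R (b - a) + W *\<^sub>R (c - a)" unfolding ca ba by (simp add: algebra_simps)
  finally have "z = U *\<^sub>R a + V *\<^sub>R b + W *\<^sub>R c" unfolding U_def by (simp add: algebra_simps)
  thus ?thesis unfolding convex_hull_3 using U0 V0 W0 U_def by (intro CollectI exI[of _ U] exI[of _ V] exI[of _ W]) auto
 qed
qed

lemma vec_angle_cos:
 assumes "vec_angle u v = \<beta>" "0 < \<beta>" "\<beta> <= pi / 3"
 shows "u ~= 0" "v ~= 0" "u \<bullet> v = cos \<beta> * (norm u * norm v)"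
proof -
 have nz: "u ~= 0 & v ~= 0"
 proof (rule ccontr)
  assume "\<not> (u ~= 0 & v ~= 0)"
  \<comment> \<open>Division by zero gives 0 and hence the angle \<open>pi / 2\<close>, which
    exceeds \<open>\<beta>\<close>; zero vectors are therefore excluded.\<close>
  hence "vec_angle u v = arccos 0" by (auto simp: vec_angle_def)
  thus False using assms pi_gt_zero by simp
 qed
 thus "u ~= 0" "v ~= 0" by auto
 have pos: "norm u * norm v > 0" using nz by simp
 have "abs((u \<bullet> v) / (norm u * norm v)) <= 1"
  using Cauchy_Schwarz_ineq2[of u v] pos by (simp add: abs_mult)
 from cos_arccos_abs[OF this] have "cos \<beta> = (u \<bullet> v) / (norm u * norm v)"
  unfolding vec_angle_def[symmetric] assms(1) .
 thus "u \<bullet> v = cos \<beta> * (norm u * norm v)" using pos by simp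
qed

lemma beta_triangle_halfdisc:
 assumes bt: "has_beta_triangle \<beta> T a b" and \<beta>: "0 < \<beta>" "\<beta> <= pi / 3"
 shows "\<exists>nv. norm nv = 1 & nv \<bullet> (b - a) = 0 & (\<forall>y\<in>cseg a b. halfdisc y nv (sin \<beta> * min (dist y a) (dist y b)) <= T)"
proof -
 obtain c where c: "convex hull {a, b, c} <= T" "vec_angle (b - a) (c - a) = \<beta>" "vec_angle (a - b) (c - b) = \<beta>"
  using bt by (auto simp: has_beta_triangle_def)
 note A = vec_angle_cos[OF c(2) \<beta>] and B = vec_angle_cos[OF c(3) \<beta>]
 have sin: "sin \<beta> > 0" using \<beta> pi_gt_zero by (intro sin_gt_zero) linarith+
 obtain nv0 where nv0: "norm nv0 = 1" "nv0 \<bullet> (b - a) = 0" using exists_perp by blast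
 define L where "L = norm (b - a)"
 have L: "L > 0" using A by (simp add: L_def)
 define e where "e = (1 / L) *\<^sub>R (b - a)"
 have e: "norm e = 1" "e \<bullet> nv0 = 0" using L nv0 by (auto simp: e_def L_def inner_commute)
 have pa: "e \<bullet> (c - a) = cos \<beta> * norm (c - a)" using A(3) L by (simp add: e_def L_def)
 have pb: "e \<bullet> (c - b) = - cos \<beta> * norm (c - b)"
 proof -
  have "(b - a) \<bullet> (c - b) = - ((a - b) \<bullet> (c - b))" by (simp add: inner_diff_left)
  thus ?thesis unfolding e_def using B(3) L by (simp add: L_def norm_minus_commute)
 qed
 have sq: "(nv0 \<bullet> v)\<^sup>2 = (sin \<beta> * norm v)\<^sup>2" if "(e \<bullet> v)\<^sup>2 = (cos \<beta> * norm v)\<^sup>2" for v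
 proof -
  have "(norm v)\<^sup>2 = (e \<bullet> v)\<^sup>2 + (nv0 \<bullet> v)\<^sup>2"
   using norm_orthonormal[OF e(1) nv0(1) e(2), of "e \<bullet> v" "nv0 \<bullet> v"] orthonormal_expand[OF e(1) nv0(1) e(2), of v] by simp
  moreover have "(norm v)\<^sup>2 = (cos \<beta> * norm v)\<^sup>2 + (sin \<beta> * norm v)\<^sup>2"
   using sin_cos_squared_add[of \<beta>] by (simp add: power_mult_distrib flip: distrib_right)
  ultimately show ?thesis using that by linarith
 qed
 \<comment> \<open>The normal that points to the side of the apex.\<close>
 define nv where "nv = (if nv0 \<bullet> (c - a) >= 0 then nv0 else - nv0)"
 have n: "norm nv = 1" "nv \<bullet> (b - a) = 0" using nv0 by (auto simp: nv_def)
 have na: "nv \<bullet> (c - a) = abs(nv0 \<bullet> (c - a))" by (auto simp: nv_def)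
 have nb: "abs(nv0 \<bullet> (c - b)) = abs(nv0 \<bullet> (c - a))"
 proof -
  have "nv0 \<bullet> (c - b) = nv0 \<bullet> (c - a) - nv0 \<bullet> (b - a)" by (simp add: inner_diff_right)
  thus ?thesis using nv0 by simp
 qed
 have ab: "abs(x) = abs(y)" if "x\<^sup>2 = y\<^sup>2" for x y :: real
  using that by (simp add: power2_eq_iff abs_eq_iff)
 have ha: "nv \<bullet> (c - a) = sin \<beta> * norm (c - a)"
 proof -
  have "(e \<bullet> (c - a))\<^sup>2 = (cos \<beta> * norm (c - a))\<^sup>2" unfolding pa ..
  from ab[OF sq[OF this]] show ?thesis unfolding na by (rule trans) (rule abs_of_nonneg, use sin in simp)
 qed
 have hb: "nv \<bullet> (c - a) = sin \<beta> * norm (c - b)"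
 proof -
  have "(e \<bullet> (c - b))\<^sup>2 = (cos \<beta> * norm (c - b))\<^sup>2" unfolding pb by (simp only: mult_minus_left power2_minus)
  from ab[OF sq[OF this]] show ?thesis unfolding na nb[symmetric] by (rule trans) (rule abs_of_nonneg, use sin in simp)
 qed
 have "halfdisc y nv (sin \<beta> * min (dist y a) (dist y b)) <= convex hull {a, b, c}" if "y \<in> cseg a b" for y
  using n sin ha hb A that by (intro triangle_halfdisc) (auto simp: dist_norm)
 thus ?thesis using n c(1) by blast
qed

section \<open>Unions of segments and their nodes\<close>

definition segs :: "(pt \<times> pt) list => pt set" where
 "segs L = (\<Union>(a,b)\<in>set L. cseg a b)"

text \<open>Two listed segments contribute a node when they meet in exactly one point. Segments that
  share more lie on one line, so away from the finitely many nodes their union is contained locally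
  in a single line.\<close>

definition nodes :: "(pt \<times> pt) list => pt set" where
 "nodes L = (\<Union>(a,b)\<in>set L. {a, b}) \<union>
   {x. \<exists>s\<in>set L. \<exists>s'\<in>set L. cseg (fst s) (snd s) \<inter> cseg (fst s') (snd s') = {x}}"

lemma nodes_card:
 "finite (nodes L)" "card (nodes L) <= 2 * length L + (length L)\<^sup>2"
proof -
 let ?f = "%(s,s'). THE x. cseg (fst s) (snd s) \<inter> cseg (fst s') (snd s') = {x :: pt}"
 let ?A = "\<Union>(a,b)\<in>set L. {a, b}" and ?B = "?f ` (set L \<times> set L)"
 have sub: "nodes L <= ?A \<union> ?B"
 proof
  fix x assume "x \<in> nodes L"
  thus "x \<in> ?A \<union> ?B"
   unfolding nodes_def
  proof
   assume "x \<in> {x. \<exists>s\<in>set L. \<exists>s'\<in>set L. cseg (fst s) (snd s) \<inter> cseg (fst s') (snd s') = {x}}"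
   then obtain s s' where s: "s \<in> set L" "s' \<in> set L" "cseg (fst s) (snd s) \<inter> cseg (fst s') (snd s') = {x}" by auto
   hence "?f (s, s') = x" by simp
   thus ?thesis using s by (intro UnI2 image_eqI[of _ _ "(s, s')"]) auto
  qed simp
 qed
 have fA: "finite ?A" by auto
 have fB: "finite ?B" by auto
 show "finite (nodes L)" using sub fA fB by (meson finite_UnI finite_subset)
 have "card ?A <= (\<Sum>p\<in>set L. card (case p of (a,b) => {a,b}))" by (rule card_UN_le) simp
 also have "... <= (\<Sum>p\<in>set L. 2)" by (intro sum_mono) (auto simp: card_insert_if)
 also have "... <= 2 * length L" by (simp add: card_length)
 finally have cA: "card ?A <= 2 * length L" .
 have "card ?B <= card (set L \<times> set L)" by (intro card_image_le) auto
 also have "... <= (length L)\<^sup>2" by (simp add: card_cartesian_product power2_eq_square mult_mono card_length)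
 finally have cB: "card ?B <= (length L)\<^sup>2" .
 have "card (nodes L) <= card (?A \<union> ?B)" using sub fA fB by (intro card_mono) auto
 also have "... <= card ?A + card ?B" by (rule card_Un_le)
 finally show "card (nodes L) <= 2 * length L + (length L)\<^sup>2" using cA cB by linarith
qed

lemma segment_param:
 assumes "z \<in> cseg c d"
 obtains s where "0 <= s" "s <= 1" "z - c = s *\<^sub>R (d - c)"
proof -
 obtain s where "0 <= s" "s <= 1" "z = (1 - s) *\<^sub>R c + s *\<^sub>R d" using assms by (auto simp: in_segment)
 thus ?thesis by (intro that[of s]) (auto simp: algebra_simps)
qed

lemma inner_segment_eq_0:
 fixes nv :: pt
 assumes y: "y \<in> cseg c d" "y' \<in> cseg c d" "y ~= y'" and z: "z \<in> cseg c d"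
  and nv: "nv \<bullet> (y' - y) = 0"
 shows "nv \<bullet> (d - c) = 0" "nv \<bullet> (z - y) = 0"
proof -
 obtain s s' t where s: "y - c = s *\<^sub>R (d - c)" "y' - c = s' *\<^sub>R (d - c)" "z - c = t *\<^sub>R (d - c)"
  using segment_param[OF y(1)] segment_param[OF y(2)] segment_param[OF z] by metis
 have "y' - y = (y' - c) - (y - c)" by simp
 hence yy: "y' - y = (s' - s) *\<^sub>R (d - c)" unfolding s by (simp add: scaleR_diff_left)
 hence "s' ~= s" using y(3) by auto
 thus 0: "nv \<bullet> (d - c) = 0" using nv unfolding yy by simp
 have "z - y = (z - c) - (y - c)" by simp
 hence "z - y = (t - s) *\<^sub>R (d - c)" unfolding s by (simp add: scaleR_diff_left)
 thus "nv \<bullet> (z - y) = 0" using 0 by simp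
qed

text \<open>Segments missing y stay at positive distance from it. Two segments through a point y
  that is no node share a second point and hence a line, so one normal serves all of them.\<close>

lemma segs_local_line:
 assumes y: "y \<in> segs L" "y \<notin> nodes L"
 obtains nv eps where "norm nv = 1" "eps > 0" "!!z. z \<in> segs L ==> dist z y < eps ==> nv \<bullet> (z - y) = 0"
proof -
 obtain a b where ab: "(a, b) \<in> set L" "y \<in> cseg a b" using y by (auto simp: segs_def)
 obtain nv where nv: "norm nv = 1" "nv \<bullet> (b - a) = 0" using exists_perp by blast
 define C where "C = (\<Union>s\<in>{s\<in>set L. y \<notin> cseg (fst s) (snd s)}. cseg (fst s) (snd s))"
 have "closed C" unfolding C_def by (intro closed_UN) auto
 moreover have "y \<notin> C" by (auto simp: C_def)
 ultimately obtain eps where eps: "eps > 0" "ball y eps <= - C" by (metis ComplI open_Compl open_contains_ball)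
 show ?thesis
 proof (rule that[OF nv(1) eps(1)])
  fix z assume z: "z \<in> segs L" "dist z y < eps"
  then obtain c d where cd: "(c, d) \<in> set L" "z \<in> cseg c d" by (auto simp: segs_def)
  have "z \<notin> C" using z eps by (auto simp: dist_commute)
  hence ycd: "y \<in> cseg c d" using cd unfolding C_def by fastforce
  have "cseg a b \<inter> cseg c d ~= {y}"
  proof
   assume "cseg a b \<inter> cseg c d = {y}"
   hence "cseg (fst (a,b)) (snd (a,b)) \<inter> cseg (fst (c,d)) (snd (c,d)) = {y}" by simp
   hence "y \<in> nodes L" unfolding nodes_def using ab(1) cd(1) by (intro UnI2 CollectI bexI)
   thus False using y by simp
  qed
  then obtain y' where y': "y' \<in> cseg a b" "y' \<in> cseg c d" "y' ~= y" using ab ycd by auto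
  obtain s s' where "y - a = s *\<^sub>R (b - a)" "y' - a = s' *\<^sub>R (b - a)" using segment_param[OF ab(2)] segment_param[OF y'(1)] by metis
  moreover have "y' - y = (y' - a) - (y - a)" by simp
  ultimately have "nv \<bullet> (y' - y) = 0" using nv by (simp add: inner_diff_right[of nv "s' *\<^sub>R (b - a)"])
  thus "nv \<bullet> (z - y) = 0" using inner_segment_eq_0(2)[OF ycd y'(2) _ cd(2)] y' by metis
 qed
qed

lemma convex_subset_closure_interior:
 fixes Q :: "pt set"
 assumes "convex Q" "interior Q ~= {}"
 shows "Q <= closure (interior Q)"
 using convex_closure_interior[OF assms] closure_subset by blast

lemma ring_subset_closure_interior:
 fixes Q1 Q2 :: "pt set"
 assumes Q1: "convex Q1" "interior Q1 ~= {}" and Q2: "closed Q2"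
 shows "Q1 - Q2 <= closure (interior (Q1 - Q2))"
proof
 fix x assume x: "x \<in> Q1 - Q2"
 have "interior Q1 - Q2 <= interior (Q1 - Q2)"
  using Q2 by (intro interior_maximal open_Diff) (use interior_subset in auto)
 moreover have "x \<in> closure (interior Q1 - Q2)"
 proof -
  have "x \<in> closure (interior Q1)" using convex_subset_closure_interior[OF Q1] x by auto
  hence "x \<in> (- Q2) \<inter> closure (interior Q1)" using x by auto
  also have "... <= closure ((- Q2) \<inter> interior Q1)" using Q2 by (intro open_Int_closure_subset) auto
  finally show ?thesis by (simp add: Diff_eq Int_commute)
 qed
 ultimately show "x \<in> closure (interior (Q1 - Q2))" using closure_mono by blast
qed

lemma off_line_point:
 fixes nv :: pt
 assumes "norm nv = 1" "open U" "x \<in> U"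
 obtains x' where "x' \<in> U" "nv \<bullet> (x' - y) ~= 0"
proof -
 obtain dl where d: "dl > 0" "ball x dl <= U" using assms by (meson open_contains_ball)
 have nn: "nv \<bullet> nv = 1" using assms by (simp add: norm_eq_1)
 let ?x = "x + (dl/2) *\<^sub>R nv"
 have "dist x ?x = dl/2" using assms d by (simp add: dist_norm)
 hence "?x \<in> U" using d by auto
 moreover have "nv \<bullet> (?x - y) = nv \<bullet> (x - y) + dl/2" using nn by (simp add: inner_add_right inner_diff_right)
 ultimately show ?thesis
 proof (cases "nv \<bullet> (x - y) = 0")
  case True thus ?thesis using that[of ?x] \<open>?x \<in> U\<close> \<open>nv \<bullet> (?x - y) = _\<close> d by auto
 next
  case False thus ?thesis using that[of x] assms by auto
 qed
qed

text \<open>Each open half-disc off the line lies in the ring or misses it, since it contains no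
  frontier point. Both cannot lie in the ring: a removed convex set with interior would stick out of
  the line. Both cannot miss it: the ring lies in the closure of its interior. So exactly one lies
  in the ring, and the frontier fills the line.\<close>

lemma ring_frontier_local:
 fixes Q1 Q2 :: "pt set"
 assumes Q1: "convex Q1" "closed Q1" "interior Q1 ~= {}" and Q2: "closed Q2" "convex Q2" "Q2 = {} | interior Q2 ~= {}"
  and y: "y \<in> frontier (Q1 - Q2)" and nv: "norm nv = 1" and eps: "eps > 0"
  and line: "!!z. z \<in> frontier (Q1 - Q2) ==> dist z y < eps ==> nv \<bullet> (z - y) = 0"
  and z: "dist z y < eps" "nv \<bullet> (z - y) = 0"
 shows "z \<in> frontier (Q1 - Q2)"
proof -
 let ?R = "Q1 - Q2"
 have nn: "nv \<bullet> nv = 1" using nv by (simp add: norm_eq_1)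
 define S where "S sg = {x \<in> ball y eps. (sg *\<^sub>R nv) \<bullet> (x - y) > 0}" for sg :: real
 have Sc: "connected (S sg)" for sg
 proof -
  have "S sg = ball y eps \<inter> {x. (sg *\<^sub>R nv) \<bullet> x > (sg *\<^sub>R nv) \<bullet> y}" by (auto simp: S_def inner_diff_right)
  hence "convex (S sg)" using convex_halfspace_gt[of "(sg *\<^sub>R nv) \<bullet> y" "sg *\<^sub>R nv"] by (simp add: convex_Int)
  thus ?thesis by (rule convex_connected)
 qed
 have dich: "S sg <= ?R | S sg \<inter> ?R = {}" for sg
 proof (rule ccontr)
  assume "\<not> ?thesis"
  hence "S sg \<inter> frontier ?R ~= {}" by (intro connected_Int_frontier Sc) auto
  then obtain x where "x \<in> S sg" "x \<in> frontier ?R" by auto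
  thus False using line[of x] by (auto simp: S_def dist_commute)
 qed
 have near: "\<exists>x\<in>S sg. dist x p < dl" if p: "dist p y < eps" "nv \<bullet> (p - y) = 0" and d: "dl > 0" and s: "sg = 1 | sg = -1" for p dl sg
 proof -
  define t where "t = min (dl/2) ((eps - dist p y)/2)"
  have t: "t > 0" "t < dl" "t < eps - dist p y" using p d by (auto simp: t_def min_def)
  let ?x = "p + (sg * t) *\<^sub>R nv"
  have dp: "dist ?x p = t" using nv s t by (auto simp: dist_norm)
  have "dist ?x y < eps" using dist_triangle[of ?x y p] dp t by linarith
  moreover have "nv \<bullet> (?x - y) = sg * t"
  proof -
   have "?x - y = (p - y) + (sg * t) *\<^sub>R nv" by simp
   thus ?thesis using p nn by (simp only: inner_add_right inner_scaleR_right)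
  qed
  ultimately have "?x \<in> S sg" using s t by (auto simp: S_def dist_commute)
  thus ?thesis by (rule bexI[rotated]) (use dp t in simp)
 qed
 have off: "x \<in> S 1 | x \<in> S (-1)" if "dist x y < eps" "nv \<bullet> (x - y) ~= 0" for x
  using that by (auto simp: S_def dist_commute)
 have y0: "dist y y < eps" "nv \<bullet> (y - y) = 0" using eps by auto
 have notboth: "\<not> (S 1 <= ?R & S (-1) <= ?R)"
 proof
  assume both: "S 1 <= ?R & S (-1) <= ?R"
  have bQ1: "ball y eps <= Q1"
  proof
   fix p assume p: "p \<in> ball y eps"
   show "p \<in> Q1"
   proof (cases "nv \<bullet> (p - y) = 0")
    case True
    have "p \<in> closure Q1" unfolding closure_approachable
    proof (intro allI impI)
     fix e :: real assume "e > 0"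
     then obtain x where "x \<in> S 1" "dist x p < e" using near[of p e 1] p True by (auto simp: dist_commute)
     thus "\<exists>x\<in>Q1. dist x p < e" using both by auto
    qed
    thus ?thesis using Q1 by simp
   next
    case False
    thus ?thesis using off[of p] p both by (auto simp: dist_commute)
   qed
  qed
  show False
  proof (cases "Q2 \<inter> ball y eps = {}")
   case True
   hence "ball y eps <= ?R" using bQ1 by auto
   hence "y \<in> interior ?R" using eps by (meson centre_in_ball interiorI open_ball)
   thus False using y by (simp add: frontier_def)
  next
   case False
   then obtain q where q: "q \<in> Q2" "dist q y < eps" by (auto simp: dist_commute)
   hence "q \<notin> ?R" by simp
   hence q0: "nv \<bullet> (q - y) = 0" using off[of q] q both by auto
   have "interior Q2 ~= {}" using q Q2 by auto
   then obtain w0 where "w0 \<in> interior Q2" by auto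
   then obtain w where w: "w \<in> interior Q2" "nv \<bullet> (w - y) ~= 0" using off_line_point[OF nv open_interior] by metis
   hence wQ: "w \<in> Q2" using interior_subset by auto
   \<comment> \<open>Moving from q slightly towards the interior point w stays in Q2 by convexity,
     remains in the ball and leaves the line.\<close>
   define t where "t = min 1 ((eps - dist q y) / (2 * (norm (w - q) + 1)))"
   have np: "norm (w - q) + 1 > 0" by (simp add: add_nonneg_pos)
   have t: "t > 0" "t <= 1" using q np by (auto simp: t_def)
   let ?x = "(1 - t) *\<^sub>R q + t *\<^sub>R w"
   have xq: "?x - q = t *\<^sub>R (w - q)" by (simp add: algebra_simps)
   have "?x \<in> Q2" using Q2 q wQ t by (intro convexD) auto
   moreover have "dist ?x y < eps"
   proof -
    have "dist ?x q = t * norm (w - q)" unfolding dist_norm xq using t by simp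
    also have "... <= ((eps - dist q y) / (2 * (norm (w - q) + 1))) * (norm (w - q) + 1)"
     using q np by (intro mult_mono) (auto simp: t_def)
    also have "... = (eps - dist q y) / 2" using np by (simp add: field_simps)
    finally have "dist ?x q <= (eps - dist q y) / 2" .
    moreover have "dist ?x y <= dist ?x q + dist q y" by (rule dist_triangle)
    moreover have "(eps - dist q y) / 2 + dist q y < eps" using q(2) by (simp add: field_simps)
    ultimately show ?thesis by linarith
   qed
   moreover have "nv \<bullet> (?x - y) ~= 0"
   proof -
    have "?x - y = (q - y) + t *\<^sub>R ((w - y) - (q - y))" using xq by (simp add: algebra_simps)
    hence "nv \<bullet> (?x - y) = t * (nv \<bullet> (w - y))" using q0 by (simp only: inner_add_right inner_scaleR_right inner_diff_right[of nv "w - y"]) simp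
    thus ?thesis using w t by simp
   qed
   ultimately show False using off[of ?x] both by auto
  qed
 qed
 have notnone: "\<not> (S 1 \<inter> ?R = {} & S (-1) \<inter> ?R = {})"
 proof
  assume none: "S 1 \<inter> ?R = {} & S (-1) \<inter> ?R = {}"
  have "y \<in> closure (interior ?R)"
   using y ring_subset_closure_interior[OF Q1(1,3) Q2(1)] closure_mono[of ?R "closure (interior ?R)"]
   by (auto simp: frontier_def)
  then obtain x where x: "x \<in> interior ?R" "dist x y < eps" using eps by (auto simp: closure_approachable)
  have "open (interior ?R \<inter> ball y eps)" "x \<in> interior ?R \<inter> ball y eps" using x by (auto simp: dist_commute)
  from off_line_point[OF nv this] obtain x' where x': "x' \<in> interior ?R \<inter> ball y eps" "nv \<bullet> (x' - y) ~= 0" by metis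
  hence "x' \<in> ?R" using interior_subset by auto
  thus False using off[of x'] x' none by (auto simp: dist_commute)
 qed
 have "\<exists>sg. (sg = 1 | sg = -1) & S sg <= ?R & S (- sg) \<inter> ?R = {}"
 proof (cases "S 1 <= ?R")
  case True
  hence "S (-1) \<inter> ?R = {}" using dich[of "-1"] notboth by blast
  thus ?thesis using True by (intro exI[of _ 1] conjI) simp_all
 next
  case False
  hence "S 1 \<inter> ?R = {}" using dich[of 1] by blast
  moreover from this have "S (-1) <= ?R" using dich[of "-1"] notnone by blast
  ultimately show ?thesis by (intro exI[of _ "-1"] conjI) simp_all
 qed
 then obtain sg where sg: "sg = 1 | sg = -1" "S sg <= ?R" "S (- sg) \<inter> ?R = {}" by blast
 have "z \<in> closure ?R" unfolding closure_approachable
 proof (intro allI impI)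
  fix e :: real assume "e > 0"
  from near[OF z this sg(1)] show "\<exists>x\<in>?R. dist x z < e" using sg by auto
 qed
 moreover have "z \<notin> interior ?R"
 proof
  assume "z \<in> interior ?R"
  then obtain e where e: "e > 0" "ball z e <= ?R" by (meson mem_interior)
  have "- sg = 1 | - sg = -1" using sg by auto
  from near[OF z e(1) this] obtain x where x: "x \<in> S (- sg)" "dist x z < e" by auto
  hence "x \<in> ball z e" by (simp add: dist_commute)
  thus False using e(2) x(1) sg(3) by blast
 qed
 ultimately show ?thesis by (simp add: frontier_def)
qed

section \<open>Edges as maximal segments of the frontier\<close>

definition locally_line :: "pt set => pt set => bool" where
 "locally_line F Z \<longleftrightarrow> (\<forall>y\<in>F - Z. \<exists>nv eps. norm nv = 1 & eps > 0 & (\<forall>z. dist z y < eps --> (z \<in> F \<longleftrightarrow> nv \<bullet> (z - y) = 0)))"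

lemma segmentI: "0 <= s ==> s <= 1 ==> a + s *\<^sub>R (b - a) \<in> cseg a (b::pt)"
 unfolding in_segment by (intro exI[of _ s]) (simp add: algebra_simps)

lemma locally_lineD:
 assumes "locally_line F Z" "y \<in> F" "y \<notin> Z"
 obtains nv eps where "norm nv = 1" "eps > 0" "!!z. dist z y < eps ==> z \<in> F \<longleftrightarrow> nv \<bullet> (z - y) = 0"
proof -
 have "y \<in> F - Z" using assms by simp
 from bspec[OF assms(1)[unfolded locally_line_def] this] show ?thesis
  by (elim exE conjE) (rule that, assumption+, blast)
qed

text \<open>Otherwise the frontier is a line near a, and the edge could be prolonged beyond a,
  contrary to maximality.\<close>

lemma edge_endpoint:
 assumes loc: "locally_line F Z" and E: "cseg a b \<in> edges F"
 shows "a \<in> Z"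
proof (rule ccontr)
 assume aZ: "a \<notin> Z"
 obtain a' b' where E0: "cseg a b = cseg a' b'" "a' ~= b'" "cseg a' b' <= F"
  "\<forall>c d. cseg a' b' <= cseg c d & cseg c d <= F --> cseg c d = cseg a' b'"
  using E unfolding edges_def mem_Collect_eq by (elim exE conjE) (rule that)
 have E': "cseg a b = cseg a' b'" "a' ~= b'" "cseg a b <= F"
  using E0(1,2) E0(3)[folded E0(1)] by blast+
 have max: "cseg c d = cseg a b" if "cseg a b <= cseg c d" "cseg c d <= F" for c d
  using E0(4)[folded E0(1)] that by blast
 have ab: "a ~= b"
  using E0(1,2) unfolding closed_segment_eq by (auto simp: doubleton_eq_iff)
 have "a \<in> F" by (rule subsetD[OF E'(3)]) simp
 then obtain nv eps where nv: "norm nv = 1" "eps > 0" "!!z. dist z a < eps ==> z \<in> F \<longleftrightarrow> nv \<bullet> (z - a) = 0"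
  using locally_lineD[OF loc _ aZ] by metis
 define s where "s = min 1 (eps / (2 * norm (b - a)))"
 have s: "s > 0" "s <= 1" using nv ab by (auto simp: s_def)
 have sn: "s * norm (b - a) < eps"
 proof -
  have "s * norm (b - a) <= eps / (2 * norm (b - a)) * norm (b - a)" unfolding s_def by (intro mult_right_mono) auto
  also have "... = eps / 2" using ab by simp
  finally show ?thesis using nv by simp
 qed
 have sm: "dist (a + t *\<^sub>R (b - a)) a < eps" if "abs(t) <= s" for t
 proof -
  have "abs(t) * norm (b - a) <= s * norm (b - a)" using that by (intro mult_right_mono) auto
  thus ?thesis using sn by (simp add: dist_norm)
 qed
 have "a + s *\<^sub>R (b - a) \<in> cseg a b" using s by (intro segmentI) auto
 hence "a + s *\<^sub>R (b - a) \<in> F" by (rule subsetD[OF E'(3)])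
 moreover have "dist (a + s *\<^sub>R (b - a)) a < eps" by (rule sm) (use s in linarith)
 ultimately have "nv \<bullet> (a + s *\<^sub>R (b - a) - a) = 0" using nv(3) by blast
 hence "s * (nv \<bullet> (b - a)) = 0" by (simp only: add_diff_cancel_left' inner_scaleR_right)
 hence nba: "nv \<bullet> (b - a) = 0" using s(1) by (metis less_irrefl mult_eq_0_iff)
 define c where "c = a - s *\<^sub>R (b - a)"
 have sub: "cseg c b <= F"
 proof
  fix z assume "z \<in> cseg c b"
  then obtain u where u: "0 <= u" "u <= 1" "z - c = u *\<^sub>R (b - c)" by (rule segment_param)
  define t where "t = u * (1 + s) - s"
  have z: "z = a + t *\<^sub>R (b - a)"
  proof -
   have bc: "b - c = (1 + s) *\<^sub>R (b - a)" unfolding c_def by (simp add: algebra_simps)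
   have "z - c = (u * (1 + s)) *\<^sub>R (b - a)" unfolding u(3) bc by simp
   hence "z = c + (u * (1 + s)) *\<^sub>R (b - a)" by (simp only: diff_eq_eq add.commute)
   thus ?thesis by (simp add: c_def t_def scaleR_diff_left)
  qed
  have tl: "t <= 1"
  proof -
   have "u * (1 + s) <= 1 * (1 + s)" using u s by (intro mult_right_mono) auto
   thus ?thesis by (simp add: t_def)
  qed
  have tg: "t >= - s" using u s by (simp add: t_def)
  show "z \<in> F"
  proof (cases "t >= 0")
   case True
   hence "z \<in> cseg a b" unfolding z using tl True by (intro segmentI)
   thus ?thesis by (rule subsetD[OF E'(3)])
  next
   case False
   hence "abs(t) <= s" using tg by simp
   hence "dist z a < eps" unfolding z by (rule sm)
   moreover have "nv \<bullet> (z - a) = 0" unfolding z by (simp only: add_diff_cancel_left' inner_scaleR_right nba mult_zero_right)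
   ultimately show ?thesis using nv(3) by blast
  qed
 qed
 have acb: "a \<in> cseg c b"
 proof -
  have "a = (1 - s / (1 + s)) *\<^sub>R c + (s / (1 + s)) *\<^sub>R b"
  proof -
   have "(1 + s) *\<^sub>R ((1 - s / (1 + s)) *\<^sub>R c + (s / (1 + s)) *\<^sub>R b) = c + s *\<^sub>R b"
    using s by (simp add: scaleR_add_right right_diff_distrib)
   also have "... = (1 + s) *\<^sub>R a" unfolding c_def by (simp add: algebra_simps)
   finally show ?thesis using s by simp
  qed
  thus ?thesis using s by (auto simp: in_segment intro!: exI[of _ "s / (1 + s)"])
 qed
 hence "cseg a b <= cseg c b" by (simp add: subset_closed_segment)
 from max[OF this sub] have "c = a" using ab unfolding closed_segment_eq by (auto simp: doubleton_eq_iff)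
 thus False using s ab by (simp add: c_def)
qed

text \<open>On the line through y the parameters of points of F form a compact set. The component of
  0 is an interval and gives the edge; it is maximal because a longer segment in F would give a
  larger connected set of parameters.\<close>

lemma edge_exists:
 assumes F: "compact F" and loc: "locally_line F Z" and y: "y \<in> F" "y \<notin> Z"
 shows "\<exists>E\<in>edges F. y \<in> E"
proof -
 obtain nv eps where nv: "norm nv = 1" "eps > 0" "!!z. dist z y < eps ==> z \<in> F \<longleftrightarrow> nv \<bullet> (z - y) = 0"
  using locally_lineD[OF loc y] by metis
 obtain e where e: "norm e = 1" "e \<bullet> nv = 0" using exists_perp by blast
 have ee: "e \<bullet> e = 1" using e by (simp add: norm_eq_1)
 define T where "T = (%s. y + s *\<^sub>R e) -` F"
 have "closed T" unfolding T_def using F by (intro continuous_closed_vimage) (auto simp: compact_imp_closed intro!: continuous_intros)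
 moreover have "bounded T"
 proof -
  obtain B where B: "!!x. x \<in> F ==> norm x <= B" using compact_imp_bounded[OF F] by (auto simp: bounded_iff)
  have "norm s <= B + norm y" if "s \<in> T" for s
  proof -
   have "norm (s *\<^sub>R e) <= norm (y + s *\<^sub>R e) + norm y" using norm_triangle_ineq4[of "y + s *\<^sub>R e" y] by simp
   thus ?thesis using B[of "y + s *\<^sub>R e"] that e by (simp add: T_def)
  qed
  thus ?thesis unfolding bounded_iff by blast
 qed
 ultimately have cT: "compact T" by (simp add: compact_eq_bounded_closed)
 define C where "C = connected_component_set T 0"
 have near: "{-eps/2..eps/2} <= T"
 proof
  fix s assume "s \<in> {-eps/2..eps/2}"
  hence "dist (y + s *\<^sub>R e) y < eps" using e nv by (auto simp: dist_norm abs_le_iff)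
  thus "s \<in> T" using nv(3) e by (simp add: T_def inner_commute)
 qed
 hence T0: "0 \<in> T" using nv by auto
 have "C \<in> components T" unfolding C_def using T0 by (rule componentsI)
 hence "compact C" using compact_components[OF cT] by blast
 moreover have "connected C" by (simp add: C_def)
 ultimately obtain l u where C: "C = {l..u}" using connected_compact_interval_1 by blast
 have maxC: "S <= C" if "connected S" "0 \<in> S" "S <= T" for S
  unfolding C_def using that by (simp add: connected_component_maximal)
 have "{-eps/2..eps/2} <= C" using near nv by (intro maxC) auto
 hence lu: "l <= -eps/2" "u >= eps/2" unfolding C using nv by auto
 have CT: "C <= T" by (simp add: C_def connected_component_subset)
 define a b where "a = y + l *\<^sub>R e" and "b = y + u *\<^sub>R e"
 have inE: "y + s *\<^sub>R e \<in> cseg a b \<longleftrightarrow> s \<in> {l..u}" for s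
 proof
  assume "y + s *\<^sub>R e \<in> cseg a b"
  then obtain t where t: "0 <= t" "t <= 1" "y + s *\<^sub>R e - a = t *\<^sub>R (b - a)" by (rule segment_param)
  have "e \<bullet> (y + s *\<^sub>R e - a) = s - l" unfolding a_def using ee by (simp add: inner_add_right inner_diff_right)
  moreover have "e \<bullet> (b - a) = u - l" unfolding a_def b_def using ee by (simp add: inner_add_right inner_diff_right)
  ultimately have "s - l = t * (u - l)" using t by simp
  moreover have "0 <= t * (u - l)" "t * (u - l) <= 1 * (u - l)" using t lu nv by (auto intro!: mult_right_mono mult_nonneg_nonneg)
  ultimately show "s \<in> {l..u}" by auto
 next
  assume s: "s \<in> {l..u}"
  define t where "t = (s - l) / (u - l)"
  have ul: "u - l > 0" using lu nv by linarith
  have t: "0 <= t" "t <= 1" using s ul by (auto simp: t_def)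
  have st: "l + t * (u - l) = s" using ul by (simp add: t_def)
  have "(1 - t) *\<^sub>R a + t *\<^sub>R b = y + (l + t * (u - l)) *\<^sub>R e" unfolding a_def b_def by (simp add: algebra_simps)
  hence "y + s *\<^sub>R e = (1 - t) *\<^sub>R a + t *\<^sub>R b" unfolding st by simp
  thus "y + s *\<^sub>R e \<in> cseg a b" using t by (auto simp: in_segment)
 qed
 have onl: "\<exists>s\<in>{l..u}. z = y + s *\<^sub>R e" if z: "z \<in> cseg a b" for z
 proof -
  obtain t where t: "0 <= t" "t <= 1" "z - a = t *\<^sub>R (b - a)" using z by (rule segment_param)
  hence "z = y + (l + t * (u - l)) *\<^sub>R e" unfolding a_def b_def by (simp add: algebra_simps)
  thus ?thesis using inE z by metis
 qed
 have sub: "cseg a b <= F"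
 proof
  fix z assume "z \<in> cseg a b"
  then obtain s where "s \<in> {l..u}" "z = y + s *\<^sub>R e" using onl by blast
  thus "z \<in> F" using CT C by (auto simp: T_def)
 qed
 have y_in: "y \<in> cseg a b" using inE[of 0] lu nv by simp
 have ab: "a ~= b"
 proof
  assume "a = b"
  hence "e \<bullet> (b - a) = 0" by simp
  hence "u - l = 0" unfolding a_def b_def using ee by (simp add: inner_add_right inner_diff_right)
  thus False using lu nv by linarith
 qed
 have "cseg c d = cseg a b" if cd: "cseg a b <= cseg c d" "cseg c d <= F" for c d
 proof
  show "cseg c d <= cseg a b"
  proof
   fix z assume z: "z \<in> cseg c d"
   define y' where "y' = y + (eps/2) *\<^sub>R e"
   have y': "y' \<in> cseg a b" unfolding y'_def using inE[of "eps/2"] lu nv by auto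
   have yy': "y ~= y'" "y' - y = (eps/2) *\<^sub>R e" using nv e by (auto simp: y'_def)
   have par: "\<exists>s. w = y + s *\<^sub>R e" if w: "w \<in> cseg c d" for w
   proof -
    have "nv \<bullet> (y' - y) = 0" unfolding yy'(2) using e by (simp add: inner_commute)
    hence "nv \<bullet> (w - y) = 0" using inner_segment_eq_0(2)[of y c d y' w nv] y_in y' yy' cd w by blast
    hence "w - y = (e \<bullet> (w - y)) *\<^sub>R e" using orthonormal_expand[OF e(1) nv(1) e(2), of "w - y"] by simp
    thus ?thesis by (intro exI[of _ "e \<bullet> (w - y)"]) (metis add.commute diff_add_cancel)
   qed
   define S where "S = (%w. e \<bullet> (w - y)) ` cseg c d"
   have "connected S" unfolding S_def by (intro connected_continuous_image continuous_intros) auto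
   moreover have "0 \<in> S" unfolding S_def using y_in cd by (intro image_eqI[of _ _ y]) auto
   moreover have "S <= T"
   proof
    fix s assume "s \<in> S"
    then obtain w where w: "w \<in> cseg c d" "s = e \<bullet> (w - y)" by (auto simp: S_def)
    obtain s' where s': "w = y + s' *\<^sub>R e" using par[OF w(1)] by blast
    hence "s = s'" using w(2) ee by simp
    thus "s \<in> T" using s' w cd by (auto simp: T_def)
   qed
   ultimately have SC: "S <= {l..u}" using maxC[of S] unfolding C by blast
   obtain s where s: "z = y + s *\<^sub>R e" using par[OF z] by blast
   hence "s = e \<bullet> (z - y)" using ee by simp
   hence "s \<in> S" using z by (auto simp: S_def)
   thus "z \<in> cseg a b" unfolding s using inE SC by blast
  qed
 qed (use cd in simp)
 hence "cseg a b \<in> edges F" unfolding edges_def using ab sub by blast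
 thus ?thesis using y_in by blast
qed

lemma reg_polygonD:
 assumes "reg_polygon N0 c0 Q"
 shows "compact Q" "convex Q" "closed Q" "interior Q ~= {}"
  "\<exists>x r. r > 0 & cball x r <= Q & (\<forall>a\<in>Q. dist x a <= 2 * c0 * r)"
  "\<exists>L. length L <= N0 & frontier Q = segs L"
proof -
 show 1: "compact Q" "convex Q" using assms by (auto simp: reg_polygon_def regular_set_def)
 thus "closed Q" by (simp add: compact_imp_closed)
 obtain x1 x2 r1 r2 where r: "r2 > 0" "cball x2 r2 <= Q" "Q <= cball x1 r1" "r1 <= c0 * r2"
  using assms by (auto simp: reg_polygon_def regular_set_def)
 have "ball x2 r2 <= interior Q" using r by (intro interior_maximal) auto
 thus "interior Q ~= {}" using r by auto
 have "dist x2 a <= 2 * c0 * r2" if "a \<in> Q" for a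
 proof -
  have "x2 \<in> Q" using r by auto
  hence "dist x1 x2 <= r1" "dist x1 a <= r1" using r that by auto
  thus ?thesis using dist_triangle3[of x2 a x1] r by linarith
 qed
 thus "\<exists>x r. r > 0 & cball x r <= Q & (\<forall>a\<in>Q. dist x a <= 2 * c0 * r)" using r by blast
 show "\<exists>L. length L <= N0 & frontier Q = segs L" using assms by (auto simp: reg_polygon_def polygon_boundary_def segs_def)
qed

section \<open>Rings and their exteriors as sets with half-discs along edges\<close>

lemma ring_locally_line:
 assumes Q1: "convex Q1" "closed Q1" "interior Q1 ~= {}" and Q2: "closed Q2" "convex Q2" "Q2 = {} | interior Q2 ~= {}"
  and F: "frontier (Q1 - Q2) <= segs L"
 shows "locally_line (frontier (Q1 - Q2)) (nodes L)"
 unfolding locally_line_def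
proof
 fix y assume y: "y \<in> frontier (Q1 - Q2) - nodes L"
 hence "y \<in> segs L" "y \<notin> nodes L" using F by auto
 then obtain nv eps where nv: "norm nv = 1" "eps > 0" "!!z. z \<in> segs L ==> dist z y < eps ==> nv \<bullet> (z - y) = 0"
  using segs_local_line by blast
 have line: "!!z. z \<in> frontier (Q1 - Q2) ==> dist z y < eps ==> nv \<bullet> (z - y) = 0" using nv(3) F by blast
 have "z \<in> frontier (Q1 - Q2) \<longleftrightarrow> nv \<bullet> (z - y) = 0" if "dist z y < eps" for z
  using ring_frontier_local[OF Q1 Q2 _ nv(1,2) line that] line[of z] y that by blast
 thus "\<exists>nv eps. norm nv = 1 & eps > 0 & (\<forall>z. dist z y < eps --> (z \<in> frontier (Q1 - Q2)) = (nv \<bullet> (z - y) = 0))"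
  using nv by blast
qed

lemma ring_shape:
 assumes "is_ring N0 c0 \<beta> R"
 obtains Q1 Q2 L1 L2 where "R = Q1 - Q2" "reg_polygon N0 c0 Q1" "Q2 = {} | reg_polygon N0 c0 Q2"
  "frontier Q1 = segs L1" "frontier Q2 = segs L2" "length L1 <= N0" "length L2 <= N0"
  "\<forall>E\<in>edges (frontier R). \<exists>a b m. E = cseg a b &
      (has_beta_triangle \<beta> (closure R) a b |
       (m \<in> open_segment a b & has_beta_triangle \<beta> (closure R) a m & has_beta_triangle \<beta> (closure R) m b))"
proof -
 obtain Q1 Q2 where Q: "R = Q1 - Q2" "reg_polygon N0 c0 Q1" "Q2 = {} | reg_polygon N0 c0 Q2"
  "\<forall>E\<in>edges (frontier R). \<exists>a b m. E = cseg a b &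
      (has_beta_triangle \<beta> (closure R) a b |
       (m \<in> open_segment a b & has_beta_triangle \<beta> (closure R) a m & has_beta_triangle \<beta> (closure R) m b))"
  using assms unfolding is_ring_def by blast
 obtain L1 where L1: "length L1 <= N0" "frontier Q1 = segs L1" using reg_polygonD(6)[OF Q(2)] by blast
 obtain L2 where L2: "length L2 <= N0" "frontier Q2 = segs L2"
 proof (cases "Q2 = {}")
  case True
  hence "frontier Q2 = segs []" by (simp add: segs_def)
  thus ?thesis using that[of "[]"] by simp
 next
  case False
  thus ?thesis using that reg_polygonD(6)[of N0 c0 Q2] Q(3) by blast
 qed
 show ?thesis by (rule that[OF Q(1-3) L1(2) L2(2) L1(1) L2(1) Q(4)])
qed

lemma frontier_Diff_subset:
 fixes A B :: "pt set"
 shows "frontier (A - B) <= frontier A \<union> frontier B"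
 using frontier_Int_subset[of A "- B"] by (simp add: Diff_eq frontier_complement)

lemma segs_append: "segs (L1 @ L2) = segs L1 \<union> segs L2"
 by (auto simp: segs_def)

text \<open>The two boundaries together have at most \<open>4 * N0 + 4 * N0\<^sup>2\<close> nodes.
  Each node may give a degenerate pair, and each pair of nodes one edge, split into at most two
  pieces.\<close>

definition ring_const :: "nat => nat" where
 "ring_const N0 = (4 * N0 + 4 * N0\<^sup>2) + 2 * (4 * N0 + 4 * N0\<^sup>2)\<^sup>2"

text \<open>Endpoints of edges are nodes, so the number of edges is bounded in terms of N0 alone.
  The half-discs come from the beta-triangles over the one or two pieces of each edge.\<close>

lemma ring_skel:
 assumes R: "is_ring N0 c0 \<beta> R" and \<beta>: "0 < \<beta>" "\<beta> <= pi / 3"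
 shows "\<exists>E. skel (sin \<beta>) E R & card E <= ring_const N0"
proof -
 obtain Q1 Q2 L1 L2 where Q: "R = Q1 - Q2" "reg_polygon N0 c0 Q1" "Q2 = {} | reg_polygon N0 c0 Q2"
  and L: "frontier Q1 = segs L1" "frontier Q2 = segs L2" "length L1 <= N0" "length L2 <= N0"
  and tri: "\<forall>E\<in>edges (frontier R). \<exists>a b m. E = cseg a b &
      (has_beta_triangle \<beta> (closure R) a b |
       (m \<in> open_segment a b & has_beta_triangle \<beta> (closure R) a m & has_beta_triangle \<beta> (closure R) m b))"
  using R by (rule ring_shape)
 note q1 = reg_polygonD[OF Q(2)]
 have q2: "closed Q2" "convex Q2" "Q2 = {} | interior Q2 ~= {}" using Q(3) reg_polygonD by auto
 define Lx where "Lx = L1 @ L2"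
 define F where "F = frontier R"
 define Z where "Z = nodes Lx"
 have FL: "F <= segs Lx" unfolding F_def Q(1) Lx_def segs_append using frontier_Diff_subset[of Q1 Q2] L by simp
 have loc: "locally_line F Z"
  using ring_locally_line[OF q1(2,3,4) q2] FL unfolding F_def Q(1) Z_def by blast
 have cF: "compact F" unfolding F_def Q(1)
  using compact_imp_bounded[OF q1(1)] by (intro compact_frontier_bounded) (auto intro: bounded_subset)
 have fZ: "finite Z" and cZ: "card Z <= 4 * N0 + 4 * N0\<^sup>2"
 proof -
  show "finite Z" unfolding Z_def by (rule nodes_card)
  have l: "length Lx <= 2 * N0" using L by (simp add: Lx_def)
  have "card Z <= 2 * length Lx + (length Lx)\<^sup>2" unfolding Z_def by (rule nodes_card)
  also have "... <= 2 * (2 * N0) + (2 * N0)\<^sup>2" using l by (intro add_mono mult_le_mono2 power_mono) auto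
  finally show "card Z <= 4 * N0 + 4 * N0\<^sup>2" by (simp add: power_mult_distrib)
 qed
 have "\<forall>E\<in>edges F. \<exists>P. finite P & card P <= 2 & (\<Union>(a,b)\<in>P. cseg a b) = E & (\<forall>(a,b)\<in>P. has_beta_triangle \<beta> (closure R) a b) &
   E \<in> (%(a,b). cseg a b) ` (Z \<times> Z)"
 proof
  fix E assume E: "E \<in> edges F"
  then obtain a b m where ab: "E = cseg a b" and
   t: "has_beta_triangle \<beta> (closure R) a b | (m \<in> open_segment a b & has_beta_triangle \<beta> (closure R) a m & has_beta_triangle \<beta> (closure R) m b)"
   using tri unfolding F_def by blast
  have "a \<in> Z" using edge_endpoint[OF loc] E ab by blast
  moreover have "b \<in> Z" using edge_endpoint[OF loc, of b a] E ab by (simp add: closed_segment_commute)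
  ultimately have EZ: "E \<in> (%(a,b). cseg a b) ` (Z \<times> Z)" unfolding ab by (intro image_eqI[of _ _ "(a,b)"]) auto
  from t show "\<exists>P. finite P & card P <= 2 & (\<Union>(a,b)\<in>P. cseg a b) = E & (\<forall>(a,b)\<in>P. has_beta_triangle \<beta> (closure R) a b) &
   E \<in> (%(a,b). cseg a b) ` (Z \<times> Z)"
  proof
   assume "has_beta_triangle \<beta> (closure R) a b"
   thus ?thesis using EZ ab by (intro exI[of _ "{(a,b)}"]) auto
  next
   assume t: "m \<in> open_segment a b & has_beta_triangle \<beta> (closure R) a m & has_beta_triangle \<beta> (closure R) m b"
   hence "m \<in> cseg a b" using open_closed_segment by auto
   hence "cseg a m \<union> cseg m b = cseg a b" by (rule Un_closed_segment)
   thus ?thesis using EZ ab t by (intro exI[of _ "{(a,m),(m,b)}"]) (auto simp: card_insert_if)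
  qed
 qed
 from bchoice[OF this] obtain P where PP: "\<forall>E\<in>edges F. finite (P E) & card (P E) <= 2 & (\<Union>(a,b)\<in>P E. cseg a b) = E & (\<forall>(a,b)\<in>P E. has_beta_triangle \<beta> (closure R) a b) &
   E \<in> (%(a,b). cseg a b) ` (Z \<times> Z)" ..
 have P: "finite (P E)" "card (P E) <= 2" "(\<Union>(a,b)\<in>P E. cseg a b) = E" if "E \<in> edges F" for E
  using bspec[OF PP that] by simp_all
 have P4: "has_beta_triangle \<beta> (closure R) a b" if "E \<in> edges F" "(a, b) \<in> P E" for E a b
  using bspec[OF PP that(1)] that(2) by auto
 have P5: "edges F <= (%(a,b). cseg a b) ` (Z \<times> Z)"
  using PP by (intro subsetI) simp
 have fE: "finite (edges F)" by (rule finite_subset[OF P5]) (use fZ in simp)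
 have cE: "card (edges F) <= (card Z)\<^sup>2"
 proof -
  have "card (edges F) <= card ((%(a,b). cseg a b) ` (Z \<times> Z))" using P5 fZ by (intro card_mono) auto
  also have "... <= card (Z \<times> Z)" using fZ by (intro card_image_le) auto
  finally show ?thesis by (simp add: card_cartesian_product power2_eq_square)
 qed
 \<comment> \<open>Edges are only known to cover the frontier away from the nodes; the nodes
   themselves are covered by degenerate pairs.\<close>
 define D where "D = (%z. (z, z)) ` (Z \<inter> F)"
 define E where "E = D \<union> (\<Union>e\<in>edges F. P e)"
 have finE: "finite E" unfolding E_def D_def using fZ fE P(1) by auto
 have "card E <= card D + card (\<Union>e\<in>edges F. P e)" unfolding E_def by (rule card_Un_le)
 also have "card D <= card Z" unfolding D_def using fZ by (meson card_image_le card_mono finite_Int inf_le1 order_trans)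
 also have "card (\<Union>e\<in>edges F. P e) <= (\<Sum>e\<in>edges F. card (P e))" using fE by (rule card_UN_le)
 also have "... <= (\<Sum>e\<in>edges F. 2)" using P(2) by (intro sum_mono) auto
 also have "... <= 2 * (card Z)\<^sup>2" using cE by simp
 also have "card Z + 2 * (card Z)\<^sup>2 <= ring_const N0"
  unfolding ring_const_def using cZ by (intro add_mono mult_le_mono2 power_mono) auto
 finally have card: "card E <= ring_const N0" by simp
 have cover: "F <= (\<Union>(a,b)\<in>E. cseg a b)"
 proof
  fix y assume y: "y \<in> F"
  show "y \<in> (\<Union>(a,b)\<in>E. cseg a b)"
  proof (cases "y \<in> Z")
   case True
   hence "(y, y) \<in> E" unfolding E_def D_def using y by auto
   thus ?thesis by force
  next
   case False
   from edge_exists[OF cF loc y this] obtain e where e: "e \<in> edges F" "y \<in> e" by blast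
   hence "y \<in> (\<Union>(a,b)\<in>P e. cseg a b)" using P(3)[OF e(1)] by simp
   thus ?thesis unfolding E_def using e(1) by blast
  qed
 qed
 have half: "\<exists>nv. norm nv = 1 & nv \<bullet> (b - a) = 0 & (\<forall>y\<in>cseg a b. halfdisc y nv (sin \<beta> * min (dist y a) (dist y b)) <= closure R)"
  if ab: "(a, b) \<in> E" for a b
 proof (cases "(a, b) \<in> D")
  case True
  hence "a = b" "a \<in> F" by (auto simp: D_def)
  moreover have "F <= closure R" by (simp add: F_def frontier_def)
  moreover obtain nv :: pt where "norm nv = 1" using vector_choose_size zero_le_one by blast
  ultimately show ?thesis by (intro exI[of _ nv]) (auto simp: halfdisc_def)
 next
  case False
  then obtain e where "e \<in> edges F" "(a, b) \<in> P e" using ab by (auto simp: E_def)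
  hence "has_beta_triangle \<beta> (closure R) a b" by (rule P4)
  thus ?thesis by (rule beta_triangle_halfdisc[OF _ \<beta>])
 qed
 have "skel (sin \<beta>) E R" unfolding skel_def
  using finE cover half ring_subset_closure_interior[OF q1(2) q1(4) q2(1)] unfolding F_def Q(1) by blast
 thus ?thesis using card by blast
qed

lemma halfdisc_mono: "rho <= rho' ==> halfdisc y nv rho <= halfdisc y nv rho'"
 by (auto simp: halfdisc_def)

lemma skelD:
 assumes "skel kp E R"
 shows "finite E" "R <= closure (interior R)" "frontier R <= (\<Union>(a,b)\<in>E. cseg a b)"
  "!!a b. (a, b) \<in> E ==> \<exists>nv. norm nv = 1 & nv \<bullet> (b - a) = 0 &
    (\<forall>y\<in>cseg a b. halfdisc y nv (kp * min (dist y a) (dist y b)) <= closure R)"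
proof -
 note * = assms[unfolded skel_def]
 show "finite E" using * by (rule conjunct1)
 show "R <= closure (interior R)" using * by (elim conjE)
 show "frontier R <= (\<Union>(a,b)\<in>E. cseg a b)" using * by (elim conjE)
 have "\<forall>(a,b)\<in>E. \<exists>nv. norm nv = 1 & nv \<bullet> (b - a) = 0 &
    (\<forall>y\<in>cseg a b. halfdisc y nv (kp * min (dist y a) (dist y b)) <= closure R)" using * by (elim conjE)
 thus "!!a b. (a, b) \<in> E ==> \<exists>nv. norm nv = 1 & nv \<bullet> (b - a) = 0 &
    (\<forall>y\<in>cseg a b. halfdisc y nv (kp * min (dist y a) (dist y b)) <= closure R)"
  using bspec by fastforce
qed

lemma skelI:
 assumes "finite E" "R <= closure (interior R)" "frontier R <= (\<Union>(a,b)\<in>E. cseg a b)"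
  "!!a b. (a, b) \<in> E ==> \<exists>nv. norm nv = 1 & nv \<bullet> (b - a) = 0 &
    (\<forall>y\<in>cseg a b. halfdisc y nv (kp * min (dist y a) (dist y b)) <= closure R)"
 shows "skel kp E R"
 unfolding skel_def by (intro conjI ballI assms(1-3), clarify) (rule assms(4))

lemma skel_mono:
 assumes s: "skel kp E R" and k: "kp' <= kp"
 shows "skel kp' E R"
proof -
 have "\<exists>nv. norm nv = 1 & nv \<bullet> (b - a) = 0 & (\<forall>y\<in>cseg a b. halfdisc y nv (kp' * min (dist y a) (dist y b)) <= closure R)"
  if "(a, b) \<in> E" for a b
 proof -
  obtain nv where nv: "norm nv = 1" "nv \<bullet> (b - a) = 0" "\<forall>y\<in>cseg a b. halfdisc y nv (kp * min (dist y a) (dist y b)) <= closure R"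
   using skelD(4)[OF s \<open>(a, b) \<in> E\<close>] by (elim exE conjE)
  have "halfdisc y nv (kp' * min (dist y a) (dist y b)) <= closure R" if y: "y \<in> cseg a b" for y
  proof -
   have m: "kp' * min (dist y a) (dist y b) <= kp * min (dist y a) (dist y b)" using k by (intro mult_right_mono) auto
   show ?thesis using halfdisc_mono[OF m] bspec[OF nv(3) y] by (rule subset_trans)
  qed
  thus ?thesis using nv(1,2) by (intro exI[of _ nv] conjI ballI)
 qed
 thus ?thesis using skelD(1-3)[OF s] by (intro skelI)
qed

lemma halfplane_halfdisc:
 fixes nv :: pt
 assumes "norm nv = 1" "!!z. nv \<bullet> (z - y) > 0 ==> z \<in> X"
 shows "halfdisc y nv rho <= closure X"
proof
 fix z assume "z \<in> halfdisc y nv rho"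
 hence z: "nv \<bullet> (z - y) >= 0" by (simp add: halfdisc_def)
 have nn: "nv \<bullet> nv = 1" using assms by (simp add: norm_eq_1)
 show "z \<in> closure X" unfolding closure_approachable
 proof (intro allI impI)
  fix e :: real assume e: "e > 0"
  let ?x = "z + (e/2) *\<^sub>R nv"
  have "?x - y = (z - y) + (e/2) *\<^sub>R nv" by simp
  hence "nv \<bullet> (?x - y) = nv \<bullet> (z - y) + e/2" using nn by (simp only: inner_add_right inner_scaleR_right mult_1_right)
  hence "?x \<in> X" using z e assms(2)[of ?x] by simp
  moreover have "dist ?x z < e" using assms e by (simp add: dist_norm)
  ultimately show "\<exists>x\<in>X. dist x z < e" by (rule bexI[rotated])
 qed
qed

text \<open>A supporting line at the midpoint contains both endpoints, because the linear form
  attains its minimum over Q at the mean of two points of Q.\<close>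

lemma supporting_normal:
 fixes Q :: "pt set"
 assumes Q: "convex Q" "closed Q" and seg: "cseg a b <= frontier Q" and ne: "interior Q ~= {}"
 shows "\<exists>nv. norm nv = 1 & nv \<bullet> (b - a) = 0 & (\<forall>z\<in>Q. nv \<bullet> a <= nv \<bullet> z)"
proof -
 define y where "y = midpoint a b"
 have "y \<in> cseg a b" by (simp add: y_def)
 hence y: "y \<in> frontier Q" using seg by blast
 hence yQ: "y \<in> Q" "y \<notin> rel_interior Q" using ne Q by (auto simp: frontier_def rel_interior_nonempty_interior)
 obtain w where w: "w ~= 0" "!!z. z \<in> Q ==> w \<bullet> y <= w \<bullet> z"
  by (rule supporting_hyperplane_rel_boundary[OF Q(1) yQ]) (rule that)
 have "a \<in> frontier Q" "b \<in> frontier Q" by (rule subsetD[OF seg], simp)+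
 hence ab: "a \<in> Q" "b \<in> Q" using Q by (auto simp: frontier_def)
 have "w \<bullet> y = (w \<bullet> a + w \<bullet> b) / 2" by (simp add: y_def midpoint_def inner_add_right)
 hence e: "w \<bullet> a = w \<bullet> b" "w \<bullet> y = w \<bullet> a" using w(2)[OF ab(1)] w(2)[OF ab(2)] by auto
 let ?n = "(1 / norm w) *\<^sub>R w"
 have "norm ?n = 1" "?n \<bullet> (b - a) = 0" using w(1) e by (auto simp: inner_diff_right)
 moreover have "?n \<bullet> a <= ?n \<bullet> z" if "z \<in> Q" for z
  using w(2)[of z] e that by (auto simp: divide_right_mono)
 ultimately show ?thesis by blast
qed

text \<open>Across an edge of the outer polygon lies a whole half-plane. Across an edge of the hole
  lies Q2, which contains the triangle over that edge with apex at the centre of an inscribed ball: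
  its height is at least r and its sides at the apex have length at most \<open>2 * c0 * r\<close>,
  which gives the ratio \<open>1 / (2 * c0)\<close>.\<close>

lemma ring_ext_skel:
 assumes R: "is_ring N0 c0 \<beta> R" and c0: "c0 >= 1"
 shows "\<exists>E. skel (1 / (2 * c0)) E (- R) & card E <= 2 * N0"
proof -
 obtain Q1 Q2 L1 L2 where Q: "R = Q1 - Q2" "reg_polygon N0 c0 Q1" "Q2 = {} | reg_polygon N0 c0 Q2"
  and L: "frontier Q1 = segs L1" "frontier Q2 = segs L2" "length L1 <= N0" "length L2 <= N0"
  using R by (rule ring_shape)
 note q1 = reg_polygonD[OF Q(2)]
 have q2: "closed Q2" "convex Q2" "Q2 = {} | interior Q2 ~= {}" using Q(3) reg_polygonD by auto
 define E where "E = set (L1 @ L2)"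
 have X: "- R = - Q1 \<union> Q2" unfolding Q(1) by auto
 have fE: "finite E" by (simp add: E_def)
 have cE: "card E <= 2 * N0" unfolding E_def using card_length[of "L1 @ L2"] L by simp
 have cover: "frontier (- R) <= (\<Union>(a,b)\<in>E. cseg a b)"
 proof -
  have "frontier (- R) <= segs (L1 @ L2)"
   unfolding frontier_complement Q(1) segs_append using frontier_Diff_subset[of Q1 Q2] L by simp
  thus ?thesis by (simp add: segs_def E_def)
 qed
 have ci: "- R <= closure (interior (- R))"
 proof -
  have "- Q1 <= interior (- R)" using q1(3) unfolding X by (intro interior_maximal) auto
  hence "- Q1 <= closure (interior (- R))" using closure_subset by blast
  moreover have "Q2 <= closure (interior (- R))"
  proof (cases "Q2 = {}")
   case False
   hence "Q2 <= closure (interior Q2)" using q2 by (intro convex_subset_closure_interior) auto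
   also have "... <= closure (interior (- R))" unfolding X by (intro closure_mono interior_mono) auto
   finally show ?thesis .
  qed simp
  ultimately show ?thesis unfolding X by blast
 qed
 have half: "\<exists>nv. norm nv = 1 & nv \<bullet> (b - a) = 0 & (\<forall>y\<in>cseg a b. halfdisc y nv (1 / (2 * c0) * min (dist y a) (dist y b)) <= closure (- R))"
  if ab: "(a, b) \<in> E" for a b
 proof (cases "(a, b) \<in> set L1")
  case True
  hence seg: "cseg a b <= frontier Q1" unfolding L(1) segs_def by blast
  obtain nv where nv: "norm nv = 1" "nv \<bullet> (b - a) = 0" "!!z. z \<in> Q1 ==> nv \<bullet> a <= nv \<bullet> z"
   using supporting_normal[OF q1(2,3) seg q1(4)] by blast
  have "halfdisc y (- nv) rho <= closure (- R)" if y: "y \<in> cseg a b" for y rho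
  proof (rule halfplane_halfdisc)
   fix z assume z: "- nv \<bullet> (z - y) > 0"
   obtain s where "y - a = s *\<^sub>R (b - a)" using y by (rule segment_param)
   hence "nv \<bullet> (y - a) = 0" using nv(2) by simp
   hence "nv \<bullet> z < nv \<bullet> a" using z by (simp add: inner_diff_right)
   hence "z \<notin> Q1" using nv(3)[of z] by auto
   thus "z \<in> - R" unfolding X by simp
  qed (use nv in simp)
  thus ?thesis using nv by (intro exI[of _ "- nv"] conjI ballI) auto
 next
  case False
  hence ab2: "(a, b) \<in> set L2" using ab by (simp add: E_def)
  hence seg: "cseg a b <= frontier Q2" unfolding L(2) segs_def by blast
  have "a \<in> frontier Q2" by (rule subsetD[OF seg]) simp
  hence Q2ne: "Q2 ~= {}" by auto
  hence reg: "reg_polygon N0 c0 Q2" using Q(3) by simp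
  obtain nv where nv: "norm nv = 1" "nv \<bullet> (b - a) = 0" "!!z. z \<in> Q2 ==> nv \<bullet> a <= nv \<bullet> z"
   using supporting_normal[OF q2(2,1) seg reg_polygonD(4)[OF reg]] by blast
  obtain x r where x: "r > 0" "cball x r <= Q2" "!!a. a \<in> Q2 ==> dist x a <= 2 * c0 * r" using reg_polygonD(5)[OF reg] by blast
  have nn: "nv \<bullet> nv = 1" using nv by (simp add: norm_eq_1)
  have abQ: "a \<in> Q2" "b \<in> Q2"
  proof -
   have "a \<in> frontier Q2" "b \<in> frontier Q2" by (rule subsetD[OF seg], simp)+
   thus "a \<in> Q2" "b \<in> Q2" using q2(1) by (auto simp: frontier_def)
  qed
  have "x - r *\<^sub>R nv \<in> cball x r" using nv x by (simp add: dist_norm)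
  hence "nv \<bullet> a <= nv \<bullet> (x - r *\<^sub>R nv)" using x nv(3) by blast
  hence H: "nv \<bullet> (x - a) >= r" using nn by (simp add: inner_diff_right)
  have "halfdisc y nv (1 / (2 * c0) * min (dist y a) (dist y b)) <= closure (- R)" if y: "y \<in> cseg a b" for y
  proof -
   have k: "1 / (2 * c0) * dist x p <= nv \<bullet> (x - a)" if "p \<in> Q2" for p
   proof -
    have "1 / (2 * c0) * dist x p <= 1 / (2 * c0) * (2 * c0 * r)" using x(3)[OF that] c0 by (intro mult_left_mono) auto
    also have "... = r" using c0 by simp
    finally show ?thesis using H by simp
   qed
   have "halfdisc y nv (1 / (2 * c0) * min (dist y a) (dist y b)) <= convex hull {a, b, x}"
    using nv H x(1) c0 k abQ y by (intro triangle_halfdisc) auto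
   also have "... <= Q2"
   proof (rule hull_minimal)
    show "{a, b, x} <= Q2" using abQ x(1,2) by auto
   qed (rule q2(2))
   also have "... <= closure (- R)" unfolding X using closure_subset by blast
   finally show ?thesis .
  qed
  thus ?thesis using nv by blast
 qed
 have "skel (1 / (2 * c0)) E (- R)" using fE ci cover half by (rule skelI)
 thus ?thesis using cE by blast
qed

section \<open>Cell decompositions attached to splines\<close>

lemma ring_borel_bounded:
 assumes "is_ring N0 c0 \<beta> R"
 shows "R \<in> sets borel" "bounded R"
proof -
 obtain Q1 Q2 L1 L2 where Q: "R = Q1 - Q2" "reg_polygon N0 c0 Q1" "Q2 = {} | reg_polygon N0 c0 Q2"
  using assms by (rule ring_shape)
 have c: "closed Q1" "closed Q2" using Q reg_polygonD(3) by auto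
 show "R \<in> sets borel" unfolding Q(1) using c by (intro sets.Diff borel_closed)
 show "bounded R" unfolding Q(1) using compact_imp_bounded[OF reg_polygonD(1)[OF Q(2)]] by (rule bounded_subset) auto
qed

text \<open>The common form of the decompositions of a compact domain and of the plane. Of the rings
  it remembers the half-discs along edges and a bound for the number of edges per cell.\<close>

definition cells :: "real => nat => pt set => nat => (nat => pt set) => (nat => (pt \<times> pt) set) => bool" where
 "cells kp M Om m R E \<longleftrightarrow> (\<forall>j<m. skel kp (E j) (R j) & card (E j) <= M & R j \<in> sets borel) &
   (\<forall>i<m. \<forall>j<m. i ~= j --> interior (R i) \<inter> interior (R j) = {}) & (\<Union>j<m. R j) = Om & closed Om"

definition pcw :: "nat => nat => (nat => pt set) => (nat => nat => nat => real) => pt => real" where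
 "pcw k m R P x = (\<Sum>j<m. poly2 k (P j) x * indicator (R j) x)"

lemma polygonal_domain_closed: "polygonal_domain Om ==> closed Om"
proof -
 assume "polygonal_domain Om"
 then obtain \<T> where T: "finite \<T>" "\<forall>T\<in>\<T>. nondeg_triangle T" "Om = \<Union>\<T>" by (auto simp: polygonal_domain_def)
 have "closed T" if "T \<in> \<T>" for T
 proof -
  have "nondeg_triangle T" using T that by simp
  then obtain a b c where "T = convex hull {a, b, c}" unfolding nondeg_triangle_def by (elim exE conjE)
  moreover have "compact (convex hull {a, b, c})" by (intro compact_convex_hull finite_imp_compact) simp
  ultimately show ?thesis using compact_imp_closed by simp
 qed
 thus "closed Om" using T by auto
qed

text \<open>When the domain is the plane, the complement of the union of the rings becomes an
  additional cell with the zero polynomial, whence \<open>m <= n + 1\<close>. Aperture and number of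
  edges are chosen to suit rings and this exterior cell alike.\<close>

lemma spline_cells:
 assumes ad: "admissible_domain N0 c0 \<beta> Om n0" and S: "S \<in> splines N0 c0 \<beta> Om n k"
  and \<beta>: "0 < \<beta>" "\<beta> <= pi / 3" and c0: "c0 >= 1"
 shows "\<exists>m R E P. m <= n + 1 & cells (min (sin \<beta>) (1 / (2 * c0))) (ring_const N0 + 2 * N0) Om m R E &
   (AE x in lborel. S x = pcw k m R P x) & (k >= 2 --> C_on (k - 2) Om S) & bounded {x. pcw k m R P x ~= 0}"
proof -
 let ?k = "min (sin \<beta>) (1 / (2 * c0))" and ?M = "ring_const N0 + 2 * N0"
 obtain R P where R: "\<forall>j<n. is_ring N0 c0 \<beta> (R j)" "\<forall>i<n. \<forall>j<n. i ~= j --> interior (R i) \<inter> interior (R j) = {}"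
  "if Om = UNIV then is_ring N0 c0 \<beta> (\<Union>j<n. R j) else (\<Union>j<n. R j) = Om"
  "AE x in lborel. S x = (\<Sum>j<n. poly2 k (P j) x * indicator (R j) x)" "k >= 2 --> C_on (k - 2) Om S"
  using S unfolding splines_def mem_Collect_eq by (elim exE conjE) (rule that)
 define E where "E j = (SOME E. skel (sin \<beta>) E (R j) & card E <= ring_const N0)" for j
 have E: "skel (sin \<beta>) (E j) (R j) & card (E j) <= ring_const N0" if "j < n" for j
 proof -
  have "is_ring N0 c0 \<beta> (R j)" using R(1) that by simp
  from ring_skel[OF this \<beta>] show ?thesis unfolding E_def by (rule someI_ex)
 qed
 have sk: "skel ?k (E j) (R j) & card (E j) <= ?M & R j \<in> sets borel" if "j < n" for j
 proof -
  have "is_ring N0 c0 \<beta> (R j)" using R(1) that by simp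
  hence b: "R j \<in> sets borel" by (rule ring_borel_bounded(1))
  have c: "skel ?k (E j) (R j)" by (rule skel_mono[OF conjunct1[OF E[OF that]]]) simp
  have d: "card (E j) <= ?M" using conjunct2[OF E[OF that]] by linarith
  show ?thesis by (intro conjI b c d)
 qed
 have bU: "bounded (\<Union>j<n. R j)" using R(1) ring_borel_bounded(2) by (intro bounded_UN) auto
 have supp: "{x. pcw k n R P x ~= 0} <= (\<Union>j<n. R j)"
 proof
  fix x assume x: "x \<in> {x. pcw k n R P x ~= 0}"
  show "x \<in> (\<Union>j<n. R j)"
  proof (rule ccontr)
   assume "x \<notin> (\<Union>j<n. R j)"
   hence "pcw k n R P x = 0" unfolding pcw_def by (intro sum.neutral) auto
   thus False using x by simp
  qed
 qed
 show ?thesis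
 proof (cases "Om = UNIV")
  case False
  hence U: "(\<Union>j<n. R j) = Om" using R(3) by simp
  have "closed Om" using ad False polygonal_domain_closed by (auto simp: admissible_domain_def)
  hence A: "cells ?k ?M Om n R E" unfolding cells_def
  proof (intro conjI allI impI)
   show "skel ?k (E j) (R j)" if "j < n" for j using sk[OF that] by (rule conjunct1)
   show "card (E j) <= ?M" if "j < n" for j using sk[OF that] by (elim conjE)
   show "R j \<in> sets borel" if "j < n" for j using sk[OF that] by (elim conjE)
  qed (use R(2) U in simp_all)
  have B: "AE x in lborel. S x = pcw k n R P x" unfolding pcw_def by (rule R(4))
  have C: "bounded {x. pcw k n R P x ~= 0}" using bounded_subset[OF bU supp] .
  show ?thesis
   by (rule exI[of _ n], rule exI[of _ R], rule exI[of _ E], rule exI[of _ P], intro conjI, simp, rule A, rule B, rule R(5), rule C)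
 next
  case True
  define U where "U = (\<Union>j<n. R j)"
  have U: "is_ring N0 c0 \<beta> U" using R(3) True by (simp add: U_def)
  obtain E' where E': "skel (1 / (2 * c0)) E' (- U)" "card E' <= 2 * N0" using ring_ext_skel[OF U c0] by blast
  define R' where "R' = R(n := - U)"
  define E2 where "E2 = E(n := E')"
  define P' where "P' = P(n := (%_ _. 0))"
  have e1: "R' j = R j" "E2 j = E j" "P' j = P j" if "j < n" for j
   unfolding R'_def E2_def P'_def by (rule fun_upd_other, use that in simp)+
  have e2: "R' n = - U" "E2 n = E'" unfolding R'_def E2_def by (rule fun_upd_same)+
  have eq: "pcw k (Suc n) R' P' = pcw k n R P"
  proof
   fix x
   have "poly2 k (P' n) x = 0" unfolding P'_def fun_upd_same by (simp add: poly2_def)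
   hence "pcw k (Suc n) R' P' x = (\<Sum>j<n. poly2 k (P' j) x * indicator (R' j) x)" by (simp add: pcw_def)
   also have "... = pcw k n R P x" unfolding pcw_def by (rule sum.cong) (simp_all add: e1(1,3))
   finally show "pcw k (Suc n) R' P' x = pcw k n R P x" .
  qed
  have sk': "skel ?k (E2 j) (R' j) & card (E2 j) <= ?M & R' j \<in> sets borel" if "j < Suc n" for j
  proof (cases "j = n")
   case True
   have b: "- U \<in> sets borel" using ring_borel_bounded(1)[OF U] by (rule borel_comp)
   have c: "skel ?k E' (- U)" using E'(1) by (rule skel_mono) simp
   have d: "card E' <= ?M" using E'(2) by linarith
   show ?thesis unfolding True e2 by (intro conjI b c d)
  next
   case False
   hence j: "j < n" using that by (simp only: less_Suc_eq) simp
   show ?thesis unfolding e1(1,2)[OF j] by (rule sk[OF j])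
  qed
  have dU: "interior (R j) \<inter> interior (- U) = {}" if "j < n" for j
  proof -
   have "R j <= U" using that by (auto simp: U_def)
   thus ?thesis using interior_subset[of "R j"] interior_subset[of "- U"] by blast
  qed
  have disj: "interior (R' i) \<inter> interior (R' j) = {}" if ij: "i < Suc n" "j < Suc n" "i ~= j" for i j
  proof -
   consider "i < n" "j < n" | "i = n" "j < n" | "i < n" "j = n" using ij by linarith
   thus ?thesis
   proof cases
    case 1 show ?thesis using R(2)[rule_format, OF 1 \<open>i ~= j\<close>] unfolding e1(1)[OF 1(1)] e1(1)[OF 1(2)] .
   next
    case 2 show ?thesis using dU[OF 2(2)] unfolding 2(1) e1(1)[OF 2(2)] e2(1) by (subst Int_commute)
   next
    case 3 show ?thesis using dU[OF 3(1)] unfolding 3(2) e1(1)[OF 3(1)] e2(1) .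
   qed
  qed
  have un: "(\<Union>j<Suc n. R' j) = Om"
  proof -
   have "(\<Union>j<Suc n. R' j) = R' n \<union> (\<Union>j<n. R' j)" by (simp add: lessThan_Suc)
   also have "(\<Union>j<n. R' j) = U" unfolding U_def by (rule SUP_cong) (simp_all add: e1(1))
   finally show ?thesis unfolding e2 True by auto
  qed
  have A: "cells ?k ?M Om (Suc n) R' E2" unfolding cells_def
  proof (intro conjI allI impI)
   show "(\<Union>j<Suc n. R' j) = Om" by (rule un)
   show "closed Om" using True by simp
   show "interior (R' i) \<inter> interior (R' j) = {}" if "i < Suc n" "j < Suc n" "i ~= j" for i j by (rule disj[OF that])
   show "skel ?k (E2 j) (R' j)" if "j < Suc n" for j using sk'[OF that] by (rule conjunct1)
   show "card (E2 j) <= ?M" if "j < Suc n" for j using sk'[OF that] by (elim conjE)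
   show "R' j \<in> sets borel" if "j < Suc n" for j using sk'[OF that] by (elim conjE)
  qed
  have B: "AE x in lborel. S x = pcw k (Suc n) R' P' x" unfolding eq pcw_def by (rule R(4))
  have C: "bounded {x. pcw k (Suc n) R' P' x ~= 0}" unfolding eq by (rule bounded_subset[OF bU supp])
  show ?thesis
   by (rule exI[of _ "Suc n"], rule exI[of _ R'], rule exI[of _ E2], rule exI[of _ P'], intro conjI, simp, rule A, rule B, rule R(5), rule C)
 qed
qed

section \<open>Splines as single jumps near an edge\<close>

lemma deriv_along:
 fixes D :: "pt => real"
 assumes "!!x. (D has_derivative (%h. h$1 * g1 x + h$2 * g2 x)) (at x)"
 shows "((%t. D (z + t *\<^sub>R w)) has_real_derivative (w$1 * g1 (z + t *\<^sub>R w) + w$2 * g2 (z + t *\<^sub>R w))) (at t)"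
proof -
 have l: "((%t. z + t *\<^sub>R w) has_derivative (%s. s *\<^sub>R w)) (at t)" by (auto intro!: derivative_eq_intros)
 have "((%t. D (z + t *\<^sub>R w)) has_derivative (%s. (s *\<^sub>R w)$1 * g1 (z + t *\<^sub>R w) + (s *\<^sub>R w)$2 * g2 (z + t *\<^sub>R w))) (at t)"
  by (rule has_derivative_compose[OF l assms])
 moreover have "(%s. (s *\<^sub>R w)$1 * g1 (z + t *\<^sub>R w) + (s *\<^sub>R w)$2 * g2 (z + t *\<^sub>R w)) = (*) (w$1 * g1 (z + t *\<^sub>R w) + w$2 * g2 (z + t *\<^sub>R w))"
  by (auto simp: fun_eq_iff algebra_simps)
 ultimately show ?thesis by (simp add: has_field_derivative_def)
qed

text \<open>Since D vanishes on a piece of the line, its tangential derivative there is zero, so D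
  vanishes on the whole line. Integrating the gradient along the normal then gives the
  power.\<close>

lemma gradient_power:
 fixes D :: "pt => real"
 assumes d: "!!x. (D has_derivative (%h. h$1 * (c1 * (nv \<bullet> (x - y)) ^ e) + h$2 * (c2 * (nv \<bullet> (x - y)) ^ e))) (at x)"
  and z: "!!x. x \<in> ball y rho ==> nv \<bullet> (x - y) = 0 ==> D x = 0" and rho: "rho > 0" and nv: "norm nv = 1"
 shows "\<exists>c. \<forall>x. D x = c * (nv \<bullet> (x - y)) ^ Suc e"
proof -
 obtain tau where tau: "norm tau = 1" "tau \<bullet> nv = 0" using exists_perp[of nv] by blast
 have nn: "nv \<bullet> nv = 1" using nv by (simp add: norm_eq_1)
 have nvtau: "nv \<bullet> tau = 0" using tau by (simp add: inner_commute)
 \<comment> \<open>The factor \<open>0 ^ e\<close> is one for e = 0 and zero otherwise, so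
   \<open>?d\<close> is the tangential derivative on the line in both cases.\<close>
 let ?d = "(tau$1 * c1 + tau$2 * c2) * 0 ^ e" and ?c = "(nv$1 * c1 + nv$2 * c2) / real (Suc e)"
 have "((%t. D (y + t *\<^sub>R tau) - ?d * t) has_real_derivative 0) (at t)" for t
  using deriv_along[OF d, of y tau t] by (auto intro!: derivative_eq_intros simp: nvtau algebra_simps)
 hence a: "D (y + t *\<^sub>R tau) - ?d * t = D (y + u *\<^sub>R tau) - ?d * u" for t u
  using DERIV_isconst_all[of "%t. D (y + t *\<^sub>R tau) - ?d * t"] by blast
 have "D y = 0" using z[of y] rho by simp
 moreover have "D (y + (rho/2) *\<^sub>R tau) = 0" using z[of "y + (rho/2) *\<^sub>R tau"] rho tau nvtau by (simp add: dist_norm)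
 ultimately have "?d * (rho/2) = 0" using a[of "rho/2" 0] by simp
 hence "?d = 0" using rho by simp
 hence line: "D (y + t *\<^sub>R tau) = 0" for t using a[of t 0] \<open>D y = 0\<close> by simp
 have "D x = ?c * (nv \<bullet> (x - y)) ^ Suc e" for x
 proof -
  define t where "t = tau \<bullet> (x - y)"
  have x: "x - y = t *\<^sub>R tau + (nv \<bullet> (x - y)) *\<^sub>R nv" unfolding t_def by (rule orthonormal_expand[OF tau(1) nv tau(2)])
  have i: "nv \<bullet> (y + t *\<^sub>R tau + u *\<^sub>R nv - y) = u" for u using nn nvtau by (simp add: inner_add_right inner_diff_right)
  have dd: "((%u. D ((y + t *\<^sub>R tau) + u *\<^sub>R nv)) has_real_derivative (nv$1 * (c1 * u ^ e) + nv$2 * (c2 * u ^ e))) (at u)" for u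
   using deriv_along[OF d, of "y + t *\<^sub>R tau" nv u] unfolding i .
  have pp: "((%u. ?c * u ^ Suc e) has_real_derivative ?c * (real (Suc e) * u ^ e)) (at u)" for u
   by (rule DERIV_cmult) (use DERIV_pow[of "Suc e" u UNIV] in simp)
  have cc: "(nv$1 * (c1 * u ^ e) + nv$2 * (c2 * u ^ e)) - ?c * (real (Suc e) * u ^ e) = 0" for u
  proof -
   have "?c * real (Suc e) = nv$1 * c1 + nv$2 * c2" by simp
   hence "?c * (real (Suc e) * u ^ e) = (nv$1 * c1 + nv$2 * c2) * u ^ e" by (simp only: mult.assoc[symmetric])
   thus ?thesis by (simp add: algebra_simps)
  qed
  have "((%u. D ((y + t *\<^sub>R tau) + u *\<^sub>R nv) - ?c * u ^ Suc e) has_real_derivative 0) (at u)" for u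
   using DERIV_diff[OF dd[of u] pp[of u]] unfolding cc .
  hence "D ((y + t *\<^sub>R tau) + u *\<^sub>R nv) - ?c * u ^ Suc e = D ((y + t *\<^sub>R tau) + 0 *\<^sub>R nv) - ?c * 0 ^ Suc e" for u
   using DERIV_isconst_all[of "%u. D ((y + t *\<^sub>R tau) + u *\<^sub>R nv) - ?c * u ^ Suc e"] by blast
  hence "D ((y + t *\<^sub>R tau) + u *\<^sub>R nv) = ?c * u ^ Suc e" for u using line[of t] by simp
  moreover have "x = (y + t *\<^sub>R tau) + (nv \<bullet> (x - y)) *\<^sub>R nv" using x by (simp add: algebra_simps)
  ultimately show ?thesis using \<open>!!u. D ((y + t *\<^sub>R tau) + u *\<^sub>R nv) = ?c * u ^ Suc e\<close>[of "nv \<bullet> (x - y)"] by simp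
 qed
 thus ?thesis by (intro exI allI)
qed

lemma C_on_continuous: "C_on m Om S ==> continuous_on Om S"
 by (cases m) auto

text \<open>Induction on the smoothness. The partial derivatives of S coincide with those of p and
  p' on the two sides, so by the induction hypothesis the gradients differ by multiples of a power.
  Continuity of S makes p and p' agree on the line, and integration raises the power by one.\<close>

lemma C_on_jump:
 fixes p p' S :: "pt => real"
 assumes "C_on m Om S" "pol (Suc (Suc m)) p" "pol (Suc (Suc m)) p'" and nv: "norm nv = 1" and rho: "rho > 0" and B: "ball y rho <= Om"
  and "!!x. x \<in> ball y rho ==> nv \<bullet> (x - y) > 0 ==> S x = p x"
  and "!!x. x \<in> ball y rho ==> nv \<bullet> (x - y) < 0 ==> S x = p' x"
 shows "\<exists>c. \<forall>x. p x - p' x = c * (nv \<bullet> (x - y)) ^ Suc m"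
 using assms(1-3,7,8)
proof (induction m arbitrary: S p p')
 have nn: "nv \<bullet> nv = 1" using nv by (simp add: norm_eq_1)
 \<comment> \<open>Points of the line are approached along the normal from the side on which S
   equals p.\<close>
 have lim: "p x = S x"
  if S: "continuous_on Om S" and p: "continuous_on UNIV p" and eq: "!!x. x \<in> ball y rho ==> sg * (nv \<bullet> (x - y)) > 0 ==> S x = p x"
   and x: "x \<in> ball y rho" "nv \<bullet> (x - y) = 0" and sg: "sg ~= 0" for S p :: "pt => real" and x and sg :: real
 proof -
  let ?z = "%n::nat. x + (sg / real (Suc n)) *\<^sub>R nv"
  have "(%n. sg / real (Suc n)) \<longlonglongrightarrow> 0" using LIMSEQ_Suc[OF lim_const_over_n[of sg]] by simp
  hence "(%n. (sg / real (Suc n)) *\<^sub>R nv) \<longlonglongrightarrow> 0 *\<^sub>R nv" by (intro tendsto_intros)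
  hence z: "?z \<longlonglongrightarrow> x" using tendsto_add[OF tendsto_const[of x]] by fastforce
  have Sc: "isCont S x" using S B x(1) open_ball[of y rho] continuous_on_subset[OF S B] by (simp add: continuous_on_eq_continuous_at)
  have pc: "isCont p x" using p by (simp add: continuous_on_eq_continuous_at)
  have "eventually (%n. ?z n \<in> ball y rho) sequentially" using z x(1) by (intro topological_tendstoD[OF z]) auto
  hence "eventually (%n. S (?z n) = p (?z n)) sequentially"
  proof eventually_elim
   case (elim n)
   have "nv \<bullet> (?z n - y) = nv \<bullet> (x - y) + sg / real (Suc n) * (nv \<bullet> nv)" by (simp add: inner_diff_right inner_add_right)
   hence "nv \<bullet> (?z n - y) = sg / real (Suc n)" using x(2) nn by simp
   hence "sg * (nv \<bullet> (?z n - y)) = sg\<^sup>2 / real (Suc n)" by (simp add: power2_eq_square)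
   also have "... > 0" using sg by simp
   finally show ?case by (rule eq[OF elim])
  qed
  hence "(%n. S (?z n)) \<longlonglongrightarrow> p x" using isCont_tendsto_compose[OF pc z] by (simp add: tendsto_cong)
  thus ?thesis using isCont_tendsto_compose[OF Sc z] LIMSEQ_unique by blast
 qed
 have zero: "p x - p' x = 0" if "continuous_on Om S" "continuous_on UNIV p" "continuous_on UNIV p'"
   "!!x. x \<in> ball y rho ==> nv \<bullet> (x - y) > 0 ==> S x = p x" "!!x. x \<in> ball y rho ==> nv \<bullet> (x - y) < 0 ==> S x = p' x"
   "x \<in> ball y rho" "nv \<bullet> (x - y) = 0" for S p p' :: "pt => real" and x
  using lim[of S p 1 x] lim[of S p' "-1" x] that by simp
 {
  case 0
  note c = 0(1)[unfolded C_on.simps] pol_continuous[OF 0(2)] pol_continuous[OF 0(3)]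
  obtain g1 g2 where g: "!!x. (p has_derivative (%h. h$1 * g1 x + h$2 * g2 x)) (at x)" "pol (Suc 0) g1" "pol (Suc 0) g2" using 0(2) by auto
  obtain g1' g2' where g': "!!x. (p' has_derivative (%h. h$1 * g1' x + h$2 * g2' x)) (at x)" "pol (Suc 0) g1'" "pol (Suc 0) g2'" using 0(3) by auto
  have const: "f x = f y" if "pol (Suc 0) f" for f x
   by (rule zero_derivative_const) (use that in auto)
  have D: "((%x. p x - p' x) has_derivative (%h. h$1 * ((g1 y - g1' y) * (nv \<bullet> (x - y)) ^ 0) + h$2 * ((g2 y - g2' y) * (nv \<bullet> (x - y)) ^ 0))) (at x)" for x
   using has_derivative_diff[OF g(1) g'(1), of x] const[OF g(2), of x] const[OF g(3), of x] const[OF g'(2), of x] const[OF g'(3), of x]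
   by (simp add: algebra_simps)
  show ?case by (rule gradient_power[OF D zero[OF c 0(4,5)] rho nv])
 next
  case (Suc m)
  have c: "continuous_on Om S" "continuous_on UNIV p" "continuous_on UNIV p'"
   by (rule C_on_continuous[OF Suc.prems(1)], rule pol_continuous[OF Suc.prems(2)], rule pol_continuous[OF Suc.prems(3)])
  obtain g1 g2 where g: "!!x. (p has_derivative (%h. h$1 * g1 x + h$2 * g2 x)) (at x)" "pol (Suc (Suc m)) g1" "pol (Suc (Suc m)) g2"
   using Suc.prems(2) by (subst (asm) pol.simps) blast
  obtain g1' g2' where g': "!!x. (p' has_derivative (%h. h$1 * g1' x + h$2 * g2' x)) (at x)" "pol (Suc (Suc m)) g1'" "pol (Suc (Suc m)) g2'"
   using Suc.prems(3) by (subst (asm) pol.simps) blast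
  obtain s1 s2 where s: "!!x. x \<in> Om ==> (S has_derivative (%h. h$1 * s1 x + h$2 * s2 x)) (at x within Om)" "C_on m Om s1" "C_on m Om s2"
   using Suc.prems(1) by (subst (asm) C_on.simps) blast
  \<comment> \<open>On an open subset the derivative within \<open>Om\<close> is the full
    derivative, hence unique; the unit vectors identify both partial derivatives.\<close>
  have eq: "s1 x = q1 x & s2 x = q2 x" if q: "!!x. (q has_derivative (%h. h$1 * q1 x + h$2 * q2 x)) (at x)" and U: "open U" "x \<in> U" "U <= Om"
   and e: "!!x. x \<in> U ==> S x = q x" for q q1 q2 :: "pt => real" and U x
  proof -
   have "(S has_derivative (%h. h$1 * s1 x + h$2 * s2 x)) (at x within U)" using s(1)[of x] U has_derivative_subset by blast
   hence a: "(S has_derivative (%h. h$1 * s1 x + h$2 * s2 x)) (at x)" using at_within_open[OF U(2,1)] by simp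
   have "(q has_derivative (%h. h$1 * s1 x + h$2 * s2 x)) (at x)"
    by (rule has_derivative_transform_within_open[OF a U(1,2)]) (use e in auto)
   hence "(%h::pt. h$1 * s1 x + h$2 * s2 x) = (%h. h$1 * q1 x + h$2 * q2 x)" by (rule has_derivative_unique[OF _ q])
   from fun_cong[OF this, of "vector [1, 0]"] fun_cong[OF this, of "vector [0, 1]"] show ?thesis by (simp add: vector_2)
  qed
  have o: "open (ball y rho \<inter> {x. nv \<bullet> (x - y) > 0})" "open (ball y rho \<inter> {x. nv \<bullet> (x - y) < 0})"
   by (intro open_Int open_ball open_Collect_less continuous_intros)+
  have e1: "s1 x = g1 x & s2 x = g2 x" if "x \<in> ball y rho" "nv \<bullet> (x - y) > 0" for x
   by (rule eq[OF g(1) o(1)]) (use that B Suc.prems(4) in auto)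
  have e2: "s1 x = g1' x & s2 x = g2' x" if "x \<in> ball y rho" "nv \<bullet> (x - y) < 0" for x
   by (rule eq[OF g'(1) o(2)]) (use that B Suc.prems(5) in auto)
  obtain c1 where c1: "!!x. g1 x - g1' x = c1 * (nv \<bullet> (x - y)) ^ Suc m" using Suc.IH[OF s(2) g(2) g'(2)] e1 e2 by blast
  obtain c2 where c2: "!!x. g2 x - g2' x = c2 * (nv \<bullet> (x - y)) ^ Suc m" using Suc.IH[OF s(3) g(3) g'(3)] e1 e2 by blast
  have D: "((%x. p x - p' x) has_derivative (%h. h$1 * (c1 * (nv \<bullet> (x - y)) ^ Suc m) + h$2 * (c2 * (nv \<bullet> (x - y)) ^ Suc m))) (at x)" for x
   using has_derivative_diff[OF g(1) g'(1), of x] unfolding c1[symmetric] c2[symmetric] by (simp add: algebra_simps)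
  show ?case by (rule gradient_power[OF D zero[OF c Suc.prems(4,5)] rho nv])
 }
qed

section \<open>Vertices, frontiers and crossings of cells\<close>

lemma cellsD:
 assumes "cells kp M Om m R E"
 shows "!!j. j < m ==> skel kp (E j) (R j)" "!!j. j < m ==> card (E j) <= M" "!!j. j < m ==> R j \<in> sets borel"
  "!!i j. i < m ==> j < m ==> i ~= j ==> interior (R i) \<inter> interior (R j) = {}" "(\<Union>j<m. R j) = Om" "closed Om"
  "!!j. j < m ==> closure (R j) <= Om"
proof -
 note * = assms[unfolded cells_def]
 show "!!j. j < m ==> skel kp (E j) (R j)" "!!j. j < m ==> card (E j) <= M" "!!j. j < m ==> R j \<in> sets borel" using * by simp_all
 show "!!i j. i < m ==> j < m ==> i ~= j ==> interior (R i) \<inter> interior (R j) = {}" using * by simp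
 show U: "(\<Union>j<m. R j) = Om" and c: "closed Om" using * by simp_all
 show "closure (R j) <= Om" if "j < m" for j by (rule closure_minimal[OF _ c]) (use U that in auto)
qed

text \<open>The origin is inserted to make the set nonempty, since \<open>infdist\<close> to the
  empty set is 0 by default.\<close>

definition verts :: "nat => (nat => (pt \<times> pt) set) => pt set" where
 "verts m E = insert 0 (\<Union>j<m. fst ` E j \<union> snd ` E j)"

lemma verts_finite:
 assumes c: "cells kp M Om m R E"
 shows "finite (verts m E)" "card (verts m E) <= 1 + m * (2 * M)"
proof -
 have f: "finite (E j)" if "j < m" for j using skelD(1)[OF cellsD(1)[OF c that]] .
 thus "finite (verts m E)" by (auto simp: verts_def)
 have "card (\<Union>j<m. fst ` E j \<union> snd ` E j) <= (\<Sum>j<m. card (fst ` E j \<union> snd ` E j))" by (rule card_UN_le) simp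
 also have "... <= (\<Sum>j<m. 2 * M)"
 proof (rule sum_mono)
  fix j assume "j \<in> {..<m}"
  hence j: "j < m" by simp
  have "card (fst ` E j \<union> snd ` E j) <= card (fst ` E j) + card (snd ` E j)" by (rule card_Un_le)
  also have "... <= card (E j) + card (E j)" using f[OF j] by (intro add_mono card_image_le)
  also have "... <= 2 * M" using cellsD(2)[OF c j] by simp
  finally show "card (fst ` E j \<union> snd ` E j) <= 2 * M" .
 qed
 finally have "card (\<Union>j<m. fst ` E j \<union> snd ` E j) <= m * (2 * M)" by simp
 moreover have "card (verts m E) <= Suc (card (\<Union>j<m. fst ` E j \<union> snd ` E j))"
  unfolding verts_def using f by (intro card_insert_le_m1) auto
 ultimately show "card (verts m E) <= 1 + m * (2 * M)" by linarith
qed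

text \<open>V may exceed the vertices of this decomposition. Later it contains the vertices of both
  splines, so that their half-discs are measured by one distance; enlarging V only shrinks the
  radii.\<close>

lemma frontier_segment:
 assumes c: "cells kp M Om m R E" and V: "finite V" "verts m E <= V" and j: "j < m" and y: "y \<in> frontier (R j)" and kp: "kp >= 0"
 shows "\<exists>a b nv. (a, b) \<in> E j & y \<in> cseg a b & norm nv = 1 & nv \<bullet> (b - a) = 0 &
  (\<forall>y'\<in>cseg a b. halfdisc y' nv (kp * infdist y' V) <= closure (R j))"
proof -
 note s = cellsD(1)[OF c j]
 obtain a b where ab: "(a, b) \<in> E j" "y \<in> cseg a b" using skelD(3)[OF s] y by blast
 obtain nv where nv: "norm nv = 1" "nv \<bullet> (b - a) = 0"
  "!!y'. y' \<in> cseg a b ==> halfdisc y' nv (kp * min (dist y' a) (dist y' b)) <= closure (R j)" using skelD(4)[OF s ab(1)] by blast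
 have "a \<in> verts m E" "b \<in> verts m E" using ab(1) j unfolding verts_def by force+
 hence "a \<in> V" "b \<in> V" using V by auto
 hence le: "infdist y' V <= min (dist y' a) (dist y' b)" for y' using infdist_le[of a V y'] infdist_le[of b V y'] by simp
 have "halfdisc y' nv (kp * infdist y' V) <= closure (R j)" if "y' \<in> cseg a b" for y'
  by (rule subset_trans[OF halfdisc_mono nv(3)[OF that]], rule mult_left_mono) (use kp le in auto)
 thus ?thesis using ab nv(1,2) by (intro exI[of _ a] exI[of _ b] exI[of _ nv] conjI ballI)
qed

lemma open_meets_interior:
 assumes "R <= closure (interior R)" "open U" "U \<inter> closure R ~= {}"
 shows "U \<inter> interior R ~= {}"
proof -
 have "closure R <= closure (interior R)" using assms(1) by (rule closure_minimal) simp
 hence "U \<inter> closure (interior R) ~= {}" using assms(3) by auto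
 thus ?thesis using open_Int_closure_eq_empty[OF assms(2)] by blast
qed

lemma cells_closures_no_open:
 assumes c: "cells kp M Om m R E" and ij: "i < m" "j < m" "i ~= j" and U: "open U" "U <= closure (R i)" "U <= closure (R j)"
 shows "U = {}"
proof (rule ccontr)
 assume "U ~= {}"
 hence "U \<inter> interior (R i) ~= {}" using U by (intro open_meets_interior skelD(2)[OF cellsD(1)[OF c]] ij) auto
 hence "(U \<inter> interior (R i)) \<inter> interior (R j) ~= {}"
  using U by (intro open_meets_interior skelD(2)[OF cellsD(1)[OF c]] ij open_Int) auto
 thus False using cellsD(4)[OF c ij] by blast
qed

lemma cells_frontier:
 assumes c: "cells kp M Om m R E" and ij: "i < m" "j < m" "i ~= j" and x: "x \<in> closure (R i)" "x \<in> closure (R j)"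
 shows "x \<in> frontier (R i)"
proof (rule ccontr)
 assume "x \<notin> frontier (R i)"
 hence "x \<in> interior (R i)" using x by (simp add: frontier_def)
 hence "interior (R i) \<inter> closure (R j) ~= {}" using x by blast
 hence "interior (R i) \<inter> interior (R j) ~= {}" by (intro open_meets_interior skelD(2)[OF cellsD(1)[OF c]] ij) auto
 thus False using cellsD(4)[OF c ij] by blast
qed

text \<open>By \<open>nc\<close>, the closure of one cell and the union of the other closures are
  disjoint on K, since a common point would lie on two frontiers. Connectedness of K leaves only one
  of these two closed sets.\<close>

lemma no_crossing:
 assumes c: "cells kp M Om m R E" and K: "connected K" "K <= Om" "K ~= {}"
  and nc: "!!i j y. i < m ==> j < m ==> i ~= j ==> y \<in> K ==> y \<in> frontier (R i) ==> y \<notin> frontier (R j)"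
 shows "\<exists>j<m. K <= closure (R j)"
proof -
 obtain x where x: "x \<in> K" using K by blast
 hence "x \<in> (\<Union>j<m. R j)" using K cellsD(5)[OF c] by blast
 then obtain j where j: "j < m" "x \<in> R j" by blast
 let ?B = "\<Union>i\<in>{..<m} - {j}. closure (R i)"
 have cB: "closed ?B" by (intro closed_UN) auto
 have "K <= closure (R j) \<union> ?B"
 proof
  fix z assume "z \<in> K"
  hence "z \<in> (\<Union>j<m. R j)" using K cellsD(5)[OF c] by blast
  then obtain i where "i < m" "z \<in> R i" by blast
  thus "z \<in> closure (R j) \<union> ?B" using closure_subset[of "R i"] by (cases "i = j") auto
 qed
 moreover have "closure (R j) \<inter> ?B \<inter> K = {}"
 proof (rule ccontr)
  assume "closure (R j) \<inter> ?B \<inter> K ~= {}"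
  then obtain z i where z: "z \<in> closure (R j)" "z \<in> closure (R i)" "i < m" "i ~= j" "z \<in> K" by blast
  have "z \<in> frontier (R i)" using cells_frontier[OF c z(3) j(1) z(4) z(2) z(1)] .
  moreover have "z \<in> frontier (R j)" using cells_frontier[OF c j(1) z(3) z(4)[symmetric] z(1) z(2)] .
  ultimately show False using nc z j by blast
 qed
 moreover have "closure (R j) \<inter> K ~= {}" using x j closure_subset by blast
 ultimately have "?B \<inter> K = {}" using connected_closedD[OF K(1), of "closure (R j)" ?B] cB by blast
 hence "K <= closure (R j)" using \<open>K <= closure (R j) \<union> ?B\<close> by blast
 thus ?thesis using j by blast
qed

text \<open>If the normals were not opposite, their sum would point into both half-discs, which
  would then share an open set.\<close>

lemma opposite_normals:
 fixes nv nv' :: pt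
 assumes "norm nv = 1" "norm nv' = 1" "rho > 0" and e: "!!U. open U ==> U <= halfdisc y nv rho ==> U <= halfdisc y nv' rho ==> U = {}"
 shows "nv' = - nv"
proof (rule ccontr)
 assume ne: "nv' ~= - nv"
 have nn: "nv \<bullet> nv = 1" "nv' \<bullet> nv' = 1" using assms by (simp_all add: norm_eq_1)
 have "(nv + nv') \<bullet> (nv + nv') > 0" using ne by (simp add: add_eq_0_iff)
 hence p: "1 + nv \<bullet> nv' > 0" using nn by (simp add: inner_add_left inner_add_right inner_commute)
 let ?U = "ball y rho \<inter> {z. nv \<bullet> (z - y) > 0} \<inter> {z. nv' \<bullet> (z - y) > 0}"
 have "open ?U" by (intro open_Int open_ball open_Collect_less continuous_intros)
 moreover have "?U <= halfdisc y nv rho" "?U <= halfdisc y nv' rho" by (auto simp: halfdisc_def dist_commute)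
 ultimately have "?U = {}" by (rule e)
 moreover have "y + (rho/4) *\<^sub>R (nv + nv') \<in> ?U"
 proof -
  have "norm (nv + nv') <= 2" using norm_triangle_ineq[of nv nv'] assms by simp
  hence "rho/4 * norm (nv + nv') <= rho/4 * 2" using assms by (intro mult_left_mono) auto
  hence "dist y (y + (rho/4) *\<^sub>R (nv + nv')) < rho" using assms by (simp add: dist_norm)
  moreover have "nv \<bullet> (nv + nv') > 0" "nv' \<bullet> (nv + nv') > 0" using p nn by (simp_all add: inner_add_right inner_commute)
  ultimately show ?thesis using assms by simp
 qed
 ultimately show False by blast
qed

text \<open>Half-discs in the closures of two cells share no open set, so at a common frontier point
  they lie on opposite sides of one line and together fill a ball. Away from V a crossing thus
  involves just two cells.\<close>

lemma crossing_halves: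
 assumes c: "cells kp M Om m R E" and V: "finite V" "verts m E <= V" and kp: "kp > 0" and ij: "i < m" "j < m" "i ~= j"
  and y: "y \<in> frontier (R i)" "y \<in> frontier (R j)" and r: "infdist y V > 0"
 shows "\<exists>a b nv. (a, b) \<in> E i & y \<in> cseg a b & norm nv = 1 & nv \<bullet> (b - a) = 0 &
  (\<forall>y'\<in>cseg a b. halfdisc y' nv (kp * infdist y' V) <= closure (R i)) &
  halfdisc y (- nv) (kp * infdist y V) <= closure (R j)"
proof -
 have k0: "kp >= 0" using kp by simp
 obtain a b nv where 1: "(a, b) \<in> E i" "y \<in> cseg a b" "norm nv = 1" "nv \<bullet> (b - a) = 0"
  "\<forall>y'\<in>cseg a b. halfdisc y' nv (kp * infdist y' V) <= closure (R i)"
  using frontier_segment[OF c V ij(1) y(1) k0] by (elim exE conjE)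
 obtain a' b' nv' where 2: "y \<in> cseg a' b'" "norm nv' = 1"
  "\<forall>y'\<in>cseg a' b'. halfdisc y' nv' (kp * infdist y' V) <= closure (R j)"
  using frontier_segment[OF c V ij(2) y(2) k0] by (elim exE conjE)
 note h1 = bspec[OF 1(5) 1(2)] and h2 = bspec[OF 2(3) 2(1)]
 have "nv' = - nv"
 proof (rule opposite_normals[OF 1(3) 2(2)])
  show "kp * infdist y V > 0" using kp r by simp
  show "U = {}" if "open U" "U <= halfdisc y nv (kp * infdist y V)" "U <= halfdisc y nv' (kp * infdist y V)" for U
   by (rule cells_closures_no_open[OF c ij that(1) subset_trans[OF that(2) h1] subset_trans[OF that(3) h2]])
 qed
 hence "halfdisc y (- nv) (kp * infdist y V) <= closure (R j)" using h2 by simp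
 thus ?thesis using 1 by (intro exI[of _ a] exI[of _ b] exI[of _ nv] conjI)
qed

lemma negligible_segment: "negligible (cseg a (b :: pt))"
 by (simp add: negligible_convex_interior interior_closed_segment_ge2)

definition skelset :: "nat => (nat => pt set) => pt set" where
 "skelset m R = (\<Union>j<m. frontier (R j))"

lemma skelset_null:
 assumes c: "cells kp M Om m R E"
 shows "skelset m R \<in> null_sets lborel" "closed (skelset m R)"
proof -
 show cl: "closed (skelset m R)" unfolding skelset_def by (intro closed_UN) auto
 have "negligible (frontier (R j))" if "j < m" for j
 proof (rule negligible_subset)
  show "frontier (R j) <= (\<Union>e\<in>E j. cseg (fst e) (snd e))" using skelD(3)[OF cellsD(1)[OF c that]] by (simp only: case_prod_unfold)
  show "negligible (\<Union>e\<in>E j. cseg (fst e) (snd e))"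
   using skelD(1)[OF cellsD(1)[OF c that]] by (intro negligible_Union finite_imageI) (auto intro: negligible_segment)
 qed
 hence "negligible (skelset m R)" unfolding skelset_def by (intro negligible_Union) auto
 hence "skelset m R \<in> null_sets lebesgue" by (simp add: negligible_iff_null_sets)
 thus "skelset m R \<in> null_sets lborel" using cl by (auto simp: null_sets_def)
qed

lemma pcw_cell:
 assumes c: "cells kp M Om m R E" and j: "j < m" and x: "x \<in> closure (R j)" "x \<notin> skelset m R"
 shows "pcw k m R P x = poly2 k (P j) x"
proof -
 have nf: "x \<notin> frontier (R i)" if "i < m" for i using x that by (auto simp: skelset_def)
 have "x \<in> interior (R j)" using x nf[OF j] by (simp add: frontier_def)
 hence xj: "x \<in> R j" using interior_subset by blast
 have xi: "x \<notin> R i" if "i < m" "i ~= j" for i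
  using cells_frontier[OF c j that(1) that(2)[symmetric] x(1)] nf[OF j] closure_subset[of "R i"] by blast
 have "pcw k m R P x = (\<Sum>i<m. if i = j then poly2 k (P j) x else 0)"
  unfolding pcw_def
 proof (rule sum.cong[OF refl])
  fix i assume "i \<in> {..<m}"
  thus "poly2 k (P i) x * indicator (R i) x = (if i = j then poly2 k (P j) x else 0)"
   using xj xi[of i] by (cases "i = j") simp_all
 qed
 also have "... = poly2 k (P j) x" using j by simp
 finally show ?thesis .
qed

lemma pcw_outside:
 assumes "x \<notin> (\<Union>j<m. R j)"
 shows "pcw k m R P x = 0"
proof -
 have "poly2 k (P j) x * indicator (R j) x = 0" if "j \<in> {..<m}" for j
 proof -
  have "x \<notin> R j" using assms that by blast
  thus ?thesis by simp
 qed
 thus ?thesis unfolding pcw_def by (intro sum.neutral ballI)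
qed

lemma pcw_measurable:
 assumes c: "cells kp M Om m R E"
 shows "pcw k m R P \<in> bm"
 unfolding pcw_def[abs_def]
proof (rule borel_measurable_sum)
 fix j assume "j \<in> {..<m}"
 hence R: "R j \<in> sets borel" using cellsD(3)[OF c, of j] by simp
 have P: "poly2 k (P j) \<in> bm" by (rule borel_measurable_continuous_onI[OF continuous_poly2])
 show "(%x. poly2 k (P j) x * indicator (R j) x) \<in> bm"
  by (rule borel_measurable_times[OF P borel_measurable_indicator[OF R]])
qed

text \<open>A spline is given by polynomials almost everywhere only; continuity turns this into
  equality at every point of an open half-ball.\<close>

lemma continuous_eq_if_AE_eq:
 fixes f g :: "pt => real"
 assumes U: "open U" and f: "continuous_on U f" and g: "continuous_on U g" and ae: "AE x in lborel. x \<in> U --> f x = g x" and x: "x \<in> U"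
 shows "f x = g x"
proof (rule ccontr)
 assume ne: "f x ~= g x"
 let ?W = "U \<inter> (%x. f x - g x) -` (- {0})"
 have o: "open ?W" by (rule continuous_open_preimage[OF continuous_on_diff[OF f g] U]) auto
 obtain N where N: "{x \<in> space lborel. \<not> (x \<in> U --> f x = g x)} <= N" "N \<in> null_sets lborel"
  using ae by (rule AE_E) (auto simp: null_sets_def)
 have "N \<in> null_sets lebesgue" using N(2) by (rule null_sets_completionI)
 hence "negligible N" by (simp add: negligible_iff_null_sets)
 moreover have "?W <= N" using N(1) by auto
 ultimately have "negligible ?W" by (rule negligible_subset)
 moreover have "?W ~= {}" using x ne by auto
 ultimately show False using open_not_negligible[OF o] by blast
qed

lemma open_half_ball: "open {x. x \<in> ball (y::pt) rho & nv \<bullet> (x - y) > 0}"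
proof -
 have "open (ball y rho \<inter> {x. nv \<bullet> (x - y) > 0})" by (intro open_Int open_ball open_Collect_less continuous_intros)
 thus ?thesis by (simp only: Int_def mem_Collect_eq)
qed

text \<open>For k at least two the polynomials of the two cells differ by a multiple of a power of
  the distance from the line, by \<open>C_on_jump\<close>; for k = 1 both are constant and the power
  is one.\<close>

lemma crossing_rep:
 assumes c: "cells kp M Om m R E" and ij: "i < m" "j < m" and nv: "norm nv = 1" and rho: "rho > 0"
  and h: "halfdisc y nv rho <= closure (R i)" "halfdisc y (- nv) rho <= closure (R j)"
  and S: "AE x in lborel. S x = pcw k m R P x" "k >= 2 --> C_on (k - 2) Om S" and k: "k >= 1"
 shows "ball y rho <= Om" "\<exists>d. \<forall>x\<in>ball y rho - skelset m R. pcw k m R P x = poly2 k (P j) x + d * tp k (nv \<bullet> (x - y))"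
proof -
 have pos: "x \<in> closure (R i)" if "x \<in> ball y rho" "nv \<bullet> (x - y) > 0" for x
  using h(1) that by (auto simp: halfdisc_def dist_commute)
 have neg: "x \<in> closure (R j)" if "x \<in> ball y rho" "nv \<bullet> (x - y) <= 0" for x
  using h(2) that by (auto simp: halfdisc_def dist_commute)
 show B: "ball y rho <= Om"
  using pos neg cellsD(7)[OF c ij(1)] cellsD(7)[OF c ij(2)] by (meson linorder_not_le subset_iff)
 have "\<exists>d. \<forall>x. poly2 k (P i) x - poly2 k (P j) x = d * (nv \<bullet> (x - y)) ^ (k - 1)"
 proof (cases "k >= 2")
  case True
  have C: "C_on (k - 2) Om S" using S(2) True by simp
  have SB: "continuous_on (ball y rho) S" using C_on_continuous[OF C] B by (rule continuous_on_subset)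
  have k2: "Suc (Suc (k - 2)) = k" "Suc (k - 2) = k - 1" using True by auto
  have eq: "S x = poly2 k (P l) x" if l: "l < m" "!!x. x \<in> ball y rho ==> w \<bullet> (x - y) > 0 ==> x \<in> closure (R l)" and x: "x \<in> ball y rho" "w \<bullet> (x - y) > 0" for w l x
  proof (rule continuous_eq_if_AE_eq[OF open_half_ball[of y rho w]])
   show "continuous_on {x \<in> ball y rho. w \<bullet> (x - y) > 0} S" by (rule continuous_on_subset[OF SB]) auto
   show "continuous_on {x \<in> ball y rho. w \<bullet> (x - y) > 0} (poly2 k (P l))" by (rule continuous_poly2)
   show "x \<in> {x \<in> ball y rho. w \<bullet> (x - y) > 0}" using x by simp
   show "AE x in lborel. x \<in> {x \<in> ball y rho. w \<bullet> (x - y) > 0} --> S x = poly2 k (P l) x"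
    using S(1) AE_not_in[OF skelset_null(1)[OF c]]
   proof eventually_elim
    case (elim x)
    show ?case using elim pcw_cell[OF c l(1) l(2)[of x] elim(2)] by auto
   qed
  qed
  show ?thesis unfolding k2(2)[symmetric]
  proof (rule C_on_jump[OF C _ _ nv rho B])
   show "pol (Suc (Suc (k - 2))) (poly2 k (P i))" "pol (Suc (Suc (k - 2))) (poly2 k (P j))" unfolding k2(1) by (rule pol_poly2)+
   show "S x = poly2 k (P i) x" if "x \<in> ball y rho" "nv \<bullet> (x - y) > 0" for x by (rule eq[OF ij(1) pos that])
   show "S x = poly2 k (P j) x" if x: "x \<in> ball y rho" "nv \<bullet> (x - y) < 0" for x
   proof (rule eq[OF ij(2), of "- nv"])
    show "x \<in> closure (R j)" if "x \<in> ball y rho" "- nv \<bullet> (x - y) > 0" for x using neg that by simp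
   qed (use x in auto)
  qed
 next
  case False
  hence "k = 1" using k by simp
  thus ?thesis by (simp add: poly2_def)
 qed
 then obtain d where d: "!!x. poly2 k (P i) x - poly2 k (P j) x = d * (nv \<bullet> (x - y)) ^ (k - 1)" by blast
 have "pcw k m R P x = poly2 k (P j) x + d * tp k (nv \<bullet> (x - y))" if "x \<in> ball y rho - skelset m R" for x
 proof (cases "nv \<bullet> (x - y) > 0")
  case True
  thus ?thesis using that pcw_cell[OF c ij(1) pos] d[of x] by (simp add: tp_def)
 next
  case False
  thus ?thesis using that pcw_cell[OF c ij(2) neg] by (simp add: tp_def)
 qed
 thus "\<exists>d. \<forall>x\<in>ball y rho - skelset m R. pcw k m R P x = poly2 k (P j) x + d * tp k (nv \<bullet> (x - y))" by blast
qed

text \<open>Taking the polynomial of the one or of the other cell as base reverses the normal, so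
  the normal can be made to lie in a prescribed half-plane.\<close>

lemma crossing_rep_oriented:
 assumes c: "cells kp M Om m R E" and V: "finite V" "verts m E <= V" and kp: "kp > 0" and ij: "i < m" "j < m" "i ~= j"
  and y: "y \<in> frontier (R i)" "y \<in> frontier (R j)" and r: "infdist y V > 0"
  and S: "AE x in lborel. S x = pcw k m R P x" "k >= 2 --> C_on (k - 2) Om S" and k: "k >= 1"
 shows "\<exists>nv a d. norm nv = 1 & nv \<bullet> w >= 0 & ball y (kp * infdist y V) <= Om &
   (\<forall>x\<in>ball y (kp * infdist y V) - skelset m R. pcw k m R P x = poly2 k a x + d * tp k (nv \<bullet> (x - y)))"
proof -
 have r': "kp * infdist y V > 0" using kp r by simp
 obtain a b nv where *: "y \<in> cseg a b" "norm nv = 1"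
  "\<forall>y'\<in>cseg a b. halfdisc y' nv (kp * infdist y' V) <= closure (R i)" "halfdisc y (- nv) (kp * infdist y V) <= closure (R j)"
  using crossing_halves[OF c V kp ij y r] by (elim exE conjE)
 note h = bspec[OF *(3) *(1)]
 show ?thesis
 proof (cases "nv \<bullet> w >= 0")
  case True
  note rep = crossing_rep[OF c ij(1,2) *(2) r' h *(4) S k]
  obtain d where "\<forall>x\<in>ball y (kp * infdist y V) - skelset m R. pcw k m R P x = poly2 k (P j) x + d * tp k (nv \<bullet> (x - y))"
   using rep(2) by (elim exE)
  thus ?thesis using rep(1) *(2) True by (intro exI[of _ nv] exI[of _ "P j"] exI[of _ d] conjI)
 next
  case False
  have n: "norm (- nv) = 1" "- nv \<bullet> w >= 0" using * False by auto
  have "halfdisc y (- (- nv)) (kp * infdist y V) <= closure (R i)" using h by simp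
  note rep = crossing_rep[OF c ij(2,1) n(1) r' *(4) this S k]
  obtain d where "\<forall>x\<in>ball y (kp * infdist y V) - skelset m R. pcw k m R P x = poly2 k (P i) x + d * tp k (- nv \<bullet> (x - y))"
   using rep(2) by (elim exE)
  thus ?thesis using rep(1) n by (intro exI[of _ "- nv"] exI[of _ "P i"] exI[of _ d] conjI)
 qed
qed

section \<open>The averaging kernel\<close>

text \<open>Profile of the averaging kernel after a ball has been rescaled to the unit ball: v
  becomes the relative distance from the vertices, and B the radius of the ball divided by the width
  of the kernel.\<close>

definition wt :: "real => real => (pt => real) => real => pt => real" where
 "wt \<beta> gam v B u = max 0 (v u - B * norm u) powr \<beta> * v u powr (- gam)"

lemma wt_zero:
 assumes "!!u u'. abs(v u - v u') <= norm (u - u')" "v 0 = 1" "16 <= B" "norm u >= 1/8"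
 shows "max 0 (v u - B * norm u) = 0"
proof -
 have "v u <= 1 + norm u" using assms(1)[of u 0] assms(2) by simp
 moreover have "B * norm u >= 16 * norm u" using assms by (intro mult_right_mono) auto
 ultimately show ?thesis using assms by simp
qed

lemma wt_lipschitz:
 assumes \<beta>: "\<beta> >= 1" and gam: "gam > 0"
 shows "\<exists>A\<ge>0. \<forall>v B. (\<forall>u u'. abs(v u - v u') <= norm (u - u')) --> v 0 = 1 --> 16 <= B --> B <= 64 -->
   (\<forall>u. wt \<beta> gam v B u <= A) & (\<forall>u u'. abs(wt \<beta> gam v B u - wt \<beta> gam v B u') <= A * norm (u - u'))"
proof -
 obtain A1 where A1: "A1 >= 0" "!!x y::real. x \<in> {0..2} ==> y \<in> {0..2} ==> \<bar>x powr \<beta> - y powr \<beta>\<bar> <= A1 * \<bar>x - y\<bar>"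
  using powr_lipschitz_ge1[OF \<beta>, of 2] by auto
 obtain A2 where A2: "A2 >= 0" "!!x y::real. x \<in> {1/2..2} ==> y \<in> {1/2..2} ==> abs(x powr (-gam) - y powr (-gam)) <= A2 * abs(x - y)"
  using powr_lipschitz_pos[of "1/2" 2 "-gam"] by auto
 define M1 where "M1 = 2 powr \<beta>"
 define M2 where "M2 = (1/2) powr (-gam)"
 define A where "A = M1 * M2 + M2 * A1 * 65 + M1 * A2"
 have M: "M1 >= 0" "M2 >= 0" by (auto simp: M1_def M2_def)
 have A: "A >= 0" "M1 * M2 <= A" "M2 * A1 * 65 + M1 * A2 <= A" using M A1 A2 by (simp_all add: A_def)
 have main: "wt \<beta> gam v B u <= A" "abs(wt \<beta> gam v B u - wt \<beta> gam v B u') <= A * norm (u - u')"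
  if v: "!!u u'. abs(v u - v u') <= norm (u - u')" "v 0 = 1" and B: "16 <= B" "B <= 64" for v B u u'
 proof -
  \<comment> \<open>Clipping v to this range changes nothing where the first factor is nonzero, as
    this forces \<open>norm u < 1/4\<close>, and it makes both powers Lipschitz.\<close>
  define v' where "v' u = max (1/2) (min 2 (v u))" for u
  define a where "a u = max 0 (v' u - B * norm u)" for u
  have vb: "v' u \<in> {1/2..2}" for u by (auto simp: v'_def)
  have vl: "abs(v' u - v' u') <= norm (u - u')" for u u' using v(1)[of u u'] by (auto simp: v'_def)
  have ab: "a u \<in> {0..2}" for u
  proof -
   have "B * norm u >= 0" using B by simp
   hence "v' u - B * norm u <= 2" using vb[of u] by simp
   thus ?thesis by (simp add: a_def)
  qed
  have al: "abs(a u - a u') <= 65 * norm (u - u')" for u u'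
  proof -
   have "abs(B * norm u - B * norm u') = B * abs(norm u - norm u')" using B by (simp add: abs_mult flip: right_diff_distrib)
   also have "... <= 64 * norm (u - u')" using B norm_triangle_ineq3[of u u'] by (intro mult_mono) auto
   finally have 1: "abs(B * norm u - B * norm u') <= 64 * norm (u - u')" .
   have "abs(a u - a u') <= abs((v' u - B * norm u) - (v' u' - B * norm u'))" by (auto simp: a_def)
   also have "... <= 65 * norm (u - u')" using 1 vl[of u u'] by linarith
   finally show ?thesis .
  qed
  have eq: "wt \<beta> gam v B u = a u powr \<beta> * v' u powr (- gam)" for u
  proof (cases "norm u >= 1/4")
   case True
   have "B * norm u >= 16 * (1/4)" using B True by (intro mult_mono) auto
   hence "a u = 0" using vb[of u] by (simp add: a_def)
   moreover have "max 0 (v u - B * norm u) = 0" by (rule wt_zero[OF v B(1)]) (use True in simp)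
   ultimately show ?thesis by (simp add: wt_def)
  next
   case False
   hence "v' u = v u" using v(1)[of u 0] v(2) by (simp add: v'_def)
   thus ?thesis by (simp add: wt_def a_def)
  qed
  have b1: "a u powr \<beta> <= M1" for u unfolding M1_def using ab[of u] \<beta> by (intro powr_mono2) auto
  have b2: "v' u powr (- gam) <= M2" for u unfolding M2_def using vb[of u] gam by (intro powr_mono2') auto
  show "wt \<beta> gam v B u <= A" unfolding eq
   by (rule order_trans[OF mult_mono[OF b1 b2] A(2)]) (use M in auto)
  have "wt \<beta> gam v B u - wt \<beta> gam v B u' = (a u powr \<beta> - a u' powr \<beta>) * v' u powr (- gam) + a u' powr \<beta> * (v' u powr (- gam) - v' u' powr (- gam))"
   unfolding eq by (simp add: algebra_simps)
  also have "\<bar>...\<bar> <= \<bar>a u powr \<beta> - a u' powr \<beta>\<bar> * v' u powr (- gam) + a u' powr \<beta> * \<bar>v' u powr (- gam) - v' u' powr (- gam)\<bar>"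
   by (rule order_trans[OF abs_triangle_ineq]) (simp add: abs_mult)
  also have "... <= (A1 * (65 * norm (u - u'))) * M2 + M1 * (A2 * norm (u - u'))"
  proof (intro add_mono mult_mono b1 b2)
   show "\<bar>a u powr \<beta> - a u' powr \<beta>\<bar> <= A1 * (65 * norm (u - u'))"
    by (rule order_trans[OF A1(2)[OF ab ab] mult_left_mono[OF al A1(1)]])
   show "abs(v' u powr (- gam) - v' u' powr (- gam)) <= A2 * norm (u - u')"
    by (rule order_trans[OF A2(2)[OF vb vb] mult_left_mono[OF vl A2(1)]])
  qed (use M A1 A2 in auto)
  also have "... = (M2 * A1 * 65 + M1 * A2) * norm (u - u')" by (simp add: algebra_simps)
  also have "... <= A * norm (u - u')" by (rule mult_right_mono[OF A(3)]) simp
  finally show "abs(wt \<beta> gam v B u - wt \<beta> gam v B u') <= A * norm (u - u')" .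
 qed
 show ?thesis by (intro exI[of _ A] conjI[OF A(1)] allI impI conjI main) auto
qed

text \<open>Two uses of \<open>wt_lipschitz\<close>: with exponents divided by \<open>tau\<close>
  for the weight itself, and undivided for its tau-th power. In both cases the first exponent is at
  least one.\<close>

lemma cutoff_wt:
 assumes tau: "tau > 0"
 shows "\<exists>A\<ge>0. \<forall>v B. (\<forall>u u'. abs(v u - v u') <= norm (u - u')) --> v 0 = 1 --> (\<forall>u. 0 <= v u) --> 16 <= B --> B <= 64 -->
   cutoff A tau (%u. wt (1 + tau) (3 + tau) v B u powr (1 / tau))"
proof -
 have b: "(1 + tau) / tau >= 1" "(3 + tau) / tau > 0" "1 + tau >= 1" "3 + tau > 0" using tau by (auto simp: field_simps)
 obtain A1 where A1: "A1 >= 0" "!!v B u u'. (\<forall>u u'. abs(v u - v u') <= norm (u - u')) ==> v 0 = 1 ==> 16 <= B ==> B <= 64 ==>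
   wt ((1 + tau) / tau) ((3 + tau) / tau) v B u <= A1 & abs(wt ((1 + tau) / tau) ((3 + tau) / tau) v B u - wt ((1 + tau) / tau) ((3 + tau) / tau) v B u') <= A1 * norm (u - u')"
  using wt_lipschitz[OF b(1,2)] by meson
 obtain A2 where A2: "A2 >= 0" "!!v B u u'. (\<forall>u u'. abs(v u - v u') <= norm (u - u')) ==> v 0 = 1 ==> 16 <= B ==> B <= 64 ==>
   wt (1 + tau) (3 + tau) v B u <= A2 & abs(wt (1 + tau) (3 + tau) v B u - wt (1 + tau) (3 + tau) v B u') <= A2 * norm (u - u')"
  using wt_lipschitz[OF b(3,4)] by meson
 have "cutoff (A1 + A2) tau (%u. wt (1 + tau) (3 + tau) v B u powr (1 / tau))"
  if v: "\<forall>u u'. abs(v u - v u') <= norm (u - u')" "v 0 = 1" "\<forall>u. 0 <= v u" and B: "16 <= B" "B <= 64" for v B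
 proof -
  have eq: "wt (1 + tau) (3 + tau) v B u powr (1 / tau) = wt ((1 + tau) / tau) ((3 + tau) / tau) v B u" for u
  proof -
   have "(- 3 - tau) / tau = - ((3 + tau) / tau)" by (simp add: minus_divide_left)
   thus ?thesis unfolding wt_def by (subst powr_mult) (simp_all add: powr_powr)
  qed
  have nn: "0 <= wt \<beta> gam v B u" for \<beta> gam u by (simp add: wt_def)
  have eq2: "(wt (1 + tau) (3 + tau) v B u powr (1 / tau)) powr tau = wt (1 + tau) (3 + tau) v B u" for u
   using tau nn by (simp add: powr_powr)
  note a1 = A1(2)[OF v(1,2) B] and a2 = A2(2)[OF v(1,2) B]
  have le: "A1 * norm w <= (A1 + A2) * norm w" "A2 * norm w <= (A1 + A2) * norm w" for w :: pt using A1(1) A2(1) by (intro mult_right_mono; simp)+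
  have "continuous_on UNIV (%u. wt ((1 + tau) / tau) ((3 + tau) / tau) v B u)"
   by (rule lipschitz_on_continuous_on[of A1]) (use a1 A1 in \<open>auto simp: lipschitz_on_def dist_norm\<close>)
  hence m: "(%u. wt (1 + tau) (3 + tau) v B u powr (1 / tau)) \<in> bm" unfolding eq by (rule borel_measurable_continuous_onI)
  have z: "wt (1 + tau) (3 + tau) v B u powr (1 / tau) = 0" if "norm u >= 1/2" for u
  proof -
   have "max 0 (v u - B * norm u) = 0" by (rule wt_zero) (use v B that in auto)
   thus ?thesis by (simp add: wt_def)
  qed
  show ?thesis unfolding cutoff_def
  proof (intro conjI allI impI)
   fix u u'
   show "wt (1 + tau) (3 + tau) v B u powr (1 / tau) <= A1 + A2" unfolding eq using conjunct1[OF a1[of u u]] A2(1) by simp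
   show "(wt (1 + tau) (3 + tau) v B u powr (1 / tau)) powr tau <= A1 + A2" unfolding eq2 using conjunct1[OF a2[of u u]] A1(1) by simp
   show "abs(wt (1 + tau) (3 + tau) v B u powr (1 / tau) - wt (1 + tau) (3 + tau) v B u' powr (1 / tau)) <= (A1 + A2) * norm (u - u')"
    unfolding eq using a1[of u u'] le(1)[of "u - u'"] by linarith
   show "\<bar>(wt (1 + tau) (3 + tau) v B u powr (1 / tau)) powr tau - (wt (1 + tau) (3 + tau) v B u' powr (1 / tau)) powr tau\<bar> <= (A1 + A2) * norm (u - u')"
    unfolding eq2 using a2[of u u'] le(2)[of "u - u'"] by linarith
  qed (use m z in auto)
 qed
 thus ?thesis using A1(1) A2(1) by (intro exI[of _ "A1 + A2"]) auto
qed

text \<open>The exponent \<open>1 + tau\<close> makes the kernel and its tau-th root Lipschitz after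
  rescaling. The exponent \<open>- (3 + tau)\<close> then brings the homogeneity to -2, so that the
  integral over the centre z does not depend on x.\<close>

definition kern :: "real => real => pt set => pt => pt => real" where
 "kern tau eps V x z = max 0 (infdist x V - dist x z / eps) powr (1 + tau) * infdist x V powr (- (3 + tau))"

lemma kern_nonneg [simp]: "0 <= kern tau eps V x z" by (simp add: kern_def)

lemma infdist_measurable [measurable]: "(%x::pt. infdist x V) \<in> bm"
 by (rule borel_measurable_continuous_onI) (intro continuous_intros)

lemma kern_measurable [measurable (raw)]:
 assumes [measurable]: "f \<in> measurable M borel" "g \<in> measurable M borel"
 shows "(%w. kern tau eps V (f w) (g w)) \<in> borel_measurable M"
 unfolding kern_def by measurable

lemma kern_support:
 assumes e: "0 < eps" "eps <= 1/2" and k: "kern tau eps V x z ~= 0"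
 shows "dist x z < 2 * eps * infdist z V" "dist x z < eps * infdist x V"
proof -
 have "max 0 (infdist x V - dist x z / eps) ~= 0" using k by (auto simp: kern_def)
 hence 1: "dist x z / eps < infdist x V" by (simp add: max_def split: if_splits)
 thus 2: "dist x z < eps * infdist x V" using e by (simp add: field_simps)
 have "infdist x V <= infdist z V + dist x z" by (metis infdist_triangle)
 hence "eps * infdist x V <= eps * (infdist z V + dist x z)" using e by (intro mult_left_mono) auto
 moreover have "eps * dist x z <= 1/2 * dist x z" using e by (intro mult_right_mono) auto
 ultimately show "dist x z < 2 * eps * infdist z V" using 2 by (simp add: distrib_left)
qed

text \<open>Substituting \<open>z = x + infdist x V *\<^sub>R y\<close> removes x and V altogether.
  The same mass at every x is what later allows the average to be undone with factor one.\<close>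

lemma kern_integral:
 assumes eps: "eps > 0"  and tau: "tau > 0"
 shows "\<exists>c>0. \<forall>V x. infdist x V > 0 --> (LI z. ennreal (kern tau eps V x z)) = ennreal c"
proof -
 let ?g = "%y::pt. ennreal (max 0 (1 - norm y / eps) powr (1 + tau))"
 have le: "?g y <= indicator (ball 0 eps) y" for y
 proof (cases "norm y < eps")
  case True
  have "max 0 (1 - norm y / eps) powr (1 + tau) <= 1 powr (1 + tau)" using tau eps True by (intro powr_mono2) auto
  thus ?thesis using True by simp
 next
  case False
  hence "max 0 (1 - norm y / eps) = 0" using eps by (simp add: field_simps)
  thus ?thesis by simp
 qed
 have "(LI y. ?g y) <= (LI y. indicator (ball (0::pt) eps) y)" by (intro nn_integral_mono le)
 also have "... = emeasure lborel (ball (0::pt) eps)" by simp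
 also have "... < \<infinity>" using emeasure_bounded_finite[of "ball (0::pt) eps"] by (simp add: bounded_ball)
 finally have fin: "(LI y. ?g y) < \<infinity>" .
 have pos: "(LI y. ?g y) > 0"
 proof -
  have "0 < ennreal ((1/2) powr (1 + tau)) * emeasure lborel (ball (0::pt) (eps/2))"
   using eps unit_area_pos by (simp add: emeasure_ball_pt ennreal_zero_less_mult_iff)
  also have "... = (LI y. ennreal ((1/2) powr (1 + tau)) * indicator (ball (0::pt) (eps/2)) y)" by (simp add: nn_integral_cmult)
  also have "... <= (LI y. ?g y)"
  proof (intro nn_integral_mono)
   fix y :: pt
   show "ennreal ((1/2) powr (1 + tau)) * indicator (ball 0 (eps/2)) y <= ?g y"
   proof (cases "norm y < eps/2")
    case True
    hence "norm y / eps <= 1/2" using eps by (simp add: field_simps)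
    hence h: "1/2 <= max 0 (1 - norm y / eps)" by linarith
    have "(1/2) powr (1 + tau) <= max 0 (1 - norm y / eps) powr (1 + tau)" by (rule powr_mono2[OF _ _ h]) (use tau in auto)
    thus ?thesis using True by simp
   qed simp
  qed
  finally show ?thesis .
 qed
 define c where "c = enn2real (LI y. ?g y)"
 have c: "(LI y. ?g y) = ennreal c" using fin by (simp add: c_def)
 have c0: "c > 0" using pos unfolding c by simp
 have main: "(LI z. ennreal (kern tau eps V x z)) = ennreal c" if r: "infdist x V > 0" for V x
 proof -
  let ?r = "infdist x V"
  have "(LI y. ennreal (kern tau eps V x (x + ?r *\<^sub>R y))) = ennreal (1 / ?r\<^sup>2) * (LI z. ennreal (kern tau eps V x z))"
   using r by (intro nn_integral_scale_pt[of "%z. ennreal (kern tau eps V x z)"]) auto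
  moreover have "kern tau eps V x (x + ?r *\<^sub>R y) = ?r powr (-2) * max 0 (1 - norm y / eps) powr (1 + tau)" for y
  proof -
   have "infdist x V - dist x (x + ?r *\<^sub>R y) / eps = ?r * (1 - norm y / eps)" using r by (simp add: dist_norm algebra_simps)
   hence "max 0 (infdist x V - dist x (x + ?r *\<^sub>R y) / eps) = ?r * max 0 (1 - norm y / eps)" using r by (simp add: max_mult_distrib_left)
   hence "kern tau eps V x (x + ?r *\<^sub>R y) = (?r powr (1 + tau) * ?r powr (- (3 + tau))) * max 0 (1 - norm y / eps) powr (1 + tau)"
    using r by (simp add: kern_def powr_mult)
   also have "?r powr (1 + tau) * ?r powr (- (3 + tau)) = ?r powr (-2)" by (simp flip: powr_add)
   finally show ?thesis .
  qed
  ultimately have "ennreal (?r powr (-2)) * ennreal c = ennreal (1 / ?r\<^sup>2) * (LI z. ennreal (kern tau eps V x z))"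
   unfolding c[symmetric] by (simp add: ennreal_mult' nn_integral_cmult)
  moreover have "?r powr (-2) = 1 / ?r\<^sup>2" using r by (simp add: powr_minus powr_numeral divide_inverse)
  ultimately have "ennreal (1 / ?r\<^sup>2) * ennreal c = ennreal (1 / ?r\<^sup>2) * (LI z. ennreal (kern tau eps V x z))" by simp
  thus ?thesis using r by (subst (asm) ennreal_mult_cancel_left) auto
 qed
 show ?thesis using c0 main by blast
qed

section \<open>Rescaling weighted differences to the unit ball\<close>

lemma tp_scale: "R > 0 ==> tp k (R * s) = R ^ (k - 1) * tp k s"
 by (simp add: tp_def zero_less_mult_iff power_mult_distrib)

lemma fdiff_eq: "fdiff Om k h f x = (if cseg x (x + real k *\<^sub>R h) <= Om then dsum k h f x else 0)"
 by (simp add: fdiff_def dsum_def)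

lemma AE_translates:
 fixes N :: "pt set"
 assumes N: "N \<in> null_sets lborel"
 shows "AE x in lborel. \<forall>nv\<le>k. x + real nv *\<^sub>R h \<notin> N"
proof -
 have "AE x in lborel. x + real nv *\<^sub>R h \<notin> N" for nv
 proof -
  have "{x. x - (- (real nv *\<^sub>R h)) \<in> N} \<in> null_sets lborel" by (rule null_sets_translation[OF N])
  from AE_not_in[OF this] show ?thesis by simp
 qed
 hence "AE x in lborel. \<forall>nv\<in>{..k}. x + real nv *\<^sub>R h \<notin> N" by (intro AE_finite_allI) auto
 thus ?thesis by (rule eventually_mono) simp
qed

lemma step_in_segment:
 assumes "nv <= k"
 shows "x + real nv *\<^sub>R h \<in> cseg x (x + real k *\<^sub>R (h::pt))"
proof (cases "k = 0")
 case False
 thus ?thesis using assms unfolding in_segment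
  by (intro exI[of _ "real nv / real k"]) (auto simp: algebra_simps)
qed (use assms in simp)

lemma AE_dsum_eq:
 fixes f g :: "pt => real"
 assumes N: "N \<in> null_sets lborel" and eq: "!!x. x \<in> B ==> x \<notin> N ==> f x = g x"
 shows "AE x in lborel. (\<forall>nv\<le>k. x + real nv *\<^sub>R h \<in> B) --> dsum k h f x = dsum k h g x"
 using AE_translates[OF N, of k h]
proof eventually_elim
 case (elim x)
 show ?case
 proof
  assume "\<forall>nv\<le>k. x + real nv *\<^sub>R h \<in> B"
  thus "dsum k h f x = dsum k h g x" unfolding dsum_def using elim eq by (intro sum.cong) auto
 qed
qed

lemma AE_affine_pt:
 fixes z :: pt
 assumes ae: "AE x in lborel. Q x" and R: "R ~= 0"
 shows "AE u in lborel. Q (z + R *\<^sub>R u)"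
proof -
 obtain N where N: "{x \<in> space lborel. \<not> Q x} <= N" "N \<in> null_sets lborel" using ae by (rule AE_E) (auto simp: null_sets_def)
 have Nm [measurable]: "N \<in> sets borel" using N(2) by (auto simp: null_sets_def)
 have "(LI u. indicator N (z + R *\<^sub>R u)) = ennreal (1 / R\<^sup>2) * (LI x. indicator N x)"
  by (rule nn_integral_scale_pt) (use R in auto)
 also have "(LI x. indicator N x) = emeasure lborel N" by (rule nn_integral_indicator) simp
 finally have 0: "(LI u. indicator N (z + R *\<^sub>R u)) = 0" using N(2) by (simp add: null_sets_def)
 have "(%u. indicator N (z + R *\<^sub>R u) :: ennreal) \<in> borel_measurable lborel" by measurable
 from nn_integral_0_iff_AE[OF this] 0 have "AE u in lborel. (indicator N (z + R *\<^sub>R u) :: ennreal) = 0" by simp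
 thus ?thesis
 proof eventually_elim
  case (elim u)
  hence "z + R *\<^sub>R u \<notin> N" by (simp add: indicator_def split: if_splits)
  thus ?case using N(1) by auto
 qed
qed

lemma kern_scaled:
 assumes r: "infdist z V > 0" and R: "R > 0"
 shows "kern tau eps V (z + R *\<^sub>R u) z = infdist z V powr (-2) * wt (1 + tau) (3 + tau) (%u. infdist (z + R *\<^sub>R u) V / infdist z V) (R / (eps * infdist z V)) u"
proof -
 let ?r = "infdist z V" and ?x = "z + R *\<^sub>R u"
 have "infdist ?x V - dist ?x z / eps = ?r * (infdist ?x V / ?r - R / (eps * ?r) * norm u)"
  using r R by (simp add: dist_norm field_simps)
 hence "max 0 (infdist ?x V - dist ?x z / eps) = ?r * max 0 (infdist ?x V / ?r - R / (eps * ?r) * norm u)"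
  using r by (simp add: max_mult_distrib_left)
 moreover have "infdist ?x V powr (- (3 + tau)) = ?r powr (- (3 + tau)) * (infdist ?x V / ?r) powr (- (3 + tau))"
 proof -
  have "infdist ?x V = ?r * (infdist ?x V / ?r)" using r by simp
  thus ?thesis using r by (metis infdist_nonneg powr_mult)
 qed
 ultimately have "kern tau eps V ?x z = (?r powr (1 + tau) * ?r powr (- (3 + tau))) *
   (max 0 (infdist ?x V / ?r - R / (eps * ?r) * norm u) powr (1 + tau) * (infdist ?x V / ?r) powr (- (3 + tau)))"
  using r by (simp add: kern_def powr_mult)
 also have "?r powr (1 + tau) * ?r powr (- (3 + tau)) = ?r powr (-2)" by (simp flip: powr_add)
 finally show ?thesis by (simp add: wt_def)
qed

lemma infdist_scaled_lipschitz:
 fixes z :: pt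
 assumes r: "infdist z V > 0" and R: "R > 0" and Rr: "R <= infdist z V"
 shows "abs(infdist (z + R *\<^sub>R u) V / infdist z V - infdist (z + R *\<^sub>R u') V / infdist z V) <= norm (u - u')"
proof -
 have "abs(infdist (z + R *\<^sub>R u) V - infdist (z + R *\<^sub>R u') V) <= dist (z + R *\<^sub>R u) (z + R *\<^sub>R u')"
  by (rule infdist_triangle_abs)
 also have "... = R * norm (u - u')" using R by (simp add: dist_norm flip: scaleR_right_diff_distrib)
 also have "... <= infdist z V * norm (u - u')" using Rr by (rule mult_right_mono) simp
 finally show ?thesis using r by (simp add: diff_divide_distrib[symmetric] pos_divide_le_eq mult.commute)
qed

text \<open>Rescaling \<open>ball z R\<close> to the unit ball turns the weighted difference integral of a single-jump function into \<^const>\<open>jumpint\<close>.\<close>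

lemma kern_fdiff_jump:
 assumes r: "infdist z V > 0" and R: "R > 0" and B: "16 <= B" "B = R / (eps * infdist z V)" and tau: "tau > 0"
  and Rr: "R <= infdist z V" and sub: "ball z R <= Om" and h: "real k * norm h <= R / 4"
  and N: "N \<in> null_sets lborel" and a: "polyfun k a" and s [measurable]: "s \<in> bm"
  and m [measurable]: "fdiff Om k h s \<in> bm"
  and rep: "!!x. x \<in> ball z R ==> x \<notin> N ==> s x = a x + d * tp k (n \<bullet> (x - y))"
 shows "(LI x. ennreal (kern tau eps V x z * abs(fdiff Om k h s x) powr tau)) =
  ennreal (R\<^sup>2 * infdist z V powr (-2)) * (pw tau (d * R ^ (k - 1)) *
   jumpint k tau (%u. wt (1 + tau) (3 + tau) (%u. infdist (z + R *\<^sub>R u) V / infdist z V) B u powr (1 / tau)) n (n \<bullet> (y - z) / R) ((1 / R) *\<^sub>R h))"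
proof -
 let ?r = "infdist z V"
 define v where "v u = infdist (z + R *\<^sub>R u) V / ?r" for u
 let ?W = "wt (1 + tau) (3 + tau) v B"
 have R0: "R ~= 0" using R by simp
 define b where "b = n \<bullet> (y - z) / R"
 have vlip: "abs(v u - v u') <= norm (u - u')" for u u'
  unfolding v_def by (rule infdist_scaled_lipschitz[OF r R Rr])
 have v0: "v 0 = 1" using r by (simp add: v_def)
 have Wz: "?W u = 0" if "norm u >= 1/8" for u
  using wt_zero[OF vlip v0 B(1) that] by (simp add: wt_def)
 have Wn: "?W u >= 0" for u by (simp add: wt_def)
 have nb: "n \<bullet> (z + R *\<^sub>R u - y) = R * (n \<bullet> u - b)" for u
 proof -
  have "R * (n \<bullet> u - b) = R * (n \<bullet> u) - n \<bullet> (y - z)" using R by (simp add: b_def right_diff_distrib)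
  thus ?thesis by (simp add: inner_diff_right inner_add_right)
 qed
 have AEd: "AE x in lborel. (\<forall>nv\<le>k. x + real nv *\<^sub>R h \<in> ball z R) --> dsum k h s x = dsum k h (%x. a x + d * tp k (n \<bullet> (x - y))) x"
  by (rule AE_dsum_eq[OF N]) (rule rep)
 have AE: "AE u in lborel. ?W u * abs(fdiff Om k h s (z + R *\<^sub>R u)) powr tau =
   abs(d * R ^ (k - 1)) powr tau * abs(?W u powr (1 / tau) * dsum k (n \<bullet> ((1 / R) *\<^sub>R h)) (tp k) (n \<bullet> u - b)) powr tau"
  using AE_affine_pt[OF AEd R0, of z]
 proof eventually_elim
  case (elim u)
  show ?case
  proof (cases "norm u >= 1/8")
   case True
   thus ?thesis using Wz tau by simp
  next
   case False
   have inb: "z + R *\<^sub>R u + t *\<^sub>R h \<in> ball z R" if "0 <= t" "t <= real k" for t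
   proof -
    have "norm (R *\<^sub>R u + t *\<^sub>R h) <= R * norm u + t * norm h" using norm_triangle_ineq[of "R *\<^sub>R u" "t *\<^sub>R h"] R that by simp
    also have "R * norm u <= R * (1/8)" using False R by (intro mult_left_mono) auto
    also have "t * norm h <= real k * norm h" using that by (intro mult_right_mono) auto
    finally have "norm (R *\<^sub>R u + t *\<^sub>R h) < R" using h R by linarith
    hence "dist (z + (R *\<^sub>R u + t *\<^sub>R h)) z < R" by (simp add: dist_norm)
    thus ?thesis by (simp add: dist_commute add.assoc)
   qed
   have seg: "cseg (z + R *\<^sub>R u) (z + R *\<^sub>R u + real k *\<^sub>R h) <= Om"
   proof (rule subset_trans[OF _ sub], rule closed_segment_subset)
    show "z + R *\<^sub>R u \<in> ball z R" using inb[of 0] by simp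
    show "z + R *\<^sub>R u + real k *\<^sub>R h \<in> ball z R" using inb[of "real k"] by simp
   qed simp
   have "\<forall>nv\<le>k. z + R *\<^sub>R u + real nv *\<^sub>R h \<in> ball z R" using inb by simp
   hence ds: "dsum k h s (z + R *\<^sub>R u) = dsum k h (%x. a x + d * tp k (n \<bullet> (x - y))) (z + R *\<^sub>R u)" using elim by (rule rev_mp)
   have "dsum k h (%x. a x + d * tp k (n \<bullet> (x - y))) (z + R *\<^sub>R u) = d * dsum k h (%x. tp k (n \<bullet> (x - y))) (z + R *\<^sub>R u)"
    using a by (simp add: dsum_add dsum_cmult polyfun_def)
   also have "dsum k h (%x. tp k (n \<bullet> (x - y))) (z + R *\<^sub>R u) = dsum k ((1 / R) *\<^sub>R h) (%u. tp k (n \<bullet> (z + R *\<^sub>R u - y))) u"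
    using dsum_affine[of k "(1 / R) *\<^sub>R h" "%x. tp k (n \<bullet> (x - y))" z R u] R by simp
   also have "... = R ^ (k - 1) * dsum k ((1 / R) *\<^sub>R h) (%u. tp k (n \<bullet> u - b)) u"
    unfolding nb tp_scale[OF R] dsum_cmult ..
   also have "dsum k ((1 / R) *\<^sub>R h) (%u. tp k (n \<bullet> u - b)) u = dsum k (n \<bullet> ((1 / R) *\<^sub>R h)) (tp k) (n \<bullet> u - b)" by (rule dsum_inner)
   finally have F: "fdiff Om k h s (z + R *\<^sub>R u) = (d * R ^ (k - 1)) * dsum k (n \<bullet> ((1 / R) *\<^sub>R h)) (tp k) (n \<bullet> u - b)"
    unfolding fdiff_eq using seg ds by simp
   have W: "(?W u powr (1 / tau)) powr tau = ?W u" using Wn tau by (simp add: powr_powr)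
   define D where "D = dsum k (n \<bullet> ((1 / R) *\<^sub>R h)) (tp k) (n \<bullet> u - b)"
   have "abs(?W u powr (1 / tau) * D) powr tau = ?W u * abs(D) powr tau" by (simp add: abs_mult powr_mult W)
   moreover have "abs(d * R ^ (k - 1) * D) powr tau = abs(d * R ^ (k - 1)) powr tau * abs(D) powr tau" by (subst abs_mult) (rule powr_mult; simp)
   ultimately show ?thesis unfolding F D_def[symmetric] by (simp only: ac_simps)
  qed
 qed
 have k: "kern tau eps V (z + R *\<^sub>R u) z = ?r powr (-2) * ?W u" for u
  unfolding v_def B(2) by (rule kern_scaled[OF r R])
 have "(LI u. ennreal (kern tau eps V (z + R *\<^sub>R u) z * abs(fdiff Om k h s (z + R *\<^sub>R u)) powr tau)) =
   ennreal (1 / R\<^sup>2) * (LI x. ennreal (kern tau eps V x z * abs(fdiff Om k h s x) powr tau))"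
  by (rule nn_integral_scale_pt[of "%x. ennreal (kern tau eps V x z * abs(fdiff Om k h s x) powr tau)"]) (use R in auto)
 moreover have "(LI u. ennreal (kern tau eps V (z + R *\<^sub>R u) z * abs(fdiff Om k h s (z + R *\<^sub>R u)) powr tau)) =
   (LI u. ennreal (?r powr (-2) * abs(d * R ^ (k - 1)) powr tau) * pw tau (?W u powr (1 / tau) * dsum k (n \<bullet> ((1 / R) *\<^sub>R h)) (tp k) (n \<bullet> u - b)))"
 proof (rule nn_integral_cong_AE)
  show "AE u in lborel. ennreal (kern tau eps V (z + R *\<^sub>R u) z * abs(fdiff Om k h s (z + R *\<^sub>R u)) powr tau) =
   ennreal (?r powr (-2) * abs(d * R ^ (k - 1)) powr tau) * pw tau (?W u powr (1 / tau) * dsum k (n \<bullet> ((1 / R) *\<^sub>R h)) (tp k) (n \<bullet> u - b))"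
   using AE
  proof eventually_elim
   case (elim u)
   show ?case unfolding k mult.assoc[of "?r powr (-2)"] elim by (subst ennreal_mult[symmetric]) simp_all
  qed
 qed
 moreover have Wm [measurable]: "?W \<in> bm" unfolding wt_def[abs_def] v_def[abs_def] by measurable
 moreover have "(LI u. ennreal (?r powr (-2) * abs(d * R ^ (k - 1)) powr tau) * pw tau (?W u powr (1 / tau) * dsum k (n \<bullet> ((1 / R) *\<^sub>R h)) (tp k) (n \<bullet> u - b)))
   = ennreal (?r powr (-2) * abs(d * R ^ (k - 1)) powr tau) * jumpint k tau (%u. ?W u powr (1 / tau)) n b ((1 / R) *\<^sub>R h)"
  unfolding jumpint_def by (rule nn_integral_cmult) measurable
 ultimately have e: "ennreal (1 / R\<^sup>2) * (LI x. ennreal (kern tau eps V x z * abs(fdiff Om k h s x) powr tau)) =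
   ennreal (?r powr (-2) * abs(d * R ^ (k - 1)) powr tau) * jumpint k tau (%u. ?W u powr (1 / tau)) n b ((1 / R) *\<^sub>R h)" by simp
 have "(LI x. ennreal (kern tau eps V x z * abs(fdiff Om k h s x) powr tau)) =
   ennreal (R\<^sup>2) * (ennreal (1 / R\<^sup>2) * (LI x. ennreal (kern tau eps V x z * abs(fdiff Om k h s x) powr tau)))"
  using R by (simp add: mult.assoc[symmetric] flip: ennreal_mult)
 thus ?thesis unfolding e b_def[symmetric] v_def[abs_def, symmetric] by (simp add: ennreal_mult mult.assoc)
qed

text \<open>The points whose whole segment stays in Om form an intersection of preimages of a closed
  set under translations, hence a closed set.\<close>

lemma fdiff_measurable:
 assumes Om: "closed Om" and [measurable]: "s \<in> bm"
 shows "fdiff Om k h s \<in> bm"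
proof -
 have "closed {x. cseg x (x + real k *\<^sub>R h) <= Om}"
 proof -
  have eq: "{x. cseg x (x + real k *\<^sub>R h) <= Om} = (\<Inter>t\<in>{0..1}. (%x. x + (t * real k) *\<^sub>R h) -` Om)"
  proof -
   have "cseg x (x + real k *\<^sub>R h) = (%t. x + (t * real k) *\<^sub>R h) ` {0..1}" for x
    by (auto simp: closed_segment_image_interval algebra_simps image_def)
   thus ?thesis by auto
  qed
  show ?thesis unfolding eq by (intro closed_INT ballI closed_vimage Om continuous_intros)
 qed
 hence [measurable]: "{x. cseg x (x + real k *\<^sub>R h) <= Om} \<in> sets borel" by (rule borel_closed)
 have "(%x. if x \<in> {x. cseg x (x + real k *\<^sub>R h) <= Om} then dsum k h s x else 0) \<in> bm" by measurable
 thus ?thesis unfolding fdiff_eq[abs_def] mem_Collect_eq .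
qed

text \<open>\<open>LC\<close> and \<open>CW\<close> are the conclusions of
  \<open>local_comparison\<close> and \<open>cutoff_wt\<close>. Taking them as hypotheses fixes the
  constants A and C before ball and splines are chosen.\<close>

lemma local_step_rep:
 assumes LC: "!!w f a c1 c2 n1 n2 b1 b2 F h. cutoff A tau w ==> localpair k tau f a c1 c2 n1 n2 b1 b2 F ==> h ~= 0 ==> norm h <= 1/4 ==>
   enn_powr (pw tau c1 * jumpint k tau w n1 b1 h) (1 / max 1 tau) <=
   enn_powr (pw tau c2 * jumpint k tau w n2 b2 h) (1 / max 1 tau)
    + enn_powr (ennreal (C * F * norm h powr (tau * (real k - 1) + 1))) (1 / max 1 tau)"
  and CW: "!!v B. (\<forall>u u'. abs(v u - v u') <= norm (u - u')) ==> v 0 = 1 ==> (\<forall>u. 0 <= v u) ==> 16 <= B ==> B <= 64 ==>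
   cutoff A tau (%u. wt (1 + tau) (3 + tau) v B u powr (1 / tau))"
  and C: "C > 0" and k: "k >= 1" and tau: "tau > 0"
  and r: "infdist z V > 0" and R: "R > 0" and B: "16 <= R / (eps * infdist z V)" "R / (eps * infdist z V) <= 64"
  and Rr: "R <= infdist z V" and sub: "ball z R <= Om" and Om: "closed Om" and h: "real k * norm h <= R / 4" "h ~= 0"
  and N: "N \<in> null_sets lborel" and a: "polyfun k a1" "polyfun k a2"
  and m [measurable]: "a1 \<in> bm" "a2 \<in> bm" "s1 \<in> bm" "s2 \<in> bm"
  and n: "norm n1 = 1" "norm n2 = 1" "n1 \<bullet> n2 >= 0" and y: "dist y1 z <= R / 4" "dist y2 z <= R / 4"
  and rep1: "!!x. x \<in> ball z R ==> x \<notin> N ==> s1 x = a1 x + d1 * tp k (n1 \<bullet> (x - y1))"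
  and rep2: "!!x. x \<in> ball z R ==> x \<notin> N ==> s2 x = a2 x + d2 * tp k (n2 \<bullet> (x - y2))"
 shows "enn_powr (LI x. ennreal (kern tau eps V x z * abs(fdiff Om k h s1 x) powr tau)) (1 / max 1 tau) <=
  enn_powr (LI x. ennreal (kern tau eps V x z * abs(fdiff Om k h s2 x) powr tau)) (1 / max 1 tau) +
  enn_powr (ennreal (C * infdist z V powr (-2) * norm ((1 / R) *\<^sub>R h) powr (tau * (real k - 1) + 1)) *
    (\<integral>\<^sup>+ x\<in>ball z R. pw tau (s1 x - s2 x) \<partial>lborel)) (1 / max 1 tau)"
proof (cases "(\<integral>\<^sup>+ x\<in>ball z R. pw tau (s1 x - s2 x) \<partial>lborel) = \<infinity>")
 case True
 \<comment> \<open>An infinite integral makes the right hand side infinite; a finite one provides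
   the real number F of \<open>localpair\<close>.\<close>
 define K where "K = C * infdist z V powr (-2) * norm ((1 / R) *\<^sub>R h) powr (tau * (real k - 1) + 1)"
 have "K > 0" unfolding K_def using C r R h by simp
 hence "ennreal K * \<infinity> = \<infinity>" by (simp add: ennreal_mult_top)
 thus ?thesis unfolding True K_def[symmetric] by simp
next
 case False
 let ?r = "infdist z V" and ?h = "(1 / R) *\<^sub>R h" and ?q = "1 / max 1 tau"
 define v where "v u = infdist (z + R *\<^sub>R u) V / ?r" for u
 define w where "w u = wt (1 + tau) (3 + tau) v (R / (eps * ?r)) u powr (1 / tau)" for u
 have R0: "R ~= 0" using R by simp
 have vlip: "abs(v u - v u') <= norm (u - u')" for u u'
  unfolding v_def by (rule infdist_scaled_lipschitz[OF r R Rr])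
 have cut: "cutoff A tau w" unfolding w_def[abs_def] using r vlip B by (intro CW) (auto simp: v_def infdist_nonneg intro!: divide_nonneg_nonneg)
 define f where "f u = s1 (z + R *\<^sub>R u) - s2 (z + R *\<^sub>R u)" for u
 define a where "a u = a1 (z + R *\<^sub>R u) - a2 (z + R *\<^sub>R u)" for u
 define F where "F = enn2real (\<integral>\<^sup>+ u\<in>ball 0 1. pw tau (f u) \<partial>lborel)"
 have sc: "(\<integral>\<^sup>+ u\<in>ball 0 1. pw tau (f u) \<partial>lborel) = ennreal (1 / R\<^sup>2) * (\<integral>\<^sup>+ x\<in>ball z R. pw tau (s1 x - s2 x) \<partial>lborel)"
 proof -
  have i: "indicator (ball z R) (z + R *\<^sub>R u) = (indicator (ball 0 1) u :: ennreal)" for u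
   using R by (simp add: indicator_def dist_norm)
  show ?thesis using nn_integral_scale_pt[of "%x. pw tau (s1 x - s2 x) * indicator (ball z R) x" R z] R
   by (simp add: i f_def)
 qed
 have F: "(\<integral>\<^sup>+ u\<in>ball 0 1. pw tau (f u) \<partial>lborel) = ennreal F"
 proof -
  have "(\<integral>\<^sup>+ u\<in>ball 0 1. pw tau (f u) \<partial>lborel) < top"
   unfolding sc using False by (intro ennreal_mult_less_top[THEN iffD2]) (simp add: less_top)
  thus ?thesis by (simp add: F_def)
 qed
 have nb: "n \<bullet> (z + R *\<^sub>R u - y) = R * (n \<bullet> u - n \<bullet> (y - z) / R)" for n y u :: pt
 proof -
  have "R * (n \<bullet> u - n \<bullet> (y - z) / R) = R * (n \<bullet> u) - n \<bullet> (y - z)" using R by (simp add: right_diff_distrib)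
  thus ?thesis by (simp add: inner_diff_right inner_add_right)
 qed
 have bb: "abs(n \<bullet> (y - z) / R) <= 1/4" if "norm n = 1" "dist y z <= R / 4" for n y :: pt
 proof -
  have "abs(n \<bullet> (y - z)) <= norm n * norm (y - z)" by (rule Cauchy_Schwarz_ineq2)
  also have "... <= R / 4" using that by (simp add: dist_norm)
  finally show ?thesis using R by (simp add: field_simps)
 qed
 have lp: "localpair k tau f a (d1 * R ^ (k - 1)) (d2 * R ^ (k - 1)) n1 n2 (n1 \<bullet> (y1 - z) / R) (n2 \<bullet> (y2 - z) / R) F"
  unfolding localpair_def
 proof (intro conjI)
  show "polyfun k a" unfolding a_def[abs_def] by (intro polyfun_diff polyfun_affine a)
  show "a \<in> bm" unfolding a_def[abs_def] by measurable
  show "f \<in> bm" unfolding f_def[abs_def] by measurable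
  show "AE u in lborel. u \<in> ball 0 1 --> f u = a u + d1 * R ^ (k - 1) * tp k (n1 \<bullet> u - n1 \<bullet> (y1 - z) / R) - d2 * R ^ (k - 1) * tp k (n2 \<bullet> u - n2 \<bullet> (y2 - z) / R)"
   using AE_affine_pt[OF AE_not_in[OF N] R0, of z]
  proof eventually_elim
   case (elim u)
   show ?case
   proof
    assume "u \<in> ball 0 1"
    hence "z + R *\<^sub>R u \<in> ball z R" using R by (simp add: dist_norm)
    thus "f u = a u + d1 * R ^ (k - 1) * tp k (n1 \<bullet> u - n1 \<bullet> (y1 - z) / R) - d2 * R ^ (k - 1) * tp k (n2 \<bullet> u - n2 \<bullet> (y2 - z) / R)"
     unfolding f_def a_def using rep1[OF _ elim] rep2[OF _ elim] unfolding nb tp_scale[OF R] by simp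
   qed
  qed
 qed (use n y bb F in \<open>auto simp: F_def\<close>)
 have h': "norm ?h <= 1/4"
 proof -
  have "1 * norm h <= real k * norm h" using k by (intro mult_right_mono) auto
  hence "norm h <= R / 4" using h(1) by linarith
  thus ?thesis using R by (simp add: field_simps)
 qed
 have h0: "?h ~= 0" using h R by simp
 note loc = LC[OF cut lp h0 h']
 have G: "(LI x. ennreal (kern tau eps V x z * abs(fdiff Om k h s x) powr tau)) =
   ennreal (R\<^sup>2 * ?r powr (-2)) * (pw tau (d * R ^ (k - 1)) * jumpint k tau w n (n \<bullet> (y - z) / R) ?h)"
  if "polyfun k a" "s \<in> bm" "!!x. x \<in> ball z R ==> x \<notin> N ==> s x = a x + d * tp k (n \<bullet> (x - y))" for s a d n y
  unfolding w_def[abs_def] v_def[abs_def]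
  by (rule kern_fdiff_jump[OF r R B(1) refl tau Rr sub h(1) N that(1,2) fdiff_measurable[OF Om that(2)] that(3)])
 have q: "?q > 0" by simp
 have e: "ennreal (R\<^sup>2 * ?r powr (-2)) * ennreal (C * F * norm ?h powr (tau * (real k - 1) + 1)) =
   ennreal (C * ?r powr (-2) * norm ?h powr (tau * (real k - 1) + 1)) * (\<integral>\<^sup>+ x\<in>ball z R. pw tau (s1 x - s2 x) \<partial>lborel)"
 proof -
  have "(\<integral>\<^sup>+ x\<in>ball z R. pw tau (s1 x - s2 x) \<partial>lborel) = ennreal (R\<^sup>2) * ennreal F"
   unfolding F[symmetric] sc using R by (simp add: mult.assoc[symmetric] flip: ennreal_mult)
  also have "... = ennreal (R\<^sup>2 * F)" by (rule ennreal_mult[symmetric]) (simp_all add: F_def)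
  finally have I: "(\<integral>\<^sup>+ x\<in>ball z R. pw tau (s1 x - s2 x) \<partial>lborel) = ennreal (R\<^sup>2 * F)" .
  have "F >= 0" by (simp add: F_def)
  thus ?thesis unfolding I using C by (subst (1 2) ennreal_mult[symmetric]) (simp_all add: ac_simps)
 qed
 have "enn_powr (ennreal (R\<^sup>2 * ?r powr (-2)) * (pw tau (d1 * R ^ (k - 1)) * jumpint k tau w n1 (n1 \<bullet> (y1 - z) / R) ?h)) ?q
  <= enn_powr (ennreal (R\<^sup>2 * ?r powr (-2)) * (pw tau (d2 * R ^ (k - 1)) * jumpint k tau w n2 (n2 \<bullet> (y2 - z) / R) ?h)) ?q
   + enn_powr (ennreal (R\<^sup>2 * ?r powr (-2)) * ennreal (C * F * norm ?h powr (tau * (real k - 1) + 1))) ?q"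
  using mult_left_mono[OF loc, of "enn_powr (ennreal (R\<^sup>2 * ?r powr (-2))) ?q"] unfolding enn_powr_mult[OF q, of "ennreal (R\<^sup>2 * ?r powr (-2))"] distrib_left by simp
 note X = this
 have G1: "(LI x. ennreal (kern tau eps V x z * abs(fdiff Om k h s1 x) powr tau)) = ennreal (R\<^sup>2 * ?r powr (-2)) * (pw tau (d1 * R ^ (k - 1)) * jumpint k tau w n1 (n1 \<bullet> (y1 - z) / R) ?h)" by (rule G[OF a(1) m(3) rep1])
 have G2: "(LI x. ennreal (kern tau eps V x z * abs(fdiff Om k h s2 x) powr tau)) = ennreal (R\<^sup>2 * ?r powr (-2)) * (pw tau (d2 * R ^ (k - 1)) * jumpint k tau w n2 (n2 \<bullet> (y2 - z) / R) ?h)" by (rule G[OF a(2) m(4) rep2])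
 show ?thesis using X unfolding G1 G2 e .
qed

text \<open>The piecewise polynomial s is the Borel representative used in the integrals; S is an
  almost everywhere equal function that carries the smoothness.\<close>

definition splinerep :: "real => nat => pt set => nat => nat => (nat => pt set) => (nat => (pt \<times> pt) set) => (pt => real) => bool" where
 "splinerep kp M Om k m R E s \<longleftrightarrow> cells kp M Om m R E &
   (\<exists>P S. s = pcw k m R P & (AE x in lborel. S x = s x) & (k >= 2 --> C_on (k - 2) Om S))"

definition crosses :: "nat => (nat => pt set) => pt => bool" where
 "crosses m R y \<longleftrightarrow> (\<exists>i<m. \<exists>j<m. i ~= j & y \<in> frontier (R i) & y \<in> frontier (R j))"

lemma splinerep_cells: "splinerep kp M Om k m R E s ==> cells kp M Om m R E"
 by (simp add: splinerep_def)

lemma splinerep_cross: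
 assumes s: "splinerep kp M Om k m R E s" and V: "finite V" "verts m E <= V" and kp: "kp > 0" and k: "k >= 1"
  and y: "crosses m R y" and r: "infdist y V > 0"
 shows "\<exists>nv a d. norm nv = 1 & nv \<bullet> w >= 0 & ball y (kp * infdist y V) <= Om & polyfun k a & a \<in> bm &
   (\<forall>x\<in>ball y (kp * infdist y V) - skelset m R. s x = a x + d * tp k (nv \<bullet> (x - y)))"
proof -
 obtain P S where c: "cells kp M Om m R E" and S: "s = pcw k m R P" "AE x in lborel. S x = s x" "k >= 2 --> C_on (k - 2) Om S"
  using s unfolding splinerep_def by (elim exE conjE)
 obtain i j where ij: "i < m" "j < m" "i ~= j" "y \<in> frontier (R i)" "y \<in> frontier (R j)"
  using y unfolding crosses_def by (elim exE conjE)
 have ae: "AE x in lborel. S x = pcw k m R P x" using S(2) unfolding S(1) .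
 obtain nv a d where *: "norm nv = 1" "nv \<bullet> w >= 0" "ball y (kp * infdist y V) <= Om"
   "\<forall>x\<in>ball y (kp * infdist y V) - skelset m R. pcw k m R P x = poly2 k a x + d * tp k (nv \<bullet> (x - y))"
  using crossing_rep_oriented[OF c V kp ij r ae S(3) k, of w] by (elim exE conjE)
 have "poly2 k a \<in> bm" by (rule borel_measurable_continuous_onI[OF continuous_poly2])
 thus ?thesis using * polyfun_poly2[of k a] unfolding S(1)
  by (intro exI[of _ nv] exI[of _ "poly2 k a"] exI[of _ d] conjI)
qed

lemma splinerep_no_cross:
 assumes s: "splinerep kp M Om k m R E s" and K: "connected K" "K <= Om" "K ~= {}" and nc: "!!y. y \<in> K ==> \<not> crosses m R y"
 shows "\<exists>a. polyfun k a & a \<in> bm & (\<forall>x\<in>K - skelset m R. s x = a x)"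
proof -
 obtain P S where c: "cells kp M Om m R E" and S: "s = pcw k m R P"
  using s unfolding splinerep_def by (elim exE conjE)
 have "\<exists>j<m. K <= closure (R j)"
  by (rule no_crossing[OF c K]) (use nc in \<open>auto simp: crosses_def\<close>)
 then obtain j where j: "j < m" "K <= closure (R j)" by blast
 have "s x = poly2 k (P j) x" if "x \<in> K - skelset m R" for x
  unfolding S using j that by (intro pcw_cell[OF c j(1)]) auto
 moreover have "poly2 k (P j) \<in> bm" by (rule borel_measurable_continuous_onI[OF continuous_poly2])
 ultimately show ?thesis using polyfun_poly2[of k "P j"] by blast
qed

lemma splinerep_measurable: "splinerep kp M Om k m R E s ==> s \<in> bm"
 using pcw_measurable by (auto simp: splinerep_def)

lemma splinerep_outside: "splinerep kp M Om k m R E s ==> x \<notin> Om ==> s x = 0"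
 using pcw_outside cellsD(5) unfolding splinerep_def by metis

lemma AE_dsum_0_no_cross:
 assumes s: "splinerep kp M Om k m R E s"
 shows "AE x in lborel. (\<forall>y\<in>cseg x (x + real k *\<^sub>R h). y \<in> B & \<not> crosses m R y) --> fdiff Om k h s x = 0"
 using AE_translates[OF skelset_null(1)[OF splinerep_cells[OF s]], of k h]
proof eventually_elim
 case (elim x)
 show ?case
 proof
  assume nc: "\<forall>y\<in>cseg x (x + real k *\<^sub>R h). y \<in> B & \<not> crosses m R y"
  show "fdiff Om k h s x = 0"
  proof (cases "cseg x (x + real k *\<^sub>R h) <= Om")
   case True
   obtain a where a: "polyfun k a" "\<forall>y\<in>cseg x (x + real k *\<^sub>R h) - skelset m R. s y = a y"
    using splinerep_no_cross[OF s _ True] nc by auto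
   have "dsum k h s x = dsum k h a x"
    unfolding dsum_def
   proof (rule sum.cong[OF refl])
    fix nv assume "nv \<in> {..k}"
    hence nv: "nv <= k" by simp
    have "x + real nv *\<^sub>R h \<in> cseg x (x + real k *\<^sub>R h)" by (rule step_in_segment[OF nv])
    thus "(-1) ^ (k + nv) * real (k choose nv) * s (x + real nv *\<^sub>R h) = (-1) ^ (k + nv) * real (k choose nv) * a (x + real nv *\<^sub>R h)"
     using a(2) elim nv by simp
   qed
   thus ?thesis using a(1) True by (simp add: fdiff_eq polyfun_def)
  qed (simp add: fdiff_eq)
 qed
qed

text \<open>Let r be the distance of z from V. If s1 has no crossing within
  \<open>rho * r / 16\<close> of z, the left side vanishes. If moreover s2 has a crossing within
  \<open>rho * r / 4\<close>, both are single jumps on the ball of radius \<open>rho * r\<close>.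
  Otherwise s2 is a polynomial on the ball of radius \<open>rho * r / 4\<close> and counts as a jump
  of height zero along the line of s1. The two radii are 64 and 16 times the kernel width
  \<open>rho / 64 * r\<close>.\<close>

lemma local_step:
 assumes k: "k >= 1" and tau: "tau > 0" and kp: "0 < kp" "kp <= 1"
 defines "rho \<equiv> kp / 4"
 shows "\<exists>C>0. \<forall>M Om V m1 R1 E1 s1 m2 R2 E2 s2 h z.
   splinerep kp M Om k m1 R1 E1 s1 --> splinerep kp M Om k m2 R2 E2 s2 --> finite V --> verts m1 E1 <= V --> verts m2 E2 <= V -->
   h ~= 0 --> 32 * real k * norm h <= rho * infdist z V -->
   enn_powr (LI x. ennreal (kern tau (rho / 64) V x z * abs(fdiff Om k h s1 x) powr tau)) (1 / max 1 tau) <=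
   enn_powr (LI x. ennreal (kern tau (rho / 64) V x z * abs(fdiff Om k h s2 x) powr tau)) (1 / max 1 tau) +
   enn_powr (ennreal (C * infdist z V powr (-2) * (norm h / infdist z V) powr (tau * (real k - 1) + 1)) *
    (\<integral>\<^sup>+ x\<in>ball z (rho * infdist z V). pw tau (s1 x - s2 x) \<partial>lborel)) (1 / max 1 tau)"
proof -
 obtain A where A: "A >= 0" and CW: "!!v B. (\<forall>u u'. abs(v u - v u') <= norm (u - u')) ==> v 0 = 1 ==> (\<forall>u. 0 <= v u) ==> 16 <= B ==> B <= 64 ==>
   cutoff A tau (%u. wt (1 + tau) (3 + tau) v B u powr (1 / tau))"
  using cutoff_wt[OF tau] by meson
 obtain C where C: "C > 0" and LC: "!!w f a c1 c2 n1 n2 b1 b2 F h. cutoff A tau w ==> localpair k tau f a c1 c2 n1 n2 b1 b2 F ==> h ~= 0 ==> norm h <= 1/4 ==>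
   enn_powr (pw tau c1 * jumpint k tau w n1 b1 h) (1 / max 1 tau) <=
   enn_powr (pw tau c2 * jumpint k tau w n2 b2 h) (1 / max 1 tau)
    + enn_powr (ennreal (C * F * norm h powr (tau * (real k - 1) + 1))) (1 / max 1 tau)"
  using local_comparison[OF k tau A] by meson
 define alp where "alp = tau * (real k - 1) + 1"
 have alp: "alp > 0" using k tau by (simp add: alp_def add_nonneg_pos)
 have rho: "0 < rho" "rho <= 1/4" "kp = 4 * rho" using kp by (auto simp: rho_def)
 define C' where "C' = C * (4 / rho) powr alp"
 have C': "C' > 0" using C rho by (simp add: C'_def)
 show ?thesis unfolding alp_def[symmetric]
 proof (intro exI[of _ C'] conjI[OF C'] allI impI, goal_cases)
  case (1 M Om V m1 R1 E1 s1 m2 R2 E2 s2 h z)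
  note s1 = 1(1) and s2 = 1(2) and V = 1(3-5) and h = 1(6,7)
  let ?r = "infdist z V"
  have "32 * real k * norm h > 0" using h k by simp
  hence "rho * ?r > 0" using h by linarith
  hence r: "?r > 0" using rho by (simp add: zero_less_mult_iff)
  have Om: "closed Om" using cellsD(6)[OF splinerep_cells[OF s1]] .
  have m [measurable]: "s1 \<in> bm" "s2 \<in> bm" using splinerep_measurable s1 s2 by blast+
  have rr: "rho * ?r <= ?r" using rho r by (simp add: mult_le_cancel_right1)
  \<comment> \<open>The distance from V varies little near z, and \<open>kp\<close> is four times
    \<open>rho\<close>; so the ball about a crossing y, on which the spline is a single jump,
    contains the ball about z.\<close>
  have inr: "kp * infdist y V >= rho * ?r + dist y z" "infdist y V > 0" if "dist y z < rho * ?r / 4" for y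
  proof -
   have "?r <= infdist y V + dist y z" by (metis infdist_triangle dist_commute)
   hence "infdist y V >= ?r - rho * ?r / 4" using that by linarith
   moreover have "rho * ?r <= 1/4 * ?r" using rho r by (intro mult_right_mono) auto
   ultimately have i: "infdist y V >= ?r / 2" using r by linarith
   thus "infdist y V > 0" using r by linarith
   have "kp * (?r / 2) <= kp * infdist y V" using i kp by (intro mult_left_mono) auto
   moreover have "kp * (?r / 2) = 2 * (rho * ?r)" by (simp add: rho(3))
   ultimately show "kp * infdist y V >= rho * ?r + dist y z" using that \<open>rho * ?r > 0\<close> by linarith
  qed
  have bs: "ball z R <= ball y (kp * infdist y V)" if "dist y z < rho * ?r / 4" "R <= rho * ?r" for y R
  proof
   fix x assume "x \<in> ball z R"
   hence "dist z x < R" by simp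
   moreover have "dist y x <= dist y z + dist z x" by (rule dist_triangle)
   ultimately show "x \<in> ball y (kp * infdist y V)" using inr(1)[OF that(1)] that(2) by simp
  qed
  have fin: "enn_powr (LI x. ennreal (kern tau (rho / 64) V x z * abs(fdiff Om k h s1 x) powr tau)) (1 / max 1 tau) <=
   enn_powr (LI x. ennreal (kern tau (rho / 64) V x z * abs(fdiff Om k h s2 x) powr tau)) (1 / max 1 tau) +
   enn_powr (ennreal (C' * ?r powr (-2) * (norm h / ?r) powr alp) *
    (\<integral>\<^sup>+ x\<in>ball z (rho * ?r). pw tau (s1 x - s2 x) \<partial>lborel)) (1 / max 1 tau)"
   if R: "R = rho * ?r | R = rho * ?r / 4" and N: "N \<in> null_sets lborel" and sub: "ball z R <= Om"
    and a: "polyfun k a1" "polyfun k a2" "a1 \<in> bm" "a2 \<in> bm"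
    and n: "norm n1 = 1" "norm n2 = 1" "n1 \<bullet> n2 >= 0" "dist y1 z <= R / 4" "dist y2 z <= R / 4"
    and rep: "!!x. x \<in> ball z R ==> x \<notin> N ==> s1 x = a1 x + d1 * tp k (n1 \<bullet> (x - y1))"
     "!!x. x \<in> ball z R ==> x \<notin> N ==> s2 x = a2 x + d2 * tp k (n2 \<bullet> (x - y2))"
   for R N a1 a2 n1 n2 y1 y2 d1 d2
  proof -
   have R0: "R > 0" "rho * ?r / 4 <= R" "R <= rho * ?r" "R <= ?r"
    using R \<open>rho * ?r > 0\<close> rr by (elim disjE; linarith)+
   have "R / (rho * ?r) = 1 | R / (rho * ?r) = 1 / 4" using R r rho(1) by auto
   moreover have "R / (rho / 64 * ?r) = 64 * (R / (rho * ?r))" by simp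
   ultimately have B: "16 <= R / (rho / 64 * ?r)" "R / (rho / 64 * ?r) <= 64" by auto
   have "32 * (real k * norm h) <= rho * ?r" using h(2) by (simp only: mult.assoc)
   hence hk: "real k * norm h <= R / 4" using R0(1,2) by linarith
   have n1: "norm ((1 / R) *\<^sub>R h) powr alp <= (4 / rho) powr alp * (norm h / ?r) powr alp"
   proof -
    have "norm ((1 / R) *\<^sub>R h) = norm h / R" using R0 by simp
    also have "... <= norm h / (rho * ?r / 4)" using R0 rho r by (intro divide_left_mono) auto
    also have "... = (4 / rho) * (norm h / ?r)" by simp
    finally have "norm ((1 / R) *\<^sub>R h) powr alp <= ((4 / rho) * (norm h / ?r)) powr alp" using alp by (intro powr_mono2) auto
    also have "... = (4 / rho) powr alp * (norm h / ?r) powr alp" using rho r by (intro powr_mult)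
    finally show ?thesis .
   qed
   have "C * ?r powr (-2) * norm ((1 / R) *\<^sub>R h) powr alp <= C * ?r powr (-2) * ((4 / rho) powr alp * (norm h / ?r) powr alp)"
    using C by (intro mult_left_mono n1) auto
   also have "... = C' * ?r powr (-2) * (norm h / ?r) powr alp" by (simp add: C'_def)
   finally have c: "C * ?r powr (-2) * norm ((1 / R) *\<^sub>R h) powr alp <= C' * ?r powr (-2) * (norm h / ?r) powr alp" .
   have i: "(\<integral>\<^sup>+ x\<in>ball z R. pw tau (s1 x - s2 x) \<partial>lborel) <= (\<integral>\<^sup>+ x\<in>ball z (rho * ?r). pw tau (s1 x - s2 x) \<partial>lborel)"
    using subset_ball[OF R0(3), of z] by (intro nn_integral_mono) (auto simp: indicator_def)
   note step = local_step_rep[OF LC CW C k tau r R0(1) B R0(4) sub Om hk h(1) N a m n rep, folded alp_def]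
   have mono: "enn_powr (ennreal (C * ?r powr (-2) * norm ((1 / R) *\<^sub>R h) powr alp) * (\<integral>\<^sup>+ x\<in>ball z R. pw tau (s1 x - s2 x) \<partial>lborel)) (1 / max 1 tau)
     <= enn_powr (ennreal (C' * ?r powr (-2) * (norm h / ?r) powr alp) * (\<integral>\<^sup>+ x\<in>ball z (rho * ?r). pw tau (s1 x - s2 x) \<partial>lborel)) (1 / max 1 tau)"
    by (intro enn_powr_mono mult_mono ennreal_leI c i) simp_all
   show ?thesis by (rule order_trans[OF step add_left_mono[OF mono]])
  qed
  show ?case
  proof (cases "\<exists>y. dist y z < rho * ?r / 16 & crosses m1 R1 y")
   case False
   have z: "(LI x. ennreal (kern tau (rho / 64) V x z * abs(fdiff Om k h s1 x) powr tau)) = 0"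
   proof -
    have "AE x in lborel. ennreal (kern tau (rho / 64) V x z * abs(fdiff Om k h s1 x) powr tau) = 0"
     using AE_dsum_0_no_cross[OF s1, of h UNIV]
    proof eventually_elim
     case (elim x)
     show ?case
     proof (cases "kern tau (rho / 64) V x z = 0")
      case nz: False
      have "dist x z < 2 * (rho / 64) * ?r" by (rule kern_support(1)[OF _ _ nz]) (use rho in auto)
      hence x: "dist x z < rho * ?r / 32" by simp
      have "\<not> crosses m1 R1 y" if ys: "y \<in> cseg x (x + real k *\<^sub>R h)" for y
      proof -
       obtain u where u: "0 <= u" "u <= 1" "y - x = u *\<^sub>R (x + real k *\<^sub>R h - x)" using ys by (rule segment_param)
       have "dist y x = u * (real k * norm h)" using u by (simp add: dist_norm)
       also have "... <= 1 * (real k * norm h)" using u by (intro mult_right_mono) auto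
       also have "... <= rho * ?r / 32" using h(2) by simp
       finally have "dist y z < rho * ?r / 16" using x dist_triangle[of y z x] by linarith
       thus ?thesis using False by blast
      qed
      hence "fdiff Om k h s1 x = 0" using elim by blast
      thus ?thesis using tau by simp
     qed simp
    qed
    hence "(LI x. ennreal (kern tau (rho / 64) V x z * abs(fdiff Om k h s1 x) powr tau)) = (\<integral>\<^sup>+ x. 0 \<partial>(lborel :: pt measure))"
     by (rule nn_integral_cong_AE)
    thus ?thesis by simp
   qed
   show ?thesis unfolding z by simp
  next
   case True
   then obtain y1 where y1: "dist y1 z < rho * ?r / 16" "crosses m1 R1 y1" by blast
   have y1': "dist y1 z < rho * ?r / 4" using y1(1) \<open>rho * ?r > 0\<close> by linarith
   show ?thesis
   proof (cases "\<exists>y. dist y z < rho * ?r / 4 & crosses m2 R2 y")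
    case True
    then obtain y2 where y2: "dist y2 z < rho * ?r / 4" "crosses m2 R2 y2" by blast
    obtain n1 a1 d1 where 1: "norm n1 = 1" "n1 \<bullet> (0::pt) >= 0" "ball y1 (kp * infdist y1 V) <= Om" "polyfun k a1" "a1 \<in> bm"
     "\<forall>x\<in>ball y1 (kp * infdist y1 V) - skelset m1 R1. s1 x = a1 x + d1 * tp k (n1 \<bullet> (x - y1))"
     using splinerep_cross[OF s1 V(1,2) kp(1) k y1(2) inr(2)[OF y1'], of 0] by (elim exE conjE)
    obtain n2 a2 d2 where 2: "norm n2 = 1" "n2 \<bullet> n1 >= 0" "polyfun k a2" "a2 \<in> bm"
     "\<forall>x\<in>ball y2 (kp * infdist y2 V) - skelset m2 R2. s2 x = a2 x + d2 * tp k (n2 \<bullet> (x - y2))"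
     using splinerep_cross[OF s2 V(1,3) kp(1) k y2(2) inr(2)[OF y2(1)], of n1] by (elim exE conjE)
    have N: "skelset m1 R1 \<union> skelset m2 R2 \<in> null_sets lborel"
     by (intro null_sets.Un skelset_null(1)[OF splinerep_cells[OF s1]] skelset_null(1)[OF splinerep_cells[OF s2]])
    show ?thesis
    proof (rule fin[of "rho * ?r", OF _ N _ 1(4) 2(3) 1(5) 2(4) 1(1) 2(1)])
     show "ball z (rho * ?r) <= Om" using bs[OF y1' order_refl] 1(3) by (rule subset_trans)
     show "n1 \<bullet> n2 >= 0" using 2(2) by (simp add: inner_commute)
     show "dist y1 z <= rho * ?r / 4" "dist y2 z <= rho * ?r / 4" using y1' y2(1) by simp_all
     show "s1 x = a1 x + d1 * tp k (n1 \<bullet> (x - y1))" if "x \<in> ball z (rho * ?r)" "x \<notin> skelset m1 R1 \<union> skelset m2 R2" for x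
      using bspec[OF 1(6), of x] bs[OF y1' order_refl] that by blast
     show "s2 x = a2 x + d2 * tp k (n2 \<bullet> (x - y2))" if "x \<in> ball z (rho * ?r)" "x \<notin> skelset m1 R1 \<union> skelset m2 R2" for x
      using bspec[OF 2(5), of x] bs[OF y2(1) order_refl] that by blast
    qed simp
   next
    case False
    \<comment> \<open>On this smaller ball s2 has no crossing, and y1 is still within a quarter of
      its radius; this explains the threshold \<open>rho * ?r / 16\<close>.\<close>
    let ?R = "rho * ?r / 4"
    have Rl: "?R <= rho * ?r" "?R > 0" using \<open>rho * ?r > 0\<close> by auto
    obtain n1 a1 d1 where 1: "norm n1 = 1" "n1 \<bullet> (0::pt) >= 0" "ball y1 (kp * infdist y1 V) <= Om" "polyfun k a1" "a1 \<in> bm"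
     "\<forall>x\<in>ball y1 (kp * infdist y1 V) - skelset m1 R1. s1 x = a1 x + d1 * tp k (n1 \<bullet> (x - y1))"
     using splinerep_cross[OF s1 V(1,2) kp(1) k y1(2) inr(2)[OF y1'], of 0] by (elim exE conjE)
    have sub: "ball z ?R <= Om" using bs[OF y1' Rl(1)] 1(3) by (rule subset_trans)
    have ne: "ball z ?R ~= {}" using Rl by simp
    have nc: "\<not> crosses m2 R2 y" if "y \<in> ball z ?R" for y using False that by (auto simp: dist_commute)
    have "\<exists>a. polyfun k a & a \<in> bm & (\<forall>x\<in>ball z ?R - skelset m2 R2. s2 x = a x)"
     by (rule splinerep_no_cross[OF s2 connected_ball sub ne]) (rule nc)
    then obtain a2 where 2: "polyfun k a2" "a2 \<in> bm" "\<forall>x\<in>ball z ?R - skelset m2 R2. s2 x = a2 x" by (elim exE conjE)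
    have N: "skelset m1 R1 \<union> skelset m2 R2 \<in> null_sets lborel"
     by (intro null_sets.Un skelset_null(1)[OF splinerep_cells[OF s1]] skelset_null(1)[OF splinerep_cells[OF s2]])
    show ?thesis
    proof (rule fin[of ?R, OF _ N sub 1(4) 2(1) 1(5) 2(2) 1(1) 1(1)])
     show "n1 \<bullet> n1 >= 0" by simp
     show "dist y1 z <= ?R / 4" "dist y1 z <= ?R / 4" using y1(1) by simp_all
     show "s1 x = a1 x + d1 * tp k (n1 \<bullet> (x - y1))" if "x \<in> ball z ?R" "x \<notin> skelset m1 R1 \<union> skelset m2 R2" for x
      using bspec[OF 1(6), of x] bs[OF y1' Rl(1)] that by blast
     show "s2 x = a2 x + 0 * tp k (n1 \<bullet> (x - y1))" if "x \<in> ball z ?R" "x \<notin> skelset m1 R1 \<union> skelset m2 R2" for x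
      using bspec[OF 2(3), of x] that by simp
    qed simp
   qed
  qed
 qed
qed

section \<open>Averaging over the centre\<close>

lemma infdist_comp_measurable [measurable (raw)]:
 fixes f :: "'a => pt"
 assumes "f \<in> measurable M borel"
 shows "(%x. infdist (f x) V) \<in> borel_measurable M"
 using measurable_compose[OF assms infdist_measurable] .

lemma tonelli_pt:
 fixes g :: "pt => pt => ennreal"
 assumes "(%(x, z). g x z) \<in> borel_measurable (borel \<Otimes>\<^sub>M borel)"
 shows "(LI z. (LI x. g x z)) = (LI x. (LI z. g x z))"
proof -
 have "case_prod g \<in> borel_measurable (lborel \<Otimes>\<^sub>M lborel)" using assms by (simp cong: measurable_cong_sets sets_pair_measure_cong add: case_prod_unfold)
 from lborel_pair.Fubini'[OF this] show ?thesis .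
qed

lemma dsum_powr_le:
 assumes "tau > 0"
 shows "abs(dsum k h f x) powr tau <= (2 ^ k * real (k + 1)) powr tau * (\<Sum>nv\<le>k. abs(f (x + real nv *\<^sub>R h)) powr tau)"
proof -
 let ?S = "\<Sum>nv\<le>k. abs(f (x + real nv *\<^sub>R h))"
 have "abs(dsum k h f x) <= 2 ^ k * ?S"
  by (rule dsum_bound, rule member_le_sum) auto
 hence "abs(dsum k h f x) powr tau <= (2 ^ k * ?S) powr tau" using assms by (intro powr_mono2) auto
 also have "... = (2 ^ k) powr tau * ?S powr tau" by (rule powr_mult; simp add: sum_nonneg)
 also have "... <= (2 ^ k) powr tau * (real (card {..k}) powr tau * (\<Sum>nv\<le>k. abs(f (x + real nv *\<^sub>R h)) powr tau))"
  by (intro mult_left_mono sum_powr_le) (use assms in auto)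
 also have "... = (2 ^ k * real (k + 1)) powr tau * (\<Sum>nv\<le>k. abs(f (x + real nv *\<^sub>R h)) powr tau)" by (simp add: powr_mult)
 finally show ?thesis .
qed

lemma fdiff_diff: "fdiff Om k h (%x. f x - g x) x = fdiff Om k h f x - fdiff Om k h g x"
 by (simp add: fdiff_eq dsum_diff)

lemma fdiff_powr_le: "tau > 0 ==> abs(fdiff Om k h f x) powr tau <= (2 ^ k * real (k + 1)) powr tau * (\<Sum>nv\<le>k. abs(f (x + real nv *\<^sub>R h)) powr tau)"
 using dsum_powr_le[of tau k h f x] by (auto simp: fdiff_eq intro!: mult_nonneg_nonneg sum_nonneg)

lemma finite_null_infdist:
 assumes "finite (V :: pt set)" "V ~= {}"
 shows "AE x in lborel. infdist x V > 0"
proof -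
 have "V \<in> null_sets lborel" using assms by (intro finite_imp_null_set_lborel)
 from AE_not_in[OF this] show ?thesis
 proof eventually_elim
  case (elim x)
  have "infdist x V ~= 0" using elim in_closed_iff_infdist_zero[of V x] assms finite_imp_closed by blast
  thus ?case using infdist_nonneg[of x V] by linarith
 qed
qed

lemma weighted_quasi_triangle:
 assumes tau: "tau > 0" and K: "K >= 0"
 shows "enn_powr (ennreal (K * abs(a) powr tau)) (1 / max 1 tau) <= enn_powr (ennreal (K * abs(b) powr tau)) (1 / max 1 tau) + enn_powr (ennreal (K * abs(a - b) powr tau)) (1 / max 1 tau)"
proof -
 let ?p = "1 / max 1 tau"
 have p: "0 < tau * ?p" "tau * ?p <= 1" using tau by (auto simp: field_simps max_def)
 have e: "enn_powr (ennreal (K * abs(y) powr tau)) ?p = ennreal (K powr ?p * abs(y) powr (tau * ?p))" for y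
  using K by (simp add: powr_mult powr_powr)
 have "abs(a) powr (tau * ?p) <= (abs(b) + abs(a - b)) powr (tau * ?p)" using p by (intro powr_mono2) auto
 also have "... <= abs(b) powr (tau * ?p) + abs(a - b) powr (tau * ?p)" using p by (intro powr_sum_le) auto
 finally have "K powr ?p * abs(a) powr (tau * ?p) <= K powr ?p * (abs(b) powr (tau * ?p) + abs(a - b) powr (tau * ?p))" by (intro mult_left_mono) auto
 from ennreal_leI[OF this] show ?thesis unfolding e distrib_left by (subst (asm) ennreal_plus) auto
qed

text \<open>At distances from V comparable to the step no cancellation is used: the difference is
  bounded by translates of f, which stay where \<open>min 1 (t / infdist x V)\<close> is at least
  \<open>1 / (L + real k)\<close>.\<close>

lemma near_integral:
 assumes V: "finite V" "V ~= {}" and t: "0 < t" "t = norm h" and L: "L >= 1" and tau: "tau > 0" and alp: "alp > 0"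
  and f [measurable]: "f \<in> bm" and Om: "closed Om"
 shows "(LI x. ennreal (indicator {x. infdist x V < L * t} x * abs(fdiff Om k h f x) powr tau)) <=
  ennreal ((2 ^ k * real (k + 1)) powr tau * real (k + 1) * (L + real k) powr alp) * (LI x. ennreal (abs(f x) powr tau * min 1 (t / infdist x V) powr alp))"
proof -
 let ?D = "(2 ^ k * real (k + 1)) powr tau" and ?I = "(LI x. ennreal (abs(f x) powr tau * min 1 (t / infdist x V) powr alp))"
 let ?ind = "%x. indicator {x. infdist x V < L * t} x :: real"
 have [measurable]: "{x. infdist x V < L * t} \<in> sets borel" by measurable
 have trans: "(LI x. ennreal (?ind x * abs(f (x + real nv *\<^sub>R h)) powr tau)) <= ennreal ((L + real k) powr alp) * ?I" if nv: "nv <= k" for nv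
 proof -
  have "(LI x. ennreal (?ind x * abs(f (x + real nv *\<^sub>R h)) powr tau)) =
   (LI x. ennreal (?ind (- (real nv *\<^sub>R h) + 1 *\<^sub>R (x + real nv *\<^sub>R h)) * abs(f (x + real nv *\<^sub>R h)) powr tau))" by simp
  also have "... = (LI y. ennreal (?ind (- (real nv *\<^sub>R h) + 1 *\<^sub>R y) * abs(f y) powr tau))"
   using nn_integral_scale_pt[of "%y. ennreal (?ind (- (real nv *\<^sub>R h) + 1 *\<^sub>R y) * abs(f y) powr tau)" 1 "real nv *\<^sub>R h"] by (simp add: add.commute)
  also have "... <= (LI y. ennreal ((L + real k) powr alp) * ennreal (abs(f y) powr tau * min 1 (t / infdist y V) powr alp))"
  proof (rule nn_integral_mono_AE)
   show "AE y in lborel. ennreal (?ind (- (real nv *\<^sub>R h) + 1 *\<^sub>R y) * abs(f y) powr tau) <= ennreal ((L + real k) powr alp) * ennreal (abs(f y) powr tau * min 1 (t / infdist y V) powr alp)"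
    using finite_null_infdist[OF V]
   proof eventually_elim
    case (elim y)
    let ?x = "- (real nv *\<^sub>R h) + 1 *\<^sub>R y"
    show ?case
    proof (cases "infdist ?x V < L * t")
     case True
     have "infdist y V <= infdist ?x V + dist y ?x" by (rule infdist_triangle)
     also have "dist y ?x = real nv * t" using t by (simp add: dist_norm)
     also have "real nv * t <= real k * t" using nv t by (intro mult_right_mono) auto
     finally have "infdist y V <= (L + real k) * t" using True by (simp add: distrib_right)
     hence "t / infdist y V >= 1 / (L + real k)" using elim L by (simp add: field_simps)
     hence "1 / (L + real k) <= min 1 (t / infdist y V)" using L by simp
     hence "(L + real k) * (1 / (L + real k)) <= (L + real k) * min 1 (t / infdist y V)" using L by (intro mult_left_mono) auto
     moreover have "(L + real k) * (1 / (L + real k)) = 1" using L by simp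
     ultimately have "(L + real k) * min 1 (t / infdist y V) >= 1" by linarith
     hence "((L + real k) * min 1 (t / infdist y V)) powr alp >= 1" using alp by (intro ge_one_powr_ge_zero) auto
     moreover have "((L + real k) * min 1 (t / infdist y V)) powr alp = (L + real k) powr alp * min 1 (t / infdist y V) powr alp"
      using L t elim by (intro powr_mult)
     ultimately have "1 * abs(f y) powr tau <= ((L + real k) powr alp * min 1 (t / infdist y V) powr alp) * abs(f y) powr tau" by (intro mult_right_mono) auto
     hence "abs(f y) powr tau <= (L + real k) powr alp * (abs(f y) powr tau * min 1 (t / infdist y V) powr alp)" by (simp only: mult_1_left ac_simps)
     thus ?thesis using True by (subst ennreal_mult[symmetric]) (auto intro!: ennreal_leI)
    qed simp
   qed
  qed
  also have "... = ennreal ((L + real k) powr alp) * ?I" by (rule nn_integral_cmult) measurable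
  finally show ?thesis .
 qed
 have "(LI x. ennreal (?ind x * abs(fdiff Om k h f x) powr tau)) <= (LI x. (\<Sum>nv\<le>k. ennreal ?D * ennreal (?ind x * abs(f (x + real nv *\<^sub>R h)) powr tau)))"
 proof (rule nn_integral_mono)
  fix x
  have "?ind x * abs(fdiff Om k h f x) powr tau <= ?ind x * (?D * (\<Sum>nv\<le>k. abs(f (x + real nv *\<^sub>R h)) powr tau))"
   by (intro mult_left_mono fdiff_powr_le tau) simp
  also have "... = (\<Sum>nv\<le>k. ?D * (?ind x * abs(f (x + real nv *\<^sub>R h)) powr tau))" by (simp add: sum_distrib_left ac_simps)
  finally have "ennreal (?ind x * abs(fdiff Om k h f x) powr tau) <= ennreal (\<Sum>nv\<le>k. ?D * (?ind x * abs(f (x + real nv *\<^sub>R h)) powr tau))" by (rule ennreal_leI)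
  also have "... = (\<Sum>nv\<le>k. ennreal (?D * (?ind x * abs(f (x + real nv *\<^sub>R h)) powr tau)))" by (rule sum_ennreal[symmetric]) simp
  also have "... = (\<Sum>nv\<le>k. ennreal ?D * ennreal (?ind x * abs(f (x + real nv *\<^sub>R h)) powr tau))" by (intro sum.cong refl ennreal_mult) auto
  finally show "ennreal (?ind x * abs(fdiff Om k h f x) powr tau) <= (\<Sum>nv\<le>k. ennreal ?D * ennreal (?ind x * abs(f (x + real nv *\<^sub>R h)) powr tau))" .
 qed
 also have "... = (\<Sum>nv\<le>k. (LI x. ennreal ?D * ennreal (?ind x * abs(f (x + real nv *\<^sub>R h)) powr tau)))" by (rule nn_integral_sum) measurable
 also have "... = (\<Sum>nv\<le>k. ennreal ?D * (LI x. ennreal (?ind x * abs(f (x + real nv *\<^sub>R h)) powr tau)))" by (intro sum.cong refl nn_integral_cmult) measurable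
 also have "... <= (\<Sum>nv\<le>k. ennreal ?D * (ennreal ((L + real k) powr alp) * ?I))" by (intro sum_mono mult_left_mono trans) auto
 also have "... = of_nat (k + 1) * (ennreal ?D * (ennreal ((L + real k) powr alp) * ?I))" by simp
 also have "... = ennreal (?D * real (k + 1) * (L + real k) powr alp) * ?I"
 proof -
  have "ennreal (?D * real (k + 1) * (L + real k) powr alp) = ennreal (real (k + 1)) * ennreal ?D * ennreal ((L + real k) powr alp)"
   by (simp only: ennreal_mult[symmetric] powr_ge_zero of_nat_0_le_iff mult_nonneg_nonneg ac_simps)
  thus ?thesis by (simp only: ennreal_of_nat_eq_real_of_nat mult.assoc)
 qed
 finally show ?thesis .
qed

text \<open>By Tonelli: for fixed x the centres z whose ball contains x lie in the ball of radius
  \<open>infdist x V\<close> about x and have comparable distance from V. The area of that ball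
  cancels the factor \<open>infdist z V powr (-2)\<close>.\<close>

lemma far_integral:
 fixes f :: "pt => real" and V :: "pt set"
 assumes rho: "0 < rho" "rho <= 1/4" and t: "0 < t" and alp: "alp > 0" and k: "k >= 1" and C: "C >= 0"
  and f [measurable]: "f \<in> bm"
 shows "(LI z. (if 32 * real k * t <= rho * infdist z V then ennreal (C * infdist z V powr (-2) * (t / infdist z V) powr alp) *
    (\<integral>\<^sup>+ x\<in>ball z (rho * infdist z V). pw tau (f x) \<partial>lborel) else 0))
   <= ennreal (C * 2 * 2 powr alp * unit_area) * (LI x. ennreal (abs(f x) powr tau * min 1 (t / infdist x V) powr alp))"
proof -
 define far where "far z \<longleftrightarrow> 32 * real k * t <= rho * infdist z V" for z
 define g where "g x z = (if far z & dist z x < rho * infdist z V then ennreal (C * infdist z V powr (-2) * (t / infdist z V) powr alp) * pw tau (f x) else 0)" for x z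
 have [measurable]: "(%(x, z). g x z) \<in> borel_measurable (borel \<Otimes>\<^sub>M borel)" unfolding g_def far_def by measurable
 have L: "(if 32 * real k * t <= rho * infdist z V then ennreal (C * infdist z V powr (-2) * (t / infdist z V) powr alp) *
    (\<integral>\<^sup>+ x\<in>ball z (rho * infdist z V). pw tau (f x) \<partial>lborel) else 0) = (LI x. g x z)" for z
 proof (cases "far z")
  case True
  have "(LI x. g x z) = (LI x. ennreal (C * infdist z V powr (-2) * (t / infdist z V) powr alp) * (pw tau (f x) * indicator (ball z (rho * infdist z V)) x))"
   using True by (intro nn_integral_cong) (auto simp: g_def indicator_def)
  also have "... = ennreal (C * infdist z V powr (-2) * (t / infdist z V) powr alp) * (\<integral>\<^sup>+ x\<in>ball z (rho * infdist z V). pw tau (f x) \<partial>lborel)"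
  proof (rule nn_integral_cmult)
   have [measurable]: "ball z (rho * infdist z V) \<in> sets borel" by simp
   show "(%x. pw tau (f x) * indicator (ball z (rho * infdist z V)) x) \<in> borel_measurable lborel" by measurable
  qed
  finally show ?thesis using True by (simp add: far_def)
 qed (simp add: g_def far_def)
 have inner: "(LI z. g x z) <= ennreal (C * 2 * 2 powr alp * unit_area) * ennreal (abs(f x) powr tau * min 1 (t / infdist x V) powr alp)" for x
 proof -
  let ?r = "infdist x V"
  let ?c = "C * (2 * ?r powr (-2)) * (2 powr alp * min 1 (t / ?r) powr alp) * abs(f x) powr tau"
  have g: "g x z <= ennreal ?c * indicator (ball x ?r) z" for z
  proof (cases "far z & dist z x < rho * infdist z V")
   case True
   let ?z = "infdist z V"
   have "1 <= real k" using k by simp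
   hence "32 * 1 * t <= 32 * real k * t" using t by (intro mult_mono) auto
   hence tz: "32 * t <= rho * ?z" using True by (simp add: far_def)
   hence "rho * ?z > 0" using t by linarith
   hence z0: "?z > 0" using rho by (simp add: zero_less_mult_iff)
   have qz: "rho * ?z <= 1/4 * ?z" using rho z0 by (intro mult_right_mono) auto
   have 1: "?z <= ?r + dist z x" "?r <= ?z + dist z x" by (rule infdist_triangle, metis infdist_triangle dist_commute)
   hence rz: "?z >= 4/5 * ?r" "?r >= 3/4 * ?z" "dist z x < ?r" using True qz z0 by linarith+
   hence r0: "?r > 0" using z0 by linarith
   have tr: "t <= ?r" using tz qz rz z0 by linarith
   have a: "?z powr (-2) <= 2 * ?r powr (-2)"
   proof -
    have "?z powr (-2) <= (4/5 * ?r) powr (-2)" using rz r0 by (intro powr_mono2') auto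
    also have "... = (4/5) powr (-2) * ?r powr (-2)" using r0 by (intro powr_mult)
    also have "... <= 2 * ?r powr (-2)" by (intro mult_right_mono) (simp_all add: powr_minus powr_numeral power2_eq_square)
    finally show ?thesis .
   qed
   have b: "(t / ?z) powr alp <= 2 powr alp * min 1 (t / ?r) powr alp"
   proof -
    have "t / ?z <= t / (?r / 2)" using rz r0 t by (intro divide_left_mono) auto
    also have "... = 2 * (t / ?r)" by simp
    also have "t / ?r = min 1 (t / ?r)" using tr r0 by simp
    finally have "(t / ?z) powr alp <= (2 * min 1 (t / ?r)) powr alp" using alp t z0 by (intro powr_mono2) auto
    also have "... = 2 powr alp * min 1 (t / ?r) powr alp" using t r0 by (intro powr_mult)
    finally show ?thesis .
   qed
   have "g x z = ennreal (C * ?z powr (-2) * (t / ?z) powr alp * abs(f x) powr tau)" using True C by (simp add: g_def ennreal_mult)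
   also have "... <= ennreal ?c" using C by (intro ennreal_leI mult_right_mono mult_mono mult_left_mono a b) auto
   finally show ?thesis using rz by (simp add: dist_commute)
  next
   case False
   hence "g x z = 0" unfolding g_def by (rule if_not_P)
   thus ?thesis by simp
  qed
  have c0: "?c >= 0" using C by (intro mult_nonneg_nonneg) auto
  have "(LI z. g x z) <= (LI z. ennreal ?c * indicator (ball x ?r) z)" by (intro nn_integral_mono g)
  also have "... = ennreal ?c * emeasure lborel (ball x ?r)" by (rule nn_integral_cmult_indicator) simp
  also have "... <= ennreal (C * 2 * 2 powr alp * unit_area) * ennreal (abs(f x) powr tau * min 1 (t / ?r) powr alp)"
  proof (cases "?r > 0")
   case True
   have e: "?r powr (-2) * ?r\<^sup>2 = 1" using True by (simp add: powr_minus powr_numeral)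
   have "ennreal ?c * emeasure lborel (ball x ?r) = ennreal (?c * (?r\<^sup>2 * unit_area))"
    unfolding emeasure_ball_pt[OF True] by (rule ennreal_mult[symmetric, OF c0]) (simp add: less_imp_le[OF unit_area_pos])
   also have "?c * (?r\<^sup>2 * unit_area) = (C * 2 * 2 powr alp * unit_area) * (abs(f x) powr tau * min 1 (t / ?r) powr alp) * (?r powr (-2) * ?r\<^sup>2)"
    by (simp only: ac_simps)
   also have "... = (C * 2 * 2 powr alp * unit_area) * (abs(f x) powr tau * min 1 (t / ?r) powr alp)" unfolding e by (rule mult_1_right)
   also have "ennreal ... = ennreal (C * 2 * 2 powr alp * unit_area) * ennreal (abs(f x) powr tau * min 1 (t / ?r) powr alp)"
    using C unit_area_pos by (intro ennreal_mult mult_nonneg_nonneg) auto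
   finally show ?thesis by (rule eq_refl)
  next
   case False
   hence "ball x ?r = {}" by simp
   thus ?thesis by (simp only: emeasure_empty mult_zero_right zero_le)
  qed
  finally show ?thesis .
 qed
 have "(LI z. (LI x. g x z)) = (LI x. (LI z. g x z))" by (rule tonelli_pt) measurable
 also have "... <= (LI x. ennreal (C * 2 * 2 powr alp * unit_area) * ennreal (abs(f x) powr tau * min 1 (t / infdist x V) powr alp))" by (intro nn_integral_mono inner)
 also have "... = ennreal (C * 2 * 2 powr alp * unit_area) * (LI x. ennreal (abs(f x) powr tau * min 1 (t / infdist x V) powr alp))" by (rule nn_integral_cmult) measurable
 finally show ?thesis unfolding L .
qed

text \<open>For centres far from V the local comparison applies, for the others the triangle
  inequality. Minkowski over z keeps the factor one; by Tonelli both averages equal the plain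
  integrals times the mass of the kernel, which cancels.\<close>

lemma averaged_step:
 assumes k: "k >= 1" and tau: "tau > 0" and kp: "0 < kp" "kp <= 1"
 shows "\<exists>C>0. \<forall>M Om V m1 R1 E1 s1 m2 R2 E2 s2 h.
   splinerep kp M Om k m1 R1 E1 s1 --> splinerep kp M Om k m2 R2 E2 s2 --> finite V --> verts m1 E1 <= V --> verts m2 E2 <= V -->
   h ~= 0 -->
   enn_powr (LI x. pw tau (fdiff Om k h s1 x)) (1 / max 1 tau) <=
   enn_powr (LI x. pw tau (fdiff Om k h s2 x)) (1 / max 1 tau) +
   enn_powr (ennreal C * (LI x. ennreal (abs(s1 x - s2 x) powr tau * min 1 (norm h / infdist x V) powr (tau * (real k - 1) + 1)))) (1 / max 1 tau)"
proof (rule pos_exE[OF local_step[OF k tau kp]], goal_cases)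
 case (1 C0)
 define rho where "rho = kp / 4"
 define alp where "alp = tau * (real k - 1) + 1"
 have alp: "alp > 0" using k tau by (simp add: alp_def add_nonneg_pos)
 have rho: "0 < rho" "rho <= 1/4" using kp by (auto simp: rho_def)
 define eps where "eps = rho / 64"
 have eps: "0 < eps" "eps <= 1/2" using rho by (auto simp: eps_def)
 note C0 = 1(1) and LS = 1(2)[rule_format, folded alp_def rho_def, folded eps_def]
 obtain c where c: "c > 0" "!!V x. infdist x V > 0 ==> (LI z. ennreal (kern tau eps V x z)) = ennreal c"
  using kern_integral[OF eps(1) tau] by meson
 \<comment> \<open>A near centre satisfies \<open>rho * infdist z V < 32 * real k * t\<close>, and
   on the support of the kernel the distance from V at most doubles.\<close>
 define L where "L = 64 * real k / rho"
 have L: "L >= 1"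
 proof -
  have "real k >= 1" using k by simp
  hence "rho <= 64 * real k" using rho by linarith
  thus ?thesis using rho by (simp add: L_def field_simps)
 qed
 define Cn where "Cn = (2 ^ k * real (k + 1)) powr tau * real (k + 1) * (L + real k) powr alp"
 define Cf where "Cf = C0 * 2 * 2 powr alp * unit_area"
 define C where "C = Cn + Cf / c"
 have Cn: "Cn >= 0" and Cf: "Cf > 0" using C0 unit_area_pos by (auto simp: Cn_def Cf_def)
 have C: "C > 0" using Cn Cf c by (simp add: C_def add_nonneg_pos)
 have q: "1 / max 1 tau > 0" "1 / max 1 tau >= 0" by simp_all
 show ?thesis unfolding alp_def[symmetric]
 proof (intro exI[of _ C] conjI[OF C] allI impI, goal_cases)
  case (1 M Om V m1 R1 E1 s1 m2 R2 E2 s2 h)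
  note s1 = 1(1) and s2 = 1(2) and V = 1(3-5) and h = 1(6)
  have Vne: "V ~= {}" using V(2) by (auto simp: verts_def)
  have Om: "closed Om" using cellsD(6)[OF splinerep_cells[OF s1]] .
  have m [measurable]: "s1 \<in> bm" "s2 \<in> bm" using splinerep_measurable s1 s2 by blast+
  have [measurable]: "fdiff Om k h s1 \<in> bm" "fdiff Om k h s2 \<in> bm" "fdiff Om k h (%x. s1 x - s2 x) \<in> bm"
   by (intro fdiff_measurable Om; measurable)+
  define t where "t = norm h"
  have t: "t > 0" using h by (simp add: t_def)
  let ?J = "(LI x. ennreal (abs(s1 x - s2 x) powr tau * min 1 (t / infdist x V) powr alp))"
  define G where "G g z = (LI x. ennreal (kern tau eps V x z * abs(fdiff Om k h g x) powr tau))" for g z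
  define f where "f x = s1 x - s2 x" for x
  have fm [measurable]: "f \<in> bm" unfolding f_def[abs_def] by measurable
  have [measurable]: "fdiff Om k h f \<in> bm" by (rule fdiff_measurable[OF Om]) measurable
  define A where "A z = (if 32 * real k * t <= rho * infdist z V then ennreal (C0 * infdist z V powr (-2) * (t / infdist z V) powr alp) *
    (\<integral>\<^sup>+ x\<in>ball z (rho * infdist z V). pw tau (f x) \<partial>lborel) else 0)" for z
  define B where "B z = (LI x. ennreal (kern tau eps V x z * (indicator {x. infdist x V < L * t} x * abs(fdiff Om k h f x) powr tau)))" for z
  have [measurable]: "{x. infdist x V < L * t} \<in> sets borel" by measurable
  have kfm: "(%x. ennreal (kern tau eps V x z * abs(fdiff Om k h g x) powr tau)) \<in> borel_measurable lborel"
   if g: "g \<in> bm" for g z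
  proof -
   have [measurable]: "fdiff Om k h g \<in> bm" by (rule fdiff_measurable[OF Om g])
   show ?thesis by measurable
  qed
  have Gm [measurable]: "G g \<in> bm" if [measurable]: "fdiff Om k h g \<in> bm" for g
   unfolding G_def[abs_def] by measurable
  have Bm [measurable]: "B \<in> bm" unfolding B_def[abs_def] by measurable
  have Am [measurable]: "A \<in> bm"
  proof -
   have "(\<integral>\<^sup>+ x\<in>ball z (rho * infdist z V). pw tau (f x) \<partial>lborel) = (LI x. (if dist z x < rho * infdist z V then pw tau (f x) else 0))" for z
    by (intro nn_integral_cong) (auto simp: indicator_def)
   hence A: "A = (%z. if 32 * real k * t <= rho * infdist z V then ennreal (C0 * infdist z V powr (-2) * (t / infdist z V) powr alp) *
    (LI x. (if dist z x < rho * infdist z V then pw tau (f x) else 0)) else 0)" unfolding A_def[abs_def] by presburger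
   show ?thesis unfolding A by measurable
  qed
  have tot: "(LI z. (LI x. ennreal (kern tau eps V x z * g x))) = ennreal c * (LI x. ennreal (g x))"
   if [measurable]: "g \<in> bm" and g: "!!x. g x >= 0" for g :: "pt => real"
  proof -
   have "(LI z. (LI x. ennreal (kern tau eps V x z * g x))) = (LI x. (LI z. ennreal (kern tau eps V x z * g x)))"
    by (rule tonelli_pt) measurable
   also have "... = (LI x. ennreal c * ennreal (g x))"
   proof (rule nn_integral_cong_AE)
    show "AE x in lborel. (LI z. ennreal (kern tau eps V x z * g x)) = ennreal c * ennreal (g x)"
     using finite_null_infdist[OF V(1) Vne]
    proof eventually_elim
     case (elim x)
     have "(LI z. ennreal (kern tau eps V x z * g x)) = (LI z. ennreal (kern tau eps V x z) * ennreal (g x))"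
      by (intro nn_integral_cong ennreal_mult) (auto simp: g)
     also have "... = (LI z. ennreal (kern tau eps V x z)) * ennreal (g x)" by (rule nn_integral_multc) measurable
     finally show ?case using c(2)[OF elim] by simp
    qed
   qed
   also have "... = ennreal c * (LI x. ennreal (g x))" by (rule nn_integral_cmult) measurable
   finally show ?thesis .
  qed
  have G: "(LI z. G g z) = ennreal c * (LI x. pw tau (fdiff Om k h g x))"
   if [measurable]: "fdiff Om k h g \<in> bm" for g
   unfolding G_def by (rule tot) auto
  have B: "(LI z. B z) <= ennreal (c * Cn) * ?J"
  proof -
   have "(LI z. B z) = ennreal c * (LI x. ennreal (indicator {x. infdist x V < L * t} x * abs(fdiff Om k h f x) powr tau))"
    unfolding B_def by (rule tot) auto
   also have "... <= ennreal c * (ennreal Cn * (LI x. ennreal (abs(f x) powr tau * min 1 (t / infdist x V) powr alp)))"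
    unfolding Cn_def by (intro mult_left_mono near_integral[OF V(1) Vne t t_def L tau alp _ Om]) auto
   also have "... = ennreal (c * Cn) * ?J" unfolding f_def using c Cn by (simp add: ennreal_mult mult.assoc)
   finally show ?thesis .
  qed
  have A: "(LI z. A z) <= ennreal Cf * ?J"
   using far_integral[OF rho t alp k less_imp_le[OF C0], where f=f and tau=tau and V=V] unfolding A_def Cf_def by (simp add: f_def)
  have pt: "enn_powr (G s1 z) (1 / max 1 tau) <= enn_powr (G s2 z) (1 / max 1 tau) + enn_powr (A z + B z) (1 / max 1 tau)" for z
  proof (cases "32 * real k * t <= rho * infdist z V")
   case True
   have "enn_powr (G s1 z) (1 / max 1 tau) <= enn_powr (G s2 z) (1 / max 1 tau) + enn_powr (A z) (1 / max 1 tau)"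
    using LS[OF s1 s2 V h] True unfolding G_def A_def f_def t_def by simp
   also have "... <= enn_powr (G s2 z) (1 / max 1 tau) + enn_powr (A z + B z) (1 / max 1 tau)" by (intro add_left_mono enn_powr_mono q) simp
   finally show ?thesis .
  next
   case False
   have ind: "kern tau eps V x z * (indicator {x. infdist x V < L * t} x * y) = kern tau eps V x z * y" for x y
   proof (cases "kern tau eps V x z = 0")
    case nz: False
    have d: "dist x z < 2 * eps * infdist z V" by (rule kern_support(1)[OF eps nz])
    have "2 * eps * infdist z V <= 1 * infdist z V" using eps infdist_nonneg by (intro mult_right_mono) auto
    hence "infdist x V < 2 * infdist z V" using d infdist_triangle[of x V z] by linarith
    moreover have "rho * infdist z V < 32 * real k * t" using False by simp
    hence "infdist z V < 32 * real k * t / rho" using rho by (simp add: field_simps)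
    moreover have "2 * (32 * real k * t / rho) = L * t" by (simp add: L_def)
    ultimately have "infdist x V < L * t" by linarith
    thus ?thesis by simp
   qed simp
   have "enn_powr (G s1 z) (1 / max 1 tau) <= enn_powr (G s2 z) (1 / max 1 tau) + enn_powr (G f z) (1 / max 1 tau)"
    unfolding G_def
   proof (rule minkowski_nn)
    show "AE x in lborel. enn_powr (ennreal (kern tau eps V x z * abs(fdiff Om k h s1 x) powr tau)) (1 / max 1 tau)
      <= enn_powr (ennreal (kern tau eps V x z * abs(fdiff Om k h s2 x) powr tau)) (1 / max 1 tau)
       + enn_powr (ennreal (kern tau eps V x z * abs(fdiff Om k h f x) powr tau)) (1 / max 1 tau)"
     unfolding f_def[abs_def] fdiff_diff by (intro always_eventually allI weighted_quasi_triangle tau kern_nonneg)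
   qed (rule kfm[OF m(1)], rule kfm[OF m(2)], rule kfm[OF fm], simp)
   moreover have "G f z = B z" unfolding G_def B_def ind ..
   moreover have "enn_powr (B z) (1 / max 1 tau) <= enn_powr (A z + B z) (1 / max 1 tau)" by (intro enn_powr_mono q) simp
   ultimately show ?thesis by (metis add_left_mono order_trans)
  qed
  have "enn_powr (LI z. G s1 z) (1 / max 1 tau) <= enn_powr (LI z. G s2 z) (1 / max 1 tau) + enn_powr (LI z. A z + B z) (1 / max 1 tau)"
   by (rule minkowski_nn) (use pt in \<open>measurable, auto\<close>)
  also have "(LI z. A z + B z) = (LI z. A z) + (LI z. B z)" by (rule nn_integral_add) measurable
  also have "enn_powr ((LI z. A z) + (LI z. B z)) (1 / max 1 tau) <= enn_powr (ennreal c * (ennreal C * ?J)) (1 / max 1 tau)"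
  proof (rule enn_powr_mono[OF q(2)])
   have "(LI z. A z) + (LI z. B z) <= ennreal Cf * ?J + ennreal (c * Cn) * ?J" by (intro add_mono A B)
   also have "... = (ennreal Cf + ennreal (c * Cn)) * ?J" by (simp add: distrib_right)
   also have "ennreal Cf + ennreal (c * Cn) = ennreal (Cf + c * Cn)" using Cf c Cn by (intro ennreal_plus[symmetric]) auto
   also have "Cf + c * Cn = c * C" using c by (simp add: C_def field_simps)
   also have "ennreal (c * C) = ennreal c * ennreal C" using c C by (intro ennreal_mult) auto
   finally show "(LI z. A z) + (LI z. B z) <= ennreal c * (ennreal C * ?J)" by (simp add: mult.assoc)
  qed
  finally have fin: "enn_powr (ennreal c * (LI x. pw tau (fdiff Om k h s1 x))) (1 / max 1 tau) <=
   enn_powr (ennreal c * (LI x. pw tau (fdiff Om k h s2 x))) (1 / max 1 tau) + enn_powr (ennreal c * (ennreal C * ?J)) (1 / max 1 tau)"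
   unfolding G[OF fdiff_measurable[OF Om m(1)]] G[OF fdiff_measurable[OF Om m(2)]] by (simp add: add_left_mono)
  define p where "p = enn_powr (ennreal c) (1 / max 1 tau)"
  have p: "p ~= 0" "p < top" using c by (auto simp: p_def)
  have "p * enn_powr (LI x. pw tau (fdiff Om k h s1 x)) (1 / max 1 tau) <=
    p * (enn_powr (LI x. pw tau (fdiff Om k h s2 x)) (1 / max 1 tau) + enn_powr (ennreal C * ?J) (1 / max 1 tau))"
   using fin unfolding p_def distrib_left enn_powr_mult[OF q(1), of "ennreal c"] .
  thus ?case unfolding t_def[symmetric] using p by (subst (asm) ennreal_mult_le_mult_iff) auto
 qed
qed

text \<open>Serves the modulus of smoothness, a supremum over uncountably many steps, whose
  measurability in t comes from monotonicity.\<close>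

lemma borel_measurable_mono_ennreal:
 fixes f :: "real => ennreal"
 assumes "mono f"
 shows "f \<in> bm"
proof (rule borel_measurableI_greater)
 fix y
 have "mono (indicator {t. y < f t} :: real => real)"
 proof (rule monoI)
  fix s t :: real assume "s <= t"
  hence "f s <= f t" using assms by (rule monoD[rotated])
  thus "indicator {t. y < f t} s <= (indicator {t. y < f t} t :: real)" by (auto simp: indicator_def)
 qed
 hence "(indicator {t. y < f t} :: real => real) \<in> bm" by (rule borel_measurable_mono)
 hence "{t. y < f t} \<inter> space borel \<in> sets borel" by (rule borel_measurable_indicator_iff[THEN iffD1])
 thus "{x \<in> space borel. y < f x} \<in> sets borel" by simp
qed

lemma Lnorm_fdiff: "Lnorm tau Om (fdiff Om k h f) = enn_powr (LI x. pw tau (fdiff Om k h f x)) (1 / tau)"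
proof -
 have "(\<integral>\<^sup>+ x\<in>Om. pw tau (fdiff Om k h f x) \<partial>lborel) = (LI x. pw tau (fdiff Om k h f x))"
 proof (rule nn_integral_cong)
  fix x
  have "x \<in> cseg x (x + real k *\<^sub>R h)" by simp
  thus "pw tau (fdiff Om k h f x) * indicator Om x = pw tau (fdiff Om k h f x)"
   by (cases "x \<in> Om") (auto simp: fdiff_eq)
 qed
 thus ?thesis by (simp add: Lnorm_def)
qed

lemma fdiff_0: "k >= 1 ==> fdiff Om k 0 f x = 0"
 by (cases k) (auto simp: fdiff_eq dsum_Suc)

lemma modulus_mono: "mono (modulus Om k tau f)"
 unfolding modulus_def by (rule monoI, rule SUP_subset_mono) auto

lemma AE_translate:
 fixes h :: pt
 assumes "AE x in lborel. Q x"
 shows "AE x in lborel. Q (x + h)"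
 using AE_affine_pt[OF assms, of 1 h] by (simp add: add.commute)

lemma fdiff_cong_AE:
 assumes "AE x in lborel. f x = g x"
 shows "AE x in lborel. fdiff Om k h f x = fdiff Om k h g x"
proof -
 have "AE x in lborel. \<forall>nv\<in>{..k}. f (x + real nv *\<^sub>R h) = g (x + real nv *\<^sub>R h)"
  by (intro AE_finite_allI AE_translate assms) simp
 thus ?thesis
 proof eventually_elim
  case (elim x)
  hence "dsum k h f x = dsum k h g x" unfolding dsum_def by (intro sum.cong) auto
  thus ?case by (simp add: fdiff_eq)
 qed
qed

section \<open>Besov integrals\<close>

text \<open>The seminorm before its outer root, so that both assertions can be derived from one
  inequality about integrals.\<close>

definition besov_int :: "pt set => real => nat => real => (pt => real) => ennreal" where
 "besov_int Om s k tau f = (\<integral>\<^sup>+ t\<in>{0<..}. ennreal (t powr (- (s * tau) - 1)) * enn_powr (modulus Om k tau f t) tau \<partial>lborel)"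

lemma besov_int_cong_AE:
 assumes "AE x in lborel. f x = g x"
 shows "besov_int Om s k tau f = besov_int Om s k tau g"
proof -
 have "Lnorm tau Om (fdiff Om k h f) = Lnorm tau Om (fdiff Om k h g)" for h
  unfolding Lnorm_fdiff by (rule arg_cong[where f="%y. enn_powr y _"], rule nn_integral_cong_AE)
   (use fdiff_cong_AE[OF assms, of Om k h] in \<open>eventually_elim, simp\<close>)
 hence "modulus Om k tau f = modulus Om k tau g" by (simp add: modulus_def fun_eq_iff)
 thus ?thesis by (simp add: besov_int_def)
qed

lemma besov_semi_eq:
 assumes "tau > 0"
 shows "besov_semi Om s k tau f = enn_powr (besov_int Om s k tau f) (1 / tau)"
proof -
 have "(enn_powr (ennreal (t powr (- s)) * m) tau / ennreal t) * indicator {0<..} t =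
   ennreal (t powr (- (s * tau) - 1)) * enn_powr m tau * indicator {0<..} t" for t m
 proof (cases "t > 0")
  case True
  have "enn_powr (ennreal (t powr (- s)) * m) tau / ennreal t = (ennreal (t powr (- (s * tau))) * inverse (ennreal t)) * enn_powr m tau"
   using assms by (simp add: enn_powr_mult powr_powr divide_ennreal_def ac_simps)
  also have "ennreal (t powr (- (s * tau))) * inverse (ennreal t) = ennreal (t powr (- (s * tau)) * inverse t)"
   using True by (simp add: inverse_ennreal flip: ennreal_mult)
  also have "t powr (- (s * tau)) * inverse t = t powr (- (s * tau) - 1)" using True by (simp add: powr_diff divide_inverse)
  finally show ?thesis using True by simp
 qed simp
 thus ?thesis by (simp add: besov_semi_def besov_int_def)
qed

text \<open>Splitting at t = r: the condition \<open>sg < alp\<close> makes the part near zero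
  converge and \<open>sg > 0\<close> the part at infinity. For \<open>sg = s * tau\<close> and
  \<open>alp = tau * (real k - 1) + 1\<close> the former is the upper restriction on s.\<close>

lemma time_integral:
 assumes s: "0 < sg" "sg < alp" and r: "r > 0"
 shows "(\<integral>\<^sup>+ t\<in>{0<..}. ennreal (t powr (- sg - 1) * min 1 (t / r) powr alp) \<partial>lborel) <= ennreal ((1 / (alp - sg) + 1 / sg) * r powr (- sg))"
proof -
 let ?A = "%t. ennreal (t powr (alp - sg - 1)) * indicator {0..r} t" and ?B = "%t. ennreal (t powr (- sg - 1)) * indicator {r..} t"
 have A: "(LI t. ?A t) = ennreal (r powr (alp - sg) / (alp - sg))"
  using has_integral_powr_from_0[of "alp - sg - 1" r] s r by (intro nn_integral_has_integral_lebesgue') auto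
 have B: "(LI t. ?B t) = ennreal (r powr (- sg) / sg)"
  using has_integral_powr_to_inf[of "- sg - 1" r] s r by (intro nn_integral_has_integral_lebesgue') auto
 have "(\<integral>\<^sup>+ t\<in>{0<..}. ennreal (t powr (- sg - 1) * min 1 (t / r) powr alp) \<partial>lborel) <= (LI t. ennreal (r powr (- alp)) * ?A t + ?B t)"
 proof (rule nn_integral_mono)
  fix t :: real
  show "ennreal (t powr (- sg - 1) * min 1 (t / r) powr alp) * indicator {0<..} t <= ennreal (r powr (- alp)) * ?A t + ?B t"
  proof (cases "t > 0")
   case t: True
   show ?thesis
   proof (cases "t <= r")
    case True
    have "t powr (- sg - 1) * min 1 (t / r) powr alp = t powr (- sg - 1) * (t powr alp * r powr (- alp))"
    proof -
     have "min 1 (t / r) = t / r" using r True by (intro min_absorb2) simp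
     moreover have "(t / r) powr alp = t powr alp / r powr alp" using t r by (intro powr_divide)
     ultimately show ?thesis by (simp add: powr_minus_divide)
    qed
    also have "... = r powr (- alp) * t powr (alp - sg - 1)" by (simp add: algebra_simps flip: powr_add)
    finally have "ennreal (t powr (- sg - 1) * min 1 (t / r) powr alp) = ennreal (r powr (- alp)) * ennreal (t powr (alp - sg - 1))"
     by (simp add: ennreal_mult)
    thus ?thesis using t True by (simp add: add_increasing2)
   next
    case False
    hence "min 1 (t / r) = 1" using r by (simp add: min_def field_simps)
    thus ?thesis using t False by simp
   qed
  qed simp
 qed
 also have "... = (LI t. ennreal (r powr (- alp)) * ?A t) + (LI t. ?B t)" by (rule nn_integral_add) measurable
 also have "(LI t. ennreal (r powr (- alp)) * ?A t) = ennreal (r powr (- alp)) * (LI t. ?A t)" by (rule nn_integral_cmult) measurable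
 also have "ennreal (r powr (- alp)) * (LI t. ?A t) + (LI t. ?B t) = ennreal (r powr (- alp) * (r powr (alp - sg) / (alp - sg)) + r powr (- sg) / sg)"
 proof -
  have "ennreal (r powr (- alp)) * ennreal (r powr (alp - sg) / (alp - sg)) = ennreal (r powr (- alp) * (r powr (alp - sg) / (alp - sg)))"
   by (rule ennreal_mult[symmetric]) (use s in auto)
  thus ?thesis unfolding A B using s by (simp only:) (rule ennreal_plus[symmetric]; simp)
 qed
 also have "r powr (- alp) * (r powr (alp - sg) / (alp - sg)) + r powr (- sg) / sg = (1 / (alp - sg) + 1 / sg) * r powr (- sg)"
 proof -
  have "r powr (- alp) * r powr (alp - sg) = r powr (- sg)" by (simp flip: powr_add)
  thus ?thesis by (simp add: distrib_right)
 qed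
 finally show ?thesis .
qed

text \<open>The error for one step h grows with \<open>norm h\<close>, so the bound passes to the
  supremum over all steps up to t. Minkowski over t and Tonelli leave the integral of a truncated
  power of \<open>t / infdist x V\<close>, which \<open>time_integral\<close> bounds by the
  weight.\<close>

lemma besov_int_step:
 assumes k: "k >= 1" and tau: "tau > 0" and kp: "0 < kp" "kp <= 1" and s: "0 < s * tau" "s * tau < tau * (real k - 1) + 1"
 shows "\<exists>C>0. \<forall>M Om V m1 R1 E1 s1 m2 R2 E2 s2.
   splinerep kp M Om k m1 R1 E1 s1 --> splinerep kp M Om k m2 R2 E2 s2 --> finite V --> verts m1 E1 <= V --> verts m2 E2 <= V -->
   enn_powr (besov_int Om s k tau s1) (1 / max 1 tau) <= enn_powr (besov_int Om s k tau s2) (1 / max 1 tau) +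
   enn_powr (ennreal C * (LI x. ennreal (abs(s1 x - s2 x) powr tau * infdist x V powr (- (s * tau))))) (1 / max 1 tau)"
proof (rule pos_exE[OF averaged_step[OF k tau kp]], goal_cases)
 case (1 C0)
 define alp where "alp = tau * (real k - 1) + 1"
 define q where "q = max 1 tau"
 have q: "q >= 1" "q > 0" by (auto simp: q_def)
 have alp: "alp > 0" using k tau by (simp add: alp_def add_nonneg_pos)
 note C0 = 1(1) and AS = 1(2)[rule_format, folded alp_def q_def]
 define D where "D = 1 / (alp - s * tau) + 1 / (s * tau)"
 have D: "D > 0" using s by (auto simp: D_def alp_def intro!: add_pos_pos)
 define C where "C = C0 * D"
 have C: "C > 0" using C0 D by (simp add: C_def)
 show ?thesis unfolding q_def[symmetric]
 proof (intro exI[of _ C] conjI[OF C] allI impI, goal_cases)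
  case (1 M Om V m1 R1 E1 s1 m2 R2 E2 s2)
  note s1 = 1(1) and s2 = 1(2) and V = 1(3-5)
  have Vne: "V ~= {}" using V(2) by (auto simp: verts_def)
  have m [measurable]: "s1 \<in> bm" "s2 \<in> bm" using splinerep_measurable s1 s2 by blast+
  define f where "f x = abs(s1 x - s2 x) powr tau" for x
  have [measurable]: "f \<in> bm" unfolding f_def[abs_def] by measurable
  define E where "E t = ennreal C0 * (LI x. ennreal (f x * min 1 (t / infdist x V) powr alp))" for t
  let ?N = "%g t. enn_powr (modulus Om k tau g t) tau"
  have step: "enn_powr (?N s1 t) (1 / q) <= enn_powr (?N s2 t) (1 / q) + enn_powr (E t) (1 / q)" if t: "t > 0" for t
  proof -
   let ?X = "enn_powr (?N s2 t) (1 / q) + enn_powr (E t) (1 / q)"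
   have eX: "enn_powr (enn_powr ?X (q / tau)) (tau / q) = ?X" using tau q by (simp add: enn_powr_powr)
   have "Lnorm tau Om (fdiff Om k h s1) <= enn_powr ?X (q / tau)" if h: "norm h <= t" for h
   proof (cases "h = 0")
    case True
    have "Lnorm tau Om (fdiff Om k h s1) = 0" unfolding Lnorm_fdiff True fdiff_0[OF k] using tau by simp
    thus ?thesis by simp
   next
    case False
    let ?I = "%g. (LI x. pw tau (fdiff Om k h g x))"
    have "enn_powr (?I s2) (1 / tau) <= modulus Om k tau s2 t" unfolding modulus_def Lnorm_fdiff[symmetric] using h by (intro SUP_upper) simp
    hence "enn_powr (enn_powr (?I s2) (1 / tau)) tau <= ?N s2 t" using tau by (intro enn_powr_mono) auto
    hence I2: "?I s2 <= ?N s2 t" using tau by (simp add: enn_powr_powr)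
    have "enn_powr (?I s1) (1 / q) <= enn_powr (?I s2) (1 / q) + enn_powr (ennreal C0 * (LI x. ennreal (abs(s1 x - s2 x) powr tau * min 1 (norm h / infdist x V) powr alp))) (1 / q)"
     by (rule AS[OF s1 s2 V False])
    also have "... <= ?X" unfolding E_def f_def
    proof (intro add_mono enn_powr_mono mult_left_mono nn_integral_mono ennreal_leI powr_mono2 I2 min.mono divide_right_mono)
    qed (use q alp h in \<open>auto simp: infdist_nonneg intro!: divide_nonneg_nonneg\<close>)
    finally have "enn_powr (enn_powr (?I s1) (1 / q)) (q / tau) <= enn_powr ?X (q / tau)" using q tau by (intro enn_powr_mono) auto
    thus ?thesis unfolding Lnorm_fdiff using q by (simp add: enn_powr_powr)
   qed
   hence "modulus Om k tau s1 t <= enn_powr ?X (q / tau)" unfolding modulus_def[of _ _ _ s1] by (intro SUP_least) simp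
   hence "enn_powr (modulus Om k tau s1 t) (tau / q) <= enn_powr (enn_powr ?X (q / tau)) (tau / q)" using q tau by (intro enn_powr_mono) auto
   thus ?thesis unfolding eX by (simp add: enn_powr_powr)
  qed
  have Nm [measurable]: "(%t. modulus Om k tau g t) \<in> bm" for g by (rule borel_measurable_mono_ennreal[OF modulus_mono])
  have Em [measurable]: "E \<in> bm" unfolding E_def[abs_def] by measurable
  let ?w = "%t. ennreal (t powr (- (s * tau) - 1)) * indicator {0<..} t"
  have e: "besov_int Om s k tau g = (LI t. ?w t * ?N g t)" for g
   unfolding besov_int_def by (intro nn_integral_cong) (simp add: ac_simps)
  have "enn_powr (LI t. ?w t * ?N s1 t) (1 / q) <= enn_powr (LI t. ?w t * ?N s2 t) (1 / q) + enn_powr (LI t. ?w t * E t) (1 / q)"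
  proof (rule minkowski_nn)
   show "AE t in lborel. enn_powr (?w t * ?N s1 t) (1 / q) <= enn_powr (?w t * ?N s2 t) (1 / q) + enn_powr (?w t * E t) (1 / q)"
   proof (intro always_eventually allI)
    fix t :: real
    show "enn_powr (?w t * ?N s1 t) (1 / q) <= enn_powr (?w t * ?N s2 t) (1 / q) + enn_powr (?w t * E t) (1 / q)"
    proof (cases "t > 0")
     case True
     have p: "1 / q > 0" using q by simp
     show ?thesis using mult_left_mono[OF step[OF True], of "enn_powr (?w t) (1 / q)"]
      unfolding enn_powr_mult[OF p, of "?w t"] distrib_left by simp
    qed simp
   qed
  qed (measurable, rule q(1))
  also have "(LI t. ?w t * E t) <= ennreal C * (LI x. ennreal (f x * infdist x V powr (- (s * tau))))"
  proof -
   have "(LI t. ?w t * E t) = (LI t. ennreal C0 * (LI x. ?w t * ennreal (f x * min 1 (t / infdist x V) powr alp)))"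
    unfolding E_def by (intro nn_integral_cong) (simp add: nn_integral_cmult ac_simps)
   also have "... = ennreal C0 * (LI t. (LI x. ?w t * ennreal (f x * min 1 (t / infdist x V) powr alp)))"
    by (rule nn_integral_cmult) measurable
   also have "(LI t. (LI x. ?w t * ennreal (f x * min 1 (t / infdist x V) powr alp))) =
     (LI x. (LI t. ?w t * ennreal (f x * min 1 (t / infdist x V) powr alp)))"
    by (rule lborel_pair.Fubini') measurable
   also have "... <= (LI x. ennreal D * ennreal (f x * infdist x V powr (- (s * tau))))"
   proof (rule nn_integral_mono_AE)
    show "AE x in lborel. (LI t. ?w t * ennreal (f x * min 1 (t / infdist x V) powr alp)) <= ennreal D * ennreal (f x * infdist x V powr (- (s * tau)))"
     using finite_null_infdist[OF V(1) Vne]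
    proof eventually_elim
     case (elim x)
     have f0: "f x >= 0" by (simp add: f_def)
     have "(LI t. ?w t * ennreal (f x * min 1 (t / infdist x V) powr alp)) =
      (LI t. ennreal (f x) * (ennreal (t powr (- (s * tau) - 1) * min 1 (t / infdist x V) powr alp) * indicator {0<..} t))"
      using f0 by (intro nn_integral_cong) (simp add: ennreal_mult ac_simps)
     also have "... = ennreal (f x) * (\<integral>\<^sup>+ t\<in>{0<..}. ennreal (t powr (- (s * tau) - 1) * min 1 (t / infdist x V) powr alp) \<partial>lborel)"
      by (rule nn_integral_cmult) measurable
     also have "... <= ennreal (f x) * ennreal (D * infdist x V powr (- (s * tau)))"
      unfolding D_def by (intro mult_left_mono time_integral elim s(1)) (use s in \<open>auto simp: alp_def\<close>)
     also have "... = ennreal D * ennreal (f x * infdist x V powr (- (s * tau)))" using f0 D by (simp add: ennreal_mult ac_simps)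
     finally show ?case .
    qed
   qed
   also have "... = ennreal D * (LI x. ennreal (f x * infdist x V powr (- (s * tau))))" by (rule nn_integral_cmult) measurable
   finally show ?thesis unfolding C_def using C0 D by (simp add: ennreal_mult mult.assoc mult_left_mono)
  qed
  finally show ?case unfolding e f_def using q by (simp add: enn_powr_mono add_left_mono)
 qed
qed

text \<open>Farthest-point insertion: \<open>dl w\<close> is the distance of \<open>w\<close> to the points inserted before it.\<close>

section \<open>Vertex clusters and voids\<close>

definition insertion_scale :: "'a::metric_space set => 'a set => ('a => real) => bool" where
 "insertion_scale V A dl \<longleftrightarrow> (\<forall>u\<in>V. \<forall>\<eta>\<ge>0. \<exists>w\<in>V. dist u w <= \<eta> & (w \<in> A | dl w > \<eta>)) &
   (\<forall>w\<in>V. \<forall>w'\<in>V. w ~= w' --> \<not> (w \<in> A & w' \<in> A) --> (\<exists>x\<in>{w, w'}. x \<notin> A & dl x <= dist w w'))"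

lemma insertion_scaleD:
 assumes "insertion_scale V A dl"
 shows "u \<in> V ==> \<eta> >= 0 ==> \<exists>w\<in>V. dist u w <= \<eta> & (w \<in> A | dl w > \<eta>)"
  "w \<in> V ==> w' \<in> V ==> w ~= w' ==> \<not> (w \<in> A & w' \<in> A) ==> \<exists>x\<in>{w, w'}. x \<notin> A & dl x <= dist w w'"
 using assms unfolding insertion_scale_def by (simp_all del: insert_iff)

text \<open>The induction inserts a point v of V - A farthest from A, at scale
  \<open>infdist v A\<close>. Since v is farthest, every point of V has a point of A within any
  radius from this scale on, so A can replace v there.\<close>

lemma insertion_scale_exists:
 fixes V :: "'a::heine_borel set"
 assumes V: "finite V" and A: "A <= V" "A ~= {}"
 shows "\<exists>dl. insertion_scale V A dl"
 using A
proof (induction "card (V - A)" arbitrary: A)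
 case 0
 hence "A = V" using V by auto
 thus ?case by (intro exI[of _ "%_. 0"]) (auto simp: insertion_scale_def intro!: bexI[of _ "_::'a"])
next
 case (Suc n)
 have fA: "finite A" using V Suc.prems finite_subset by blast
 have ne: "V - A ~= {}"
 proof
  assume "V - A = {}"
  hence "card (V - A) = 0" by (simp only: card.empty)
  thus False using Suc.hyps(2) by simp
 qed
 define m where "m = Max ((%u. infdist u A) ` (V - A))"
 have fin: "finite ((%u. infdist u A) ` (V - A))" using V by simp
 have "m \<in> (%u. infdist u A) ` (V - A)" unfolding m_def using ne by (intro Max_in fin) simp
 then obtain v where vm: "v \<in> V - A" "m = infdist v A" by blast
 have v: "v \<in> V - A" "!!u. u \<in> V - A ==> infdist u A <= infdist v A"
  using vm Max_ge[OF fin] unfolding m_def by simp_all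
 let ?d = "infdist v A"
 have "V - insert v A = (V - A) - {v}" by blast
 hence card: "n = card (V - insert v A)" using Suc.hyps(2) v(1) by (simp add: card_Diff_singleton)
 have "insert v A <= V" using v(1) Suc.prems by blast
 then obtain dl where dl: "insertion_scale V (insert v A) dl" using Suc.hyps(1)[OF card] by blast
 note d1 = insertion_scaleD(1)[OF dl] and d2 = insertion_scaleD(2)[OF dl]
 have le: "infdist u A <= ?d" if "u \<in> V" for u
  using v(2)[of u] that infdist_nonneg[of v A] by (cases "u \<in> A") auto
 let ?dl = "dl(v := ?d)"
 have 1: "\<exists>w\<in>V. dist u w <= \<eta> & (w \<in> A | ?dl w > \<eta>)" if u: "u \<in> V" and \<eta>: "\<eta> >= 0" for u \<eta>
 proof -
  obtain w where w: "w \<in> V" "dist u w <= \<eta>" "w \<in> insert v A | dl w > \<eta>" using d1[OF u \<eta>] by blast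
  show ?thesis
  proof (cases "w = v & ?d <= \<eta>")
   case True
   obtain a where a: "a \<in> A" "infdist u A = dist u a" using infdist_attains_inf[of A u] fA Suc.prems finite_imp_closed by blast
   hence "dist u a <= \<eta>" using le[OF u] True by linarith
   thus ?thesis using a Suc.prems by blast
  next
   case False
   thus ?thesis using w by (intro bexI[of _ w]) auto
  qed
 qed
 have 2: "\<exists>x\<in>{w, w'}. x \<notin> A & ?dl x <= dist w w'" if w: "w \<in> V" "w' \<in> V" "w ~= w'" "\<not> (w \<in> A & w' \<in> A)" for w w'
 proof (cases "w \<in> insert v A & w' \<in> insert v A")
  case False
  then obtain x where "x \<in> {w, w'}" "x \<notin> insert v A" "dl x <= dist w w'" using d2[OF w(1-3)] by blast
  thus ?thesis by (intro bexI[of _ x]) auto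
 next
  case True
  then consider "w = v" "w' \<in> A" | "w' = v" "w \<in> A" using w v(1) by blast
  thus ?thesis
  proof cases
   case 1
   hence "?d <= dist w w'" by (simp add: infdist_le)
   thus ?thesis using 1 v(1) by auto
  next
   case 2
   hence "?d <= dist w w'" by (metis infdist_le dist_commute)
   thus ?thesis using 2 v(1) by auto
  qed
 qed
 have "insertion_scale V A ?dl" unfolding insertion_scale_def using 1 2 by (intro conjI ballI allI impI)
 thus ?case by blast
qed

text \<open>Near either end there is a point of scale above \<open>\<eta>\<close>, or else the
  starting point of the insertion. The two points found are distinct, and the scale of the one
  inserted later is at most their distance. Points of the plane will be charged to such w.\<close>

lemma separation_scale:
 fixes V :: "'a::heine_borel set"
 assumes V: "finite V"
 shows "\<exists>dl::'a => real. \<forall>u\<in>V. \<forall>v\<in>V. \<forall>\<eta>\<ge>0. dist u v > 2 * \<eta> -->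
   (\<exists>w\<in>V. \<eta> < dl w & dl w <= dist u v + 2 * \<eta> & (dist u w <= \<eta> | dist v w <= \<eta>))"
proof (cases "V = {}")
 case False
 then obtain v0 where v0: "v0 \<in> V" by blast
 obtain dl where dl: "insertion_scale V {v0} dl" using insertion_scale_exists[OF V, of "{v0}"] v0 by auto
 note d1 = insertion_scaleD(1)[OF dl] and d2 = insertion_scaleD(2)[OF dl]
 have "\<exists>w\<in>V. \<eta> < dl w & dl w <= dist u v + 2 * \<eta> & (dist u w <= \<eta> | dist v w <= \<eta>)"
  if uv: "u \<in> V" "v \<in> V" "\<eta> >= 0" "dist u v > 2 * \<eta>" for u v \<eta>
 proof -
  obtain w where w: "w \<in> V" "dist u w <= \<eta>" "w = v0 | dl w > \<eta>" using d1[OF uv(1,3)] by auto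
  obtain w' where w': "w' \<in> V" "dist v w' <= \<eta>" "w' = v0 | dl w' > \<eta>" using d1[OF uv(2,3)] by auto
  have t: "dist w w' <= dist u v + 2 * \<eta>" using w(2) w'(2) dist_triangle[of w w' u] dist_triangle[of u w' v] by (simp add: dist_commute)
  have "w ~= w'" using w(2) w'(2) uv(4) dist_triangle[of u v w] by (auto simp: dist_commute)
  then obtain x where x: "x \<in> {w, w'}" "x ~= v0" "dl x <= dist w w'" using d2[OF w(1) w'(1)] by auto
  thus ?thesis using w w' t by (intro bexI[of _ x]) auto
 qed
 thus ?thesis by blast
qed simp

text \<open>Induction on the ground set: deleting v is injective on the family apart from
  \<open>{v}\<close> and at most one member F for which \<open>F - {v}\<close> is also a member; two
  such members would be nested, and the smaller would cross the larger without v.\<close>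

lemma laminar_card:
 assumes "finite V" "!!F. F \<in> \<F> ==> F <= V & F ~= {}"
  and "!!F G. F \<in> \<F> ==> G \<in> \<F> ==> F \<inter> G ~= {} ==> F <= G | G <= F"
 shows "card \<F> <= 2 * card V"
 using assms
proof (induction V arbitrary: \<F> rule: finite_induct)
 case empty
 hence "\<F> = {}" by blast
 thus ?case by simp
next
 case (insert v V)
 define \<G> where "\<G> = {F - {v} | F. F \<in> \<F>} - {{}}"
 have fin: "finite \<F>" by (rule finite_subset[of _ "Pow (insert v V)"]) (use insert in auto)
 have IH: "card \<G> <= 2 * card V"
 proof (rule insert.IH)
  show "F <= V & F ~= {}" if "F \<in> \<G>" for F using that insert.prems(1) unfolding \<G>_def by blast
  show "F <= G | G <= F" if FG: "F \<in> \<G>" "G \<in> \<G>" "F \<inter> G ~= {}" for F G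
  proof -
   obtain F' G' where *: "F = F' - {v}" "F' \<in> \<F>" "G = G' - {v}" "G' \<in> \<F>" using FG unfolding \<G>_def by blast
   hence "F' \<inter> G' ~= {}" using FG by blast
   hence "F' <= G' | G' <= F'" using insert.prems(2) * by blast
   thus ?thesis using * by blast
  qed
 qed
 let ?B = "{F \<in> \<F>. v \<in> F & F - {v} \<in> \<F>}"
 have B: "card ?B <= 1"
 proof (rule card_le_Suc0_iff_eq[THEN iffD2, folded One_nat_def])
  show "finite ?B" using fin by simp
  show "\<forall>F\<in>?B. \<forall>G\<in>?B. F = G"
  proof (intro ballI)
   fix F G assume FG: "F \<in> ?B" "G \<in> ?B"
   have *: "H = G'" if H: "H \<in> ?B" "G' \<in> ?B" "H <= G'" for H G'
   proof -
    have "H - {v} ~= {}" using H insert.prems(1) by blast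
    hence "H \<inter> (G' - {v}) ~= {}" using H by blast
    hence "H <= G' - {v} | G' - {v} <= H" using H insert.prems(2)[of H "G' - {v}"] by blast
    thus ?thesis using H by blast
   qed
   have "F \<inter> G ~= {}" using FG by blast
   hence "F <= G | G <= F" using FG insert.prems(2)[of F G] by blast
   thus "F = G" using *[OF FG] *[OF FG(2,1)] by blast
  qed
 qed
 have inj: "inj_on (%F. F - {v}) (\<F> - ?B - {{v}})"
 proof (rule inj_onI)
  fix F G assume FG: "F \<in> \<F> - ?B - {{v}}" "G \<in> \<F> - ?B - {{v}}" "F - {v} = G - {v}"
  show "F = G"
  proof (cases "v \<in> F \<longleftrightarrow> v \<in> G")
   case True
   thus ?thesis using FG(3) by blast
  next
   case False
   then consider "v \<in> F" "G = F - {v}" | "v \<in> G" "F = G - {v}" using FG(3) by blast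
   thus ?thesis
   proof cases
    case 1
    hence "F \<in> ?B" using FG(1,2) by blast
    thus ?thesis using FG(1) by blast
   next
    case 2
    hence "G \<in> ?B" using FG(1,2) by blast
    thus ?thesis using FG(2) by blast
   qed
  qed
 qed
 have "card (\<F> - ?B - {{v}}) <= card \<G>"
 proof (rule card_inj_on_le[OF inj])
  have "\<G> <= Pow V" using insert.prems(1) unfolding \<G>_def by blast
  thus "finite \<G>" using insert.hyps finite_subset by blast
  show "(%F. F - {v}) ` (\<F> - ?B - {{v}}) <= \<G>"
  proof
   fix X assume "X \<in> (%F. F - {v}) ` (\<F> - ?B - {{v}})"
   then obtain F where F: "F \<in> \<F>" "F ~= {v}" "X = F - {v}" by blast
   hence "X ~= {}" using insert.prems(1)[of F] by blast
   thus "X \<in> \<G>" using F unfolding \<G>_def by blast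
  qed
 qed
 moreover have "card \<F> <= card (\<F> - ?B - {{v}}) + card ?B + 1"
 proof -
  have "\<F> <= (\<F> - ?B - {{v}}) \<union> ?B \<union> {{v}}" by blast
  hence "card \<F> <= card ((\<F> - ?B - {{v}}) \<union> ?B \<union> {{v}})" using fin by (intro card_mono) auto
  also have "... <= card (\<F> - ?B - {{v}}) + card ?B + card {{v}}"
   by (intro order_trans[OF card_Un_le] add_mono card_Un_le order_refl)
  finally show ?thesis by simp
 qed
 ultimately have "card \<F> <= 2 * card V + 2" using IH B by linarith
 thus ?case using insert.hyps by simp
qed

section \<open>Voids, their clusters and their number\<close>

definition clus :: "real => pt set => pt => pt set" where
 "clus La V x = V \<inter> cball x (La * infdist x V)"

text \<open>Seen from x, the vertices within \<open>La\<close> times the distance from V form one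
  cluster, of diameter at most a quarter of that distance. Between this cluster and the radius of
  the search there is no vertex.\<close>

definition void :: "real => pt set => pt => bool" where
 "void La V x \<longleftrightarrow> infdist x V > 0 & (\<forall>u\<in>clus La V x. \<forall>v\<in>clus La V x. dist u v <= infdist x V / 4)"

lemma clus_nearest:
 assumes V: "finite V" "V ~= {}" and La: "La >= 1"
 shows "\<exists>v\<in>clus La V x. dist x v = infdist x V"
proof -
 obtain v where v: "v \<in> V" "infdist x V = dist x v" using infdist_attains_inf[of V x] V finite_imp_closed by blast
 have "1 * infdist x V <= La * infdist x V" using La infdist_nonneg by (intro mult_right_mono) auto
 thus ?thesis using v by (intro bexI[of _ v]) (auto simp: clus_def)
qed

lemma void_dist:
 assumes V: "finite V" "V ~= {}" and La: "La >= 1" and x: "void La V x" and c: "c \<in> clus La V x"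
 shows "infdist x V <= dist x c" "dist x c <= 5/4 * infdist x V"
proof -
 show "infdist x V <= dist x c" using c by (intro infdist_le) (simp add: clus_def)
 obtain v where v: "v \<in> clus La V x" "dist x v = infdist x V" using clus_nearest[OF V La] by blast
 have "dist v c <= infdist x V / 4" using x v c by (simp add: void_def)
 thus "dist x c <= 5/4 * infdist x V" using dist_triangle[of x c v] v(2) by linarith
qed

text \<open>From the point with the larger distance from V, a common vertex is within 5/4 of that
  distance and the rest of the other cluster within a further quarter; this stays below the factor
  2.\<close>

lemma clus_laminar:
 assumes V: "finite V" "V ~= {}" and La: "La >= 2" and x: "void La V x" "void La V x'" and ne: "clus La V x \<inter> clus La V x' ~= {}"
 shows "clus La V x <= clus La V x' | clus La V x' <= clus La V x"
proof -
 have *: "clus La V x <= clus La V x'" if x: "void La V x" "void La V x'" and ne: "clus La V x \<inter> clus La V x' ~= {}" and le: "infdist x V <= infdist x' V" for x x'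
 proof
  fix u assume u: "u \<in> clus La V x"
  obtain z where z: "z \<in> clus La V x" "z \<in> clus La V x'" using ne by blast
  have "dist x' z <= 5/4 * infdist x' V" using void_dist(2)[OF V _ x(2) z(2)] La by simp
  moreover have "dist z u <= infdist x V / 4" using x(1) z u by (simp add: void_def)
  moreover have "2 * infdist x' V <= La * infdist x' V" using La infdist_nonneg by (intro mult_right_mono) auto
  ultimately have "dist x' u <= La * infdist x' V" using dist_triangle[of x' u z] le infdist_nonneg[of x' V] by linarith
  thus "u \<in> clus La V x'" using u by (simp add: clus_def)
 qed
 show ?thesis
 proof (cases "infdist x V <= infdist x' V")
  case True
  thus ?thesis using *[OF x ne] by blast
 next
  case False
  thus ?thesis using *[OF x(2,1)] ne by (simp add: Int_commute)
 qed
qed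

text \<open>There may be many scales around one vertex, but laminarity keeps the number of distinct
  clusters linear in the number of vertices.\<close>

lemma void_clusters_card:
 assumes V: "finite V" "V ~= {}" and La: "La >= 2"
 shows "finite (clus La V ` Collect (void La V))" "card (clus La V ` Collect (void La V)) <= 2 * card V"
proof -
 show "finite (clus La V ` Collect (void La V))"
  by (rule finite_subset[of _ "Pow V"]) (use V in \<open>auto simp: clus_def\<close>)
 show "card (clus La V ` Collect (void La V)) <= 2 * card V"
 proof (rule laminar_card[OF V(1)])
  show "F <= V & F ~= {}" if F: "F \<in> clus La V ` Collect (void La V)" for F
  proof -
   obtain x where "F = clus La V x" using F by blast
   thus ?thesis using clus_nearest[OF V, of La x] La by (auto simp: clus_def)
  qed
  show "F <= G | G <= F" if "F \<in> clus La V ` Collect (void La V)" "G \<in> clus La V ` Collect (void La V)" "F \<inter> G ~= {}" for F G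
   using that clus_laminar[OF V La] by blast
 qed
qed

text \<open>Inside the vertex-free annulus around a cluster, the cluster can be recovered from any point.\<close>

lemma void_annulus:
 assumes V: "finite V" "V ~= {}" and mu: "mu >= 0" and x: "void (20 * (1 + mu)) V x" and c: "c \<in> clus (20 * (1 + mu)) V x"
  and l: "1 <= l" "l <= 1 + mu" and y: "y = c + l *\<^sub>R (x - c)"
 shows "infdist y V >= l * dist x c - infdist x V / 4" "infdist y V <= l * dist x c" "infdist x V <= infdist y V * 4/3"
  "V \<inter> cball y (2 * infdist y V) = clus (20 * (1 + mu)) V x"
proof -
 let ?L = "20 * (1 + mu)" and ?r = "infdist x V"
 have L: "?L >= 1" using mu by simp
 note d = void_dist[OF V L x c]
 have r: "?r > 0" using x by (simp add: void_def)
 have yo: "dist y c = l * dist x c" using l by (simp add: y dist_norm)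
 have xy: "dist x y = (l - 1) * dist x c"
 proof -
  have "y - x = (l - 1) *\<^sub>R (x - c)" by (simp add: y algebra_simps)
  hence "norm (y - x) = (l - 1) * norm (x - c)" using l by simp
  thus ?thesis by (simp add: dist_norm norm_minus_commute)
 qed
 have "(l - 1) * dist x c <= mu * (5/4 * ?r)" using l d by (intro mult_mono) auto
 hence xy2: "dist x y <= 5/4 * (mu * ?r)" using xy by simp
 have "l * dist x c <= (1 + mu) * (5/4 * ?r)" using l d by (intro mult_mono) auto
 hence yo2: "l * dist x c <= 5/4 * ?r + 5/4 * (mu * ?r)" by (simp add: algebra_simps)
 have "1 * ?r <= l * dist x c" using l d r by (intro mult_mono) auto
 hence yo1: "?r <= l * dist x c" by simp
 have mr: "mu * ?r >= 0" using mu r by simp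
 have inn: "dist y u <= l * dist x c + ?r / 4" "dist y u >= l * dist x c - ?r / 4" if "u \<in> clus ?L V x" for u
 proof -
  have "dist c u <= ?r / 4" using x c that by (simp add: void_def)
  thus "dist y u <= l * dist x c + ?r / 4" "dist y u >= l * dist x c - ?r / 4"
   using yo dist_triangle[of y u c] dist_triangle[of y c u] by (simp_all add: dist_commute)
 qed
 have out: "dist y u > 2 * (l * dist x c)" if "u \<in> V" "u \<notin> clus ?L V x" for u
 proof -
  have "dist x u > ?L * ?r" using that by (simp add: clus_def)
  hence "dist x u > 20 * ?r + 20 * (mu * ?r)" by (simp add: algebra_simps)
  thus ?thesis using dist_triangle[of x u y] xy2 yo2 mr r by linarith
 qed
 have oV: "c \<in> V" using c by (simp add: clus_def)
 show up: "infdist y V <= l * dist x c" using infdist_le[OF oV, of y] yo by simp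
 obtain v where v: "v \<in> V" "infdist y V = dist y v" using infdist_attains_inf[of V y] V finite_imp_closed by blast
 have "v \<in> clus ?L V x" using out[OF v(1)] v(2) up yo1 r by fastforce
 thus lo: "infdist y V >= l * dist x c - ?r / 4" using inn(2) v(2) by simp
 thus "?r <= infdist y V * 4/3" using yo1 by linarith
 show "V \<inter> cball y (2 * infdist y V) = clus ?L V x"
 proof (intro equalityI subsetI)
  fix u assume u: "u \<in> V \<inter> cball y (2 * infdist y V)"
  hence "dist y u <= 2 * (l * dist x c)" using up by simp
  thus "u \<in> clus ?L V x" using out[of u] u by force
 next
  fix u assume u: "u \<in> clus ?L V x"
  hence "dist y u <= 2 * infdist y V" using inn(1)[OF u] lo yo1 r by linarith
  thus "u \<in> V \<inter> cball y (2 * infdist y V)" using u by (simp add: clus_def)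
 qed
qed

lemma clus_iff: "u \<in> clus La V x \<longleftrightarrow> u \<in> V & dist x u <= La * infdist x V"
 by (simp add: clus_def)

lemma void_borel:
 assumes V: "finite V"
 shows "{x. void La V x} \<in> sets borel" "{x. clus La V x = A} \<in> sets borel"
proof -
 have 1: "{x. void La V x} = {x. infdist x V > 0} \<inter> (\<Inter>u\<in>V. \<Inter>v\<in>V. {x. dist x u <= La * infdist x V & dist x v <= La * infdist x V --> dist u v <= infdist x V / 4})"
  by (auto simp: void_def clus_iff)
 show "{x. void La V x} \<in> sets borel"
 proof (cases "V = {}")
  case True
  thus ?thesis unfolding void_def by (simp add: infdist_def)
 next
  case False
  thus ?thesis unfolding 1 using V by (intro sets.Int sets.finite_INT) measurable
 qed
 show "{x. clus La V x = A} \<in> sets borel"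
 proof (cases "A <= V")
  case True
  have eq: "{x. clus La V x = A} = {x. \<forall>u\<in>V. dist x u <= La * infdist x V \<longleftrightarrow> u \<in> A}"
   using True by (auto simp: clus_def)
  have [measurable]: "Measurable.pred borel (%x. dist x u <= La * infdist x V)" for u :: pt by measurable
  have "Measurable.pred borel (%x. \<forall>u\<in>V. dist x u <= La * infdist x V \<longleftrightarrow> u \<in> A)"
   using V by (intro pred_intros_finite) measurable
  thus ?thesis unfolding eq by simp
 next
  case False
  hence "{x. clus La V x = A} = {}" by (auto simp: clus_def)
  thus ?thesis by simp
 qed
qed

section \<open>Weighted area estimates\<close>

text \<open>A point at distance r from V that lies in no void sees two vertices more than r/4 apart.
  \<open>separation_scale\<close> with \<open>\<eta>\<close> equal to r/8 gives a vertex w near one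
  of them whose scale \<open>dl w\<close> is comparable to r. The points charged to w lie in a ball
  of radius comparable to \<open>dl w\<close>, so w contributes a bounded amount.\<close>

lemma nonvoid_integral:
 assumes La: "La >= 1"
 shows "\<exists>C>0. \<forall>V. finite V --> V ~= {} -->
  (LI x. ennreal (infdist x V powr (-2)) * indicator {x. infdist x V > 0 & \<not> void La V x} x) <= ennreal (C * real (card V))"
proof -
 define C where "C = (2 * La + 1)\<^sup>2 * (9 * (La + 1))\<^sup>2 * unit_area"
 have C: "C > 0" using La unit_area_pos unfolding C_def by (intro mult_pos_pos zero_less_power) auto
 show ?thesis
 proof (intro exI[of _ C] conjI[OF C] allI impI, goal_cases)
  case (1 V)
  note V = 1
  obtain dl where dl: "!!u v \<eta>. u \<in> V ==> v \<in> V ==> \<eta> >= 0 ==> dist u v > 2 * \<eta> ==>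
    \<exists>w\<in>V. \<eta> < dl w & dl w <= dist u v + 2 * \<eta> & (dist u w <= \<eta> | dist v w <= \<eta>)"
   using separation_scale[OF V(1)] by blast
  let ?W = "{w \<in> V. dl w > 0}"
  let ?g = "%w x. ennreal ((dl w / (2 * La + 1)) powr (-2)) * indicator (ball w (9 * (La + 1) * dl w)) x"
  have "(LI x. ennreal (infdist x V powr (-2)) * indicator {x. infdist x V > 0 & \<not> void La V x} x) <= (LI x. (\<Sum>w\<in>?W. ?g w x))"
  proof (rule nn_integral_mono)
   fix x
   let ?r = "infdist x V"
   show "ennreal (?r powr (-2)) * indicator {x. infdist x V > 0 & \<not> void La V x} x <= (\<Sum>w\<in>?W. ?g w x)"
   proof (cases "?r > 0 & \<not> void La V x")
    case True
    then obtain u v where uv: "u \<in> clus La V x" "v \<in> clus La V x" "dist u v > ?r / 4" by (auto simp: void_def not_le)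
    have uV: "u \<in> V" "v \<in> V" "dist x u <= La * ?r" "dist x v <= La * ?r" using uv by (simp_all add: clus_iff)
    have d8: "2 * (?r / 8) < dist u v" "0 <= ?r / 8" using uv(3) True by auto
    obtain w where w: "w \<in> V" "?r / 8 < dl w" "dl w <= dist u v + 2 * (?r / 8)" "dist u w <= ?r / 8 | dist v w <= ?r / 8"
     using dl[OF uV(1,2) d8(2,1)] by blast
    have xw: "dist x w <= La * ?r + ?r / 8"
     using w(4) uV(3,4) dist_triangle[of x w u] dist_triangle[of x w v] by linarith
    have "dist u v <= 2 * (La * ?r)" using uV(3,4) dist_triangle[of u v x] by (simp add: dist_commute)
    hence "dl w <= (2 * La + 1) * ?r" using w(3) True by (simp add: distrib_right)
    hence d1: "dl w / (2 * La + 1) <= ?r" using La by (simp add: field_simps)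
    have dw: "dl w > 0" using w(2) True by linarith
    have "(La + 1) * ?r <= (La + 1) * (8 * dl w)" using w(2) La by (intro mult_left_mono) auto
    also have "... < 9 * (La + 1) * dl w" using La dw by simp
    finally have "dist w x < 9 * (La + 1) * dl w" using xw True by (simp add: distrib_right dist_commute)
    hence a: "?g w x = ennreal ((dl w / (2 * La + 1)) powr (-2))" by simp
    have b: "ennreal (?r powr (-2)) <= ennreal ((dl w / (2 * La + 1)) powr (-2))" using d1 dw La by (intro ennreal_leI powr_mono2') auto
    have "?g w x <= (\<Sum>w\<in>?W. ?g w x)" using w(1) dw V by (intro member_le_sum) auto
    hence "ennreal (?r powr (-2)) <= (\<Sum>w\<in>?W. ?g w x)" unfolding a by (rule order_trans[OF b])
    moreover have "ennreal (?r powr (-2)) * indicator {x. infdist x V > 0 & \<not> void La V x} x = ennreal (?r powr (-2))" using True by simp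
    ultimately show ?thesis by (simp only:)
   qed simp
  qed
  also have "... = (\<Sum>w\<in>?W. (LI x. ?g w x))" by (rule nn_integral_sum) simp
  also have "... <= (\<Sum>w\<in>?W. ennreal C)"
  proof (rule sum_mono)
   fix w assume "w \<in> ?W"
   hence d: "dl w > 0" by simp
   have R: "9 * (La + 1) * dl w > 0" using d La by simp
   have "(LI x. ?g w x) = ennreal ((dl w / (2 * La + 1)) powr (-2)) * emeasure lborel (ball w (9 * (La + 1) * dl w))"
    by (rule nn_integral_cmult_indicator) simp
   also have "... = ennreal ((dl w / (2 * La + 1)) powr (-2) * ((9 * (La + 1) * dl w)\<^sup>2 * unit_area))"
    unfolding emeasure_ball_pt[OF R] by (rule ennreal_mult[symmetric]) (use unit_area_pos in auto)
   also have "(dl w / (2 * La + 1)) powr (-2) * ((9 * (La + 1) * dl w)\<^sup>2 * unit_area) = C"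
   proof -
    have "(dl w / (2 * La + 1)) powr (-2) = (2 * La + 1)\<^sup>2 / (dl w)\<^sup>2"
     using d La by (simp add: powr_minus powr_numeral power_divide)
    thus ?thesis using d by (simp add: C_def power_mult_distrib)
   qed
   finally show "(LI x. ?g w x) <= ennreal C" by simp
  qed
  also have "... = of_nat (card ?W) * ennreal C" by simp
  also have "... <= of_nat (card V) * ennreal C" using V by (intro mult_right_mono) (auto intro: card_mono)
  also have "... = ennreal (C * real (card V))" using C by (simp add: ennreal_of_nat_eq_real_of_nat ennreal_mult mult.commute)
  finally show ?case .
 qed
qed

lemma strip_area_scaled:
 "\<exists>C>0. \<forall>nv (q::pt) t u. norm nv = 1 --> t > 0 --> u > 0 --> emeasure lborel {x \<in> ball q t. abs(nv \<bullet> (x - q)) <= u} <= ennreal (C * t * u)"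
proof -
 obtain Cs where Cs: "Cs > 0" "!!(n::pt) a s. norm n = 1 ==> s > 0 ==> emeasure lborel {u \<in> ball 0 5. abs(n \<bullet> u - a) <= s} <= ennreal (Cs * s)"
  using strip_area by auto
 show ?thesis
 proof (intro exI[of _ Cs] conjI[OF Cs(1)] allI impI, goal_cases)
  case (1 nv q t u)
  note n = 1(1) and t = 1(2) and u = 1(3)
  let ?S = "{x \<in> ball q t. abs(nv \<bullet> (x - q)) <= u}" and ?T = "{y \<in> ball 0 5. abs(nv \<bullet> y - 0) <= 5 * u / t}"
  have [measurable]: "?S \<in> sets borel" "?T \<in> sets borel" by measurable
  have mem: "q + (t / 5) *\<^sub>R y \<in> ?S \<longleftrightarrow> y \<in> ?T" for y
   using t by (auto simp: dist_norm abs_mult field_simps)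
  have "(LI y. indicator ?S (q + (t / 5) *\<^sub>R y)) = ennreal (1 / (t / 5)\<^sup>2) * (LI x. indicator ?S x)"
   by (rule nn_integral_scale_pt) (use t in auto)
  also have "(LI y. indicator ?S (q + (t / 5) *\<^sub>R y)) = (LI y. indicator ?T y)"
   using mem by (intro nn_integral_cong) (simp only: indicator_def)
  finally have e: "emeasure lborel ?T = ennreal (1 / (t / 5)\<^sup>2) * emeasure lborel ?S" by simp
  have "emeasure lborel ?S = ennreal ((t / 5)\<^sup>2) * (ennreal (1 / (t / 5)\<^sup>2) * emeasure lborel ?S)"
   using t by (simp add: mult.assoc[symmetric] flip: ennreal_mult)
  also have "... <= ennreal ((t / 5)\<^sup>2) * ennreal (Cs * (5 * u / t))"
   unfolding e[symmetric] using t u by (intro mult_left_mono Cs n) auto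
  also have "... = ennreal ((t / 5)\<^sup>2 * (Cs * (5 * u / t)))" using Cs t u by (intro ennreal_mult[symmetric]) auto
  also have "... <= ennreal (Cs * t * u)"
  proof (rule ennreal_leI)
   have e: "(t / 5)\<^sup>2 * (Cs * (5 * u / t)) = (Cs * t * u) / 5" using t by (simp add: power2_eq_square)
   have "Cs * t * u >= 0" using Cs t u by simp
   thus "(t / 5)\<^sup>2 * (Cs * (5 * u / t)) <= Cs * t * u" unfolding e by linarith
  qed
  finally show ?case .
 qed
qed

text \<open>The part of the strip within distance about t of q has area at most a multiple of t u,
  so by layers the integral is bounded by u times the integral of \<open>t powr (-2)\<close> from c
  u on, which is \<open>1 / c\<close> irrespective of u.\<close>

lemma strip_integral:
 "\<exists>C>0. \<forall>nv (q::pt) u c. norm nv = 1 --> u >= 0 --> c > 0 -->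
   (LI x. ennreal (dist x q powr (-2)) * indicator {x. abs(nv \<bullet> (x - q)) <= u & c * u <= dist x q} x) <= ennreal (C / c)"
proof -
 obtain Cs where Cs: "Cs > 0" "!!nv (q::pt) t u. norm nv = 1 ==> t > 0 ==> u > 0 ==> emeasure lborel {x \<in> ball q t. abs(nv \<bullet> (x - q)) <= u} <= ennreal (Cs * t * u)"
  using strip_area_scaled by blast
 have main: "(LI x. ennreal (dist x q powr (-2)) * indicator {x. abs(nv \<bullet> (x - q)) <= u & c * u <= dist x q} x) <= ennreal (4 * Cs / c)"
  if n: "norm nv = 1" and u: "u >= 0" and c: "c > 0" for nv q :: pt and u c
 proof (cases "u = 0")
  case True
  \<comment> \<open>A strip of width zero is a line.\<close>
  have "negligible {x. nv \<bullet> x = nv \<bullet> q}" using n by (intro negligible_hyperplane) auto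
  hence "{x. nv \<bullet> x = nv \<bullet> q} \<in> null_sets lebesgue" by (simp add: negligible_iff_null_sets)
  hence "AE x in lebesgue. x \<notin> {x. nv \<bullet> x = nv \<bullet> q}" by (rule AE_not_in)
  hence "AE x in lborel. x \<notin> {x. nv \<bullet> x = nv \<bullet> q}" by (simp only: AE_completion_iff)
  hence "AE x in lborel. ennreal (dist x q powr (-2)) * indicator {x. abs(nv \<bullet> (x - q)) <= u & c * u <= dist x q} x = 0"
   by (rule eventually_mono) (auto simp: True inner_diff_right)
  hence "(LI x. ennreal (dist x q powr (-2)) * indicator {x. abs(nv \<bullet> (x - q)) <= u & c * u <= dist x q} x) = (\<integral>\<^sup>+ x. 0 \<partial>(lborel :: pt measure))"
   by (rule nn_integral_cong_AE)
  thus ?thesis by simp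
 next
  case False
  hence u: "u > 0" using u by simp
  let ?S = "{x. abs(nv \<bullet> (x - q)) <= u & c * u <= dist x q}"
  have [measurable]: "?S \<in> sets borel" by measurable
  \<comment> \<open>Layer cake formula for the inverse square; it turns the weight into areas of
    strips in balls.\<close>
  have lay: "ennreal (d powr (-2)) = (LI t. ennreal (2 * t powr (-3)) * indicator {d..} t)" if "d > 0" for d :: real
  proof -
   have "((%t. 2 * t powr (-3)) has_integral 2 * (- (d powr (-3 + 1)) / (-3 + 1))) {d..}"
    by (intro has_integral_mult_right has_integral_powr_to_inf that) auto
   from nn_integral_has_integral_lebesgue'[OF _ this] show ?thesis by simp
  qed
  let ?G = "%x t. ennreal (2 * t powr (-3)) * indicator {dist x q..} t * indicator ?S x"
  have "(LI x. ennreal (dist x q powr (-2)) * indicator ?S x) = (LI x. (LI t. ?G x t))"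
  proof (rule nn_integral_cong)
   fix x
   show "ennreal (dist x q powr (-2)) * indicator ?S x = (LI t. ?G x t)"
   proof (cases "x \<in> ?S")
    case True
    hence "dist x q > 0" using u c by (smt (verit, best) mem_Collect_eq mult_pos_pos)
    thus ?thesis using True lay by simp
   qed simp
  qed
  also have "... = (LI t. (LI x. ?G x t))"
  proof (rule lborel_pair.Fubini'[symmetric])
   have "?G x t = (if dist x q <= t & x \<in> ?S then ennreal (2 * t powr (-3)) else 0)" for x t by (auto simp: indicator_def)
   hence "(%(x, t). ?G x t) = (%(x, t). if dist x q <= t & x \<in> ?S then ennreal (2 * t powr (-3)) else 0)" by (auto simp: fun_eq_iff)
   moreover have "(%(x, t). if dist x q <= t & x \<in> ?S then ennreal (2 * t powr (-3)) else 0) \<in> borel_measurable (lborel \<Otimes>\<^sub>M lborel)" by measurable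
   ultimately show "(%(x, t). ?G x t) \<in> borel_measurable (lborel \<Otimes>\<^sub>M lborel)" by simp
  qed
  also have "... <= (LI t. ennreal (4 * Cs * u * t powr (-2)) * indicator {c * u..} t)"
  proof (rule nn_integral_mono)
   fix t :: real
   show "(LI x. ?G x t) <= ennreal (4 * Cs * u * t powr (-2)) * indicator {c * u..} t"
   proof (cases "c * u <= t")
    case True
    have "c * u > 0" using u c by simp
    hence t: "t > 0" using True by linarith
    have "(LI x. ?G x t) <= (LI x. ennreal (2 * t powr (-3)) * indicator {x \<in> ball q (2 * t). abs(nv \<bullet> (x - q)) <= u} x)"
     using t by (intro nn_integral_mono) (auto simp: indicator_def dist_commute)
    also have "... = ennreal (2 * t powr (-3)) * emeasure lborel {x \<in> ball q (2 * t). abs(nv \<bullet> (x - q)) <= u}"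
     by (rule nn_integral_cmult_indicator) measurable
    also have "... <= ennreal (2 * t powr (-3)) * ennreal (Cs * (2 * t) * u)" using t u n by (intro mult_left_mono Cs) auto
    also have "... = ennreal (2 * t powr (-3) * (Cs * (2 * t) * u))" using Cs t u by (intro ennreal_mult[symmetric]) auto
    also have "2 * t powr (-3) * (Cs * (2 * t) * u) = 4 * Cs * u * t powr (-2)"
    proof -
     have "t powr (-3) * t powr 1 = t powr (-3 + 1)" by (rule powr_add[symmetric])
     hence "t powr (-3) * t = t powr (-2)" using t by simp
     thus ?thesis by (simp add: ac_simps)
    qed
    finally show ?thesis using True by simp
   next
    case False
    hence "?G x t = 0" for x by (auto simp: indicator_def)
    hence "(LI x. ?G x t) = (\<integral>\<^sup>+ x. 0 \<partial>(lborel :: pt measure))" by (intro nn_integral_cong)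
    thus ?thesis by (simp only: zero_le nn_integral_const mult_zero_left)
   qed
  qed
  also have "... = ennreal (4 * Cs / c)"
  proof -
   have "((%t. 4 * Cs * u * t powr (-2)) has_integral 4 * Cs * u * (- ((c * u) powr (-2 + 1)) / (-2 + 1))) {c * u..}"
    by (intro has_integral_mult_right has_integral_powr_to_inf) (use u c in auto)
   from nn_integral_has_integral_lebesgue'[OF _ this]
   have "(LI t. ennreal (4 * Cs * u * t powr (-2)) * indicator {c * u..} t) = ennreal (4 * Cs * u * (- ((c * u) powr (-2 + 1)) / (-2 + 1)))"
    using Cs u by simp
   also have "4 * Cs * u * (- ((c * u) powr (-2 + 1)) / (-2 + 1)) = 4 * Cs / c" using u c by (simp add: powr_minus field_simps)
   finally show ?thesis .
  qed
  finally show ?thesis .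
 qed
 show ?thesis using Cs(1) by (intro exI[of _ "4 * Cs"] conjI allI impI main) auto
qed

section \<open>Edges that can cross a vertex-free annulus\<close>

lemma disjoint_balls_card:
 fixes y :: "'i => pt"
 assumes fin: "finite J" and rho: "rho > 0" and D: "D > 0" and sub: "!!j. j \<in> J ==> ball (y j) rho <= ball q D"
  and disj: "!!i j. i \<in> J ==> j \<in> J ==> i ~= j ==> ball (y i) rho \<inter> ball (y j) rho = {}"
 shows "real (card J) <= (D / rho)\<^sup>2"
proof -
 have "(\<Sum>j\<in>J. emeasure lborel (ball (y j) rho)) = emeasure lborel (\<Union>j\<in>J. ball (y j) rho)"
  by (rule sum_emeasure) (use fin disj in \<open>auto simp: disjoint_family_on_def\<close>)
 also have "... <= emeasure lborel (ball q D)" by (rule emeasure_mono) (use sub in auto)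
 finally have "ennreal (real (card J) * (rho\<^sup>2 * unit_area)) <= ennreal (D\<^sup>2 * unit_area)"
  using rho D unit_area_pos by (simp add: emeasure_ball_pt ennreal_mult ennreal_of_nat_eq_real_of_nat)
 hence "real (card J) * (rho\<^sup>2 * unit_area) <= D\<^sup>2 * unit_area" using unit_area_pos by (subst (asm) ennreal_le_iff) auto
 hence "real (card J) * rho\<^sup>2 <= D\<^sup>2" using unit_area_pos by (simp add: mult.assoc[symmetric])
 thus ?thesis using rho by (simp add: power_divide pos_le_divide_eq)
qed

text \<open>D will be the distance from q to the vertices outside the cluster. An edge crossing the
  annulus makes its cell contain a half-disc of size comparable to D at distance D/2 from q, and few
  cells have room for that. The demand \<open>D > 0\<close> also discards the default distance to an
  empty set.\<close>

definition cands :: "real => nat => (nat => pt set) => (nat => (pt \<times> pt) set) => pt => real => (nat \<times> pt \<times> pt) set" where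
 "cands kp m R E q D = {(j, e). j < m & e \<in> E j & D > 0 &
   (\<exists>y nv. dist y q = D / 2 & norm nv = 1 & halfdisc y nv (kp * D / 4) <= closure (R j))}"

lemma ball_subset_halfdisc:
 fixes nv :: pt
 assumes nv: "norm nv = 1" and rho: "rho > 0"
 shows "ball (y + (rho / 2) *\<^sub>R nv) (rho / 2) <= halfdisc y nv rho"
proof
 fix z assume "z \<in> ball (y + (rho / 2) *\<^sub>R nv) (rho / 2)"
 hence z: "norm (z - y - (rho / 2) *\<^sub>R nv) < rho / 2" by (simp add: dist_norm norm_minus_commute algebra_simps)
 have "norm (z - y) <= norm (z - y - (rho / 2) *\<^sub>R nv) + norm ((rho / 2) *\<^sub>R nv)" using norm_triangle_sub[of "z - y" "(rho / 2) *\<^sub>R nv"] by linarith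
 hence "dist z y <= rho" using z nv rho by (simp add: dist_norm)
 moreover have "abs(nv \<bullet> (z - y - (rho / 2) *\<^sub>R nv)) <= norm nv * norm (z - y - (rho / 2) *\<^sub>R nv)" by (rule Cauchy_Schwarz_ineq2)
 hence "abs(nv \<bullet> (z - y) - rho / 2) <= rho / 2" using z nv by (simp add: inner_diff_right norm_eq_1)
 hence "nv \<bullet> (z - y) >= 0" by linarith
 ultimately show "z \<in> halfdisc y nv rho" by (simp add: halfdisc_def)
qed

text \<open>The half-discs of distinct cells contain disjoint balls of radius
  \<open>kp * D / 8\<close> inside a ball of radius D, which bounds the number of cells by area;
  each cell has at most M edges.\<close>

lemma cands_card:
 assumes c: "cells kp M Om m R E" and kp: "0 < kp" "kp <= 1"
 shows "finite (cands kp m R E q D)" "real (card (cands kp m R E q D)) <= 64 / kp\<^sup>2 * real M"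
proof -
 let ?J = "fst ` cands kp m R E q D"
 have fJ: "finite ?J" by (rule finite_subset[of _ "{..<m}"]) (auto simp: cands_def)
 have fE: "finite (E j)" if "j < m" for j using skelD(1)[OF cellsD(1)[OF c that]] .
 have sub: "cands kp m R E q D <= Sigma ?J E" by (force simp: cands_def)
 have fin: "finite (Sigma ?J E)" by (rule finite_SigmaI[OF fJ]) (use fE in \<open>auto simp: cands_def\<close>)
 show "finite (cands kp m R E q D)" by (rule finite_subset[OF sub fin])
 have cJ: "real (card ?J) <= 64 / kp\<^sup>2"
 proof (cases "?J = {}")
  case False
  hence D: "D > 0" by (auto simp: cands_def)
  have "\<forall>j\<in>?J. \<exists>y nv. dist y q = D / 2 & norm nv = 1 & halfdisc y nv (kp * D / 4) <= closure (R j)" by (auto simp: cands_def)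
  then obtain y nv where y: "!!j. j \<in> ?J ==> dist (y j) q = D / 2 & norm (nv j) = 1 & halfdisc (y j) (nv j) (kp * D / 4) <= closure (R j)" by metis
  let ?rho = "kp * D / 4"
  let ?y = "%j. y j + (?rho / 2) *\<^sub>R nv j"
  have rho: "?rho > 0" using kp D by simp
  have cl: "ball (?y j) (?rho / 2) <= closure (R j)" if "j \<in> ?J" for j
   using ball_subset_halfdisc[OF _ rho, of "nv j" "y j"] y[OF that] by blast
  have jm: "j < m" if "j \<in> ?J" for j using that by (auto simp: cands_def)
  have "real (card ?J) <= (D / (?rho / 2))\<^sup>2"
  proof (rule disjoint_balls_card[where y="?y" and q=q])
   show "ball (?y j) (?rho / 2) <= ball q D" if j: "j \<in> ?J" for j
   proof
    fix z assume "z \<in> ball (?y j) (?rho / 2)"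
    hence z: "dist (?y j) z < ?rho / 2" by simp
    have 1: "dist (y j) (?y j) = ?rho / 2" using y[OF j] rho by (simp add: dist_norm)
    have 2: "dist q (y j) = D / 2" using y[OF j] by (simp add: dist_commute)
    have 3: "kp * D <= D" using kp D by simp
    have "dist q z < D" using z 1 2 3 D dist_triangle[of q z "?y j"] dist_triangle[of q "?y j" "y j"] by linarith
    thus "z \<in> ball q D" by simp
   qed
   show "ball (?y i) (?rho / 2) \<inter> ball (?y j) (?rho / 2) = {}" if ij: "i \<in> ?J" "j \<in> ?J" "i ~= j" for i j
    by (rule cells_closures_no_open[OF c jm[OF ij(1)] jm[OF ij(2)] ij(3)]) (use cl ij in auto)
  qed (use fJ rho D in auto)
  also have "(D / (?rho / 2))\<^sup>2 = 64 / kp\<^sup>2" using D kp by (simp add: power_divide power_mult_distrib)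
  finally show ?thesis .
 qed simp
 have "card (cands kp m R E q D) <= card (Sigma ?J E)" by (rule card_mono[OF fin sub])
 also have "... = (\<Sum>j\<in>?J. card (E j))" by (rule card_SigmaI[OF fJ]) (use fE in \<open>auto simp: cands_def\<close>)
 also have "... <= (\<Sum>j\<in>?J. M)" by (intro sum_mono cellsD(2)[OF c]) (auto simp: cands_def)
 finally have "card (cands kp m R E q D) <= card ?J * M" by simp
 hence "real (card (cands kp m R E q D)) <= real (card ?J) * real M" by (metis of_nat_le_iff of_nat_mult)
 also have "... <= 64 / kp\<^sup>2 * real M" by (rule mult_right_mono[OF cJ]) simp
 finally show "real (card (cands kp m R E q D)) <= 64 / kp\<^sup>2 * real M" .
qed

definition nrm :: "pt \<times> pt => pt" where
 "nrm e = (SOME nv. norm nv = 1 & nv \<bullet> (snd e - fst e) = 0)"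

lemma nrm: "norm (nrm e) = 1" "nrm e \<bullet> (snd e - fst e) = 0"
 using someI_ex[OF exists_perp[of "snd e - fst e"]] by (auto simp: nrm_def)

text \<open>Contains every x whose ray from q meets the line of e at
  \<open>q + l *\<^sub>R (x - q)\<close> with l between 1 and \<open>1 + mu\<close>: then
  \<open>nrm e \<bullet> (fst e - q)\<close> is l times \<open>nrm e \<bullet> (x - q)\<close>,
  which gives both conditions.\<close>

definition strip :: "real => pt => pt \<times> pt => pt set" where
 "strip mu q e = {x. abs(nrm e \<bullet> (x - q)) <= abs(nrm e \<bullet> (fst e - q)) & (1 / (1 + mu)) * abs(nrm e \<bullet> (fst e - q)) <= dist x q}"

text \<open>Chosen from the set alone, so that all points with the same cluster share one centre and
  only finitely many centres occur.\<close>

definition ctr :: "pt set => pt" where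
 "ctr A = (SOME u. u \<in> A)"

definition bad :: "real => nat => (nat => pt set) => (nat => (pt \<times> pt) set) => real => pt set => pt set => pt set" where
 "bad kp m R E mu V A = (\<Union>(j, e)\<in>cands kp m R E (ctr A) (infdist (ctr A) (V - A)). strip mu (ctr A) e)"

lemma bad_borel:
 assumes c: "cells kp M Om m R E" and kp: "0 < kp" "kp <= 1"
 shows "bad kp m R E mu V A \<in> sets borel"
 unfolding bad_def
proof (intro sets.finite_UN)
 show "finite (cands kp m R E (ctr A) (infdist (ctr A) (V - A)))" by (rule cands_card(1)[OF c kp])
 have "strip mu (ctr A) e \<in> sets borel" for e unfolding strip_def by measurable
 thus "(case je of (j, e) => strip mu (ctr A) e) \<in> sets borel" for je by (cases je) auto
qed

text \<open>An edge that crosses the annulus cannot have both ends in the cluster, for it would stay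
  within a quarter of \<open>infdist x V\<close> of the centre. So it runs to a vertex outside and
  passes a point at distance D/2 from the centre, where V is at least D/4 away; the half-disc there
  makes it a candidate.\<close>

lemma void_frontier_bad:
 assumes c: "cells kp M Om m R E" and kp: "0 < kp" "kp <= 1" and V: "finite V" "verts m E <= V" and mu: "mu >= 0"
  and x: "void (20 * (1 + mu)) V x" and l: "1 <= l" "l <= 1 + mu" and j: "j < m"
  and y: "ctr (clus (20 * (1 + mu)) V x) + l *\<^sub>R (x - ctr (clus (20 * (1 + mu)) V x)) \<in> frontier (R j)"
 shows "x \<in> bad kp m R E mu V (clus (20 * (1 + mu)) V x)"
proof -
 let ?L = "20 * (1 + mu)" and ?r = "infdist x V"
 let ?K = "clus ?L V x"
 define q where "q = ctr ?K"
 define y' where "y' = q + l *\<^sub>R (x - q)"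
 have L1: "?L >= 1" using mu by simp
 have Vne: "V ~= {}" using V(2) by (auto simp: verts_def)
 have r: "?r > 0" using x by (simp add: void_def)
 have "\<exists>u. u \<in> ?K" using clus_nearest[OF V(1) Vne L1] by blast
 hence q: "q \<in> ?K" unfolding q_def ctr_def by (rule someI_ex)
 note d = void_dist[OF V(1) Vne L1 x q]
 have yq: "dist y' q = l * dist x q" using l by (simp add: y'_def dist_norm)
 have yq1: "dist y' q >= ?r"
 proof -
  have "1 * ?r <= l * dist x q" using l d r by (intro mult_mono) auto
  thus ?thesis using yq by simp
 qed
 have yq2: "dist y' q <= 5/4 * ?r + 5/4 * (mu * ?r)"
 proof -
  have "l * dist x q <= (1 + mu) * (5/4 * ?r)" using l d by (intro mult_mono) auto
  thus ?thesis using yq by (simp add: algebra_simps)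
 qed
 have yf: "y' \<in> frontier (R j)" using y by (simp add: y'_def q_def)
 have k0: "kp >= 0" using kp by simp
 obtain a b nv where ab: "(a, b) \<in> E j" "y' \<in> cseg a b" "norm nv = 1" "nv \<bullet> (b - a) = 0"
  "\<forall>z\<in>cseg a b. halfdisc z nv (kp * infdist z V) <= closure (R j)"
  using frontier_segment[OF c V j yf k0] by (elim exE conjE)
 have "a \<in> verts m E" "b \<in> verts m E" using ab(1) j unfolding verts_def by force+
 hence abV: "a \<in> V" "b \<in> V" using V by auto
 have Kq: "dist u q <= ?r / 4" if "u \<in> ?K" for u using x q that by (simp add: void_def)
 have "\<exists>w\<in>{a, b}. w \<notin> ?K"
 proof (rule ccontr)
  assume "\<not> (\<exists>w\<in>{a, b}. w \<notin> ?K)"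
  hence "a \<in> cball q (?r / 4)" "b \<in> cball q (?r / 4)" using Kq by (auto simp: dist_commute)
  hence "cseg a b <= cball q (?r / 4)" by (intro closed_segment_subset) auto
  hence "dist y' q <= ?r / 4" using ab(2) by (auto simp: dist_commute)
  thus False using yq1 r by linarith
 qed
 then obtain w where w: "w \<in> {a, b}" "w \<notin> ?K" by blast
 have wV: "w \<in> V - ?K" using w abV by auto
 define D where "D = infdist q (V - ?K)"
 have farD: "dist u q >= D" if "u \<in> V - ?K" for u using infdist_le[OF that, of q] by (simp add: D_def dist_commute)
 \<comment> \<open>Vertices outside the cluster are farther than \<open>20 * (1 + mu) * ?r\<close>
   from x, which leaves room for y' within D/2 of the centre.\<close>
 have D: "D >= 20 * ?r + 20 * (mu * ?r) - 5/4 * ?r"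
 proof -
  obtain u where u: "u \<in> V - ?K" "infdist q (V - ?K) = dist q u"
   using infdist_attains_inf[of "V - ?K" q] V wV finite_imp_closed[of "V - ?K"] by auto
  have "dist x u > ?L * ?r" using u(1) by (auto simp: clus_iff not_le)
  hence "dist x u > 20 * ?r + 20 * (mu * ?r)" by (simp add: algebra_simps)
  thus ?thesis using u(2) d(2) dist_triangle[of x u q] by (simp add: D_def)
 qed
 have mr: "mu * ?r >= 0" using mu r by simp
 have D0: "D > 0" "D >= ?r" "dist y' q <= D / 2" using D mr r yq2 by linarith+
 have seg: "cseg y' w <= cseg a b" using ab(2) w(1) by (intro closed_segment_subset) auto
 \<comment> \<open>Intermediate values of the distance from q along the edge.\<close>
 have "\<exists>z\<in>cseg y' w. dist z q = D / 2"
 proof -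
  have "connected ((%z. dist z q) ` cseg y' w)" by (intro connected_continuous_image continuous_intros connected_segment)
  moreover have "dist y' q \<in> (%z. dist z q) ` cseg y' w" "dist w q \<in> (%z. dist z q) ` cseg y' w" by auto
  moreover have "D / 2 <= dist w q" using farD[OF wV] D0 by linarith
  ultimately have "D / 2 \<in> (%z. dist z q) ` cseg y' w" using D0(3) connectedD_interval by blast
  thus ?thesis by auto
 qed
 then obtain z where z: "z \<in> cseg a b" "dist z q = D / 2" using seg by blast
 have rz: "infdist z V >= D / 4"
 proof -
  obtain u where u: "u \<in> V" "infdist z V = dist z u" using infdist_attains_inf[of V z] V Vne finite_imp_closed by blast
  show ?thesis
  proof (cases "u \<in> ?K")
   case True
   thus ?thesis using Kq[OF True] u(2) z(2) D0 dist_triangle[of z q u] by linarith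
  next
   case False
   hence "dist u q >= D" using farD u(1) by blast
   thus ?thesis using u(2) z(2) D0 dist_triangle[of u q z] by (simp add: dist_commute)
  qed
 qed
 have "halfdisc z nv (kp * D / 4) <= closure (R j)"
 proof (rule subset_trans[OF halfdisc_mono bspec[OF ab(5) z(1)]])
  have "kp * (D / 4) <= kp * infdist z V" using rz k0 by (rule mult_left_mono)
  thus "kp * D / 4 <= kp * infdist z V" by simp
 qed
 hence cand: "(j, (a, b)) \<in> cands kp m R E q D" unfolding cands_def using j ab(1,3) D0(1) z(2) by blast
 have "x \<in> strip mu q (a, b)"
 proof -
  let ?n = "nrm (a, b)"
  obtain s where "y' - a = s *\<^sub>R (b - a)" using ab(2) by (rule segment_param)
  hence "?n \<bullet> (y' - a) = 0" using nrm(2)[of "(a, b)"] by simp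
  hence n1: "?n \<bullet> (y' - q) = ?n \<bullet> (a - q)" by (simp add: inner_diff_right)
  have n2: "?n \<bullet> (y' - q) = l * (?n \<bullet> (x - q))" by (simp add: y'_def)
  have "1 * abs(?n \<bullet> (x - q)) <= l * abs(?n \<bullet> (x - q))" using l by (intro mult_right_mono) auto
  hence 1: "abs(?n \<bullet> (x - q)) <= abs(?n \<bullet> (a - q))" using n1 n2 l by (simp add: abs_mult)
  have "abs(?n \<bullet> (x - q)) <= norm ?n * norm (x - q)" by (rule Cauchy_Schwarz_ineq2)
  hence 3: "abs(?n \<bullet> (x - q)) <= dist x q" using nrm(1)[of "(a, b)"] by (simp add: dist_norm)
  have "?n \<bullet> (a - q) = l * (?n \<bullet> (x - q))" using n1 n2 by (simp only:)
  hence "abs(?n \<bullet> (a - q)) = l * abs(?n \<bullet> (x - q))" using l by (simp add: abs_mult)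
  also have "... <= (1 + mu) * dist x q" using l 3 by (intro mult_mono) auto
  finally have "(1 / (1 + mu)) * abs(?n \<bullet> (a - q)) <= dist x q" using mu by (simp add: field_simps)
  thus ?thesis using 1 by (simp add: strip_def)
 qed
 thus ?thesis using cand unfolding bad_def D_def q_def by blast
qed

text \<open>There are at most \<open>2 * card V\<close> clusters, boundedly many candidates for
  each, and a bounded integral over each strip. In a void the distances from V and from the centre
  agree up to the factor 5/4.\<close>

lemma bad_integral:
 assumes kp: "0 < kp" "kp <= 1" and mu: "mu >= 0"
 shows "\<exists>C>0. \<forall>Om m R E V. cells kp M Om m R E --> finite V --> V ~= {} -->
  (LI x. ennreal (infdist x V powr (-2)) * indicator {x. void (20 * (1 + mu)) V x & x \<in> bad kp m R E mu V (clus (20 * (1 + mu)) V x)} x)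
   <= ennreal (C * real (card V))"
proof -
 let ?L = "20 * (1 + mu)"
 obtain C0 where C0: "C0 > 0" "!!nv (q::pt) u c. norm nv = 1 ==> u >= 0 ==> c > 0 ==>
   (LI x. ennreal (dist x q powr (-2)) * indicator {x. abs(nv \<bullet> (x - q)) <= u & c * u <= dist x q} x) <= ennreal (C0 / c)"
  using strip_integral by blast
 define B where "B = 2 * (C0 * (1 + mu))"
 have B: "B > 0" using C0 mu by (simp add: B_def)
 define C where "C = 2 * (64 / kp\<^sup>2 * real M * B) + 1"
 have C: "C > 0" using B kp by (simp add: C_def add_nonneg_pos)
 show ?thesis
 proof (intro exI[of _ C] conjI[OF C] allI impI, goal_cases)
  case (1 Om m R E V)
  note c = 1(1) and V = 1(2,3)
  let ?F = "clus ?L V ` Collect (void ?L V)"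
  let ?c = "%A. cands kp m R E (ctr A) (infdist (ctr A) (V - A))"
  let ?g = "%A je x. ennreal 2 * (ennreal (dist x (ctr A) powr (-2)) * indicator (strip mu (ctr A) (snd je)) x)"
  have L: "?L >= 1" "?L >= 2" using mu by auto
  have fF: "finite ?F" "card ?F <= 2 * card V" using void_clusters_card[OF V L(2)] by auto
  have sm [measurable]: "strip mu q e \<in> sets borel" for q e unfolding strip_def by measurable
  have "(LI x. ennreal (infdist x V powr (-2)) * indicator {x. void ?L V x & x \<in> bad kp m R E mu V (clus ?L V x)} x) <=
    (LI x. (\<Sum>A\<in>?F. \<Sum>je\<in>?c A. ?g A je x))"
  proof (rule nn_integral_mono)
   fix x
   show "ennreal (infdist x V powr (-2)) * indicator {x. void ?L V x & x \<in> bad kp m R E mu V (clus ?L V x)} x <= (\<Sum>A\<in>?F. \<Sum>je\<in>?c A. ?g A je x)"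
   proof (cases "void ?L V x & x \<in> bad kp m R E mu V (clus ?L V x)")
    case True
    let ?A = "clus ?L V x"
    have A: "?A \<in> ?F" using True by blast
    obtain j e where je: "(j, e) \<in> ?c ?A" "x \<in> strip mu (ctr ?A) e" using True unfolding bad_def by blast
    have "\<exists>u. u \<in> ?A" using clus_nearest[OF V L(1)] by blast
    hence "ctr ?A \<in> ?A" unfolding ctr_def by (rule someI_ex)
    note d = void_dist[OF V L(1) _ this]
    have r: "infdist x V > 0" using True by (simp add: void_def)
    have "4/5 * dist x (ctr ?A) <= infdist x V" using d True by simp
    hence "infdist x V powr (-2) <= (4/5 * dist x (ctr ?A)) powr (-2)" using d True r by (intro powr_mono2') auto
    also have "... = (4/5) powr (-2) * dist x (ctr ?A) powr (-2)" by (rule powr_mult)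
    also have "... <= 2 * dist x (ctr ?A) powr (-2)" by (intro mult_right_mono) (simp_all add: powr_minus powr_numeral power2_eq_square)
    finally have "ennreal (infdist x V powr (-2)) <= ennreal (2 * dist x (ctr ?A) powr (-2))" by (rule ennreal_leI)
    also have "... = ?g ?A (j, e) x" using je(2) by (simp add: ennreal_mult)
    also have "... <= (\<Sum>je\<in>?c ?A. ?g ?A je x)" using je(1) cands_card(1)[OF c kp] by (intro member_le_sum) auto
    also have "... <= (\<Sum>A\<in>?F. \<Sum>je\<in>?c A. ?g A je x)" using A fF(1) by (intro member_le_sum[of _ _ "%A. \<Sum>je\<in>?c A. ?g A je x"]) auto
    finally show ?thesis using True by simp
   qed simp
  qed
  also have "... = (\<Sum>A\<in>?F. \<Sum>je\<in>?c A. (LI x. ?g A je x))"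
   by (subst nn_integral_sum, measurable, intro sum.cong refl nn_integral_sum, measurable)
  also have "... <= (\<Sum>A\<in>?F. \<Sum>je\<in>?c A. ennreal B)"
  proof (intro sum_mono)
   fix A je
   have "(LI x. ?g A je x) = ennreal 2 * (LI x. ennreal (dist x (ctr A) powr (-2)) * indicator (strip mu (ctr A) (snd je)) x)"
    by (rule nn_integral_cmult) measurable
   also have "... <= ennreal 2 * ennreal (C0 / (1 / (1 + mu)))"
    unfolding strip_def using mu by (intro mult_left_mono C0 nrm) auto
   also have "... = ennreal (2 * (C0 / (1 / (1 + mu))))" by (rule ennreal_mult[symmetric]) (use C0 mu in auto)
   also have "2 * (C0 / (1 / (1 + mu))) = B" by (simp add: B_def)
   finally show "(LI x. ?g A je x) <= ennreal B" .
  qed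
  also have "... = (\<Sum>A\<in>?F. ennreal (real (card (?c A)) * B))" using B by (simp add: ennreal_of_nat_eq_real_of_nat ennreal_mult)
  also have "... <= (\<Sum>A\<in>?F. ennreal (64 / kp\<^sup>2 * real M * B))"
   using B by (intro sum_mono ennreal_leI mult_right_mono cands_card(2)[OF c kp]) auto
  also have "... = ennreal (real (card ?F) * (64 / kp\<^sup>2 * real M * B))"
  proof -
   have "ennreal (real (card ?F) * (64 / kp\<^sup>2 * real M * B)) = ennreal (real (card ?F)) * ennreal (64 / kp\<^sup>2 * real M * B)"
    by (rule ennreal_mult) (use B in auto)
   thus ?thesis by (simp only: sum_constant ennreal_of_nat_eq_real_of_nat)
  qed
  also have "... <= ennreal (C * real (card V))"
  proof (rule ennreal_leI)
   have "real (card ?F) <= 2 * real (card V)" using fF(2) by linarith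
   hence "real (card ?F) * (64 / kp\<^sup>2 * real M * B) <= 2 * real (card V) * (64 / kp\<^sup>2 * real M * B)" using B by (intro mult_right_mono) auto
   also have "... <= C * real (card V)" by (simp add: C_def algebra_simps)
   finally show "real (card ?F) * (64 / kp\<^sup>2 * real M * B) <= C * real (card V)" .
  qed
  finally show ?case .
 qed
qed

text \<open>A segment that avoids all frontiers lies in one cell or meets none, and s is polynomial
  on it in both cases. It may leave Om, where s is zero, so rays need not be cut off at the
  boundary.\<close>

lemma dsum_0_off_skelset:
 assumes s: "splinerep kp M Om k m R E s" and S: "cseg x (x + real k *\<^sub>R h) \<inter> skelset m R = {}"
 shows "dsum k h s x = 0"
proof -
 obtain P where c: "cells kp M Om m R E" and P: "s = pcw k m R P"
  using s unfolding splinerep_def by (elim exE conjE)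
 let ?S = "cseg x (x + real k *\<^sub>R h)"
 show ?thesis
 proof (cases "\<exists>j<m. ?S \<inter> R j ~= {}")
  case True
  then obtain j where j: "j < m" "?S \<inter> R j ~= {}" by blast
  have "?S \<inter> frontier (R j) = {}" using S j(1) unfolding skelset_def by blast
  hence sub: "?S <= R j" using connected_Int_frontier[OF connected_segment(1) j(2)] by blast
  have "s y = poly2 k (P j) y" if "y \<in> ?S" for y
   unfolding P using sub S that closure_subset[of "R j"] by (intro pcw_cell[OF c j(1)]) auto
  hence "dsum k h s x = dsum k h (poly2 k (P j)) x" unfolding dsum_def using step_in_segment by (intro sum.cong) auto
  thus ?thesis using polyfun_poly2[of k "P j"] by (simp add: polyfun_def)
 next
  case False
  have "s y = 0" if "y \<in> ?S" for y unfolding P using False that by (intro pcw_outside) auto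
  thus ?thesis unfolding dsum_def using step_in_segment by (intro sum.neutral) auto
 qed
qed

lemma dsum_0_powr_le:
 assumes tau: "tau > 0" and d: "dsum k h f x = 0"
 shows "abs(f x) powr tau <= (2 ^ k * real k) powr tau * (\<Sum>nv\<in>{1..k}. abs(f (x + real nv *\<^sub>R h)) powr tau)"
proof -
 let ?t = "%nv. (-1) ^ (k + nv) * real (k choose nv) * f (x + real nv *\<^sub>R h)"
 have "{..k} = insert 0 {1..k}" by auto
 hence "dsum k h f x = ?t 0 + (\<Sum>nv\<in>{1..k}. ?t nv)" unfolding dsum_def by simp
 hence "\<bar>?t 0\<bar> = \<bar>\<Sum>nv\<in>{1..k}. ?t nv\<bar>" using d by linarith
 hence "\<bar>f x\<bar> = \<bar>\<Sum>nv\<in>{1..k}. ?t nv\<bar>" by (simp add: abs_mult power_abs)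
 also have "... <= (\<Sum>nv\<in>{1..k}. \<bar>?t nv\<bar>)" by (rule sum_abs)
 also have "... <= (\<Sum>nv\<in>{1..k}. 2 ^ k * abs(f (x + real nv *\<^sub>R h)))"
 proof (rule sum_mono)
  fix nv assume "nv \<in> {1..k}"
  have "real (k choose nv) <= real (2 ^ k)" using binomial_le_pow2[of k nv] by (simp only: of_nat_le_iff)
  hence "real (k choose nv) * abs(f (x + real nv *\<^sub>R h)) <= 2 ^ k * abs(f (x + real nv *\<^sub>R h))" by (intro mult_right_mono) auto
  thus "\<bar>?t nv\<bar> <= 2 ^ k * \<bar>f (x + real nv *\<^sub>R h)\<bar>" by (simp add: abs_mult power_abs)
 qed
 also have "... = 2 ^ k * (\<Sum>nv\<in>{1..k}. abs(f (x + real nv *\<^sub>R h)))" by (rule sum_distrib_left[symmetric])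
 finally have "abs(f x) powr tau <= (2 ^ k * (\<Sum>nv\<in>{1..k}. abs(f (x + real nv *\<^sub>R h)))) powr tau" using tau by (intro powr_mono2) auto
 also have "... = (2 ^ k) powr tau * (\<Sum>nv\<in>{1..k}. abs(f (x + real nv *\<^sub>R h))) powr tau" by (rule powr_mult; simp add: sum_nonneg)
 also have "... <= (2 ^ k) powr tau * (real (card {1..k}) powr tau * (\<Sum>nv\<in>{1..k}. abs(f (x + real nv *\<^sub>R h)) powr tau))"
  by (intro mult_left_mono sum_powr_le) (use tau in auto)
 also have "... = (2 ^ k * real k) powr tau * (\<Sum>nv\<in>{1..k}. abs(f (x + real nv *\<^sub>R h)) powr tau)" by (simp add: powr_mult)
 finally show ?thesis .
qed

lemma good_off_skelset:
 assumes c: "cells kp M Om m R E" and kp: "0 < kp" "kp <= 1" and V: "finite V" "verts m E <= V" and mu: "mu >= 0"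
  and x: "void (20 * (1 + mu)) V x" "x \<notin> bad kp m R E mu V (clus (20 * (1 + mu)) V x)"
 shows "cseg x (x + mu *\<^sub>R (x - ctr (clus (20 * (1 + mu)) V x))) \<inter> skelset m R = {}"
proof (rule ccontr)
 let ?q = "ctr (clus (20 * (1 + mu)) V x)"
 assume "cseg x (x + mu *\<^sub>R (x - ?q)) \<inter> skelset m R ~= {}"
 then obtain y j where y: "y \<in> cseg x (x + mu *\<^sub>R (x - ?q))" "j < m" "y \<in> frontier (R j)" unfolding skelset_def by blast
 obtain s where s: "0 <= s" "s <= 1" "y - x = s *\<^sub>R (x + mu *\<^sub>R (x - ?q) - x)" using y(1) by (rule segment_param)
 have "y = x + (s * mu) *\<^sub>R (x - ?q)" using s(3) by (simp add: algebra_simps)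
 also have "... = ?q + (1 + s * mu) *\<^sub>R (x - ?q)" by (simp add: algebra_simps)
 finally have yq: "y = ?q + (1 + s * mu) *\<^sub>R (x - ?q)" .
 have l: "1 <= 1 + s * mu" "1 + s * mu <= 1 + mu" using s mu mult_right_mono[OF s(2) mu] by auto
 have "x \<in> bad kp m R E mu V (clus (20 * (1 + mu)) V x)"
  by (rule void_frontier_bad[OF c kp V mu x(1) l y(2)]) (use y(3) yq in simp)
 thus False using x(2) by blast
qed

lemma ctr_in_clus: "finite V ==> V ~= {} ==> La >= 1 ==> ctr (clus La V x) \<in> clus La V x"
 using clus_nearest[of V La x] unfolding ctr_def by (metis someI)

section \<open>The weighted inequality\<close>

text \<open>Dilation by l from the centre of the cluster costs \<open>l powr (-2)\<close> for the
  area and gains at most \<open>(5/4 * l) powr T\<close> from the weight, so for T < 2 the total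
  tends to zero with growing l. Nothing is counted twice, since the cluster of x can be read off
  from the dilated point. The bound \<open>5/4 <= l\<close> keeps the distance from V from
  decreasing, which preserves the truncation at eps.\<close>

lemma absorb:
 fixes g :: "pt => real"
 assumes V: "finite V" "V ~= {}" and mu: "mu >= 0" and l: "5/4 <= l" "l <= 1 + mu" and T: "T > 0" and eps: "eps > 0"
  and g [measurable]: "g \<in> bm" "!!x. g x >= 0"
 shows "(LI x. ennreal (g (ctr (clus (20 * (1 + mu)) V x) + l *\<^sub>R (x - ctr (clus (20 * (1 + mu)) V x))) * infdist x V powr (- T)) *
   indicator {x. void (20 * (1 + mu)) V x & eps <= infdist x V} x) <=
  ennreal ((5/4) powr T * l powr (T - 2)) * (LI x. ennreal (g x * infdist x V powr (- T)) * indicator {x. eps <= infdist x V} x)"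
proof -
 let ?L = "20 * (1 + mu)"
 let ?F = "clus ?L V ` Collect (void ?L V)"
 have L: "?L >= 1" "?L >= 2" using mu by auto
 have l0: "l > 0" using l by simp
 have fF: "finite ?F" using void_clusters_card(1)[OF V L(2)] .
 have [measurable]: "{x. clus 2 V x = A} \<in> sets borel" for A by (rule void_borel(2)[OF V(1)])
 have [measurable]: "{x::pt. eps <= infdist x V} \<in> sets borel" by measurable
 \<comment> \<open>Restricted to points y with \<open>clus 2 V y\<close> equal to A, so that the sum
   over A counts each y at most once.\<close>
 define h where "h A y = ennreal ((5/4 * l) powr T) * (ennreal (g y * infdist y V powr (- T)) * indicator {x. eps <= infdist x V} y) * indicator {x. clus 2 V x = A} y" for A y
 have hm [measurable]: "h A \<in> bm" for A unfolding h_def[abs_def] by measurable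
 have "(LI x. ennreal (g (ctr (clus ?L V x) + l *\<^sub>R (x - ctr (clus ?L V x))) * infdist x V powr (- T)) *
   indicator {x. void ?L V x & eps <= infdist x V} x) <= (LI x. (\<Sum>A\<in>?F. h A ((ctr A - l *\<^sub>R ctr A) + l *\<^sub>R x)))"
 proof (rule nn_integral_mono)
  fix x
  show "ennreal (g (ctr (clus ?L V x) + l *\<^sub>R (x - ctr (clus ?L V x))) * infdist x V powr (- T)) * indicator {x. void ?L V x & eps <= infdist x V} x
   <= (\<Sum>A\<in>?F. h A ((ctr A - l *\<^sub>R ctr A) + l *\<^sub>R x))"
  proof (cases "void ?L V x & eps <= infdist x V")
   case True
   let ?A = "clus ?L V x" and ?r = "infdist x V"
   let ?q = "ctr ?A"
   define y where "y = ?q + l *\<^sub>R (x - ?q)"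
   have q: "?q \<in> ?A" by (rule ctr_in_clus[OF V L(1)])
   have vx: "void ?L V x" using True by simp
   have r: "?r > 0" using vx by (simp add: void_def)
   note d = void_dist[OF V L(1) vx q]
   have l1: "1 <= l" using l by simp
   note an = void_annulus[OF V mu vx q l1 l(2) y_def]
   have "5/4 * ?r <= l * dist x ?q" using l d r by (intro mult_mono) auto
   hence ry: "?r <= infdist y V" using an(1) by linarith
   have "l * dist x ?q <= l * (5/4 * ?r)" using d l0 by (intro mult_left_mono) auto
   hence "infdist y V <= (5/4 * l) * ?r" using an(2) by (simp add: ac_simps)
   hence "((5/4 * l) * ?r) powr (- T) <= infdist y V powr (- T)" using T ry r by (intro powr_mono2') auto
   hence "(5/4 * l) powr (- T) * ?r powr (- T) <= infdist y V powr (- T)" by (subst (asm) powr_mult) (use l0 r in auto)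
   hence "(5/4 * l) powr T * ((5/4 * l) powr (- T) * ?r powr (- T)) <= (5/4 * l) powr T * infdist y V powr (- T)" by (intro mult_left_mono) auto
   moreover have "(5/4 * l) powr T * (5/4 * l) powr (- T) = 1" using l0 by (simp flip: powr_add)
   ultimately have rT: "?r powr (- T) <= (5/4 * l) powr T * infdist y V powr (- T)" by (simp add: mult.assoc[symmetric])
   have "ennreal (g y * ?r powr (- T)) <= ennreal ((5/4 * l) powr T * (g y * infdist y V powr (- T)))"
    using mult_left_mono[OF rT g(2)[of y]] by (intro ennreal_leI) (simp add: ac_simps)
   also have "... = h ?A y"
   proof -
    have "clus 2 V y = ?A" using an(4) by (simp add: clus_def)
    thus ?thesis using True ry g(2)[of y] by (simp add: h_def ennreal_mult)
   qed
   finally have hA: "ennreal (g y * ?r powr (- T)) <= h ?A y" .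
   have yeq: "y = (?q - l *\<^sub>R ?q) + l *\<^sub>R x" by (simp add: y_def algebra_simps)
   have "h ?A ((?q - l *\<^sub>R ?q) + l *\<^sub>R x) <= (\<Sum>A\<in>?F. h A ((ctr A - l *\<^sub>R ctr A) + l *\<^sub>R x))"
    using vx fF by (intro member_le_sum[of ?A ?F "%A. h A ((ctr A - l *\<^sub>R ctr A) + l *\<^sub>R x)"]) auto
   hence "ennreal (g y * ?r powr (- T)) <= (\<Sum>A\<in>?F. h A ((ctr A - l *\<^sub>R ctr A) + l *\<^sub>R x))"
    using hA unfolding yeq[symmetric] by (rule order_trans[rotated])
   thus ?thesis using True unfolding y_def by simp
  qed simp
 qed
 also have "... = (\<Sum>A\<in>?F. (LI x. h A ((ctr A - l *\<^sub>R ctr A) + l *\<^sub>R x)))" by (rule nn_integral_sum) measurable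
 also have "... = (\<Sum>A\<in>?F. ennreal (1 / l\<^sup>2) * (LI x. h A x))"
  by (intro sum.cong refl nn_integral_scale_pt hm) (use l0 in simp)
 also have "... = ennreal (1 / l\<^sup>2) * (\<Sum>A\<in>?F. (LI x. h A x))" by (rule sum_distrib_left[symmetric])
 also have "(\<Sum>A\<in>?F. (LI x. h A x)) = (LI x. (\<Sum>A\<in>?F. h A x))" by (rule nn_integral_sum[symmetric]) measurable
 also have "ennreal (1 / l\<^sup>2) * (LI x. (\<Sum>A\<in>?F. h A x)) <=
   ennreal (1 / l\<^sup>2) * (LI x. ennreal ((5/4 * l) powr T) * (ennreal (g x * infdist x V powr (- T)) * indicator {x. eps <= infdist x V} x))"
 proof (intro mult_left_mono nn_integral_mono)
  fix x
  let ?c = "ennreal ((5/4 * l) powr T) * (ennreal (g x * infdist x V powr (- T)) * indicator {x. eps <= infdist x V} x)"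
  have "(\<Sum>A\<in>?F. h A x) = (\<Sum>A\<in>?F. if A = clus 2 V x then ?c else 0)"
   by (intro sum.cong refl) (auto simp: h_def)
  also have "... = (if clus 2 V x \<in> ?F then ?c else 0)" using fF by (rule sum.delta)
  also have "... <= ?c" by simp
  finally show "(\<Sum>A\<in>?F. h A x) <= ?c" .
 qed simp
 also have "(LI x. ennreal ((5/4 * l) powr T) * (ennreal (g x * infdist x V powr (- T)) * indicator {x. eps <= infdist x V} x)) =
   ennreal ((5/4 * l) powr T) * (LI x. ennreal (g x * infdist x V powr (- T)) * indicator {x. eps <= infdist x V} x)"
  by (rule nn_integral_cmult) measurable
 also have "ennreal (1 / l\<^sup>2) * (ennreal ((5/4 * l) powr T) * (LI x. ennreal (g x * infdist x V powr (- T)) * indicator {x. eps <= infdist x V} x)) =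
   ennreal ((5/4) powr T * l powr (T - 2)) * (LI x. ennreal (g x * infdist x V powr (- T)) * indicator {x. eps <= infdist x V} x)"
 proof -
  have "1 / l\<^sup>2 * (5/4 * l) powr T = (5/4) powr T * l powr (T - 2)"
  proof -
   have "(5/4 * l) powr T = (5/4) powr T * l powr T" by (rule powr_mult)
   moreover have "l powr (T - 2) = l powr T / l\<^sup>2" using l0 by (simp add: powr_diff powr_numeral)
   ultimately show ?thesis by simp
  qed
  hence "ennreal (1 / l\<^sup>2) * ennreal ((5/4 * l) powr T) = ennreal ((5/4) powr T * l powr (T - 2))"
   by (subst ennreal_mult[symmetric]) auto
  thus ?thesis by (simp only: mult.assoc[symmetric])
 qed
 finally show ?thesis .
qed

text \<open>The map takes finitely many values on Borel sets, so the arbitrary choice in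
  \<open>ctr\<close> does no harm.\<close>

lemma ctr_clus_measurable:
 assumes V: "finite V"
 shows "(%x. ctr (clus La V x)) \<in> bm"
proof -
 have "clus La V \<in> measurable borel (count_space (Pow V))"
 proof (subst measurable_count_space_eq2)
  show "finite (Pow V)" using V by simp
  have "clus La V -` {A} \<inter> space borel \<in> sets borel" for A
   using void_borel(2)[OF V, of La A] by (simp add: vimage_def)
  thus "clus La V \<in> space borel \<rightarrow> Pow V & (\<forall>a\<in>Pow V. clus La V -` {a} \<inter> space borel \<in> sets borel)"
   by (auto simp: clus_def)
 qed
 thus ?thesis by (rule measurable_compose) simp
qed

lemma bad_region_borel:
 assumes c: "cells kp M Om m R E" and kp: "0 < kp" "kp <= 1" and V: "finite V"
 shows "{x. void La V x & x \<in> bad kp m R E mu V (clus La V x)} \<in> sets borel"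
proof -
 have "clus La V x \<in> Pow V" for x by (auto simp: clus_def)
 hence "{x. void La V x & x \<in> bad kp m R E mu V (clus La V x)} = (\<Union>A\<in>Pow V. {x. void La V x} \<inter> {x. clus La V x = A} \<inter> bad kp m R E mu V A)"
  by blast
 moreover have "... \<in> sets borel"
  using V by (intro sets.finite_UN sets.Int void_borel bad_borel[OF c kp]) auto
 ultimately show ?thesis by simp
qed

text \<open>W collects the points in no void and those in bad strips. Elsewhere the difference of
  the splines is polynomial along the ray from the centre through x up to the factor
  \<open>1 + mu\<close>, so its value at x is controlled by its values at k dilated points. By
  \<open>absorb\<close> these contribute at most half of the truncated integral, which is finite and
  can be subtracted.\<close>

lemma weighted_reduction:
 assumes k: "k >= 1" and tau: "tau > 0" and kp: "0 < kp" "kp <= 1" and T: "0 < T" "T < 2"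
 shows "\<exists>C>0. \<forall>Om V m1 R1 E1 s1 m2 R2 E2 s2.
   splinerep kp M Om k m1 R1 E1 s1 --> splinerep kp M Om k m2 R2 E2 s2 --> finite V --> verts m1 E1 <= V --> verts m2 E2 <= V -->
   (LI x. pw tau (s1 x - s2 x)) < \<infinity> -->
   (\<exists>W\<in>sets borel. (LI x. ennreal (infdist x V powr (-2)) * indicator W x) <= ennreal (C * real (card V)) &
    (LI x. ennreal (abs(s1 x - s2 x) powr tau * infdist x V powr (- T))) <=
    2 * (LI x. ennreal (abs(s1 x - s2 x) powr tau * infdist x V powr (- T)) * indicator W x))"
proof -
 define Ck where "Ck = (2 ^ k * real k) powr tau"
 define X where "X = 2 * (Ck * real k * (5/4) powr T)"
 have Ck: "Ck > 0" using k by (simp add: Ck_def)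
 have X: "X > 0" using Ck k by (simp add: X_def)
 \<comment> \<open>From this dilation on, each of the k terms is at most
   \<open>1 / (2 * real k)\<close> of the whole.\<close>
 define l0 where "l0 = max 2 (X powr (1 / (2 - T)))"
 have l0: "l0 >= 2" by (simp add: l0_def)
 have l0T: "l powr (T - 2) <= 1 / X" if "l >= l0" for l
 proof -
  have "(X powr (1 / (2 - T))) powr (2 - T) <= l powr (2 - T)" using that T by (intro powr_mono2) (auto simp: l0_def)
  hence "X <= l powr (2 - T)" using T X by (simp add: powr_powr)
  moreover have "l powr (T - 2) = 1 / l powr (2 - T)" using powr_minus_divide[of l "2 - T"] by simp
  ultimately show ?thesis using X by (simp add: frac_le)
 qed
 \<comment> \<open>The smallest of the factors \<open>1 + real nv * N\<close>, at
   \<open>nv = 1\<close>, is then l0.\<close>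
 define N where "N = l0 - 1"
 define mu where "mu = real k * N"
 have N: "N >= 1" using l0 by (simp add: N_def)
 have mu: "mu >= 0" using N by (simp add: mu_def)
 let ?L = "20 * (1 + mu)"
 have L: "?L >= 1" using mu by simp
 obtain C1 where C1: "C1 > 0" "!!V. finite V ==> V ~= {} ==>
  (LI x. ennreal (infdist x V powr (-2)) * indicator {x. infdist x V > 0 & \<not> void ?L V x} x) <= ennreal (C1 * real (card V))"
  using nonvoid_integral[OF L] by blast
 obtain C2 where C2: "C2 > 0" "!!Om m R E V. cells kp M Om m R E ==> finite V ==> V ~= {} ==>
  (LI x. ennreal (infdist x V powr (-2)) * indicator {x. void ?L V x & x \<in> bad kp m R E mu V (clus ?L V x)} x)
   <= ennreal (C2 * real (card V))"
  using bad_integral[OF kp mu, of M] by meson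
 define C where "C = C1 + (C2 + C2)"
 have C: "C > 0" using C1 C2 by (simp add: C_def)
 show ?thesis
 proof (intro exI[of _ C] conjI[OF C] allI impI, goal_cases)
  case (1 Om V m1 R1 E1 s1 m2 R2 E2 s2)
  note s1 = 1(1) and s2 = 1(2) and V = 1(3-5) and fin = 1(6)
  have Vne: "V ~= {}" using V(2) by (auto simp: verts_def)
  note c1 = splinerep_cells[OF s1] and c2 = splinerep_cells[OF s2]
  have m [measurable]: "s1 \<in> bm" "s2 \<in> bm" using splinerep_measurable s1 s2 by blast+
  define g where "g x = abs(s1 x - s2 x) powr tau" for x
  have gm [measurable]: "g \<in> bm" unfolding g_def[abs_def] by measurable
  have g0: "g x >= 0" for x by (simp add: g_def)
  define W0 where "W0 = {x. infdist x V > 0 & \<not> void ?L V x}"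
  define W1 where "W1 = {x. void ?L V x & x \<in> bad kp m1 R1 E1 mu V (clus ?L V x)}"
  define W2 where "W2 = {x. void ?L V x & x \<in> bad kp m2 R2 E2 mu V (clus ?L V x)}"
  define W where "W = W0 \<union> (W1 \<union> W2)"
  have vm [measurable]: "{x. void ?L V x} \<in> sets borel" by (rule void_borel(1)[OF V(1)])
  have W0m [measurable]: "W0 \<in> sets borel"
  proof -
   have "W0 = {x. infdist x V > 0} - {x. void ?L V x}" by (auto simp: W0_def)
   also have "... \<in> sets borel" by measurable
   finally show ?thesis .
  qed
  have W1m [measurable]: "W1 \<in> sets borel" unfolding W1_def by (rule bad_region_borel[OF c1 kp V(1)])
  have W2m [measurable]: "W2 \<in> sets borel" unfolding W2_def by (rule bad_region_borel[OF c2 kp V(1)])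
  have Wm [measurable]: "W \<in> sets borel" unfolding W_def by measurable
  have Wint: "(LI x. ennreal (infdist x V powr (-2)) * indicator W x) <= ennreal (C * real (card V))"
  proof -
   let ?i = "%W. (LI x. ennreal (infdist x V powr (-2)) * indicator W x)"
   have "?i W <= (LI x. ennreal (infdist x V powr (-2)) * indicator W0 x + (ennreal (infdist x V powr (-2)) * indicator W1 x + ennreal (infdist x V powr (-2)) * indicator W2 x))"
    unfolding W_def by (intro nn_integral_mono) (auto simp: indicator_def)
   also have "... = ?i W0 + (LI x. ennreal (infdist x V powr (-2)) * indicator W1 x + ennreal (infdist x V powr (-2)) * indicator W2 x)"
    by (rule nn_integral_add) measurable
   also have "(LI x. ennreal (infdist x V powr (-2)) * indicator W1 x + ennreal (infdist x V powr (-2)) * indicator W2 x) = ?i W1 + ?i W2"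
    by (rule nn_integral_add) measurable
   also have "?i W0 + (?i W1 + ?i W2) <= ennreal (C1 * real (card V)) + (ennreal (C2 * real (card V)) + ennreal (C2 * real (card V)))"
    unfolding W0_def W1_def W2_def by (intro add_mono C1(2) C2(2)[OF c1] C2(2)[OF c2] V Vne)
   also have "... = ennreal (C1 * real (card V) + (C2 * real (card V) + C2 * real (card V)))"
    using C1 C2 by (simp add: ennreal_plus[symmetric] del: ennreal_plus)
   also have "C1 * real (card V) + (C2 * real (card V) + C2 * real (card V)) = C * real (card V)" by (simp add: C_def distrib_right)
   finally show ?thesis .
  qed
  let ?q = "%x. ctr (clus ?L V x)"
  have qm [measurable]: "?q \<in> bm" by (rule ctr_clus_measurable[OF V(1)])
  define H where "H = (LI x. ennreal (g x * infdist x V powr (- T)) * indicator W x)"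
  have trunc: "(LI x. ennreal (g x * infdist x V powr (- T)) * indicator {x. eps <= infdist x V} x) <= 2 * H" if eps: "eps > 0" for eps
  proof -
   let ?ind = "indicator {x. eps <= infdist x V} :: pt => ennreal"
   let ?I = "(LI x. ennreal (g x * infdist x V powr (- T)) * ?ind x)"
   have em [measurable]: "{x::pt. eps <= infdist x V} \<in> sets borel" by measurable
   have evm [measurable]: "{x. void ?L V x & eps <= infdist x V} \<in> sets borel"
   proof -
    have "{x. void ?L V x & eps <= infdist x V} = {x. void ?L V x} \<inter> {x. eps <= infdist x V}" by auto
    also have "... \<in> sets borel" by measurable
    finally show ?thesis .
   qed
   let ?a = "%nv x. ennreal (g (?q x + (1 + real nv * N) *\<^sub>R (x - ?q x)) * infdist x V powr (- T)) * indicator {x. void ?L V x & eps <= infdist x V} x"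
   have am [measurable]: "?a nv \<in> bm" for nv by measurable
   have "?I <= (LI x. ennreal (g x * infdist x V powr (- T)) * indicator W x + (\<Sum>nv\<in>{1..k}. ennreal Ck * ?a nv x))"
   proof (rule nn_integral_mono)
    fix x
    show "ennreal (g x * infdist x V powr (- T)) * ?ind x <= ennreal (g x * infdist x V powr (- T)) * indicator W x + (\<Sum>nv\<in>{1..k}. ennreal Ck * ?a nv x)"
    proof (cases "eps <= infdist x V & x \<notin> W")
     case True
     hence r: "infdist x V > 0" using eps by linarith
     have v: "void ?L V x" using True r unfolding W_def W0_def by blast
     have b: "x \<notin> bad kp m1 R1 E1 mu V (clus ?L V x)" "x \<notin> bad kp m2 R2 E2 mu V (clus ?L V x)"
      using True v unfolding W_def W1_def W2_def by blast+
     \<comment> \<open>Its k steps cover exactly the piece of the ray on which neither skeleton is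
       met.\<close>
     define h where "h = N *\<^sub>R (x - ?q x)"
     have kh: "mu *\<^sub>R (x - ?q x) = real k *\<^sub>R h" by (simp add: h_def mu_def)
     have "dsum k h s1 x = 0" by (rule dsum_0_off_skelset[OF s1]) (use good_off_skelset[OF c1 kp V(1,2) mu v b(1)] in \<open>simp only: kh\<close>)
     moreover have "dsum k h s2 x = 0" by (rule dsum_0_off_skelset[OF s2]) (use good_off_skelset[OF c2 kp V(1,3) mu v b(2)] in \<open>simp only: kh\<close>)
     ultimately have "dsum k h (%x. s1 x - s2 x) x = 0" by (simp add: dsum_diff)
     from dsum_0_powr_le[OF tau this]
     have "g x <= Ck * (\<Sum>nv\<in>{1..k}. g (x + real nv *\<^sub>R h))" by (simp add: g_def Ck_def)
     hence "g x * infdist x V powr (- T) <= (Ck * (\<Sum>nv\<in>{1..k}. g (x + real nv *\<^sub>R h))) * infdist x V powr (- T)" by (intro mult_right_mono) auto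
     also have "... = (\<Sum>nv\<in>{1..k}. Ck * (g (x + real nv *\<^sub>R h) * infdist x V powr (- T)))" by (simp add: sum_distrib_left sum_distrib_right ac_simps)
     finally have "ennreal (g x * infdist x V powr (- T)) <= ennreal (\<Sum>nv\<in>{1..k}. Ck * (g (x + real nv *\<^sub>R h) * infdist x V powr (- T)))" by (rule ennreal_leI)
     also have "... = (\<Sum>nv\<in>{1..k}. ennreal (Ck * (g (x + real nv *\<^sub>R h) * infdist x V powr (- T))))"
      by (rule sum_ennreal[symmetric]) (use Ck g0 in auto)
     also have "... = (\<Sum>nv\<in>{1..k}. ennreal Ck * ?a nv x)"
     proof (rule sum.cong[OF refl])
      fix nv
      have "?q x + (1 + real nv * N) *\<^sub>R (x - ?q x) = x + real nv *\<^sub>R h" by (simp add: h_def algebra_simps)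
      hence "?a nv x = ennreal (g (x + real nv *\<^sub>R h) * infdist x V powr (- T))" using v True by simp
      thus "ennreal (Ck * (g (x + real nv *\<^sub>R h) * infdist x V powr (- T))) = ennreal Ck * ?a nv x"
       using Ck g0 by (simp add: ennreal_mult)
     qed
     finally show ?thesis using True by simp
    next
     case False
     then consider "\<not> eps <= infdist x V" | "x \<in> W" by blast
     thus ?thesis
     proof cases
      case 1
      hence "?ind x = 0" by simp
      thus ?thesis by (simp only: mult_zero_right zero_le)
     next
      case 2
      hence i: "indicator W x = (1::ennreal)" by simp
      have "ennreal (g x * infdist x V powr (- T)) * ?ind x <= ennreal (g x * infdist x V powr (- T)) * 1" by (rule mult_left_mono) (auto simp: indicator_def)
      thus ?thesis unfolding i by (rule order_trans) simp
     qed
    qed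
   qed
   also have "... = H + (LI x. (\<Sum>nv\<in>{1..k}. ennreal Ck * ?a nv x))" unfolding H_def by (rule nn_integral_add) measurable
   also have "(LI x. (\<Sum>nv\<in>{1..k}. ennreal Ck * ?a nv x)) = (\<Sum>nv\<in>{1..k}. (LI x. ennreal Ck * ?a nv x))" by (rule nn_integral_sum) measurable
   also have "H + (\<Sum>nv\<in>{1..k}. (LI x. ennreal Ck * ?a nv x)) <= H + (\<Sum>nv\<in>{1..k}. ennreal (1 / (2 * real k)) * ?I)"
   proof (rule add_left_mono, rule sum_mono)
    fix nv assume nv: "nv \<in> {1..k}"
    let ?l = "1 + real nv * N"
    have "1 * N <= real nv * N" using nv N by (intro mult_right_mono) auto
    hence ll: "l0 <= ?l" by (simp add: N_def)
    have l1: "5/4 <= ?l" using ll l0 by linarith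
    have l2: "?l <= 1 + mu" unfolding mu_def using nv N by (intro add_left_mono mult_right_mono) auto
    have "(LI x. ennreal Ck * ?a nv x) = ennreal Ck * (LI x. ?a nv x)" by (rule nn_integral_cmult) measurable
    also have "... <= ennreal Ck * (ennreal ((5/4) powr T * ?l powr (T - 2)) * ?I)"
     by (intro mult_left_mono absorb[OF V(1) Vne mu l1 l2 T(1) eps gm g0]) simp
    also have "... = ennreal (Ck * ((5/4) powr T * ?l powr (T - 2))) * ?I"
     using Ck by (simp add: ennreal_mult mult.assoc)
    also have "... <= ennreal (1 / (2 * real k)) * ?I"
    proof (intro mult_right_mono ennreal_leI)
     have "Ck * ((5/4) powr T * ?l powr (T - 2)) <= Ck * ((5/4) powr T * (1 / X))"
      using Ck by (intro mult_left_mono l0T ll) auto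
     also have "... = 1 / (2 * real k)" using Ck k by (simp add: X_def)
     finally show "Ck * ((5/4) powr T * ?l powr (T - 2)) <= 1 / (2 * real k)" .
    qed simp
    finally show "(LI x. ennreal Ck * ?a nv x) <= ennreal (1 / (2 * real k)) * ?I" .
   qed
   also have "(\<Sum>nv\<in>{1..k}. ennreal (1 / (2 * real k)) * ?I) = (\<Sum>nv\<in>{1..k}. ennreal (1 / (2 * real k))) * ?I" by (rule sum_distrib_right[symmetric])
   also have "(\<Sum>nv\<in>{1..k}. ennreal (1 / (2 * real k))) = ennreal (1/2)"
    using k by (simp add: ennreal_of_nat_eq_real_of_nat flip: ennreal_mult)
   finally have le: "?I <= H + ennreal (1/2) * ?I" .
   \<comment> \<open>Finiteness, needed to subtract half of \<open>?I\<close>: on the truncated set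
     the weight is bounded, and \<open>g\<close> is integrable.\<close>
   have "?I <= (LI x. ennreal (eps powr (- T)) * ennreal (g x))"
   proof (rule nn_integral_mono)
    fix x
    show "ennreal (g x * infdist x V powr (- T)) * ?ind x <= ennreal (eps powr (- T)) * ennreal (g x)"
    proof (cases "eps <= infdist x V")
     case True
     hence "infdist x V powr (- T) <= eps powr (- T)" using eps T by (intro powr_mono2') auto
     hence "g x * infdist x V powr (- T) <= g x * eps powr (- T)" by (intro mult_left_mono g0)
     hence le: "ennreal (g x * infdist x V powr (- T)) <= ennreal (eps powr (- T) * g x)" by (intro ennreal_leI) (simp add: mult.commute)
     have e: "ennreal (eps powr (- T) * g x) = ennreal (eps powr (- T)) * ennreal (g x)" by (rule ennreal_mult) (use g0 in auto)
     have i: "?ind x = 1" using True by simp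
     show ?thesis unfolding i mult_1_right e[symmetric] by (rule le)
    qed simp
   qed
   also have "... = ennreal (eps powr (- T)) * (LI x. ennreal (g x))" by (rule nn_integral_cmult) measurable
   also have "... < \<infinity>" using fin unfolding g_def by (simp add: ennreal_mult_less_top)
   finally have "?I < \<infinity>" .
   then obtain i where i: "?I = ennreal i" "i >= 0" by (cases ?I) auto
   show ?thesis
   proof (cases H)
    case real: (real h)
    have e: "ennreal (1/2) * ennreal i = ennreal (1/2 * i)" by (rule ennreal_mult[symmetric]) (use i in auto)
    have "ennreal h + ennreal (1/2 * i) = ennreal (h + 1/2 * i)" by (rule ennreal_plus[symmetric]) (use i real in auto)
    hence "ennreal i <= ennreal (h + 1/2 * i)" using le unfolding i(1) real(2) e by (simp only:)
    hence "i <= h + 1/2 * i" using real i by (subst (asm) ennreal_le_iff) auto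
    hence "ennreal i <= ennreal (2 * h)" by (intro ennreal_leI) simp
    thus ?thesis using real i by (simp add: ennreal_mult)
   next
    case top
    thus ?thesis by (simp add: ennreal_mult_top)
   qed
  qed
  have "(LI x. ennreal (g x * infdist x V powr (- T))) <= 2 * H"
  proof -
   \<comment> \<open>The truncation is removed by monotone convergence; at points of V the weight is
     0 by the convention for \<open>powr\<close> at 0.\<close>
   let ?f = "%n::nat. %x. ennreal (g x * infdist x V powr (- T)) * indicator {x. 1 / real (Suc n) <= infdist x V} x"
   have sup: "(SUP n. ?f n x) = ennreal (g x * infdist x V powr (- T))" for x
   proof (rule antisym)
    show "(SUP n. ?f n x) <= ennreal (g x * infdist x V powr (- T))" by (rule SUP_least) (simp add: indicator_def)
    show "ennreal (g x * infdist x V powr (- T)) <= (SUP n. ?f n x)"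
    proof (cases "infdist x V > 0")
     case True
     then obtain n where n: "1 / real (Suc n) < infdist x V" using nat_approx_posE by metis
     hence "ennreal (g x * infdist x V powr (- T)) = ?f n x" by simp
     also have "... <= (SUP n. ?f n x)" by (rule SUP_upper) simp
     finally show ?thesis .
    next
     case False
     hence "infdist x V = 0" using infdist_nonneg[of x V] by linarith
     thus ?thesis by simp
    qed
   qed
   have "incseq ?f"
   proof (rule incseq_SucI, rule le_funI)
    fix n x
    have "1 / real (Suc (Suc n)) <= 1 / real (Suc n)" by (simp add: frac_le)
    thus "?f n x <= ?f (Suc n) x" by (auto simp: indicator_def)
   qed
   moreover have "?f n \<in> borel_measurable lborel" for n
   proof -
    have [measurable]: "{x::pt. 1 / real (Suc n) <= infdist x V} \<in> sets borel" by measurable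
    show ?thesis by measurable
   qed
   ultimately have "(LI x. (SUP n. ?f n x)) = (SUP n. (LI x. ?f n x))" by (rule nn_integral_monotone_convergence_SUP)
   also have "... <= 2 * H" by (intro SUP_least trunc) simp
   finally show ?thesis unfolding sup .
  qed
  thus ?case using Wint Wm unfolding H_def g_def by (intro bexI[of _ W] conjI)
 qed
qed

section \<open>Integrability of splines and passage to the p-norm\<close>

lemma pcw_bounded:
 assumes b: "bounded {x. pcw k m R P x ~= 0}"
 shows "\<exists>B. \<forall>x. abs(pcw k m R P x) <= B"
proof -
 let ?K = "closure {x. pcw k m R P x ~= 0}"
 have K: "compact ?K" using b by (simp add: compact_closure)
 have "continuous_on ?K (%x. \<Sum>j<m. abs(poly2 k (P j) x))" by (intro continuous_intros continuous_poly2)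
 hence "compact ((%x. \<Sum>j<m. abs(poly2 k (P j) x)) ` ?K)" using K by (rule compact_continuous_image)
 hence "bounded ((%x. \<Sum>j<m. abs(poly2 k (P j) x)) ` ?K)" by (rule compact_imp_bounded)
 then obtain B where B: "!!x. x \<in> ?K ==> norm (\<Sum>j<m. abs(poly2 k (P j) x)) <= B" unfolding bounded_iff by blast
 have "abs(pcw k m R P x) <= max 0 B" for x
 proof (cases "pcw k m R P x = 0")
  case False
  hence "x \<in> ?K" using closure_subset by fast
  have "abs(pcw k m R P x) <= (\<Sum>j<m. abs(poly2 k (P j) x * indicator (R j) x))" unfolding pcw_def by (rule sum_abs)
  also have "... <= (\<Sum>j<m. abs(poly2 k (P j) x))" by (intro sum_mono) (auto simp: abs_mult indicator_def)
  also have "... <= B" using B[OF \<open>x \<in> ?K\<close>] by (simp add: sum_nonneg)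
  finally show ?thesis by simp
 qed simp
 thus ?thesis by blast
qed

lemma finite_integral_bounded_support:
 fixes f :: "pt => real"
 assumes S: "bounded S" "!!x. x \<notin> S ==> f x = 0" and B: "!!x. abs(f x) <= B" and tau: "tau > 0"
 shows "(LI x. pw tau (f x)) < \<infinity>"
proof -
 obtain rho where rho: "rho > 0" "S <= ball (0::pt) rho" using bounded_subset_ballD[OF S(1)] by blast
 have "(LI x. pw tau (f x)) <= (LI x. ennreal (B powr tau) * indicator (ball (0::pt) rho) x)"
 proof (rule nn_integral_mono)
  fix x
  show "pw tau (f x) <= ennreal (B powr tau) * indicator (ball (0::pt) rho) x"
  proof (cases "x \<in> ball (0::pt) rho")
   case True
   have "abs(f x) powr tau <= B powr tau" using B[of x] tau by (intro powr_mono2) auto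
   thus ?thesis using True by (simp add: ennreal_leI)
  next
   case False
   hence "f x = 0" using S(2) rho(2) by blast
   thus ?thesis by simp
  qed
 qed
 also have "... = ennreal (B powr tau) * emeasure lborel (ball (0::pt) rho)" by (rule nn_integral_cmult_indicator) simp
 also have "... < \<infinity>" unfolding emeasure_ball_pt[OF rho(1)] by (simp add: ennreal_mult_less_top)
 finally show ?thesis .
qed

text \<open>The relation between \<open>tau\<close>, s and p, multiplied by \<open>tau\<close>,
  makes \<open>tau / p\<close> and \<open>T / 2\<close> add up to one; the weight then becomes
  exactly the inverse square that the area estimates control.\<close>

lemma weighted_holder:
 fixes f :: "pt => real"
 assumes [measurable]: "f \<in> bm" "W \<in> sets borel" and p: "p > 0" and tau: "tau > 0" and T: "0 < T" "tau / p + T / 2 = 1"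
 shows "(LI x. ennreal (abs(f x) powr tau * infdist x V powr (- T)) * indicator W x) <=
   enn_powr (LI x. pw p (f x)) (tau / p) * enn_powr (LI x. ennreal (infdist x V powr (-2)) * indicator W x) (T / 2)"
proof -
 have l: "0 < tau / p" "tau / p < 1" "1 - tau / p = T / 2"
  using divide_pos_pos[OF tau p] T by linarith+
 let ?g = "%x. infdist x V powr (-2) * indicator W x"
 have e1: "ennreal (abs(f x) powr tau * infdist x V powr (- T)) * indicator W x = ennreal ((abs(f x) powr p) powr (tau / p) * ?g x powr (1 - tau / p))" for x
  using p T unfolding l(3) by (auto simp: indicator_def powr_powr)
 have e2: "ennreal (infdist x V powr (-2)) * indicator W x = ennreal (?g x)" for x by (auto simp: indicator_def)
 show ?thesis unfolding e1 e2 using l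
  by (subst l(3)[symmetric], intro holder_nn) auto
qed

lemma splinerep_of_spline:
 assumes ad: "admissible_domain N0 c0 \<beta> Om n0" and S: "S \<in> splines N0 c0 \<beta> Om n k"
  and \<beta>: "0 < \<beta>" "\<beta> <= pi / 3" and c0: "c0 >= 1"
 shows "\<exists>m R E s. m <= n + 1 & splinerep (min (sin \<beta>) (1 / (2 * c0))) (ring_const N0 + 2 * N0) Om k m R E s &
   (AE x in lborel. S x = s x) & bounded {x. s x ~= 0} & (\<exists>B. \<forall>x. abs(s x) <= B)"
proof -
 obtain m R E P where *: "m <= n + 1" "cells (min (sin \<beta>) (1 / (2 * c0))) (ring_const N0 + 2 * N0) Om m R E"
   "AE x in lborel. S x = pcw k m R P x" "k >= 2 --> C_on (k - 2) Om S" "bounded {x. pcw k m R P x ~= 0}"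
  using spline_cells[OF ad S \<beta> c0] by (elim exE conjE)
 have "splinerep (min (sin \<beta>) (1 / (2 * c0))) (ring_const N0 + 2 * N0) Om k m R E (pcw k m R P)"
  unfolding splinerep_def
  by (intro conjI *(2) exI[of _ P] exI[of _ S] refl *(3,4))
 thus ?thesis using * pcw_bounded[OF *(5)]
  by (intro exI[of _ m] exI[of _ R] exI[of _ E] exI[of _ "pcw k m R P"] conjI)
qed

text \<open>The power of n comes from \<open>card V\<close>, which is linear in n, raised to
  \<open>T / 2\<close> by Hoelder's inequality.\<close>

lemma besov_int_comparison:
 assumes c0: "c0 >= 1" and \<beta>: "0 < \<beta>" "\<beta> <= pi / 3" and p: "p > 0" and k: "k >= 1" and s: "0 < s / 2" "s / 2 < real k - 1 + 1 / p"
  and taup: "1 / tau = s / 2 + 1 / p"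
 shows "\<exists>K>0. \<forall>Om n0 n S1 S2. admissible_domain N0 c0 \<beta> Om n0 --> n >= n0 -->
   S1 \<in> splines N0 c0 \<beta> Om n k --> S2 \<in> splines N0 c0 \<beta> Om n k -->
   enn_powr (besov_int Om s k tau S1) (1 / max 1 tau) <= enn_powr (besov_int Om s k tau S2) (1 / max 1 tau) +
    enn_powr (ennreal (K * real n powr (tau * s / 2)) * enn_powr (Lnorm p Om (%x. S1 x - S2 x)) tau) (1 / max 1 tau)"
proof -
 have "1 / tau > 0" unfolding taup using s p by (intro add_pos_pos) auto
 hence tau: "tau > 0" by simp
 define T where "T = s * tau"
 have T0: "T > 0" using s tau by (simp add: T_def)
 have Tp: "tau / p + T / 2 = 1"
 proof -
  have "tau * (1 / tau) = tau * (s / 2 + 1 / p)" unfolding taup ..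
  thus ?thesis using tau by (simp add: T_def algebra_simps)
 qed
 have T2: "T < 2" using Tp tau p divide_pos_pos[OF tau p] by linarith
 \<comment> \<open>The upper restriction on s in the form needed at t = 0; one half of
   \<open>T\<close> is moved across by \<open>tau / p = 1 - T / 2\<close>.\<close>
 have Ta: "T < tau * (real k - 1) + 1"
 proof -
  have "tau * (s / 2) < tau * (real k - 1 + 1 / p)" using s tau by (intro mult_strict_left_mono)
  hence "T / 2 < tau * (real k - 1) + tau / p" by (simp add: T_def algebra_simps)
  thus ?thesis using Tp by linarith
 qed
 define kp where "kp = min (sin \<beta>) (1 / (2 * c0))"
 have "sin \<beta> > 0" using \<beta> by (intro sin_gt_zero) (auto simp: field_simps)
 hence kp: "0 < kp" "kp <= 1" using c0 by (auto simp: kp_def min_le_iff_disj)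
 define M where "M = ring_const N0 + 2 * N0"
 show ?thesis
 proof (rule pos_exE[OF besov_int_step[OF k tau kp, of s, folded T_def, OF T0 Ta]], rule pos_exE[OF weighted_reduction[OF k tau kp T0 T2, of M]], goal_cases)
 case (1 C1 C2)
 note C1 = 1(1) 1(2)[rule_format] and C2 = 1(3) 1(4)[rule_format]
 define Cv where "Cv = 2 * (1 + 4 * real M)"
 define K where "K = C1 * 2 * (C2 * Cv) powr (T / 2)"
 have Cv: "Cv > 0" by (simp add: Cv_def add_pos_nonneg)
 have K: "K > 0" using C1 C2 Cv by (simp add: K_def)
 show ?thesis
 proof (intro exI[of _ K] conjI[OF K] allI impI, goal_cases)
  case (1 Om n0 n S1 S2)
  note ad = 1(1) and n = 1(2) and S = 1(3,4)
  \<comment> \<open>As n is at least one, the additional cell and the inserted origin are absorbed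
    in a multiple of n.\<close>
  have n1: "n >= 1" using ad n by (auto simp: admissible_domain_def)
  obtain m1 R1 E1 s1 B1 where 1: "m1 <= n + 1" "splinerep kp M Om k m1 R1 E1 s1" "AE x in lborel. S1 x = s1 x" "bounded {x. s1 x ~= 0}" "\<forall>x. abs(s1 x) <= B1"
   using splinerep_of_spline[OF ad S(1) \<beta> c0] unfolding kp_def M_def by (elim exE conjE)
  obtain m2 R2 E2 s2 B2 where 2: "m2 <= n + 1" "splinerep kp M Om k m2 R2 E2 s2" "AE x in lborel. S2 x = s2 x" "bounded {x. s2 x ~= 0}" "\<forall>x. abs(s2 x) <= B2"
   using splinerep_of_spline[OF ad S(2) \<beta> c0] unfolding kp_def M_def by (elim exE conjE)
  \<comment> \<open>One vertex set for both splines, so that one distance function serves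
    both.\<close>
  define V where "V = verts m1 E1 \<union> verts m2 E2"
  note v1 = verts_finite[OF splinerep_cells[OF 1(2)]] and v2 = verts_finite[OF splinerep_cells[OF 2(2)]]
  have V: "finite V" "verts m1 E1 <= V" "verts m2 E2 <= V" using v1(1) v2(1) by (auto simp: V_def)
  have cV: "real (card V) <= Cv * real n"
  proof -
   have "card V <= card (verts m1 E1) + card (verts m2 E2)" unfolding V_def by (rule card_Un_le)
   also have "... <= (1 + m1 * (2 * M)) + (1 + m2 * (2 * M))" by (rule add_mono[OF v1(2) v2(2)])
   also have "... <= (1 + (n + n) * (2 * M)) + (1 + (n + n) * (2 * M))" using 1(1) 2(1) n1 by (intro add_mono mult_right_mono) auto
   also have "... <= 2 * (n + 4 * n * M)" using n1 by (simp add: algebra_simps)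
   finally have "card V <= 2 * (n + 4 * n * M)" .
   hence "real (card V) <= real (2 * (n + 4 * n * M))" by (simp only: of_nat_le_iff)
   also have "... = Cv * real n" by (simp add: Cv_def algebra_simps)
   finally show ?thesis .
  qed
  have m [measurable]: "s1 \<in> bm" "s2 \<in> bm" using splinerep_measurable 1(2) 2(2) by blast+
  have fin: "(LI x. pw tau (s1 x - s2 x)) < \<infinity>"
  proof (rule finite_integral_bounded_support[where S="{x. s1 x ~= 0} \<union> {x. s2 x ~= 0}" and B="B1 + B2"])
   show "bounded ({x. s1 x ~= 0} \<union> {x. s2 x ~= 0})" using 1(4) 2(4) by simp
   show "abs(s1 x - s2 x) <= B1 + B2" for x using spec[OF 1(5), of x] spec[OF 2(5), of x] by linarith
  qed (use tau in auto)
  obtain W where W: "W \<in> sets borel" "(LI x. ennreal (infdist x V powr (-2)) * indicator W x) <= ennreal (C2 * real (card V))"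
    "(LI x. ennreal (abs(s1 x - s2 x) powr tau * infdist x V powr (- T))) <=
    2 * (LI x. ennreal (abs(s1 x - s2 x) powr tau * infdist x V powr (- T)) * indicator W x)"
   using C2(2)[OF 1(2) 2(2) V fin] by blast
  have LN: "enn_powr (Lnorm p Om (%x. S1 x - S2 x)) tau = enn_powr (LI x. pw p (s1 x - s2 x)) (tau / p)"
  proof -
   have "(\<integral>\<^sup>+ x\<in>Om. pw p (S1 x - S2 x) \<partial>lborel) = (LI x. pw p (s1 x - s2 x))"
   proof (rule nn_integral_cong_AE)
    show "AE x in lborel. pw p (S1 x - S2 x) * indicator Om x = pw p (s1 x - s2 x)"
     using 1(3) 2(3)
    proof eventually_elim
     case (elim x)
     show ?case using elim splinerep_outside[OF 1(2), of x] splinerep_outside[OF 2(2), of x] by (cases "x \<in> Om") auto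
    qed
   qed
   thus ?thesis by (simp add: Lnorm_def enn_powr_powr)
  qed
  let ?P = "enn_powr (LI x. pw p (s1 x - s2 x)) (tau / p)"
  have "(LI x. ennreal (abs(s1 x - s2 x) powr tau * infdist x V powr (- T)) * indicator W x) <=
    ?P * enn_powr (LI x. ennreal (infdist x V powr (-2)) * indicator W x) (T / 2)"
   by (rule weighted_holder[OF _ W(1) p tau T0 Tp]) measurable
  also have "... <= ?P * enn_powr (ennreal (C2 * (Cv * real n))) (T / 2)"
  proof (intro mult_left_mono enn_powr_mono)
   have "C2 * real (card V) <= C2 * (Cv * real n)" using cV C2(1) by (intro mult_left_mono) auto
   thus "(LI x. ennreal (infdist x V powr (-2)) * indicator W x) <= ennreal (C2 * (Cv * real n))"
    using W(2) by (meson ennreal_leI order_trans)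
  qed (use T0 in auto)
  also have "enn_powr (ennreal (C2 * (Cv * real n))) (T / 2) = ennreal ((C2 * Cv) powr (T / 2) * real n powr (T / 2))"
  proof -
   have "enn_powr (ennreal (C2 * (Cv * real n))) (T / 2) = ennreal ((C2 * (Cv * real n)) powr (T / 2))" using C2 Cv by (intro enn_powr_ennreal) auto
   also have "(C2 * (Cv * real n)) powr (T / 2) = (C2 * Cv) powr (T / 2) * real n powr (T / 2)" using C2 Cv by (simp add: powr_mult)
   finally show ?thesis .
  qed
  finally have A: "(LI x. ennreal (abs(s1 x - s2 x) powr tau * infdist x V powr (- T)) * indicator W x) <=
    ?P * ennreal ((C2 * Cv) powr (T / 2) * real n powr (T / 2))" .
  have "ennreal C1 * (LI x. ennreal (abs(s1 x - s2 x) powr tau * infdist x V powr (- T))) <=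
    ennreal C1 * (ennreal 2 * (?P * ennreal ((C2 * Cv) powr (T / 2) * real n powr (T / 2))))"
  proof (rule mult_left_mono)
   have "2 * (LI x. ennreal (abs(s1 x - s2 x) powr tau * infdist x V powr (- T)) * indicator W x) <=
     ennreal 2 * (?P * ennreal ((C2 * Cv) powr (T / 2) * real n powr (T / 2)))" using mult_left_mono[OF A, of 2] by simp
   thus "(LI x. ennreal (abs(s1 x - s2 x) powr tau * infdist x V powr (- T))) <= ennreal 2 * (?P * ennreal ((C2 * Cv) powr (T / 2) * real n powr (T / 2)))"
    using W(3) by (rule order_trans[rotated])
  qed simp
  also have "... = (ennreal C1 * ennreal 2 * ennreal ((C2 * Cv) powr (T / 2) * real n powr (T / 2))) * ?P" by (simp only: ac_simps)
  also have "ennreal C1 * ennreal 2 * ennreal ((C2 * Cv) powr (T / 2) * real n powr (T / 2)) = ennreal (K * real n powr (tau * s / 2))"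
  proof -
   have "ennreal C1 * ennreal 2 * ennreal ((C2 * Cv) powr (T / 2) * real n powr (T / 2)) = ennreal (C1 * 2 * ((C2 * Cv) powr (T / 2) * real n powr (T / 2)))"
    using C1(1) by (simp only: ennreal_mult[symmetric] mult_nonneg_nonneg powr_ge_zero less_imp_le zero_le_numeral)
   also have "C1 * 2 * ((C2 * Cv) powr (T / 2) * real n powr (T / 2)) = K * real n powr (tau * s / 2)" by (simp add: K_def T_def mult.commute)
   finally show ?thesis .
  qed
  finally have F: "ennreal C1 * (LI x. ennreal (abs(s1 x - s2 x) powr tau * infdist x V powr (- T))) <= ennreal (K * real n powr (tau * s / 2)) * ?P" .
  have cong: "besov_int Om s k tau S1 = besov_int Om s k tau s1" "besov_int Om s k tau S2 = besov_int Om s k tau s2"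
   using besov_int_cong_AE 1(3) 2(3) by blast+
  show ?case unfolding LN cong
   by (rule order_trans[OF C1(2)[OF 1(2) 2(2) V]], rule add_left_mono, rule enn_powr_mono[OF _ F]) simp
 qed
 qed
qed

theorem theorem4p2:
  fixes N0 :: nat and c0 \<beta> p s \<tau> :: real and k :: nat
  assumes "c0 \<ge> 1" and "0 < \<beta>" and "\<beta> \<le> pi / 3"
    and "0 < p" and "k \<ge> 1" and "0 < s / 2" and "s / 2 < real k - 1 + 1 / p"
    and "1 / \<tau> = s / 2 + 1 / p"
  shows "\<exists>c > 0. \<forall>(\<Omega> :: pt set) n0 n S1 S2.
     admissible_domain N0 c0 \<beta> \<Omega> n0 \<longrightarrow> n \<ge> n0 \<longrightarrow>
     S1 \<in> splines N0 c0 \<beta> \<Omega> n k \<longrightarrow> S2 \<in> splines N0 c0 \<beta> \<Omega> n k \<longrightarrow>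
     (\<tau> \<ge> 1 \<longrightarrow>
        besov_semi \<Omega> s k \<tau> S1 \<le> besov_semi \<Omega> s k \<tau> S2
          + ennreal (c * real n powr (s / 2)) * Lnorm p \<Omega> (\<lambda>x. S1 x - S2 x)) \<and>
     (\<tau> < 1 \<longrightarrow>
        enn_powr (besov_semi \<Omega> s k \<tau> S1) \<tau> \<le> enn_powr (besov_semi \<Omega> s k \<tau> S2) \<tau>
          + ennreal (c * real n powr (\<tau> * s / 2)) * enn_powr (Lnorm p \<Omega> (\<lambda>x. S1 x - S2 x)) \<tau>)"
proof -
 have "1 / \<tau> > 0" unfolding assms(8) using assms(4,6) by (intro add_pos_pos) auto
 hence \<tau>: "\<tau> > 0" by simp
 obtain K where K: "K > 0" "!!\<Omega> n0 n S1 S2. admissible_domain N0 c0 \<beta> \<Omega> n0 ==> n >= n0 ==>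
   S1 \<in> splines N0 c0 \<beta> \<Omega> n k ==> S2 \<in> splines N0 c0 \<beta> \<Omega> n k ==>
   enn_powr (besov_int \<Omega> s k \<tau> S1) (1 / max 1 \<tau>) <= enn_powr (besov_int \<Omega> s k \<tau> S2) (1 / max 1 \<tau>) +
    enn_powr (ennreal (K * real n powr (\<tau> * s / 2)) * enn_powr (Lnorm p \<Omega> (%x. S1 x - S2 x)) \<tau>) (1 / max 1 \<tau>)"
  using besov_int_comparison[OF assms(1-8), of N0] by meson
 \<comment> \<open>For \<open>\<tau>\<close> at least one the bound on integrals is under the root
   of order \<open>\<tau>\<close>; for smaller \<open>\<tau>\<close> it already concerns the
   powers.\<close>
 define c where "c = (if \<tau> >= 1 then K powr (1 / \<tau>) else K)"
 have c: "c > 0" using K by (simp add: c_def)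
 have semi: "besov_semi \<Omega> s k \<tau> S = enn_powr (besov_int \<Omega> s k \<tau> S) (1 / \<tau>)" for \<Omega> S by (rule besov_semi_eq[OF \<tau>])
 have ge1: "besov_semi \<Omega> s k \<tau> S1 <= besov_semi \<Omega> s k \<tau> S2 + ennreal (c * real n powr (s / 2)) * Lnorm p \<Omega> (%x. S1 x - S2 x)"
  if h: "admissible_domain N0 c0 \<beta> \<Omega> n0" "n >= n0" "S1 \<in> splines N0 c0 \<beta> \<Omega> n k" "S2 \<in> splines N0 c0 \<beta> \<Omega> n k" and t: "\<tau> >= 1" for \<Omega> n0 n S1 S2
 proof -
  have m: "max 1 \<tau> = \<tau>" using t by simp
  have "enn_powr (ennreal (K * real n powr (\<tau> * s / 2)) * enn_powr (Lnorm p \<Omega> (%x. S1 x - S2 x)) \<tau>) (1 / \<tau>) =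
    enn_powr (ennreal (K * real n powr (\<tau> * s / 2))) (1 / \<tau>) * Lnorm p \<Omega> (%x. S1 x - S2 x)"
   using \<tau> by (simp add: enn_powr_mult enn_powr_powr)
  also have "enn_powr (ennreal (K * real n powr (\<tau> * s / 2))) (1 / \<tau>) = ennreal (c * real n powr (s / 2))"
   using K(1) \<tau> t by (simp add: c_def powr_mult powr_powr)
  finally show ?thesis using K(2)[OF h] unfolding m semi by simp
 qed
 have lt1: "enn_powr (besov_semi \<Omega> s k \<tau> S1) \<tau> <= enn_powr (besov_semi \<Omega> s k \<tau> S2) \<tau> + ennreal (c * real n powr (\<tau> * s / 2)) * enn_powr (Lnorm p \<Omega> (%x. S1 x - S2 x)) \<tau>"
  if h: "admissible_domain N0 c0 \<beta> \<Omega> n0" "n >= n0" "S1 \<in> splines N0 c0 \<beta> \<Omega> n k" "S2 \<in> splines N0 c0 \<beta> \<Omega> n k" and t: "\<tau> < 1" for \<Omega> n0 n S1 S2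
 proof -
  have m: "max 1 \<tau> = 1" using t by simp
  have "enn_powr (besov_semi \<Omega> s k \<tau> S) \<tau> = besov_int \<Omega> s k \<tau> S" for S unfolding semi using \<tau> by (simp add: enn_powr_powr)
  thus ?thesis using K(2)[OF h] t unfolding m c_def by simp
 qed
 show ?thesis by (intro exI[of _ c] conjI[OF c] allI impI conjI ge1 lt1)
qed

end
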